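(* Let $A=A(x,t)$ be a matrix valued function satisfying, for some constants $\Lambda\ge1$ and $K$, $$\Lambda^{-1}\mathbb I_n\le A(x,t)\le \Lambda\,\mathbb I_n,\qquad |A(x,t)-A(y,s)|\le K\big(|x-y|+|t-s|^{1/2}\big),$$ and let $V=V(x,t)$ be $C^1$ in the $x$-variable and $1/2$-Hölder continuous in the $t$-variable. Assume $A(0,0)=\mathbb I_n$. There exist universal constants $N$ and $\delta\in(0,1)$ such that for all $\alpha\ge N\big(1+\|V\|_1^{1/2}+[V]_{1/2}^{1/2}\big)$ the following inequality holds: $$\begin{aligned} &\alpha^2\int\sigma_a^{-2\alpha}w^2G_a\,dx\,dt+\alpha\int\sigma_a^{1-2\alpha}|\nabla w|^2G_a\,dx\,dt\\ &\le N\int\sigma_a^{1-2\alpha}\big(\operatorname{div}(A(x,t)\nabla w)+w_t+V(x,t)w\big)^2G_a\,dx\,dt+N^{2\alpha}\alpha^{2\alpha}\sup_{t\ge0}\int\big(w^2+t|\nabla w|^2\big)\,dx\\ &\quad+\sigma(a)^{-2\alpha}\left(-\frac aN\int|\nabla w(x,0)|^2G(x,a)\,dx+N\alpha\int w^2(x,0)G(x,a)\,dx\right) \end{aligned}$$ for all $0<a\le\frac1{4\lambda}$ and all $w\in C_0^\infty\big(B_4\times[0,\tfrac1{2\lambda})\big)$, where $\lambda=\alpha/\delta^2$, $G_a(x,t)=G(x,t+a)$ and $\sigma_a(t)=\sigma(t+a)$, with $G$ the Gaussian $G(x,t)=t^{-n/2}e^{-|x|^2/4t}$ and $\sigma$ the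 weight function (depending on $\lambda$) defined in the context.
   Context: Notation: $n$ is the space dimension, $\mathbb I_n$ is the $n\times n$ identity matrix, $B_r=B_r(0)\subset\mathbb R^n$, $Q_r=B_r\times[0,r^2]$ (so $Q_4=B_4\times[0,16]$). $\nabla$ and $\operatorname{div}$ are taken in the $x$-variable only. The matrix inequalities are understood in the usual order on symmetric matrices. $C_0^\infty(\Omega)$ denotes compactly supported smooth functions in the space-time region $\Omega$; functions in $C_0^\infty(B_4\times[0,\frac1{2\lambda}))$ need not vanish at $t=0$. Space-time integrals are over $\mathbb R^n\times[0,\infty)$ (effectively over the support of $w$), and integrals with respect to $dx$ alone are over $\mathbb R^n$. Weight function: let $\theta(t)=t^{1/2}\left(\log\frac1t\right)^{3/2}$. For $\lambda>0$, $\sigma$ is the solution, for $0\le\lambda t\le1$, of $$\frac{d}{dt}\log\left(\frac{\sigma}{t\sigma'}\right)=\frac{\theta(\lambda t)}{t},\qquad \sigma(0)=0,\quad \sigma'(0)=1 .$$ The norms of $V$ are $$\|V\|_1=\|V\|_{L^\infty(Q_4)}+\|\nabla_xV\|_{L^\infty(Q_4)},\qquad [V]_{1/2}=\sup_{(x,t),(x,s)\in Q_4}\frac{|V(x,t)-V(x,s)|}{|t-s|^{1/2}}.$$ A constant is called universal if it depends only on the dimension $n$, the ellipticity constant $\Lambda$ and the Lipschitz constant $K$ of $A$ (in particular not on $V$, $\alpha$, $a$ or $w$). *)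

theory Defs
  imports "HOL-Analysis.Analysis" "HOL-Probability.Essential_Supremum"
begin

text \<open>Points of space-time are pairs \<open>(x, t)\<close>; \<open>grad_x\<close> and \<open>div_x\<close> differentiate in \<open>x\<close> only.\<close>

definition partial_x :: "'n::finite \<Rightarrow> ((real^'n) \<times> real \<Rightarrow> real) \<Rightarrow> (real^'n) \<times> real \<Rightarrow> real"
  where "partial_x i f p = deriv (\<lambda>h. f (fst p + h *\<^sub>R axis i 1, snd p)) 0"

definition partial_t :: "((real^'n) \<times> real \<Rightarrow> real) \<Rightarrow> (real^'n) \<times> real \<Rightarrow> real"
  where "partial_t f p = deriv (\<lambda>s. f (fst p, s)) (snd p)"

definition grad_x :: "((real^'n) \<times> real \<Rightarrow> real) \<Rightarrow> (real^'n) \<times> real \<Rightarrow> real^'n"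
  where "grad_x f p = (\<chi> i. partial_x i f p)"

text \<open>For a field that is only Lipschitz in \<open>x\<close>, such as \<open>A \<nabla>w\<close>, the partial derivatives exist almost
  everywhere and \<open>deriv\<close> has an unspecified value on the exceptional null set. Space-time integrals
  are therefore taken over the complete measure \<open>lebesgue\<close>.\<close>

definition div_x :: "((real^'n) \<times> real \<Rightarrow> real^'n) \<Rightarrow> (real^'n) \<times> real \<Rightarrow> real"
  where "div_x F p = (\<Sum>i\<in>UNIV. partial_x i (\<lambda>q. F q $ i) p)"

definition Q :: "real \<Rightarrow> ((real^'n) \<times> real) set"
  where "Q r = ball 0 r \<times> {0..r\<^sup>2}"

primrec Ck :: "nat \<Rightarrow> ('a::euclidean_space \<Rightarrow> real) \<Rightarrow> bool"
  where
    "Ck 0 f \<longleftrightarrow> continuous_on UNIV f"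
  | "Ck (Suc k) f \<longleftrightarrow> (\<forall>x. f differentiable (at x)) \<and>
       (\<forall>v. Ck k (\<lambda>x. frechet_derivative f (at x) v))"

definition smooth :: "('a::euclidean_space \<Rightarrow> real) \<Rightarrow> bool"
  where "smooth f \<longleftrightarrow> (\<forall>k. Ck k f)"

text \<open>Test functions on a region \<open>\<Omega>\<close> of the half space \<open>t \<ge> 0\<close>, smooth up to \<open>t = 0\<close>, where they need
  not vanish. Each is represented by a smooth extension to all times; the support condition
  concerns times \<open>t \<ge> 0\<close> only, and the values at \<open>t < 0\<close> play no role.\<close>

definition C0_infty :: "((real^'n) \<times> real) set \<Rightarrow> ((real^'n) \<times> real \<Rightarrow> real) set"
  where "C0_infty \<Omega> = {w. smooth w \<and>
    (\<exists>S. compact S \<and> S \<subseteq> \<Omega> \<and> (\<forall>x t. t \<ge> 0 \<and> (x, t) \<notin> S \<longrightarrow> w (x, t) = 0))}"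

definition loewner_le :: "real^'n^'n \<Rightarrow> real^'n^'n \<Rightarrow> bool"
  where "loewner_le M M' \<longleftrightarrow> transpose M = M \<and> transpose M' = M' \<and>
    (\<forall>v. v \<bullet> (M *v v) \<le> v \<bullet> (M' *v v))"

definition elliptic_on :: "((real^'n) \<times> real) set \<Rightarrow> real \<Rightarrow> ((real^'n) \<times> real \<Rightarrow> real^'n^'n) \<Rightarrow> bool"
  where "elliptic_on S \<Lambda> A \<longleftrightarrow>
    (\<forall>p\<in>S. loewner_le (inverse \<Lambda> *\<^sub>R mat 1) (A p) \<and> loewner_le (A p) (\<Lambda> *\<^sub>R mat 1))"

definition parabolic_lipschitz_on ::
    "((real^'n) \<times> real) set \<Rightarrow> real \<Rightarrow> ((real^'n) \<times> real \<Rightarrow> real^'n^'n) \<Rightarrow> bool"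
  where "parabolic_lipschitz_on S K A \<longleftrightarrow>
    (\<forall>x t y s. (x, t) \<in> S \<and> (y, s) \<in> S \<longrightarrow>
      norm (A (x, t) - A (y, s)) \<le> K * (norm (x - y) + sqrt \<bar>t - s\<bar>))"

definition C1_in_x :: "((real^'n) \<times> real \<Rightarrow> real) \<Rightarrow> bool"
  where "C1_in_x V \<longleftrightarrow> (\<forall>t\<in>{0..16}. (\<lambda>x. V (x, t)) differentiable_on ball 0 4 \<and>
    continuous_on (ball 0 4) (\<lambda>x. grad_x V (x, t)))"

text \<open>The norms of \<open>V\<close> are extended reals; \<open>V\<close> is \<open>1/2\<close>-Hoelder in \<open>t\<close> iff \<open>holder_half V < \<infinity>\<close>.\<close>

definition Linf_norm :: "'a::euclidean_space set \<Rightarrow> ('a \<Rightarrow> 'b::real_normed_vector) \<Rightarrow> ereal"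
  where "Linf_norm S f = esssup (lebesgue_on S) (\<lambda>p. ereal (norm (f p)))"

definition norm1 :: "((real^'n) \<times> real \<Rightarrow> real) \<Rightarrow> ereal"
  where "norm1 V = Linf_norm (Q 4) V + Linf_norm (Q 4) (grad_x V)"

definition holder_half :: "((real^'n) \<times> real \<Rightarrow> real) \<Rightarrow> ereal"
  where "holder_half V = Sup {ereal (\<bar>V (x, t) - V (x, s)\<bar> / sqrt \<bar>t - s\<bar>) | x t s.
    (x, t) \<in> Q 4 \<and> (x, s) \<in> Q 4 \<and> t \<noteq> s}"

definition \<theta> :: "real \<Rightarrow> real"
  where "\<theta> t = sqrt t * ln (1 / t) powr (3 / 2)"

text \<open>The equation is imposed for \<open>0 < lam * t \<le> 1\<close>: at \<open>t = 0\<close> its right-hand side is singular. Positivity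
  of \<open>\<sigma> / (t \<sigma>')\<close> makes the logarithm meaningful. The normalisation at \<open>0\<close> then determines
  \<open>\<sigma>\<close> on \<open>[0, 1/lam]\<close>; its values elsewhere are irrelevant.\<close>

definition is_weight :: "real \<Rightarrow> (real \<Rightarrow> real) \<Rightarrow> bool"
  where "is_weight lam \<sigma> \<longleftrightarrow> (\<exists>\<sigma>'.
    (\<forall>t\<in>{0..1/lam}. (\<sigma> has_real_derivative \<sigma>' t) (at t within {0..1/lam})) \<and>
    \<sigma> 0 = 0 \<and> \<sigma>' 0 = 1 \<and>
    (\<forall>t\<in>{0<..1/lam}. \<sigma> t / (t * \<sigma>' t) > 0 \<and>
      ((\<lambda>s. ln (\<sigma> s / (s * \<sigma>' s))) has_real_derivative \<theta> (lam * t) / t) (at t within {0..1/lam})))"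

definition G :: "real^'n \<Rightarrow> real \<Rightarrow> real"
  where "G x t = t powr (- real CARD('n) / 2) * exp (- (norm x)\<^sup>2 / (4 * t))"

definition space_time_integral :: "((real^'n) \<times> real \<Rightarrow> real) \<Rightarrow> real"
  where "space_time_integral f = (LINT p:UNIV \<times> {0..}|lebesgue. f p)"

end

theory Submission
  imports Defs
begin

text \<open>Write \<open>\<tau> = t + a\<close>, \<open>\<gamma> = \<sigma> / \<sigma>'\<close> and let \<open>E = \<sigma>(\<tau>)\<^sup>-\<^sup>2\<^sup>\<alpha> G(x, \<tau>)\<close> be the weight.
The inequality is proved by the classical commutator method, with two extra ideas that let it tolerate
coefficients that are merely Lipschitz in \<open>x\<close> and \<open>1/2\<close>-Hoelder in \<open>t\<close>.

\<^emph>\<open>Freezing.\<close> Differentiating the weighted operator in time would differentiate \<open>A\<close> and \<open>V\<close> in time, so both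
are replaced by their values at \<open>t = 0\<close>, \<open>A0\<close> and \<open>V0\<close>. For the frozen operator the conjugated expression
splits as \<open>S + B\<close>, a symmetric part \<open>S\<close> (\<open>St\<close> below) and a skew part \<open>B\<close> (\<open>Bt\<close>). The product \<open>2 \<omega> G B S\<close>, with
\<open>\<omega> = \<gamma> \<sigma>\<^sup>-\<^sup>2\<^sup>\<alpha>\<close>, equals a spatial divergence plus a time derivative plus \<open>\<omega> G\<close> times
\<open>(\<theta>/\<tau>) q - ((1 + \<theta>)/\<tau>) U w\<^sup>2 + R\<close>, where \<open>q = \<nabla>w \<bullet> A0 \<nabla>w\<close> (\<open>commutator_identity\<close>). The equation for \<open>\<sigma>\<close> is exactly
what makes the coefficient of \<open>q\<close> equal to \<open>\<theta>/\<tau> > 0\<close>; \<open>A0(0) = 1\<close> makes every term of \<open>R\<close> carry a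
factor \<open>|x|\<close>. Integration gives \<open>basic_inequality\<close>: it controls \<open>\<integral> \<omega> G S\<^sup>2\<close> and the gradient with weight \<open>\<theta> E\<close>,
and the time boundary term at \<open>t = 0\<close> is the one on the right of the theorem.

\<^emph>\<open>Closing.\<close> Testing the symmetric part against \<open>w\<close> turns the gradient bound into a bound on \<open>w\<close> itself with weight
\<open>\<theta> (\<alpha>/\<tau>) E\<close> (\<open>zero_order_inequality\<close>). The errors \<open>\<integral> E |x| |\<nabla>w|\<^sup>2\<close> are controlled by testing the true equation
with \<open>w (|x|\<^sup>2 + \<tau>)\<^sup>1\<^sup>/\<^sup>2\<close> (\<open>gradient_inequality\<close>). The error of freezing is \<open>O(t) |D\<^sup>2w|\<^sup>2\<close>, since \<open>|A - A0| \<le> K t\<^sup>1\<^sup>/\<^sup>2\<close>,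
and is recovered by a weighted \<open>H\<^sup>2\<close> estimate (\<open>second_derivative_inequality\<close>), whose factor \<open>t \<le> 1/\<lambda>\<close> makes it
small. What remains has weights such as \<open>(|x|\<^sup>3/\<tau>\<^sup>2 + \<alpha> |x|/\<tau>) E\<close>. Where \<open>|x|\<^sup>2 \<le> c \<alpha> \<tau> log(1/\<lambda>\<tau>)\<close> this is at most a
multiple of \<open>\<delta> \<theta> (\<alpha>/\<tau>) E\<close>, because \<open>\<theta>\<close> is \<open>(\<lambda>\<tau>)\<^sup>1\<^sup>/\<^sup>2\<close> times a power \<open>3/2\<close> of the logarithm; elsewhere the
Gaussian beats the singularity of \<open>\<sigma>\<^sup>-\<^sup>2\<^sup>\<alpha>\<close> and the weight is at most \<open>N\<^sup>2\<^sup>\<alpha> \<alpha>\<^sup>2\<^sup>\<alpha>\<close>, which yields the supremum term.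
Choosing \<open>\<delta>\<close> small and then \<open>N\<close> large closes the system of inequalities (\<open>absorption\<close>).

\<^emph>\<open>Regularity.\<close> The fields involved are Lipschitz in \<open>x\<close>, so their divergences exist almost everywhere and
integrate to zero. This rests on the one-dimensional Rademacher theorem, proved here from Vitali's covering
theorem and applied on lines. All divergences are then computed pointwise almost everywhere.\<close>

section \<open>Lipschitz functions of one real variable\<close>

lemma cball_real: "cball (c::real) r = {c - r..c + r}"
  by (auto simp: dist_real_def)

text \<open>Half of the one-dimensional Rademacher theorem. The images of the short intervals of small slope form a Vitali cover of the
image of \<open>E\<close>; disjoint ones exhaust it up to a null set, each is at most \<open>\<rho>\<close> times as long as its interval, and the
intervals are disjoint subsets of \<open>O'\<close>.\<close>

lemma image_measure_le_slope:
  fixes g :: "real \<Rightarrow> real" and E :: "real set"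
  assumes mono: "strict_mono g" and cont: "continuous_on UNIV g"
    and null: "\<And>N. negligible N \<Longrightarrow> negligible (g ` N)"
    and E: "E \<subseteq> O'" "open O'" and rho: "\<rho> \<ge> 0"
    and slope: "\<And>x d. x \<in> E \<Longrightarrow> d > 0 \<Longrightarrow>
       \<exists>u v. u < v \<and> x \<in> {u..v} \<and> v - u < d \<and> {u..v} \<subseteq> O' \<and> g v - g u \<le> \<rho> * (v - u)"
    and mE: "g ` E \<in> sets lebesgue"
  shows "emeasure lebesgue (g ` E) \<le> ennreal \<rho> * emeasure lebesgue O'"
proof -
  define K where "K = {(c, r). r > 0 \<and> {c - r..c + r} \<subseteq> O' \<and> g (c + r) - g (c - r) \<le> \<rho> * (2 * r)}"
  obtain C where C: "countable C" "C \<subseteq> K"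
    "pairwise (\<lambda>i j. disjnt (cball (fst i) (snd i)) (cball (fst j) (snd j))) C"
    "negligible (E - (\<Union>i \<in> C. cball (fst i) (snd i)))"
  proof (rule Vitali_covering_theorem_cballs[of K snd E fst])
    show "0 < snd i" if "i \<in> K" for i using that by (auto simp: K_def)
    fix x d :: real assume "x \<in> E" "0 < d"
    then obtain u v where uv: "u < v" "x \<in> {u..v}" "v - u < d" "{u..v} \<subseteq> O'" "g v - g u \<le> \<rho> * (v - u)"
      using slope by blast
    have eq: "(u + v) / 2 - (v - u) / 2 = u" "(u + v) / 2 + (v - u) / 2 = v" "2 * ((v - u) / 2) = v - u"
      by (simp_all add: field_simps)
    have "((u + v) / 2, (v - u) / 2) \<in> K"
      using uv unfolding K_def mem_Collect_eq case_prod_conv eq by simp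
    moreover have "x \<in> cball ((u + v) / 2) ((v - u) / 2)"
      unfolding cball_real eq using uv by auto
    ultimately show "\<exists>i. i \<in> K \<and> x \<in> cball (fst i) (snd i) \<and> snd i < d"
      using uv by (intro exI[of _ "((u + v) / 2, (v - u) / 2)"]) auto
  qed
  define I where "I i = cball (fst i) (snd i :: real)" for i :: "real \<times> real"
  have disj: "disjoint_family_on I C"
    using C(3) by (auto simp: pairwise_def disjnt_def disjoint_family_on_def I_def)
  have inj: "inj g" using mono by (rule strict_mono_imp_inj_on)
  have disj2: "disjoint_family_on (\<lambda>i. g ` I i) C"
    using disj inj unfolding disjoint_family_on_def by (metis image_Int image_empty)
  have img: "g ` I i \<subseteq> {g (fst i - snd i)..g (fst i + snd i)}" for i
    using mono by (auto simp: I_def cball_real strict_mono_less_eq)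
  have gI: "g ` I i \<in> sets lebesgue" for i
  proof -
    have "compact (g ` I i)" unfolding I_def
      by (intro compact_continuous_image continuous_on_subset[OF cont]) auto
    thus ?thesis by (simp add: borel_compact)
  qed
  have le: "emeasure lebesgue (g ` I i) \<le> ennreal \<rho> * emeasure lebesgue (I i)" if "i \<in> C" for i
  proof -
    have K: "i \<in> K" using that C(2) by auto
    hence r: "snd i > 0" and gr: "g (fst i + snd i) - g (fst i - snd i) \<le> \<rho> * (2 * snd i)"
      by (auto simp: K_def)
    have "emeasure lebesgue (g ` I i) \<le> emeasure lebesgue {g (fst i - snd i)..g (fst i + snd i)}"
      by (rule emeasure_mono[OF img]) auto
    also have "\<dots> = ennreal (g (fst i + snd i) - g (fst i - snd i))"
      using mono r by (simp add: strict_mono_less_eq)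
    also have "\<dots> \<le> ennreal (\<rho> * (2 * snd i))" using gr by (rule ennreal_leI)
    also have "\<dots> = ennreal \<rho> * emeasure lebesgue (I i)"
      using r rho by (simp add: I_def cball_real ennreal_mult)
    finally show ?thesis .
  qed
  have "negligible (g ` (E - (\<Union>i\<in>C. I i)))"
    using null C(4) by (auto simp: I_def)
  hence null0: "emeasure lebesgue (g ` (E - (\<Union>i\<in>C. I i))) = 0" "g ` (E - (\<Union>i\<in>C. I i)) \<in> sets lebesgue"
    by (auto simp: negligible_iff_null_sets)
  have "emeasure lebesgue (g ` E) \<le> emeasure lebesgue (g ` (E - (\<Union>i\<in>C. I i)) \<union> (\<Union>i\<in>C. g ` I i))"
  proof (rule emeasure_mono)
    show "g ` E \<subseteq> g ` (E - (\<Union>i\<in>C. I i)) \<union> (\<Union>i\<in>C. g ` I i)" by blast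
  qed (use null0 gI C(1) in \<open>auto intro!: sets.countable_UN'\<close>)
  also have "\<dots> \<le> emeasure lebesgue (g ` (E - (\<Union>i\<in>C. I i))) + emeasure lebesgue (\<Union>i\<in>C. g ` I i)"
    using null0 gI C(1) by (intro emeasure_subadditive) (auto intro!: sets.countable_UN')
  also have "\<dots> = emeasure lebesgue (\<Union>i\<in>C. g ` I i)" using null0 by simp
  also have "\<dots> = (\<integral>\<^sup>+i. emeasure lebesgue (g ` I i) \<partial>count_space C)"
    using gI C(1) disj2 by (intro emeasure_UN_countable) auto
  also have "\<dots> \<le> (\<integral>\<^sup>+i. ennreal \<rho> * emeasure lebesgue (I i) \<partial>count_space C)"
    using le by (intro nn_integral_mono) auto
  also have "\<dots> = ennreal \<rho> * (\<integral>\<^sup>+i. emeasure lebesgue (I i) \<partial>count_space C)"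
    by (intro nn_integral_cmult) auto
  also have "(\<integral>\<^sup>+i. emeasure lebesgue (I i) \<partial>count_space C) = emeasure lebesgue (\<Union>i\<in>C. I i)"
    using C(1) disj by (intro emeasure_UN_countable[symmetric]) (simp_all add: I_def[THEN arg_cong[of _ _ "\<lambda>S. S \<in> sets lebesgue"]])
  also have "\<dots> \<le> emeasure lebesgue O'"
    using C(2) E(2) by (intro emeasure_mono) (auto simp: K_def I_def cball_real subset_iff)
  finally show ?thesis by (simp add: mult_left_mono)
qed

lemma image_measure_ge_slope:
  fixes g :: "real \<Rightarrow> real" and E :: "real set"
  assumes mono: "strict_mono g" and cont: "continuous_on UNIV g"
    and E: "E \<subseteq> O'" "open O'" and rho: "\<rho> \<ge> 0"
    and slope: "\<And>x d. x \<in> E \<Longrightarrow> d > 0 \<Longrightarrow>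
       \<exists>u v. u < v \<and> x \<in> {u..v} \<and> v - u < d \<and> {u..v} \<subseteq> O' \<and> g v - g u \<ge> \<rho> * (v - u)"
    and mE: "E \<in> sets lebesgue" and mO: "g ` O' \<in> sets lebesgue"
  shows "ennreal \<rho> * emeasure lebesgue E \<le> emeasure lebesgue (g ` O')"
proof -
  define K where "K = {(c, r). r > 0 \<and> {c - r..c + r} \<subseteq> O' \<and> g (c + r) - g (c - r) \<ge> \<rho> * (2 * r)}"
  obtain C where C: "countable C" "C \<subseteq> K"
    "pairwise (\<lambda>i j. disjnt (cball (fst i) (snd i)) (cball (fst j) (snd j))) C"
    "negligible (E - (\<Union>i \<in> C. cball (fst i) (snd i)))"
  proof (rule Vitali_covering_theorem_cballs[of K snd E fst])
    show "0 < snd i" if "i \<in> K" for i using that by (auto simp: K_def)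
    fix x d :: real assume "x \<in> E" "0 < d"
    then obtain u v where uv: "u < v" "x \<in> {u..v}" "v - u < d" "{u..v} \<subseteq> O'" "g v - g u \<ge> \<rho> * (v - u)"
      using slope by blast
    have eq: "(u + v) / 2 - (v - u) / 2 = u" "(u + v) / 2 + (v - u) / 2 = v" "2 * ((v - u) / 2) = v - u"
      by (simp_all add: field_simps)
    have "((u + v) / 2, (v - u) / 2) \<in> K"
      using uv unfolding K_def mem_Collect_eq case_prod_conv eq by simp
    moreover have "x \<in> cball ((u + v) / 2) ((v - u) / 2)"
      unfolding cball_real eq using uv by auto
    ultimately show "\<exists>i. i \<in> K \<and> x \<in> cball (fst i) (snd i) \<and> snd i < d"
      using uv by (intro exI[of _ "((u + v) / 2, (v - u) / 2)"]) auto
  qed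
  define I where "I i = cball (fst i) (snd i :: real)" for i :: "real \<times> real"
  have disj: "disjoint_family_on I C"
    using C(3) by (auto simp: pairwise_def disjnt_def disjoint_family_on_def I_def)
  have inj: "inj g" using mono by (rule strict_mono_imp_inj_on)
  have disj2: "disjoint_family_on (\<lambda>i. g ` I i) C"
    using disj inj unfolding disjoint_family_on_def by (metis image_Int image_empty)
  have gI: "g ` I i \<in> sets lebesgue" for i
  proof -
    have "compact (g ` I i)" unfolding I_def
      by (intro compact_continuous_image continuous_on_subset[OF cont]) auto
    thus ?thesis by (simp add: borel_compact)
  qed
  have le: "ennreal \<rho> * emeasure lebesgue (I i) \<le> emeasure lebesgue (g ` I i)" if "i \<in> C" for i
  proof -
    have K: "i \<in> K" using that C(2) by auto
    hence r: "snd i > 0" and gr: "g (fst i + snd i) - g (fst i - snd i) \<ge> \<rho> * (2 * snd i)"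
      by (auto simp: K_def)
    have "ennreal \<rho> * emeasure lebesgue (I i) = ennreal (\<rho> * (2 * snd i))"
      using r rho by (simp add: I_def cball_real ennreal_mult)
    also have "\<dots> \<le> ennreal (g (fst i + snd i) - g (fst i - snd i))" using gr by (rule ennreal_leI)
    also have "\<dots> = emeasure lebesgue {g (fst i - snd i)..g (fst i + snd i)}"
      using mono r by (simp add: strict_mono_less_eq)
    also have "{g (fst i - snd i)..g (fst i + snd i)} \<subseteq> g ` I i"
    proof
      fix z assume "z \<in> {g (fst i - snd i)..g (fst i + snd i)}"
      then obtain x where "fst i - snd i \<le> x" "x \<le> fst i + snd i" "g x = z"
        using IVT'[of g "fst i - snd i" z "fst i + snd i"] r continuous_on_subset[OF cont] by auto
      thus "z \<in> g ` I i" by (auto simp: I_def cball_real)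
    qed
    hence "emeasure lebesgue {g (fst i - snd i)..g (fst i + snd i)} \<le> emeasure lebesgue (g ` I i)"
      using gI by (intro emeasure_mono) auto
    finally show ?thesis .
  qed
  have null0: "emeasure lebesgue (E - (\<Union>i\<in>C. I i)) = 0" "E - (\<Union>i\<in>C. I i) \<in> sets lebesgue"
    using C(4) by (auto simp: negligible_iff_null_sets I_def)
  have UI: "(\<Union>i\<in>C. I i) \<in> sets lebesgue" using C(1) by (auto intro!: sets.countable_UN' simp: I_def)
  have "emeasure lebesgue E \<le> emeasure lebesgue ((E - (\<Union>i\<in>C. I i)) \<union> (\<Union>i\<in>C. I i))"
    using sets.Un[OF null0(2) UI] by (intro emeasure_mono) blast+
  also have "\<dots> \<le> emeasure lebesgue (E - (\<Union>i\<in>C. I i)) + emeasure lebesgue (\<Union>i\<in>C. I i)"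
    using null0 UI by (intro emeasure_subadditive) auto
  also have "\<dots> = (\<integral>\<^sup>+i. emeasure lebesgue (I i) \<partial>count_space C)"
    using C(1) disj null0 by (simp, intro emeasure_UN_countable) (simp_all add: I_def[THEN arg_cong[of _ _ "\<lambda>S. S \<in> sets lebesgue"]])
  finally have "ennreal \<rho> * emeasure lebesgue E \<le> ennreal \<rho> * (\<integral>\<^sup>+i. emeasure lebesgue (I i) \<partial>count_space C)"
    by (simp add: mult_left_mono)
  also have "\<dots> = (\<integral>\<^sup>+i. ennreal \<rho> * emeasure lebesgue (I i) \<partial>count_space C)"
    by (intro nn_integral_cmult[symmetric]) auto
  also have "\<dots> \<le> (\<integral>\<^sup>+i. emeasure lebesgue (g ` I i) \<partial>count_space C)"
    using le by (intro nn_integral_mono) auto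
  also have "\<dots> = emeasure lebesgue (\<Union>i\<in>C. g ` I i)"
    using gI C(1) disj2 by (intro emeasure_UN_countable[symmetric]) auto
  also have "\<dots> \<le> emeasure lebesgue (g ` O')"
    using C(2) mO by (intro emeasure_mono) (force simp: K_def I_def cball_real subset_iff)+
  finally show ?thesis .
qed


text \<open>If difference quotients fall below \<open>r\<close> and exceed \<open>s > r\<close> at every point of a set, the two image estimates say that
the image has measure at most \<open>r\<close> times and at least \<open>s\<close> times that of the set, after adding a multiple of the
identity that makes all slopes positive. Hence the set is null.\<close>

lemma lipschitz_oscillation_null:
  fixes f :: "real \<Rightarrow> real"
  assumes lip: "\<And>x y. \<bar>f x - f y\<bar> \<le> L * \<bar>x - y\<bar>"
    and rs: "r < s"
  shows "emeasure lebesgue {x. (\<forall>d>0. \<exists>h. h \<noteq> 0 \<and> \<bar>h\<bar> < d \<and> (f (x + h) - f x) / h < r) \<and>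
     (\<forall>d>0. \<exists>h. h \<noteq> 0 \<and> \<bar>h\<bar> < d \<and> (f (x + h) - f x) / h > s)} = 0"
proof -
  have L0: "L \<ge> 0" using lip[of 1 0] by auto
  define c where "c = L + 1"
  define g where "g x = f x + c * x" for x
  have g_diff: "g y - g x \<ge> y - x" "g y - g x \<le> (2 * L + 1) * (y - x)" if "x \<le> y" for x y
  proof -
    have "\<bar>f y - f x\<bar> \<le> L * (y - x)" using lip[of y x] that by simp
    thus "g y - g x \<ge> y - x" "g y - g x \<le> (2 * L + 1) * (y - x)"
      by (auto simp: g_def c_def algebra_simps)
  qed
  have mono: "strict_mono g"
    using g_diff(1) by (intro strict_monoI) (smt (verit))
  have lipg: "\<bar>g y - g x\<bar> \<le> (2 * L + 1) * \<bar>y - x\<bar>" for x y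
    using g_diff[of x y] g_diff[of y x] by (cases "x \<le> y") auto
  have cont: "continuous_on UNIV g"
  proof (rule continuous_on_subset[OF lipschitz_on_continuous_on])
    show "(2 * L + 1)-lipschitz_on UNIV g"
      using lipg L0 by (intro lipschitz_onI) (auto simp: dist_real_def)
  qed auto
  have contf: "continuous_on UNIV f"
  proof (rule continuous_on_subset[OF lipschitz_on_continuous_on])
    show "L-lipschitz_on UNIV f"
      using lip L0 by (intro lipschitz_onI) (auto simp: dist_real_def)
  qed auto
  have null: "negligible (g ` N)" if "negligible N" for N
  proof (rule negligible_locally_Lipschitz_image[OF _ that])
    show "\<exists>T B. open T \<and> x \<in> T \<and> (\<forall>y\<in>N \<inter> T. norm (g y - g x) \<le> B * norm (y - x))" for x
      using lipg by (intro exI[of _ UNIV] exI[of _ "2 * L + 1"]) auto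
  qed auto
  have g_open: "open (g ` U)" if "open U" for U
    using invariance_of_domain[OF _ that, of g] continuous_on_subset[OF cont] mono
    by (metis inj_on_subset strict_mono_imp_inj_on subset_UNIV)
  have bij: "bij g"
  proof (rule bijI)
    show "inj g" using mono by (rule strict_mono_imp_inj_on)
    show "surj g"
    proof (rule surjI[of g "\<lambda>y. SOME x. g x = y"])
      fix y
      have "\<exists>x. g x = y"
      proof -
        define M where "M = \<bar>y - g 0\<bar>"
        have "g (- M) \<le> y" "y \<le> g M" using g_diff(1)[of "-M" 0] g_diff(1)[of 0 M] by (auto simp: M_def)
        moreover have "- M \<le> M" by (simp add: M_def)
        ultimately show ?thesis using IVT'[of g "-M" y M] continuous_on_subset[OF cont] by blast
      qed
      thus "g (SOME x. g x = y) = y" by (rule someI_ex)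
    qed
  qed
  define E where "E = {x. (\<forall>d>0. \<exists>h. h \<noteq> 0 \<and> \<bar>h\<bar> < d \<and> (f (x + h) - f x) / h < r) \<and>
     (\<forall>d>0. \<exists>h. h \<noteq> 0 \<and> \<bar>h\<bar> < d \<and> (f (x + h) - f x) / h > s)}"
  have Eb: "E \<in> sets borel"
  proof -
    have eq: "E = (\<Inter>n. \<Union>h\<in>{h. h \<noteq> 0 \<and> \<bar>h\<bar> < 1 / Suc n}. {x. (f (x + h) - f x) / h < r}) \<inter>
      (\<Inter>n. \<Union>h\<in>{h. h \<noteq> 0 \<and> \<bar>h\<bar> < 1 / Suc n}. {x. s < (f (x + h) - f x) / h})"
      (is "_ = ?R")
    proof (intro set_eqI iffI)
      fix x assume "x \<in> E"
      thus "x \<in> ?R" by (fastforce simp: E_def)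
    next
      fix x assume x: "x \<in> ?R"
      show "x \<in> E" unfolding E_def
      proof (intro CollectI conjI allI impI)
        fix d :: real assume "d > 0"
        then obtain n where n: "1 / Suc n < d" using nat_approx_posE by blast
        from x have "x \<in> (\<Union>h\<in>{h. h \<noteq> 0 \<and> \<bar>h\<bar> < 1 / Suc n}. {x. (f (x + h) - f x) / h < r})" by blast
        then obtain h where "h \<noteq> 0" "\<bar>h\<bar> < 1 / Suc n" "(f (x + h) - f x) / h < r" by blast
        thus "\<exists>h. h \<noteq> 0 \<and> \<bar>h\<bar> < d \<and> (f (x + h) - f x) / h < r" using n by force
      next
        fix d :: real assume "d > 0"
        then obtain n where n: "1 / Suc n < d" using nat_approx_posE by blast
        from x have "x \<in> (\<Union>h\<in>{h. h \<noteq> 0 \<and> \<bar>h\<bar> < 1 / Suc n}. {x. s < (f (x + h) - f x) / h})" by blast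
        then obtain h where "h \<noteq> 0" "\<bar>h\<bar> < 1 / Suc n" "s < (f (x + h) - f x) / h" by blast
        thus "\<exists>h. h \<noteq> 0 \<and> \<bar>h\<bar> < d \<and> s < (f (x + h) - f x) / h" using n by force
      qed
    qed
    have "continuous_on UNIV (\<lambda>x. (f (x + h) - f x) / h)" if "h \<noteq> 0" for h
      using that by (intro continuous_intros continuous_on_compose2[OF contf]) auto
    hence "open {x. (f (x + h) - f x) / h < r}" "open {x. s < (f (x + h) - f x) / h}" if "h \<noteq> 0" for h
      using that by (intro open_Collect_less continuous_on_const; blast)+
    thus ?thesis unfolding eq
      by (intro sets.Int sets.countable_INT'' borel_open open_UN) auto
  qed
  have quot: "\<exists>u v. u < v \<and> x \<in> {u..v} \<and> v - u = \<bar>h\<bar> \<and> g v - g u = ((f (x + h) - f x) / h + c) * (v - u)"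
    if "h \<noteq> 0" for x h
  proof (cases "h > 0")
    case True
    have "g (x + h) - g x = ((f (x + h) - f x) / h + c) * (x + h - x)"
      using that by (simp add: g_def field_simps)
    hence "x < x + h \<and> x \<in> {x..x + h} \<and> x + h - x = \<bar>h\<bar> \<and>
        g (x + h) - g x = ((f (x + h) - f x) / h + c) * (x + h - x)"
      using True by simp
    thus ?thesis by blast
  next
    case False
    have "g x - g (x + h) = ((f (x + h) - f x) / h + c) * (x - (x + h))"
      using that by (simp add: g_def field_simps)
    hence "x + h < x \<and> x \<in> {x + h..x} \<and> x - (x + h) = \<bar>h\<bar> \<and>
        g x - g (x + h) = ((f (x + h) - f x) / h + c) * (x - (x + h))"
      using False that by simp
    thus ?thesis by blast
  qed
  have main: "emeasure lebesgue (E \<inter> {-M<..<M}) = 0" if "M > 0" for M :: real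
  proof -
    define B where "B = E \<inter> {-M<..<M}"
    have Bb: "B \<in> sets borel" using Eb by (auto simp: B_def)
    hence B: "B \<in> sets lebesgue" by simp
    have fin: "emeasure lebesgue B < \<infinity>"
    proof -
      have "emeasure lebesgue B \<le> emeasure lebesgue {-M<..<M}" by (intro emeasure_mono) (auto simp: B_def)
      thus ?thesis using that by (auto intro: order_le_less_trans)
    qed
    have rc: "r + c \<ge> 0" if "B \<noteq> {}"
    proof -
      from that obtain x where "x \<in> E" by (auto simp: B_def)
      then obtain h where h: "h \<noteq> 0" "(f (x + h) - f x) / h < r" unfolding E_def using zero_less_one by blast
      have "\<bar>(f (x + h) - f x) / h\<bar> \<le> L" using lip[of "x + h" x] h by (simp add: field_simps)
      hence "- ((f (x + h) - f x) / h) \<le> L" unfolding abs_le_iff by blast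
      thus ?thesis using h(2) unfolding c_def by linarith
    qed
    have mg: "g ` A \<in> sets lebesgue" if "A \<in> sets borel" for A
    proof -
      have "g ` A = inv g -` A" using bij by (simp add: bij_vimage_eq_inv_image bij_imp_bij_inv inv_inv_eq)
      moreover have "continuous_on UNIV (inv g)"
        unfolding continuous_on_open_vimage[OF open_UNIV]
      proof (intro allI impI)
        fix U :: "real set" assume "open U"
        have "inv g -` U = g ` U" using bij by (simp add: bij_vimage_eq_inv_image bij_imp_bij_inv inv_inv_eq)
        thus "open (inv g -` U \<inter> UNIV)" using g_open[OF \<open>open U\<close>] by simp
      qed
      hence "inv g \<in> borel_measurable borel" by (rule borel_measurable_continuous_onI)
      hence "inv g -` A \<inter> space borel \<in> sets borel" using that by (rule measurable_sets)
      ultimately show ?thesis by simp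
    qed
    have oc: "\<exists>e>0. cball x e \<subseteq> W" if "open W" "x \<in> W" for W and x :: real
      using that unfolding open_contains_cball by blast
    have upper: "emeasure lebesgue (g ` A) \<le> ennreal (2 * L + 1) * emeasure lebesgue U"
      if AU: "A \<in> sets borel" "A \<subseteq> U" "open U" for A U
    proof (rule image_measure_le_slope[OF mono cont null AU(2,3) _ _ mg[OF AU(1)]])
      show "0 \<le> 2 * L + 1" using L0 by simp
      fix x d :: real assume "x \<in> A" "d > 0"
      then obtain e where e: "e > 0" "cball x e \<subseteq> U" using oc[OF AU(3)] AU(2) by blast
      define d' where "d' = min e (d / 2)"
      have d': "d' > 0" "d' \<le> e" "d' < d" using e \<open>d > 0\<close> by (auto simp: d'_def)
      show "\<exists>u v. u < v \<and> x \<in> {u..v} \<and> v - u < d \<and> {u..v} \<subseteq> U \<and> g v - g u \<le> (2 * L + 1) * (v - u)"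
      proof (rule exI[of _ x], rule exI[of _ "x + d'"], intro conjI)
        have "{x..x + d'} \<subseteq> cball x e" using d' by (auto simp: cball_real)
        thus "{x..x + d'} \<subseteq> U" using e(2) by blast
        show "g (x + d') - g x \<le> (2 * L + 1) * (x + d' - x)" using g_diff(2)[of x "x + d'"] d' by simp
      qed (use d' in auto)
    qed
    have "emeasure lebesgue B \<le> ennreal e" if "e > 0" "B \<noteq> {}" for e :: real
    proof -
      define e' where "e' = e * (s - r) / (2 * (2 * L + 1 + \<bar>r + c\<bar>))"
      have den: "2 * L + 1 + \<bar>r + c\<bar> > 0" using L0 by auto
      have e': "e' > 0" using that rs den by (simp add: e'_def)
      obtain U where U: "open U" "B \<subseteq> U" "U - B \<in> lmeasurable" "emeasure lebesgue (U - B) < ennreal e'"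
        using sets_lebesgue_outer_open[OF B e'] by blast
      have UB: "emeasure lebesgue U \<le> emeasure lebesgue B + ennreal e'"
      proof -
        have "emeasure lebesgue U = emeasure lebesgue (B \<union> (U - B))" using U(2) by (simp add: Un_absorb1)
        also have "\<dots> \<le> emeasure lebesgue B + emeasure lebesgue (U - B)"
          using B U by (intro emeasure_subadditive) auto
        also have "\<dots> \<le> emeasure lebesgue B + ennreal e'" using U(4) by (intro add_left_mono) auto
        finally show ?thesis .
      qed
      have Eprop: "\<exists>h. h \<noteq> 0 \<and> \<bar>h\<bar> < d \<and> (f (x + h) - f x) / h < r"
           "\<exists>h. h \<noteq> 0 \<and> \<bar>h\<bar> < d \<and> (f (x + h) - f x) / h > s" if "x \<in> B" "d > 0" for x d
        using that by (auto simp: B_def E_def)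
      have le: "emeasure lebesgue (g ` B) \<le> ennreal (r + c) * emeasure lebesgue U"
      proof (rule image_measure_le_slope[OF mono cont null U(2,1) _ _ mg[OF Bb]])
        show "0 \<le> r + c" by (rule rc[OF that(2)])
        fix x d :: real assume xd: "x \<in> B" "d > 0"
        then obtain e where e: "e > 0" "cball x e \<subseteq> U" using oc[OF U(1)] U(2) by blast
        obtain h where h: "h \<noteq> 0" "\<bar>h\<bar> < min d e" "(f (x + h) - f x) / h < r"
          using Eprop(1)[of x "min d e"] xd e by auto
        obtain u v where uv: "u < v" "x \<in> {u..v}" "v - u = \<bar>h\<bar>" "g v - g u = ((f (x + h) - f x) / h + c) * (v - u)"
          using quot[OF h(1)] by blast
        have "{u..v} \<subseteq> cball x e" using uv h(2) by (auto simp: cball_real)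
        hence "{u..v} \<subseteq> U" using e(2) by blast
        moreover have "g v - g u \<le> (r + c) * (v - u)" unfolding uv(4) using h(3) uv(1) by (intro mult_right_mono) auto
        moreover have "v - u < d" using uv(3) h(2) by simp
        ultimately show "\<exists>u v. u < v \<and> x \<in> {u..v} \<and> v - u < d \<and> {u..v} \<subseteq> U \<and> g v - g u \<le> (r + c) * (v - u)"
          using uv(1,2) by blast
      qed
      have ge: "ennreal (s + c) * emeasure lebesgue B \<le> emeasure lebesgue (g ` U)"
      proof (rule image_measure_ge_slope[OF mono cont U(2,1) _ _ B mg])
        show "0 \<le> s + c" using rc[OF that(2)] rs by simp
        show "U \<in> sets borel" using U(1) by simp
        fix x d :: real assume xd: "x \<in> B" "d > 0"
        then obtain e where e: "e > 0" "cball x e \<subseteq> U" using oc[OF U(1)] U(2) by blast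
        obtain h where h: "h \<noteq> 0" "\<bar>h\<bar> < min d e" "(f (x + h) - f x) / h > s"
          using Eprop(2)[of x "min d e"] xd e by auto
        obtain u v where uv: "u < v" "x \<in> {u..v}" "v - u = \<bar>h\<bar>" "g v - g u = ((f (x + h) - f x) / h + c) * (v - u)"
          using quot[OF h(1)] by blast
        have "{u..v} \<subseteq> cball x e" using uv h(2) by (auto simp: cball_real)
        hence "{u..v} \<subseteq> U" using e(2) by blast
        moreover have "g v - g u \<ge> (s + c) * (v - u)" unfolding uv(4) using h(3) uv(1) by (intro mult_right_mono) auto
        moreover have "v - u < d" using uv(3) h(2) by simp
        ultimately show "\<exists>u v. u < v \<and> x \<in> {u..v} \<and> v - u < d \<and> {u..v} \<subseteq> U \<and> (s + c) * (v - u) \<le> g v - g u"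
          using uv(1,2) by blast
      qed
      have diff: "emeasure lebesgue (g ` (U - B)) \<le> ennreal ((2 * L + 1) * e')"
      proof -
        have "emeasure lebesgue (g ` (U - B)) \<le> ennreal (2 * L + 1) * emeasure lebesgue (U - B)"
        proof (rule ennreal_le_epsilon)
          fix \<epsilon> :: real assume eps: "\<epsilon> > 0"
          hence "\<epsilon> / (2 * L + 1) > 0" using L0 by simp
          then obtain W where W: "open W" "U - B \<subseteq> W" "W - (U - B) \<in> lmeasurable"
             "emeasure lebesgue (W - (U - B)) < ennreal (\<epsilon> / (2 * L + 1))"
            using sets_lebesgue_outer_open[OF fmeasurableD[OF U(3)]] by blast
          have "emeasure lebesgue W = emeasure lebesgue ((U - B) \<union> (W - (U - B)))" using W(2) by (simp add: Un_absorb1)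
          also have "\<dots> \<le> emeasure lebesgue (U - B) + emeasure lebesgue (W - (U - B))"
            using U W by (intro emeasure_subadditive) auto
          also have "\<dots> \<le> emeasure lebesgue (U - B) + ennreal (\<epsilon> / (2 * L + 1))" using W(4) by (intro add_left_mono) auto
          finally have WW: "emeasure lebesgue W \<le> emeasure lebesgue (U - B) + ennreal (\<epsilon> / (2 * L + 1))" .
          have "emeasure lebesgue (g ` (U - B)) \<le> ennreal (2 * L + 1) * emeasure lebesgue W"
            using upper[of "U - B" W] W U(1) Bb by auto
          also have "\<dots> \<le> ennreal (2 * L + 1) * (emeasure lebesgue (U - B) + ennreal (\<epsilon> / (2 * L + 1)))"
            by (intro mult_left_mono WW) auto
          also have "\<dots> = ennreal (2 * L + 1) * emeasure lebesgue (U - B) + ennreal \<epsilon>"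
            using L0 eps by (simp add: distrib_left ennreal_mult[symmetric] del: ennreal_plus)
          finally show "emeasure lebesgue (g ` (U - B)) \<le> ennreal (2 * L + 1) * emeasure lebesgue (U - B) + ennreal \<epsilon>" .
        qed
        also have "\<dots> \<le> ennreal (2 * L + 1) * ennreal e'" using U(4) by (intro mult_left_mono) auto
        finally show ?thesis using L0 e' by (simp add: ennreal_mult[symmetric] del: ennreal_plus)
      qed
      define m where "m = measure lebesgue B"
      have m: "emeasure lebesgue B = ennreal m" "m \<ge> 0"
        using fin by (auto simp: m_def emeasure_eq_ennreal_measure top.not_eq_extremum)
      have "ennreal ((s + c) * m) = ennreal (s + c) * emeasure lebesgue B"
        unfolding m(1) using rc[OF that(2)] rs m(2) by (intro ennreal_mult) auto
      also have "\<dots> \<le> emeasure lebesgue (g ` B \<union> g ` (U - B))"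
      proof -
        have "B \<union> (U - B) = U" using U(2) by blast
        hence "g ` B \<union> g ` (U - B) = g ` U" by (simp only: image_Un[symmetric])
        thus ?thesis using ge by simp
      qed
      also have "\<dots> \<le> emeasure lebesgue (g ` B) + emeasure lebesgue (g ` (U - B))"
        using mg Bb U(1) by (intro emeasure_subadditive) auto
      also have "\<dots> \<le> ennreal (r + c) * (emeasure lebesgue B + ennreal e') + ennreal ((2 * L + 1) * e')"
        by (intro add_mono order_trans[OF le] mult_left_mono UB diff) simp
      also have "\<dots> = ennreal ((r + c) * (m + e') + (2 * L + 1) * e')"
        unfolding m(1) using rc[OF that(2)] m(2) e' L0
        by (simp add: ennreal_mult[symmetric] ennreal_plus[symmetric] del: ennreal_plus)
      finally have "(s + c) * m \<le> (r + c) * (m + e') + (2 * L + 1) * e'"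
        using rc[OF that(2)] m(2) e' L0 by (subst (asm) ennreal_le_iff) auto
      hence "(s - r) * m \<le> (2 * L + 1 + \<bar>r + c\<bar>) * e'" using rc[OF that(2)] by (simp add: algebra_simps)
      also have "\<dots> = (s - r) * (e / 2)" using den by (simp add: e'_def field_simps)
      finally have "m \<le> e / 2" using rs by simp
      thus ?thesis unfolding m(1) using that(1) by (intro ennreal_leI) auto
    qed
    note small = this
    show ?thesis
    proof (cases "B = {}")
      case False
      have "emeasure lebesgue B \<le> 0"
        by (rule ennreal_le_epsilon) (use small[OF _ False] in simp)
      thus ?thesis by (simp add: B_def)
    qed (simp add: B_def)
  qed
  have "E = (\<Union>n. E \<inter> {-real (Suc n)<..<real (Suc n)})"
  proof (intro equalityI subsetI)
    fix x assume "x \<in> E"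
    obtain n where "\<bar>x\<bar> < real n" using reals_Archimedean2 by blast
    thus "x \<in> (\<Union>n. E \<inter> {-real (Suc n)<..<real (Suc n)})" using \<open>x \<in> E\<close> by (intro UN_I[of n]) auto
  qed auto
  moreover have "emeasure lebesgue (\<Union>n. E \<inter> {-real (Suc n)<..<real (Suc n)}) = 0"
  proof (rule emeasure_UN_eq_0)
    show "emeasure lebesgue (E \<inter> {-real (Suc n)<..<real (Suc n)}) = 0" for n
      by (rule main) simp
  qed (use Eb in auto)
  ultimately show ?thesis by (metis E_def)
qed

section \<open>Directional derivatives of Lipschitz functions\<close>

text \<open>The points at which the quotients in direction \<open>e\<close> oscillate across the gap from \<open>r\<close> to \<open>s\<close>. Differentiability fails for
a Lipschitz function only on the union of these sets over rational gaps.\<close>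

definition osc :: "'a::real_vector \<Rightarrow> ('a \<Rightarrow> real) \<Rightarrow> real \<Rightarrow> real \<Rightarrow> 'a set"
  where "osc e f r s = {p. (\<forall>d>0. \<exists>h. h \<noteq> 0 \<and> \<bar>h\<bar> < d \<and> (f (p + h *\<^sub>R e) - f p) / h < r) \<and>
     (\<forall>d>0. \<exists>h. h \<noteq> 0 \<and> \<bar>h\<bar> < d \<and> (f (p + h *\<^sub>R e) - f p) / h > s)}"

lemma osc_borel:
  fixes f :: "'a::real_normed_vector \<Rightarrow> real"
  assumes contf: "continuous_on UNIV f"
  shows "osc e f r s \<in> sets borel"
proof -
  let ?q = "\<lambda>h x. (f (x + h *\<^sub>R e) - f x) / h"
  have eq: "osc e f r s = (\<Inter>n. \<Union>h\<in>{h. h \<noteq> 0 \<and> \<bar>h\<bar> < 1 / Suc n}. {x. ?q h x < r}) \<inter>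
    (\<Inter>n. \<Union>h\<in>{h. h \<noteq> 0 \<and> \<bar>h\<bar> < 1 / Suc n}. {x. s < ?q h x})"
    (is "_ = ?R")
  proof (intro set_eqI iffI)
    fix x assume "x \<in> osc e f r s"
    hence "\<exists>h. h \<noteq> 0 \<and> \<bar>h\<bar> < 1 / Suc n \<and> ?q h x < r" "\<exists>h. h \<noteq> 0 \<and> \<bar>h\<bar> < 1 / Suc n \<and> ?q h x > s" for n
      by (auto simp: osc_def)
    thus "x \<in> ?R" by blast
  next
    fix x assume x: "x \<in> ?R"
    show "x \<in> osc e f r s" unfolding osc_def
    proof (intro CollectI conjI allI impI)
      fix d :: real assume "d > 0"
      then obtain n where n: "1 / Suc n < d" using nat_approx_posE by blast
      from x have "x \<in> (\<Union>h\<in>{h. h \<noteq> 0 \<and> \<bar>h\<bar> < 1 / Suc n}. {x. ?q h x < r})" by blast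
      then obtain h where "h \<noteq> 0" "\<bar>h\<bar> < 1 / Suc n" "?q h x < r" by blast
      thus "\<exists>h. h \<noteq> 0 \<and> \<bar>h\<bar> < d \<and> ?q h x < r" using n by (intro exI[of _ h]) auto
    next
      fix d :: real assume "d > 0"
      then obtain n where n: "1 / Suc n < d" using nat_approx_posE by blast
      from x have "x \<in> (\<Union>h\<in>{h. h \<noteq> 0 \<and> \<bar>h\<bar> < 1 / Suc n}. {x. s < ?q h x})" by blast
      then obtain h where "h \<noteq> 0" "\<bar>h\<bar> < 1 / Suc n" "s < ?q h x" by blast
      thus "\<exists>h. h \<noteq> 0 \<and> \<bar>h\<bar> < d \<and> s < ?q h x" using n by (intro exI[of _ h]) auto
    qed
  qed
  have "continuous_on UNIV (?q h)" if "h \<noteq> 0" for h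
    using that by (intro continuous_intros continuous_on_compose2[OF contf]) auto
  hence "open {x. ?q h x < r}" "open {x. s < ?q h x}" if "h \<noteq> 0" for h
    using that by (intro open_Collect_less continuous_on_const; blast)+
  thus ?thesis unfolding eq
    by (intro sets.Int sets.countable_INT'' borel_open open_UN) auto
qed

text \<open>Fubini along the direction \<open>e\<close>: every line meets the set in a null set by the one-dimensional case.\<close>

lemma osc_null:
  fixes f :: "'a::euclidean_space \<Rightarrow> real"
  assumes contf: "continuous_on UNIV f"
    and lip: "\<And>p h. \<bar>f (p + h *\<^sub>R e) - f p\<bar> \<le> L * \<bar>h\<bar>" and rs: "r < s"
  shows "emeasure lborel (osc e f r s) = 0"
proof -
  define B where "B = osc e f r s"
  have B[measurable]: "B \<in> sets borel" unfolding B_def by (rule osc_borel[OF contf])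
  have line: "emeasure lborel {z::real. p + z *\<^sub>R e \<in> B} = 0" for p
  proof -
    have b: "{z::real. p + z *\<^sub>R e \<in> B} \<in> sets borel"
    proof -
      have "(\<lambda>z::real. p + z *\<^sub>R e) -` B \<inter> space borel \<in> sets borel"
        by (rule measurable_sets[OF borel_measurable_continuous_onI B]) (intro continuous_intros)
      thus ?thesis by (simp add: vimage_def)
    qed
    have "emeasure lebesgue {x. (\<forall>d>0. \<exists>h. h \<noteq> 0 \<and> \<bar>h\<bar> < d \<and> (f (p + (x + h) *\<^sub>R e) - f (p + x *\<^sub>R e)) / h < r) \<and>
     (\<forall>d>0. \<exists>h. h \<noteq> 0 \<and> \<bar>h\<bar> < d \<and> (f (p + (x + h) *\<^sub>R e) - f (p + x *\<^sub>R e)) / h > s)} = 0"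
    proof (rule lipschitz_oscillation_null[OF _ rs])
      show "\<bar>f (p + x *\<^sub>R e) - f (p + y *\<^sub>R e)\<bar> \<le> L * \<bar>x - y\<bar>" for x y
        using lip[of "p + y *\<^sub>R e" "x - y"] by (simp add: algebra_simps)
    qed
    moreover have "{x. (\<forall>d>0. \<exists>h. h \<noteq> 0 \<and> \<bar>h\<bar> < d \<and> (f (p + (x + h) *\<^sub>R e) - f (p + x *\<^sub>R e)) / h < r) \<and>
     (\<forall>d>0. \<exists>h. h \<noteq> 0 \<and> \<bar>h\<bar> < d \<and> (f (p + (x + h) *\<^sub>R e) - f (p + x *\<^sub>R e)) / h > s)} = {z::real. p + z *\<^sub>R e \<in> B}"
      by (simp add: B_def osc_def scaleR_add_left add.assoc)
    ultimately show ?thesis using b by simp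
  qed
  have meas: "(\<lambda>(z::real, p). indicator {0..1} z * indicator B (p + z *\<^sub>R e) :: ennreal) \<in> borel_measurable (lborel \<Otimes>\<^sub>M lborel)"
    by measurable
  have shift: "(\<integral>\<^sup>+p. indicator B (p + z *\<^sub>R e) \<partial>lborel) = emeasure lborel B" for z :: real
  proof -
    have "emeasure lborel B = (\<integral>\<^sup>+p. indicator B p \<partial>distr lborel borel ((+) (z *\<^sub>R e)))"
      by (simp add: lborel_distr_plus)
    also have "\<dots> = (\<integral>\<^sup>+p. indicator B (p + z *\<^sub>R e) \<partial>lborel)"
      by (subst nn_integral_distr) (auto simp: add.commute)
    finally show ?thesis by simp
  qed
  have "emeasure lborel B = (\<integral>\<^sup>+z. indicator {0..1::real} z * emeasure lborel B \<partial>lborel)"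
    by (simp add: nn_integral_multc)
  also have "\<dots> = (\<integral>\<^sup>+z. \<integral>\<^sup>+p. indicator {0..1::real} z * indicator B (p + z *\<^sub>R e) \<partial>lborel \<partial>lborel)"
    by (subst nn_integral_cmult) (auto simp: shift)
  also have "\<dots> = (\<integral>\<^sup>+p. \<integral>\<^sup>+z. indicator {0..1::real} z * indicator B (p + z *\<^sub>R e) \<partial>lborel \<partial>lborel)"
    using lborel_pair.Fubini'[OF meas] by simp
  also have "\<dots> = (\<integral>\<^sup>+p. 0 \<partial>(lborel :: 'a measure))"
  proof (intro nn_integral_cong)
    fix p
    have b: "{z::real. p + z *\<^sub>R e \<in> B} \<in> sets borel"
    proof -
      have "(\<lambda>z::real. p + z *\<^sub>R e) -` B \<inter> space borel \<in> sets borel"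
        by (rule measurable_sets[OF borel_measurable_continuous_onI B]) (intro continuous_intros)
      thus ?thesis by (simp add: vimage_def)
    qed
    have "(\<integral>\<^sup>+z. indicator {0..1::real} z * indicator B (p + z *\<^sub>R e) \<partial>lborel)
       \<le> (\<integral>\<^sup>+z. indicator {z. p + z *\<^sub>R e \<in> B} z \<partial>lborel)"
      by (intro nn_integral_mono) (auto simp: indicator_def)
    also have "\<dots> = emeasure lborel {z::real. p + z *\<^sub>R e \<in> B}" using b by simp
    finally show "(\<integral>\<^sup>+z. indicator {0..1::real} z * indicator B (p + z *\<^sub>R e) \<partial>lborel) = 0"
      using line[of p] by simp
  qed
  finally show ?thesis by (simp add: B_def)
qed

lemma not_osc_imp_derivative:
  assumes lip: "\<And>h. \<bar>f (p + h *\<^sub>R e) - f p\<bar> \<le> L * \<bar>h\<bar>"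
    and no: "\<And>r s. r \<in> \<rat> \<Longrightarrow> s \<in> \<rat> \<Longrightarrow> r < s \<Longrightarrow> p \<notin> osc e f r s"
  shows "\<exists>D. ((\<lambda>h. f (p + h *\<^sub>R e)) has_real_derivative D) (at 0)"
proof -
  define q where "q h = (f (p + h *\<^sub>R e) - f p) / h" for h
  have bd: "\<bar>q h\<bar> \<le> L" if "h \<noteq> 0" for h using lip[of h] that by (simp add: q_def field_simps)
  have "bounded (range (\<lambda>n. q (1 / Suc n)))"
    by (rule boundedI[of _ L]) (use bd in auto)
  then obtain D and g :: "nat \<Rightarrow> nat" where g: "strict_mono g" "((\<lambda>n. q (1 / Suc n)) \<circ> g) \<longlonglongrightarrow> D"
    using bounded_imp_convergent_subsequence by blast
  have seq: "\<exists>h. h \<noteq> 0 \<and> \<bar>h\<bar> < d \<and> \<bar>q h - D\<bar> < \<epsilon>" if d: "d > 0" and eps: "\<epsilon> > 0" for d \<epsilon>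
  proof -
    obtain m where m: "1 / Suc m < d" using nat_approx_posE[OF d] by blast
    have "\<forall>\<^sub>F n in sequentially. dist (((\<lambda>n. q (1 / Suc n)) \<circ> g) n) D < \<epsilon>"
      using g(2) eps by (rule tendstoD)
    hence "\<forall>\<^sub>F n in sequentially. n \<ge> m \<and> dist (((\<lambda>n. q (1 / Suc n)) \<circ> g) n) D < \<epsilon>"
      by (intro eventually_conj eventually_ge_at_top)
    then obtain n where n: "n \<ge> m" "dist (q (1 / Suc (g n))) D < \<epsilon>"
      by (auto simp: eventually_sequentially)
    have "g n \<ge> m" using n(1) seq_suble[OF g(1), of n] by simp
    hence "1 / real (Suc (g n)) \<le> 1 / Suc m" by (simp add: field_simps)
    thus ?thesis using n(2) m by (intro exI[of _ "1 / Suc (g n)"]) (auto simp: dist_real_def)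
  qed
  have lim: "(q \<longlongrightarrow> D) (at 0)"
  proof (rule ccontr)
    assume "\<not> (q \<longlongrightarrow> D) (at 0)"
    then obtain \<epsilon> where eps: "\<epsilon> > 0" and bad: "\<And>d. d > 0 \<Longrightarrow> \<exists>h. h \<noteq> 0 \<and> \<bar>h\<bar> < d \<and> \<bar>q h - D\<bar> \<ge> \<epsilon>"
      unfolding LIM_def dist_real_def by (force simp: not_less)
    obtain r1 where r1: "r1 \<in> \<rat>" "D + \<epsilon> / 3 < r1" "r1 < D + \<epsilon> / 2" using Rats_dense_in_real[of "D + \<epsilon> / 3" "D + \<epsilon> / 2"] eps by auto
    obtain s1 where s1: "s1 \<in> \<rat>" "D + \<epsilon> / 2 < s1" "s1 < D + \<epsilon>" using Rats_dense_in_real[of "D + \<epsilon> / 2" "D + \<epsilon>"] eps by auto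
    obtain r2 where r2: "r2 \<in> \<rat>" "D - \<epsilon> < r2" "r2 < D - \<epsilon> / 2" using Rats_dense_in_real[of "D - \<epsilon>" "D - \<epsilon> / 2"] eps by auto
    obtain s2 where s2: "s2 \<in> \<rat>" "D - \<epsilon> / 2 < s2" "s2 < D - \<epsilon> / 3" using Rats_dense_in_real[of "D - \<epsilon> / 2" "D - \<epsilon> / 3"] eps by auto
    have "p \<notin> osc e f r1 s1" using no r1 s1 by auto
    moreover have "\<forall>d>0. \<exists>h. h \<noteq> 0 \<and> \<bar>h\<bar> < d \<and> q h < r1"
      using seq[where \<epsilon>="\<epsilon> / 3"] eps r1 by (smt (verit, best) divide_pos_pos)
    ultimately have "\<not> (\<forall>d>0. \<exists>h. h \<noteq> 0 \<and> \<bar>h\<bar> < d \<and> q h > s1)"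
      unfolding osc_def q_def by blast
    then obtain d1 where d1: "d1 > 0" "\<And>h. h \<noteq> 0 \<Longrightarrow> \<bar>h\<bar> < d1 \<Longrightarrow> q h \<le> s1"
      by (meson not_less)
    have "p \<notin> osc e f r2 s2" using no r2 s2 by auto
    moreover have "\<forall>d>0. \<exists>h. h \<noteq> 0 \<and> \<bar>h\<bar> < d \<and> q h > s2"
      using seq[where \<epsilon>="\<epsilon> / 3"] eps s2 by (smt (verit, best) divide_pos_pos)
    ultimately have "\<not> (\<forall>d>0. \<exists>h. h \<noteq> 0 \<and> \<bar>h\<bar> < d \<and> q h < r2)"
      unfolding osc_def q_def by blast
    then obtain d2 where d2: "d2 > 0" "\<And>h. h \<noteq> 0 \<Longrightarrow> \<bar>h\<bar> < d2 \<Longrightarrow> q h \<ge> r2"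
      by (meson not_less)
    obtain h where h: "h \<noteq> 0" "\<bar>h\<bar> < min d1 d2" "\<bar>q h - D\<bar> \<ge> \<epsilon>" using bad[of "min d1 d2"] d1 d2 by auto
    have "q h \<le> s1" "q h \<ge> r2" using d1(2)[of h] d2(2)[of h] h by auto
    thus False using h(3) s1 r2 by linarith
  qed
  have "((\<lambda>h. f (p + h *\<^sub>R e)) has_real_derivative D) (at 0)"
    using lim by (simp add: has_field_derivative_iff q_def[abs_def])
  thus ?thesis by blast
qed

theorem directional_derivative_AE:
  fixes f :: "'a::euclidean_space \<Rightarrow> real"
  assumes contf: "continuous_on UNIV f"
    and lip: "\<And>p h. \<bar>f (p + h *\<^sub>R e) - f p\<bar> \<le> L * \<bar>h\<bar>"
  obtains D where "D \<in> borel_measurable borel" "\<And>p. \<bar>D p\<bar> \<le> L"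
    "AE p in lborel. ((\<lambda>h. f (p + h *\<^sub>R e)) has_real_derivative D p) (at 0)"
proof -
  have L0: "L \<ge> 0" using lip[of 0 1] abs_ge_zero[of "f (0 + 1 *\<^sub>R e) - f 0"] by linarith
  define N where "N = (\<Union>(r, s)\<in>{(r, s). r \<in> \<rat> \<and> s \<in> \<rat> \<and> r < s}. osc e f r s)"
  have cnt: "countable {(r::real, s). r \<in> \<rat> \<and> s \<in> \<rat> \<and> r < s}"
    by (rule countable_subset[of _ "\<rat> \<times> \<rat>"]) (auto intro: countable_rat)
  have Nb[measurable]: "N \<in> sets borel" unfolding N_def
    using osc_borel[OF contf] by (intro sets.countable_UN'[OF cnt]) auto
  have N0: "N \<in> null_sets lborel" unfolding N_def
    using osc_borel[OF contf] osc_null[OF contf lip]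
    by (intro null_sets_UN'[OF cnt]) (auto intro!: null_setsI)
  have f_meas[measurable]: "f \<in> borel_measurable borel" using contf by (rule borel_measurable_continuous_onI)
  define D where "D p = (if p \<in> N then 0 else lim (\<lambda>n. (f (p + (1 / Suc n) *\<^sub>R e) - f p) / (1 / Suc n)))" for p
  have der: "((\<lambda>h. f (p + h *\<^sub>R e)) has_real_derivative D p) (at 0)" if "p \<notin> N" for p
  proof -
    obtain D' where D': "((\<lambda>h. f (p + h *\<^sub>R e)) has_real_derivative D') (at 0)"
      using not_osc_imp_derivative[of f p e L] lip \<open>p \<notin> N\<close> by (auto simp: N_def)
    have "((\<lambda>h. (f (p + h *\<^sub>R e) - f p) / h) \<longlongrightarrow> D') (at 0)"
      using D' by (simp add: has_field_derivative_iff)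
    moreover have "filterlim (\<lambda>n. 1 / real (Suc n)) (at 0) sequentially"
      by (rule filterlim_atI) (use LIMSEQ_inverse_real_of_nat in \<open>auto simp: inverse_eq_divide\<close>)
    ultimately have "(\<lambda>n. (f (p + (1 / Suc n) *\<^sub>R e) - f p) / (1 / Suc n)) \<longlonglongrightarrow> D'"
      by (rule filterlim_compose)
    hence "D p = D'" using that by (simp add: D_def limI)
    thus ?thesis using D' by simp
  qed
  show ?thesis
  proof
    show "D \<in> borel_measurable borel" unfolding D_def by measurable
    show "\<bar>D p\<bar> \<le> L" for p
    proof (cases "p \<in> N")
      case False
      hence "((\<lambda>h. \<bar>(f (p + h *\<^sub>R e) - f p) / h\<bar>) \<longlongrightarrow> \<bar>D p\<bar>) (at 0)"
        using der[of p] by (intro tendsto_rabs) (simp add: has_field_derivative_iff)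
      moreover have "\<bar>(f (p + h *\<^sub>R e) - f p) / h\<bar> \<le> L" if "h \<noteq> 0" for h
        using lip[of p h] that by (simp add: field_simps)
      hence "\<forall>\<^sub>F h in at 0. \<bar>(f (p + h *\<^sub>R e) - f p) / h\<bar> \<le> L"
        by (auto simp: eventually_at_filter)
      ultimately show ?thesis by (intro tendsto_upperbound[of _ "\<bar>D p\<bar>" "at 0"]) auto
    qed (simp add: D_def L0)
    show "AE p in lborel. ((\<lambda>h. f (p + h *\<^sub>R e)) has_real_derivative D p) (at 0)"
      by (rule AE_I'[OF N0]) (use der in auto)
  qed
qed

text \<open>The integral of each difference quotient vanishes by translation invariance of Lebesgue measure; the quotients are
bounded by the Lipschitz constant, so dominated convergence passes to the derivative.\<close>

lemma integral_directional_derivative_eq_0: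
  fixes f :: "'a::euclidean_space \<Rightarrow> real"
  assumes f[measurable]: "f \<in> borel_measurable borel" and bd: "\<And>p. \<bar>f p\<bar> \<le> C"
    and supp: "\<And>p. norm p > R \<Longrightarrow> f p = 0"
    and lip: "\<And>p h. \<bar>f (p + h *\<^sub>R e) - f p\<bar> \<le> L * \<bar>h\<bar>"
    and D[measurable]: "D \<in> borel_measurable borel"
    and der: "AE p in lborel. ((\<lambda>h. f (p + h *\<^sub>R e)) has_real_derivative D p) (at 0)"
  shows "integral\<^sup>L lborel D = 0"
proof -
  define q where "q n p = (f (p + (1 / Suc n) *\<^sub>R e) - f p) / (1 / Suc n)" for n p
  have fi: "integrable lborel f"
  proof (rule integrableI_bounded_set[where A="cball 0 R" and B=C])
    show "emeasure lborel (cball (0::'a) R) < \<infinity>" using emeasure_bounded_finite[OF bounded_cball] by auto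
    show "AE x in lborel. x \<notin> cball 0 R \<longrightarrow> f x = 0" using supp by auto
  qed (use bd in auto)
  have q0: "integral\<^sup>L lborel (q n) = 0" for n
  proof -
    have shift: "f = (\<lambda>p. f p)" by simp
    have eq: "distr lborel borel ((+) ((1 / Suc n) *\<^sub>R e)) = (lborel :: 'a measure)"
      by (rule lborel_distr_plus)
    have i: "integrable lborel (\<lambda>p. f (p + (1 / Suc n) *\<^sub>R e))"
    proof -
      have "integrable (distr lborel borel ((+) ((1 / Suc n) *\<^sub>R e))) f" using fi by (simp only: eq)
      thus ?thesis by (subst (asm) integrable_distr_eq) (auto simp: add.commute)
    qed
    have "integral\<^sup>L lborel f = integral\<^sup>L (distr lborel borel ((+) ((1 / Suc n) *\<^sub>R e))) f"
      by (simp only: eq)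
    also have "\<dots> = (\<integral>p. f (p + (1 / Suc n) *\<^sub>R e) \<partial>lborel)"
      by (subst integral_distr) (auto simp: add.commute)
    finally have "(\<integral>p. f (p + (1 / Suc n) *\<^sub>R e) - f p \<partial>lborel) = 0" using i fi by simp
    moreover have "q n = (\<lambda>p. (f (p + (1 / Suc n) *\<^sub>R e) - f p) / (1 / Suc n))"
      by (rule ext) (simp only: q_def)
    ultimately show ?thesis by (simp only: integral_divide_zero)
  qed
  have "(\<lambda>n. integral\<^sup>L lborel (q n)) \<longlonglongrightarrow> integral\<^sup>L lborel D"
  proof (rule integral_dominated_convergence[where w="\<lambda>p. L * indicator (cball 0 (\<bar>R\<bar> + norm e)) p"])
    show "integrable lborel (\<lambda>p. L * indicator (cball (0::'a) (\<bar>R\<bar> + norm e)) p)"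
      using emeasure_bounded_finite[OF bounded_cball] by (intro integrable_mult_right integrable_real_indicator) auto
    show "AE p in lborel. (\<lambda>n. q n p) \<longlonglongrightarrow> D p"
      using der
    proof eventually_elim
      case (elim p)
      have "((\<lambda>h. (f (p + h *\<^sub>R e) - f p) / h) \<longlongrightarrow> D p) (at 0)"
        using elim by (simp add: has_field_derivative_iff)
      moreover have "filterlim (\<lambda>n. 1 / real (Suc n)) (at 0) sequentially"
        by (rule filterlim_atI) (use LIMSEQ_inverse_real_of_nat in \<open>auto simp: inverse_eq_divide\<close>)
      ultimately show ?case unfolding q_def by (rule filterlim_compose)
    qed
    show "AE p in lborel. norm (q n p) \<le> L * indicator (cball 0 (\<bar>R\<bar> + norm e)) p" for n
    proof (rule AE_I2)
      fix p
      show "norm (q n p) \<le> L * indicator (cball 0 (\<bar>R\<bar> + norm e)) p"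
      proof (cases "norm p \<le> \<bar>R\<bar> + norm e")
        case True
        have div: "\<bar>a / h\<bar> \<le> L" if "\<bar>a\<bar> \<le> L * \<bar>h\<bar>" "h \<noteq> 0" for a h :: real
          using that by (simp add: field_simps)
        have "\<bar>q n p\<bar> \<le> L" unfolding q_def by (rule div[OF lip]) simp
        thus ?thesis using True by simp
      next
        case False
        have "norm ((1 / Suc n) *\<^sub>R e) \<le> norm e" by (simp add: field_simps)
        hence "norm (p + (1 / Suc n) *\<^sub>R e) > R" using False norm_diff_ineq[of p "(1 / Suc n) *\<^sub>R e"] by linarith
        moreover have "norm p > R" using False norm_ge_zero[of e] by linarith
        ultimately show ?thesis using supp False by (simp add: q_def)
      qed
    qed
    show "q n \<in> borel_measurable lborel" for n unfolding q_def[abs_def] by measurable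
  qed auto
  thus ?thesis using q0 LIMSEQ_unique[OF tendsto_const] by fastforce
qed

section \<open>Calculus of smooth functions\<close>

text \<open>Directional derivative, as a function of the point, so that it can be iterated.\<close>

definition dd :: "'a::euclidean_space \<Rightarrow> ('a \<Rightarrow> real) \<Rightarrow> 'a \<Rightarrow> real"
  where "dd v f p = frechet_derivative f (at p) v"

lemma smooth_dd: "smooth f \<Longrightarrow> smooth (dd v f)"
  unfolding smooth_def dd_def[abs_def] by (metis Ck.simps(2))

lemma smooth_has_derivative: "smooth f \<Longrightarrow> (f has_derivative (\<lambda>v. dd v f p)) (at p)"
  unfolding smooth_def dd_def by (metis Ck.simps(2) frechet_derivative_works)

lemma smooth_continuous: "smooth f \<Longrightarrow> continuous_on S f"
  unfolding smooth_def by (meson Ck.simps(1) continuous_on_subset subset_UNIV)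

lemma smooth_line_derivative:
  assumes "smooth f"
  shows "((\<lambda>h. f (p + h *\<^sub>R v)) has_real_derivative dd v f (p + s *\<^sub>R v)) (at s)"
proof -
  have "((\<lambda>h. p + h *\<^sub>R v) has_derivative (\<lambda>h. h *\<^sub>R v)) (at s)" by (auto intro!: derivative_eq_intros)
  from has_derivative_compose[OF this smooth_has_derivative[OF assms]]
  have "((\<lambda>h. f (p + h *\<^sub>R v)) has_derivative (\<lambda>h. dd (h *\<^sub>R v) f (p + s *\<^sub>R v))) (at s)" .
  moreover have "(\<lambda>h. dd (h *\<^sub>R v) f (p + s *\<^sub>R v)) = (\<lambda>h. h * dd v f (p + s *\<^sub>R v))"
  proof
    fix h
    have bl: "bounded_linear (\<lambda>u. dd u f (p + s *\<^sub>R v))"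
      using smooth_has_derivative[OF assms] by (rule has_derivative_bounded_linear)
    show "dd (h *\<^sub>R v) f (p + s *\<^sub>R v) = h * dd v f (p + s *\<^sub>R v)"
      using linear_cmul[OF bounded_linear.linear[OF bl], of h v] by simp
  qed
  moreover have "(\<lambda>h. h * dd v f (p + s *\<^sub>R v)) = (*) (dd v f (p + s *\<^sub>R v))"
    by (rule ext) (rule mult.commute)
  ultimately show ?thesis by (simp only: has_field_derivative_def)
qed

text \<open>The mean value theorem applied twice writes the second difference through the mixed derivative at an intermediate point;
as the second difference is symmetric in the two directions, this gives \<open>dd_commute\<close> in the limit.\<close>

lemma second_difference_mean_value:
  assumes f: "smooth f" and s: "s > 0"
  shows "\<exists>\<xi> \<eta>. 0 < \<xi> \<and> \<xi> < s \<and> 0 < \<eta> \<and> \<eta> < s \<and>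
    f (p + s *\<^sub>R u + s *\<^sub>R v) - f (p + s *\<^sub>R u) - f (p + s *\<^sub>R v) + f p
      = s\<^sup>2 * dd v (dd u f) (p + \<xi> *\<^sub>R u + \<eta> *\<^sub>R v)"
proof -
  define g where "g r = f ((p + s *\<^sub>R v) + r *\<^sub>R u) - f (p + r *\<^sub>R u)" for r
  have "\<exists>\<xi>. 0 < \<xi> \<and> \<xi> < s \<and> g s - g 0 = (s - 0) * (dd u f (p + s *\<^sub>R v + \<xi> *\<^sub>R u) - dd u f (p + \<xi> *\<^sub>R u))"
    unfolding g_def by (rule MVT2[OF s]) (intro DERIV_diff smooth_line_derivative f)
  then obtain \<xi> where \<xi>: "0 < \<xi>" "\<xi> < s" "g s - g 0 = s * (dd u f (p + s *\<^sub>R v + \<xi> *\<^sub>R u) - dd u f (p + \<xi> *\<^sub>R u))"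
    by auto
  have "\<exists>\<eta>. 0 < \<eta> \<and> \<eta> < s \<and> dd u f ((p + \<xi> *\<^sub>R u) + s *\<^sub>R v) - dd u f ((p + \<xi> *\<^sub>R u) + 0 *\<^sub>R v) =
      (s - 0) * dd v (dd u f) ((p + \<xi> *\<^sub>R u) + \<eta> *\<^sub>R v)"
    by (rule MVT2[OF s]) (intro smooth_line_derivative smooth_dd f)
  then obtain \<eta> where \<eta>: "0 < \<eta>" "\<eta> < s" "dd u f (p + \<xi> *\<^sub>R u + s *\<^sub>R v) - dd u f (p + \<xi> *\<^sub>R u) =
      s * dd v (dd u f) (p + \<xi> *\<^sub>R u + \<eta> *\<^sub>R v)" by auto
  have "g s - g 0 = s * (s * dd v (dd u f) (p + \<xi> *\<^sub>R u + \<eta> *\<^sub>R v))"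
    unfolding \<xi>(3) \<eta>(3)[symmetric] by (simp add: algebra_simps)
  moreover have "g s - g 0 = f (p + s *\<^sub>R u + s *\<^sub>R v) - f (p + s *\<^sub>R u) - f (p + s *\<^sub>R v) + f p"
    by (simp add: g_def algebra_simps)
  ultimately show ?thesis using \<xi>(1,2) \<eta>(1,2)
    by (intro exI[of _ \<xi>] exI[of _ \<eta>]) (simp add: power2_eq_square mult.assoc)
qed

lemma dd_commute:
  assumes f: "smooth f"
  shows "dd u (dd v f) p = dd v (dd u f) p"
proof (rule ccontr)
  assume ne: "dd u (dd v f) p \<noteq> dd v (dd u f) p"
  define e where "e = \<bar>dd u (dd v f) p - dd v (dd u f) p\<bar> / 2"
  have e: "e > 0" using ne by (simp add: e_def)
  have near: "\<exists>d>0. \<forall>q. dist q p < d \<longrightarrow> \<bar>dd a (dd b f) q - dd a (dd b f) p\<bar> < e" for a b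
  proof -
    have "isCont (dd a (dd b f)) p"
      using smooth_continuous[OF smooth_dd[OF smooth_dd[OF f]], of UNIV]
      by (simp add: continuous_on_eq_continuous_at)
    thus ?thesis using e unfolding continuous_at_eps_delta dist_real_def by blast
  qed
  obtain d1 where d1: "d1 > 0" "\<And>q. dist q p < d1 \<Longrightarrow> \<bar>dd u (dd v f) q - dd u (dd v f) p\<bar> < e" using near by blast
  obtain d2 where d2: "d2 > 0" "\<And>q. dist q p < d2 \<Longrightarrow> \<bar>dd v (dd u f) q - dd v (dd u f) p\<bar> < e" using near by blast
  define M where "M = norm u + norm v + 1"
  have M: "M > 0" by (simp add: M_def add_nonneg_pos)
  define s where "s = min d1 d2 / M"
  have s: "s > 0" using d1(1) d2(1) M by (simp add: s_def)
  have close: "dist (p + \<xi> *\<^sub>R a + \<eta> *\<^sub>R b) p < min d1 d2"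
    if "0 < \<xi>" "\<xi> < s" "0 < \<eta>" "\<eta> < s" "(a = u \<and> b = v) \<or> (a = v \<and> b = u)" for \<xi> \<eta> a b
  proof -
    have "dist (p + \<xi> *\<^sub>R a + \<eta> *\<^sub>R b) p = norm (\<xi> *\<^sub>R a + \<eta> *\<^sub>R b)" by (simp add: dist_norm add.assoc)
    also have "\<dots> \<le> \<xi> * norm a + \<eta> * norm b" using norm_triangle_ineq[of "\<xi> *\<^sub>R a" "\<eta> *\<^sub>R b"] that by simp
    also have "\<dots> \<le> s * norm a + s * norm b" using that by (intro add_mono mult_right_mono) auto
    also have "\<dots> < s * M" using that(5) s by (auto simp: M_def algebra_simps)
    also have "\<dots> = min d1 d2" using M by (simp add: s_def)
    finally show ?thesis .
  qed
  obtain \<xi> \<eta> where 1: "0 < \<xi>" "\<xi> < s" "0 < \<eta>" "\<eta> < s"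
    "f (p + s *\<^sub>R u + s *\<^sub>R v) - f (p + s *\<^sub>R u) - f (p + s *\<^sub>R v) + f p
      = s\<^sup>2 * dd v (dd u f) (p + \<xi> *\<^sub>R u + \<eta> *\<^sub>R v)"
    using second_difference_mean_value[OF f s] by blast
  obtain \<xi>' \<eta>' where 2: "0 < \<xi>'" "\<xi>' < s" "0 < \<eta>'" "\<eta>' < s"
    "f (p + s *\<^sub>R v + s *\<^sub>R u) - f (p + s *\<^sub>R v) - f (p + s *\<^sub>R u) + f p
      = s\<^sup>2 * dd u (dd v f) (p + \<xi>' *\<^sub>R v + \<eta>' *\<^sub>R u)"
    using second_difference_mean_value[OF f s] by blast
  have swap: "p + s *\<^sub>R v + s *\<^sub>R u = p + s *\<^sub>R u + s *\<^sub>R v" by simp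
  have "s\<^sup>2 * dd v (dd u f) (p + \<xi> *\<^sub>R u + \<eta> *\<^sub>R v) = s\<^sup>2 * dd u (dd v f) (p + \<xi>' *\<^sub>R v + \<eta>' *\<^sub>R u)"
    using 1(5) 2(5) unfolding swap by linarith
  hence eq: "dd v (dd u f) (p + \<xi> *\<^sub>R u + \<eta> *\<^sub>R v) = dd u (dd v f) (p + \<xi>' *\<^sub>R v + \<eta>' *\<^sub>R u)" using s by simp
  have "\<bar>dd v (dd u f) (p + \<xi> *\<^sub>R u + \<eta> *\<^sub>R v) - dd v (dd u f) p\<bar> < e"
    by (rule d2(2)) (use close[OF 1(1-4), of u v] in simp)
  moreover have "\<bar>dd u (dd v f) (p + \<xi>' *\<^sub>R v + \<eta>' *\<^sub>R u) - dd u (dd v f) p\<bar> < e"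
    by (rule d1(2)) (use close[OF 2(1-4), of v u] in simp)
  ultimately have "\<bar>dd u (dd v f) p - dd v (dd u f) p\<bar> < 2 * e" unfolding eq by linarith
  thus False by (simp add: e_def)
qed

lemma smooth_lipschitz_on_convex_compact:
  assumes f: "smooth f" and S: "convex S" "compact S"
  shows "\<exists>L. \<forall>p\<in>S. \<forall>q\<in>S. \<bar>f p - f q\<bar> \<le> L * norm (p - q)"
proof -
  have "\<exists>B. \<forall>p\<in>S. \<bar>dd b f p\<bar> \<le> B" for b
  proof -
    have "compact ((\<lambda>p. dd b f p) ` S)"
      by (intro compact_continuous_image smooth_continuous smooth_dd f S)
    thus ?thesis by (meson bounded_real compact_imp_bounded imageI)
  qed
  then obtain B where B: "\<And>b p. p \<in> S \<Longrightarrow> \<bar>dd b f p\<bar> \<le> B b" by metis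
  have on: "onorm (\<lambda>v. dd v f p) \<le> (\<Sum>b\<in>Basis. B b)" if p: "p \<in> S" for p
  proof (rule onorm_bound)
    show "0 \<le> (\<Sum>b\<in>Basis. B b)" using B[OF p] by (intro sum_nonneg) (meson abs_ge_zero order_trans)
    fix v
    have lin: "linear (\<lambda>v. dd v f p)"
      using has_derivative_bounded_linear[OF smooth_has_derivative[OF f]] by (rule bounded_linear.linear)
    have "dd v f p = dd (\<Sum>b\<in>Basis. (v \<bullet> b) *\<^sub>R b) f p" by (simp add: euclidean_representation)
    also have "\<dots> = (\<Sum>b\<in>Basis. (v \<bullet> b) * dd b f p)"
      using linear_sum[OF lin, of "\<lambda>b. (v \<bullet> b) *\<^sub>R b" Basis] linear_cmul[OF lin] by simp
    also have "norm \<dots> \<le> (\<Sum>b\<in>Basis. norm v * B b)"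
      by (intro sum_norm_le) (auto simp: abs_mult intro!: mult_mono Basis_le_norm B p)
    finally show "norm (dd v f p) \<le> (\<Sum>b\<in>Basis. B b) * norm v" by (simp add: sum_distrib_left mult.commute)
  qed
  have "norm (f p - f q) \<le> (\<Sum>b\<in>Basis. B b) * norm (p - q)" if "p \<in> S" "q \<in> S" for p q
    by (rule differentiable_bound[OF S(1) has_derivative_at_withinI[OF smooth_has_derivative[OF f]] on])
       (use that in auto)
  thus ?thesis by auto
qed

text \<open>A test function is known to vanish only for \<open>t \<ge> 0\<close>, so at \<open>t = 0\<close> and at the final time its derivatives
have to be computed from one side.\<close>

lemma dd_eq_0_one_sided:
  assumes f: "smooth f" and z: "\<And>h. h \<in> {0..<d} \<Longrightarrow> f (p + h *\<^sub>R v) = 0" and d: "d > 0"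
  shows "dd v f p = 0"
proof -
  have "((\<lambda>h. f (p + h *\<^sub>R v)) has_real_derivative dd v f p) (at 0)"
    using smooth_line_derivative[OF f, of p v 0] by simp
  hence "((\<lambda>h. (f (p + h *\<^sub>R v) - f p) / h) \<longlongrightarrow> dd v f p) (at 0)"
    by (simp add: has_field_derivative_iff)
  moreover have "filterlim (\<lambda>n. d / real (n + 2)) (at 0) sequentially"
  proof (rule filterlim_atI)
    show "(\<lambda>n. d / real (n + 2)) \<longlonglongrightarrow> 0"
      by (rule LIMSEQ_ignore_initial_segment[of "\<lambda>n. d / real n" 0 2]) (rule lim_const_over_n)
  qed (use d in auto)
  ultimately have "(\<lambda>n. (f (p + (d / real (n + 2)) *\<^sub>R v) - f p) / (d / real (n + 2))) \<longlonglongrightarrow> dd v f p"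
    by (rule filterlim_compose)
  moreover have "(\<lambda>n. (f (p + (d / real (n + 2)) *\<^sub>R v) - f p) / (d / real (n + 2))) = (\<lambda>n. 0)"
  proof (rule ext)
    fix n :: nat
    have "d / real (n + 2) \<in> {0..<d}" using d by (simp add: divide_less_eq)
    hence "f (p + (d / real (n + 2)) *\<^sub>R v) = 0" by (rule z)
    moreover have "f p = 0" using z[of 0] d by simp
    ultimately show "(f (p + (d / real (n + 2)) *\<^sub>R v) - f p) / (d / real (n + 2)) = 0" by simp
  qed
  ultimately have "(\<lambda>n::nat. 0::real) \<longlonglongrightarrow> dd v f p" by (simp only:)
  thus ?thesis by (simp add: LIMSEQ_const_iff)
qed

lemma partial_x_smooth:
  assumes "smooth f" shows "partial_x i f p = dd (axis i 1, 0) f p"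
proof -
  have "((\<lambda>h. f (fst p + h *\<^sub>R axis i 1, snd p)) has_real_derivative dd (axis i 1, 0) f p) (at 0)"
    using smooth_line_derivative[OF assms, of p "(axis i 1, 0)" 0] by (cases p) simp
  thus ?thesis unfolding partial_x_def by (rule DERIV_imp_deriv)
qed

lemma partial_t_smooth:
  assumes "smooth f" shows "partial_t f p = dd (0, 1) f p"
proof -
  have "((\<lambda>s. f (fst p, s)) has_real_derivative dd (0, 1) f p) (at (snd p))"
    using smooth_line_derivative[OF assms, of "(fst p, 0)" "(0, 1)" "snd p"] by simp
  thus ?thesis unfolding partial_t_def by (rule DERIV_imp_deriv)
qed

section \<open>Integration over a space-time cylinder\<close>

text \<open>The support of every test function lies in such a compact cylinder, so one finite measure \<open>\<mu>\<close> serves for all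
integrals, and bounded measurable functions on it are integrable.\<close>

definition strip :: "real \<Rightarrow> ((real^'n) \<times> real) set"
  where "strip T = cball 0 4 \<times> {0..T}"

definition \<mu> :: "real \<Rightarrow> ((real^'n) \<times> real) measure"
  where "\<mu> T = restrict_space lborel (strip T)"

text \<open>Regularity classes: \<open>xlip\<close> for functions whose divergences are integrated by parts, \<open>tame\<close> for their almost everywhere
defined derivatives. Both are closed under the algebraic operations, which makes integrability a syntactic matter.\<close>

definition xlip :: "real \<Rightarrow> ((real^'n) \<times> real \<Rightarrow> 'b::real_normed_vector) \<Rightarrow> bool"
  where "xlip T F \<longleftrightarrow> continuous_on (strip T) F \<and>
    (\<exists>L. \<forall>x y t. (x, t) \<in> strip T \<longrightarrow> (y, t) \<in> strip T \<longrightarrow> norm (F (x, t) - F (y, t)) \<le> L * norm (x - y))"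

definition tame :: "real \<Rightarrow> ((real^'n) \<times> real \<Rightarrow> 'b::{real_normed_vector, second_countable_topology}) \<Rightarrow> bool"
  where "tame T F \<longleftrightarrow> F \<in> borel_measurable (\<mu> T) \<and> (\<exists>C. \<forall>p\<in>strip T. norm (F p) \<le> C)"

lemma compact_strip [simp]: "compact (strip T)"
  unfolding strip_def by (intro compact_Times) auto

lemma strip_borel [measurable, simp]: "strip T \<in> sets borel"
  by (intro borel_compact) simp

lemma space_\<mu> [simp]: "space (\<mu> T) = strip T"
  by (simp add: \<mu>_def space_restrict_space)

lemma finite_\<mu>: "finite_measure (\<mu> T :: ((real^'n) \<times> real) measure)"
proof
  have "emeasure (\<mu> T :: ((real^'n) \<times> real) measure) (space (\<mu> T)) = emeasure lborel (strip T :: ((real^'n) \<times> real) set)"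
    by (simp add: \<mu>_def emeasure_restrict_space space_restrict_space)
  thus "emeasure (\<mu> T :: ((real^'n) \<times> real) measure) (space (\<mu> T)) \<noteq> \<infinity>" using emeasure_bounded_finite[OF compact_imp_bounded[OF compact_strip]] by (simp add: less_top[symmetric])
qed

lemma tame_integrable: "tame T F \<Longrightarrow> integrable (\<mu> T) F"
  for F :: "_ \<Rightarrow> 'b::{banach, second_countable_topology}"
proof -
  assume F: "tame T F"
  then obtain C where C: "\<And>p. p \<in> strip T \<Longrightarrow> norm (F p) \<le> C" unfolding tame_def by blast
  show "integrable (\<mu> T) F"
    by (rule finite_measure.integrable_const_bound[OF finite_\<mu>, of _ C])
       (use F C in \<open>auto simp: tame_def intro!: AE_I2\<close>)
qed

lemma tame_continuous: "continuous_on (strip T) F \<Longrightarrow> tame T F"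
proof -
  assume c: "continuous_on (strip T) F"
  have "bounded (F ` strip T)" by (intro compact_imp_bounded compact_continuous_image c) simp
  moreover have "F \<in> borel_measurable (\<mu> T)"
    using borel_measurable_continuous_on_restrict[OF c]
    by (simp add: \<mu>_def cong: measurable_cong_sets restrict_space_sets_cong)
  ultimately show ?thesis by (auto simp: tame_def bounded_iff)
qed

lemma xlip_continuous: "xlip T F \<Longrightarrow> continuous_on (strip T) F" by (simp add: xlip_def)

lemma xlip_tame: "xlip T F \<Longrightarrow> tame T F" by (intro tame_continuous xlip_continuous)

lemma tame_bounded: "tame T F \<Longrightarrow> \<exists>C\<ge>0. \<forall>p\<in>strip T. norm (F p) \<le> C"
proof -
  assume "tame T F"
  then obtain C where C: "\<And>p. p \<in> strip T \<Longrightarrow> norm (F p) \<le> C" unfolding tame_def by blast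
  show ?thesis
    by (rule exI[of _ "\<bar>C\<bar>"]) (auto intro: order_trans[OF C abs_ge_self])
qed

lemma xlip_bound: "xlip T F \<Longrightarrow> \<exists>C\<ge>0. \<forall>p\<in>strip T. norm (F p) \<le> C"
proof -
  assume c: "xlip T F"
  have "bounded (F ` strip T)" by (intro compact_imp_bounded compact_continuous_image xlip_continuous c) simp
  then obtain C where C: "\<And>p. p \<in> strip T \<Longrightarrow> norm (F p) \<le> C" unfolding bounded_iff by blast
  show ?thesis
    by (rule exI[of _ "\<bar>C\<bar>"]) (auto intro: order_trans[OF C abs_ge_self])
qed

lemma xlipE:
  fixes F :: "(real^'n) \<times> real \<Rightarrow> 'b::real_normed_vector"
  assumes "xlip T F"
  obtains L where "L \<ge> 0" "\<And>x y t. (x, t) \<in> strip T \<Longrightarrow> (y, t) \<in> strip T \<Longrightarrow> norm (F (x, t) - F (y, t)) \<le> L * norm (x - y)"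
proof -
  obtain L where L: "\<And>x y t. (x, t) \<in> strip T \<Longrightarrow> (y, t) \<in> strip T \<Longrightarrow> norm (F (x, t) - F (y, t)) \<le> L * norm (x - y)"
    using assms unfolding xlip_def by blast
  show ?thesis
  proof (rule that[of "\<bar>L\<bar>"])
    fix x y :: "real^'n" and t assume "(x, t) \<in> strip T" "(y, t) \<in> strip T"
    hence "norm (F (x, t) - F (y, t)) \<le> L * norm (x - y)" by (rule L)
    also have "\<dots> \<le> \<bar>L\<bar> * norm (x - y)" by (intro mult_right_mono) auto
    finally show "norm (F (x, t) - F (y, t)) \<le> \<bar>L\<bar> * norm (x - y)" .
  qed auto
qed

lemma xlip_const [intro]: "xlip T (\<lambda>p. c)"
  unfolding xlip_def by (auto intro!: exI[of _ 0])

lemma xlip_time: "continuous_on {0..T} \<phi> \<Longrightarrow> xlip T (\<lambda>p. \<phi> (snd p))"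
  unfolding xlip_def strip_def
  by (auto intro!: exI[of _ 0] continuous_on_compose2[of "{0..T}" \<phi> _ snd] continuous_intros)

lemma xlip_fst: "xlip T fst"
  unfolding xlip_def by (auto intro!: exI[of _ 1] continuous_intros)

lemma xlip_add: "xlip T F \<Longrightarrow> xlip T H \<Longrightarrow> xlip T (\<lambda>p. F p + H p)"
proof -
  assume F: "xlip T F" and H: "xlip T H"
  obtain L where L: "\<And>x y t. (x, t) \<in> strip T \<Longrightarrow> (y, t) \<in> strip T \<Longrightarrow> norm (F (x, t) - F (y, t)) \<le> L * norm (x - y)"
    using xlipE[OF F] by metis
  obtain M where M: "\<And>x y t. (x, t) \<in> strip T \<Longrightarrow> (y, t) \<in> strip T \<Longrightarrow> norm (H (x, t) - H (y, t)) \<le> M * norm (x - y)"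
    using xlipE[OF H] by metis
  have "norm (F (x, t) + H (x, t) - (F (y, t) + H (y, t))) \<le> (L + M) * norm (x - y)"
    if "(x, t) \<in> strip T" "(y, t) \<in> strip T" for x y t
    using L[OF that] M[OF that] norm_triangle_ineq[of "F (x, t) - F (y, t)" "H (x, t) - H (y, t)"]
    by (simp add: algebra_simps)
  thus ?thesis using xlip_continuous[OF F] xlip_continuous[OF H]
    unfolding xlip_def by (auto intro!: continuous_intros exI[of _ "L + M"])
qed

lemma xlip_bilinear:
  assumes b: "bounded_bilinear pr" and F: "xlip T F" and H: "xlip T H"
  shows "xlip T (\<lambda>p. pr (F p) (H p))"
proof -
  interpret bounded_bilinear pr by fact
  obtain L where L: "L \<ge> 0" "\<And>x y t. (x, t) \<in> strip T \<Longrightarrow> (y, t) \<in> strip T \<Longrightarrow> norm (F (x, t) - F (y, t)) \<le> L * norm (x - y)"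
    using xlipE[OF F] by metis
  obtain M where M: "M \<ge> 0" "\<And>x y t. (x, t) \<in> strip T \<Longrightarrow> (y, t) \<in> strip T \<Longrightarrow> norm (H (x, t) - H (y, t)) \<le> M * norm (x - y)"
    using xlipE[OF H] by metis
  obtain C where C: "C \<ge> 0" "\<And>p. p \<in> strip T \<Longrightarrow> norm (F p) \<le> C" using xlip_bound[OF F] by metis
  obtain D where D: "D \<ge> 0" "\<And>p. p \<in> strip T \<Longrightarrow> norm (H p) \<le> D" using xlip_bound[OF H] by metis
  obtain K where K: "K \<ge> 0" "\<And>a b. norm (pr a b) \<le> norm a * norm b * K" using nonneg_bounded by metis
  have "norm (pr (F (x, t)) (H (x, t)) - pr (F (y, t)) (H (y, t))) \<le> (L * D * K + C * M * K) * norm (x - y)"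
    if s: "(x, t) \<in> strip T" "(y, t) \<in> strip T" for x y t
  proof -
    have "pr (F (x, t)) (H (x, t)) - pr (F (y, t)) (H (y, t))
       = pr (F (x, t) - F (y, t)) (H (x, t)) + pr (F (y, t)) (H (x, t) - H (y, t))"
      by (simp add: diff_left diff_right)
    also have "norm \<dots> \<le> norm (F (x, t) - F (y, t)) * norm (H (x, t)) * K + norm (F (y, t)) * norm (H (x, t) - H (y, t)) * K"
      by (intro norm_triangle_le add_mono K)
    also have "\<dots> \<le> (L * norm (x - y)) * D * K + C * (M * norm (x - y)) * K"
      using K(1) L(1) C(1) by (intro add_mono mult_right_mono mult_mono L(2) M(2) C(2) D(2) s) auto
    finally show ?thesis by (simp add: algebra_simps)
  qed
  moreover have "continuous_on (strip T) (\<lambda>p. pr (F p) (H p))"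
    by (intro continuous_on xlip_continuous F H)
  ultimately show ?thesis unfolding xlip_def by blast
qed

lemma bounded_bilinear_matrix_vector_mult: "bounded_bilinear (\<lambda>(M::real^'n^'m) v. M *v v)"
proof
  show "\<exists>K. \<forall>(a::real^'n^'m) b. norm (a *v b) \<le> norm a * norm b * K"
  proof (intro exI[of _ 1] allI)
    fix a :: "real^'n^'m" and b
    have "norm (a *v b) \<le> L2_set (\<lambda>i. norm (a $ i) * norm b) UNIV"
      unfolding norm_vec_def[of "a *v b"]
      by (rule L2_set_mono) (auto simp: matrix_vector_mul_component intro: Cauchy_Schwarz_ineq2)
    also have "\<dots> = norm a * norm b" by (simp add: L2_set_left_distrib norm_vec_def[of a])
    finally show "norm (a *v b) \<le> norm a * norm b * 1" by simp
  qed
qed (simp_all add: matrix_vector_mult_add_rdistrib matrix_vector_right_distrib scaleR_matrix_vector_assoc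
   matrix_vector_mult_scaleR)

lemmas xlip_mult = xlip_bilinear[OF bounded_bilinear_mult]
  and xlip_scaleR = xlip_bilinear[OF bounded_bilinear_scaleR]
  and xlip_inner = xlip_bilinear[OF bounded_bilinear_inner]
  and xlip_mv = xlip_bilinear[OF bounded_bilinear_matrix_vector_mult]

lemma xlip_minus: "xlip T F \<Longrightarrow> xlip T (\<lambda>p. - F p)"
  using xlip_scaleR[OF xlip_const[of T "-1"], of F] by simp

lemma xlip_diff: "xlip T F \<Longrightarrow> xlip T H \<Longrightarrow> xlip T (\<lambda>p. F p - H p)"
  using xlip_add[OF _ xlip_minus, of T F H] by simp

lemma xlip_sum: "(\<And>i. i \<in> I \<Longrightarrow> xlip T (F i)) \<Longrightarrow> xlip T (\<lambda>p. \<Sum>i\<in>I. F i p)"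
  by (induction I rule: infinite_finite_induct) (simp_all add: xlip_add xlip_const)

lemma xlip_power: "xlip T F \<Longrightarrow> xlip T (\<lambda>p. (F p :: real) ^ k)"
  by (induction k) (simp_all add: xlip_mult xlip_const)

lemma xlip_vec_nth: "xlip T F \<Longrightarrow> xlip T (\<lambda>p. (F p :: real^'m) $ k)"
proof -
  assume "xlip T F"
  from xlip_inner[OF this xlip_const[of T "axis k 1"]] show ?thesis by (simp add: inner_axis)
qed

lemma xlip_vec: "(\<And>k. xlip T (\<lambda>p. F p k :: real)) \<Longrightarrow> xlip T (\<lambda>p. (\<chi> k. F p k) :: real^'m)"
proof -
  assume a: "\<And>k. xlip T (\<lambda>p. F p k :: real)"
  have eq: "(\<chi> k. F p k) = (\<Sum>k\<in>UNIV. F p k *\<^sub>R (axis k 1 :: real^'m))" for p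
    by (simp add: vec_eq_iff axis_def if_distrib[where f="\<lambda>x. _ * x"] cong: if_cong)
  show ?thesis unfolding eq by (intro xlip_sum xlip_scaleR a xlip_const)
qed

text \<open>The values on the compact cylinder lie in a compact interval on which the derivative is bounded.\<close>

lemma xlip_compose:
  fixes F :: "(real^'n) \<times> real \<Rightarrow> real"
  assumes F: "xlip T F" and I: "convex I" "\<And>p. p \<in> strip T \<Longrightarrow> F p \<in> I"
    and der: "\<And>u. u \<in> I \<Longrightarrow> (\<phi> has_real_derivative \<phi>' u) (at u)" and c: "continuous_on I \<phi>'"
  shows "xlip T (\<lambda>p. \<phi> (F p))"
proof (cases "strip T = ({} :: ((real^'n) \<times> real) set)")
  case False
  have cF: "compact (F ` strip T)" by (intro compact_continuous_image xlip_continuous F) simp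
  have ne: "F ` strip T \<noteq> {}" using False by simp
  obtain m where m: "m \<in> F ` strip T" "\<And>u. u \<in> F ` strip T \<Longrightarrow> m \<le> u" using compact_attains_inf[OF cF ne] by blast
  obtain M where M: "M \<in> F ` strip T" "\<And>u. u \<in> F ` strip T \<Longrightarrow> u \<le> M" using compact_attains_sup[OF cF ne] by blast
  have mM: "m \<le> M" using m M by blast
  have sub: "{m..M} \<subseteq> I"
  proof -
    have "m \<in> I" "M \<in> I" using m(1) M(1) I(2) by auto
    hence "closed_segment m M \<subseteq> I" using I(1) by (simp add: closed_segment_subset)
    thus ?thesis using mM by (simp add: closed_segment_eq_real_ivl)
  qed
  have "compact (\<phi>' ` {m..M})" by (intro compact_continuous_image continuous_on_subset[OF c sub]) simp
  then obtain B where B: "\<And>u. u \<in> {m..M} \<Longrightarrow> norm (\<phi>' u) \<le> B"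
    by (meson bounded_iff compact_imp_bounded imageI)
  have lip: "norm (\<phi> u - \<phi> v) \<le> B * norm (u - v)" if "u \<in> {m..M}" "v \<in> {m..M}" for u v
    by (rule field_differentiable_bound[OF convex_real_interval(5)[of m M]])
       (use sub that B in \<open>auto intro!: has_field_derivative_at_within[OF der]\<close>)
  obtain L where L: "L \<ge> 0" "\<And>x y t. (x, t) \<in> strip T \<Longrightarrow> (y, t) \<in> strip T \<Longrightarrow> norm (F (x, t) - F (y, t)) \<le> L * norm (x - y)"
    using xlipE[OF F] by metis
  have B0: "B \<ge> 0" using B[of m] mM norm_ge_zero[of "\<phi>' m"] by fastforce
  have "norm (\<phi> (F (x, t)) - \<phi> (F (y, t))) \<le> (B * L) * norm (x - y)" if s: "(x, t) \<in> strip T" "(y, t) \<in> strip T" for x y t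
  proof -
    have "F (x, t) \<in> {m..M}" "F (y, t) \<in> {m..M}" using m M s by auto
    from lip[OF this] have "norm (\<phi> (F (x, t)) - \<phi> (F (y, t))) \<le> B * norm (F (x, t) - F (y, t))" .
    also have "\<dots> \<le> B * (L * norm (x - y))" by (intro mult_left_mono L(2) s B0)
    finally show ?thesis by simp
  qed
  moreover have "continuous_on (strip T) (\<lambda>p. \<phi> (F p))"
  proof (rule continuous_on_compose2[of I \<phi> _ F])
    show "continuous_on I \<phi>" using der by (intro continuous_at_imp_continuous_on ballI) (rule DERIV_isCont)
  qed (use I F xlip_continuous in auto)
  ultimately show ?thesis unfolding xlip_def by blast
qed (simp add: xlip_def)

lemma xlip_exp: "xlip T F \<Longrightarrow> xlip T (\<lambda>p. exp (F p :: real))"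
  by (rule xlip_compose[where I=UNIV and \<phi>'=exp]) (auto intro!: derivative_eq_intros continuous_intros)

lemma xlip_sqrt: "xlip T F \<Longrightarrow> (\<And>p. p \<in> strip T \<Longrightarrow> F p > 0) \<Longrightarrow> xlip T (\<lambda>p. sqrt (F p))"
  by (rule xlip_compose[where I="{0<..}" and \<phi>'="\<lambda>u. inverse (sqrt u) / 2"])
     (auto intro!: derivative_eq_intros continuous_intros)

lemma xlip_inverse: "xlip T F \<Longrightarrow> (\<And>p. p \<in> strip T \<Longrightarrow> F p > 0) \<Longrightarrow> xlip T (\<lambda>p. inverse (F p :: real))"
  by (rule xlip_compose[where I="{0<..}" and \<phi>'="\<lambda>u. - (inverse u * inverse u)"])
     (auto intro!: derivative_eq_intros continuous_intros)

lemma xlip_smooth: "smooth f \<Longrightarrow> xlip T f"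
proof -
  assume f: "smooth f"
  have "convex (strip T)" unfolding strip_def by (intro convex_Times) auto
  from smooth_lipschitz_on_convex_compact[OF f this] obtain L where
    L: "\<And>p q. p \<in> strip T \<Longrightarrow> q \<in> strip T \<Longrightarrow> \<bar>f p - f q\<bar> \<le> L * norm (p - q)" by auto
  have "norm (f (x, t) - f (y, t)) \<le> L * norm (x - y)" if "(x, t) \<in> strip T" "(y, t) \<in> strip T" for x y t
    using L[OF that] by simp
  thus ?thesis unfolding xlip_def using smooth_continuous[OF f] by blast
qed

lemma tame_const [intro]: "tame T (\<lambda>p. c)" unfolding tame_def by auto

lemma tame_add: "tame T F \<Longrightarrow> tame T H \<Longrightarrow> tame T (\<lambda>p. F p + H p)"
proof -
  assume F: "tame T F" and H: "tame T H"
  obtain C where C: "\<And>p. p \<in> strip T \<Longrightarrow> norm (F p) \<le> C" using tame_bounded[OF F] by metis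
  obtain D where D: "\<And>p. p \<in> strip T \<Longrightarrow> norm (H p) \<le> D" using tame_bounded[OF H] by metis
  have "norm (F p + H p) \<le> C + D" if "p \<in> strip T" for p
    using C[OF that] D[OF that] norm_triangle_ineq[of "F p" "H p"] by linarith
  moreover have "(\<lambda>p. F p + H p) \<in> borel_measurable (\<mu> T)"
    using F H unfolding tame_def by (intro borel_measurable_add) blast+
  ultimately show ?thesis unfolding tame_def by blast
qed

lemma tame_bilinear:
  assumes b: "bounded_bilinear pr" and F: "tame T F" and H: "tame T H"
  shows "tame T (\<lambda>p. pr (F p) (H p))"
proof -
  interpret bounded_bilinear pr by fact
  obtain C where C: "C \<ge> 0" "\<And>p. p \<in> strip T \<Longrightarrow> norm (F p) \<le> C" using tame_bounded[OF F] by metis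
  obtain D where D: "D \<ge> 0" "\<And>p. p \<in> strip T \<Longrightarrow> norm (H p) \<le> D" using tame_bounded[OF H] by metis
  obtain K where K: "K \<ge> 0" "\<And>a b. norm (pr a b) \<le> norm a * norm b * K" using nonneg_bounded by metis
  have "norm (pr (F p) (H p)) \<le> C * D * K" if p: "p \<in> strip T" for p
  proof -
    have "norm (pr (F p) (H p)) \<le> norm (F p) * norm (H p) * K" by (rule K(2))
    also have "\<dots> \<le> C * D * K"
      using C(1) K(1) by (intro mult_right_mono mult_mono C(2) D(2) p) auto
    finally show ?thesis .
  qed
  moreover have "(\<lambda>p. pr (F p) (H p)) \<in> borel_measurable (\<mu> T)"
  proof -
    have c: "continuous_on UNIV (\<lambda>x. pr (fst x) (snd x))"
      by (rule continuous_on[OF continuous_on_fst[OF continuous_on_id] continuous_on_snd[OF continuous_on_id]])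
    have "F \<in> borel_measurable (\<mu> T)" "H \<in> borel_measurable (\<mu> T)"
      using F H unfolding tame_def by blast+
    from borel_measurable_continuous_Pair[where H=pr, OF this c] show ?thesis .
  qed
  ultimately show ?thesis unfolding tame_def by blast
qed

lemmas tame_mult = tame_bilinear[OF bounded_bilinear_mult]
  and tame_scaleR = tame_bilinear[OF bounded_bilinear_scaleR]
  and tame_inner = tame_bilinear[OF bounded_bilinear_inner]
  and tame_mv = tame_bilinear[OF bounded_bilinear_matrix_vector_mult]

lemma tame_minus: "tame T F \<Longrightarrow> tame T (\<lambda>p. - F p)"
proof -
  assume F: "tame T F"
  have "tame T (\<lambda>p. (-1) *\<^sub>R F p)" by (rule tame_scaleR[OF tame_const F])
  thus ?thesis by simp
qed

lemma tame_diff: "tame T F \<Longrightarrow> tame T H \<Longrightarrow> tame T (\<lambda>p. F p - H p)"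
proof -
  assume F: "tame T F" and H: "tame T H"
  have "tame T (\<lambda>p. F p + - H p)" by (rule tame_add[OF F tame_minus[OF H]])
  thus ?thesis by simp
qed

lemma tame_sum: "(\<And>i. i \<in> I \<Longrightarrow> tame T (F i)) \<Longrightarrow> tame T (\<lambda>p. \<Sum>i\<in>I. F i p)"
  by (induction I rule: infinite_finite_induct) (simp_all add: tame_add tame_const)

lemma tame_power: "tame T F \<Longrightarrow> tame T (\<lambda>p. (F p :: real) ^ k)"
  by (induction k) (simp_all add: tame_mult tame_const)

lemma tame_vec_nth: "tame T F \<Longrightarrow> tame T (\<lambda>p. (F p :: real^'m) $ k)"
proof -
  assume F: "tame T F"
  have "tame T (\<lambda>p. F p \<bullet> axis k 1)" by (rule tame_inner[OF F tame_const])
  thus ?thesis by (simp add: inner_axis)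
qed

lemma tame_abs: "tame T F \<Longrightarrow> tame T (\<lambda>p. \<bar>F p :: real\<bar>)"
  unfolding tame_def by auto

lemma tame_norm: "tame T F \<Longrightarrow> tame T (\<lambda>p. norm (F p))"
  unfolding tame_def by auto

lemma AE_\<mu>_iff: "(AE p in \<mu> T. P p) \<longleftrightarrow> (AE p in lborel. p \<in> strip T \<longrightarrow> P p)"
  unfolding \<mu>_def by (rule AE_restrict_space_iff) simp

lemma AE_\<mu>I: "AE p in lborel. P p \<Longrightarrow> AE p in \<mu> T. P p"
proof -
  assume "AE p in lborel. P p"
  hence "AE p in lborel. p \<in> strip T \<longrightarrow> P p" by eventually_elim simp
  thus ?thesis by (simp add: AE_\<mu>_iff)
qed

lemma integral_\<mu>_eq:
  fixes F :: "(real^'n) \<times> real \<Rightarrow> real"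
  shows "integral\<^sup>L (\<mu> T) F = integral\<^sup>L lborel (\<lambda>p. indicator (strip T) p * F p)"
  by (simp add: \<mu>_def integral_restrict_space)

lemma measurable_\<mu>_iff:
  fixes F :: "(real^'n) \<times> real \<Rightarrow> real"
  shows "F \<in> borel_measurable (\<mu> T) \<longleftrightarrow> (\<lambda>p. indicator (strip T) p * F p) \<in> borel_measurable borel"
  by (simp add: \<mu>_def borel_measurable_restrict_space_iff)

lemma tame_borel:
  assumes "F \<in> borel_measurable borel" "\<And>p. norm (F p) \<le> C"
  shows "tame T F"
proof -
  have "F \<in> borel_measurable (restrict_space lborel (strip T))"
    using assms(1) by (intro measurable_restrict_space1) simp
  thus ?thesis unfolding tame_def \<mu>_def using assms(2) by blast
qed

text \<open>Rademacher's theorem in the coordinate directions, applied to each coordinate of the values. The representative of the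
derivative is Borel and everywhere bounded; the factor \<open>DIM('b)\<close> comes from summing over the coordinates.\<close>

lemma lipschitz_x_derivative:
  fixes F :: "(real^'n) \<times> real \<Rightarrow> 'b::euclidean_space"
  assumes c: "continuous_on UNIV F"
    and lip: "\<And>x y t. norm (F (x, t) - F (y, t)) \<le> L * norm (x - y)"
  obtains D where "\<And>k T. tame T (D k)" "\<And>k p. norm (D k p) \<le> real DIM('b) * L"
    "\<And>T. AE p in \<mu> T. \<forall>k. ((\<lambda>h. F (fst p + h *\<^sub>R axis k 1, snd p)) has_vector_derivative D k p) (at 0)"
proof -
  define P where "P k b d \<longleftrightarrow> d \<in> borel_measurable borel \<and> (\<forall>p. \<bar>d p\<bar> \<le> L) \<and>
     (AE p in lborel. ((\<lambda>h. F (p + h *\<^sub>R (axis k 1, 0)) \<bullet> b) has_real_derivative d p) (at 0))" for k b d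
  have ex: "\<exists>d. P k b d" if b: "b \<in> Basis" for k b
  proof -
    have lb: "\<bar>F (p + h *\<^sub>R (axis k 1, 0)) \<bullet> b - F p \<bullet> b\<bar> \<le> L * \<bar>h\<bar>" for p h
    proof -
      have "\<bar>F (p + h *\<^sub>R (axis k 1, 0)) \<bullet> b - F p \<bullet> b\<bar> \<le> norm (F (p + h *\<^sub>R (axis k 1, 0)) - F p)"
        using Basis_le_norm[OF b, of "F (p + h *\<^sub>R (axis k 1, 0)) - F p"] by (simp add: inner_diff_left)
      also have "\<dots> \<le> L * norm (h *\<^sub>R (axis k (1::real) :: real^'n))"
        using lip[of "fst p + h *\<^sub>R axis k 1" "snd p" "fst p"] by (cases p) simp
      finally show ?thesis by simp
    qed
    obtain d where "d \<in> borel_measurable borel" "\<And>p. \<bar>d p\<bar> \<le> L"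
      "AE p in lborel. ((\<lambda>h. F (p + h *\<^sub>R (axis k 1, 0)) \<bullet> b) has_real_derivative d p) (at 0)"
      by (rule directional_derivative_AE[of "\<lambda>p. F p \<bullet> b" "(axis k 1, 0)" L])
         (use lb in \<open>auto intro!: continuous_on_inner[OF c continuous_on_const]\<close>)
    thus ?thesis unfolding P_def by blast
  qed
  have "\<forall>b\<in>Basis. \<exists>d. P k b d" for k by (intro ballI ex)
  hence "\<forall>k. \<exists>d. \<forall>b\<in>Basis. P k b (d b)" by (intro allI bchoice)
  from choice[OF this] obtain d where "\<forall>k. \<forall>b\<in>Basis. P k b (d k b)" ..
  hence d: "\<And>k b. b \<in> Basis \<Longrightarrow> d k b \<in> borel_measurable borel"
      "\<And>k b p. b \<in> Basis \<Longrightarrow> \<bar>d k b p\<bar> \<le> L"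
      "\<And>k b. b \<in> Basis \<Longrightarrow> AE p in lborel. ((\<lambda>h. F (p + h *\<^sub>R (axis k 1, 0)) \<bullet> b) has_real_derivative d k b p) (at 0)"
    unfolding P_def by (simp, metis, simp)
  define D where "D k p = (\<Sum>b\<in>Basis. d k b p *\<^sub>R b)" for k p
  have nD: "norm (D k p) \<le> real DIM('b) * L" for k p
  proof -
    have "norm (D k p) \<le> (\<Sum>b\<in>(Basis::'b set). L)" unfolding D_def
      by (rule sum_norm_le) (use d(2) in auto)
    thus ?thesis by simp
  qed
  show ?thesis
  proof (rule that[of D])
    have "D k \<in> borel_measurable borel" for k
      unfolding D_def[abs_def] by (intro borel_measurable_sum borel_measurable_scaleR d(1)) auto
    thus "tame T (D k)" for k T using nD by (rule tame_borel)
    show "AE p in \<mu> T. \<forall>k. ((\<lambda>h. F (fst p + h *\<^sub>R axis k 1, snd p)) has_vector_derivative D k p) (at 0)" for T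
    proof (rule AE_\<mu>I)
      have "AE p in lborel. \<forall>b\<in>(Basis::'b set). \<forall>k. ((\<lambda>h. F (p + h *\<^sub>R (axis k 1, 0)) \<bullet> b) has_real_derivative d k b p) (at 0)"
        by (intro AE_ball_countable[THEN iffD2] AE_all_countable[THEN iffD2] ballI allI d(3)) (auto intro: countable_finite)
      thus "AE p in lborel. \<forall>k. ((\<lambda>h. F (fst p + h *\<^sub>R axis k 1, snd p)) has_vector_derivative D k p) (at 0)"
      proof eventually_elim
        case (elim p)
        show ?case
        proof
          fix k
          have "((\<lambda>h. (F (p + h *\<^sub>R (axis k 1, 0)) \<bullet> b) *\<^sub>R b) has_vector_derivative d k b p *\<^sub>R b) (at 0)" if "b \<in> Basis" for b
            using elim that by (auto intro!: derivative_eq_intros)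
          hence "((\<lambda>h. \<Sum>b\<in>Basis. (F (p + h *\<^sub>R (axis k 1, 0)) \<bullet> b) *\<^sub>R b) has_vector_derivative D k p) (at 0)"
            unfolding D_def by (rule has_vector_derivative_sum)
          thus "((\<lambda>h. F (fst p + h *\<^sub>R axis k 1, snd p)) has_vector_derivative D k p) (at 0)"
            by (cases p) (simp add: euclidean_representation)
        qed
      qed
    qed
  qed (rule nD)
qed

text \<open>Continued by zero outside the cylinder, the function stays Lipschitz in \<open>x\<close> because it vanishes near the lateral
boundary; the jumps in \<open>t\<close> do no harm to a derivative in \<open>x\<close>.\<close>

lemma integral_x_derivative_eq_0:
  fixes f :: "(real^'n) \<times> real \<Rightarrow> real"
  assumes f: "xlip T f" and r: "r < 4"
    and z: "\<And>x t. t \<in> {0..T} \<Longrightarrow> norm x \<ge> r \<Longrightarrow> f (x, t) = 0"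
    and D: "tame T D" and der: "AE p in \<mu> T. ((\<lambda>h. f (fst p + h *\<^sub>R axis k 1, snd p)) has_real_derivative D p) (at 0)"
  shows "integral\<^sup>L (\<mu> T) D = 0"
proof -
  define F where "F p = indicator (strip T) p * f p" for p
  obtain C where C: "C \<ge> 0" "\<And>p. p \<in> strip T \<Longrightarrow> norm (f p) \<le> C" using xlip_bound[OF f] by metis
  obtain L where L: "L \<ge> 0" "\<And>x y t. (x, t) \<in> strip T \<Longrightarrow> (y, t) \<in> strip T \<Longrightarrow> norm (f (x, t) - f (y, t)) \<le> L * norm (x - y)"
    using xlipE[OF f] by metis
  define M where "M = L + C / (4 - r)"
  have "C / (4 - r) \<ge> 0" using C r by simp
  hence M: "M \<ge> L" "M \<ge> 0" using L(1) by (auto simp: M_def)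
  have "M * (4 - r) = L * (4 - r) + C" using r by (simp add: M_def field_simps)
  hence M': "C \<le> M * (4 - r)" using L(1) r by simp
  have half: "\<bar>F (x, t) - F (y, t)\<bar> \<le> M * norm (x - y)" if "(x, t) \<in> strip T" for x y t
  proof (cases "(y, t) \<in> strip T")
    case True
    thus ?thesis using L(2)[OF that True] M(1) mult_right_mono[OF M(1), of "norm (x - y)"] that by (simp add: F_def)
  next
    case False
    have t: "t \<in> {0..T}" "norm y > 4" using that False by (auto simp: strip_def)
    show ?thesis
    proof (cases "norm x \<ge> r")
      case True thus ?thesis using z[OF t(1)] False M by (simp add: F_def)
    next
      case False': False
      have "norm (x - y) \<ge> 4 - r" using t False' norm_triangle_ineq3[of x y] by linarith
      hence "C \<le> M * norm (x - y)" using M' M(2) mult_left_mono[of "4 - r" "norm (x - y)" M] by linarith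
      thus ?thesis using C(2)[OF that] False that by (simp add: F_def)
    qed
  qed
  have lipF: "\<bar>F (x, t) - F (y, t)\<bar> \<le> M * norm (x - y)" for x y t
  proof (cases "(x, t) \<in> strip T")
    case False
    show ?thesis
    proof (cases "(y, t) \<in> strip T")
      case True
      thus ?thesis using half[OF True, of x] by (simp add: abs_minus_commute norm_minus_commute)
    qed (use False M in \<open>simp add: F_def\<close>)
  qed (rule half)
  have Fm: "F \<in> borel_measurable borel"
    using xlip_tame[OF f] unfolding tame_def measurable_\<mu>_iff F_def[abs_def] by blast
  have Dm: "(\<lambda>p. indicator (strip T) p * D p) \<in> borel_measurable borel"
    using D unfolding tame_def measurable_\<mu>_iff by blast
  obtain R where R: "\<And>p. p \<in> (strip T :: ((real^'n) \<times> real) set) \<Longrightarrow> norm p \<le> R"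
    using compact_imp_bounded[OF compact_strip] unfolding bounded_iff by blast
  have "integral\<^sup>L lborel (\<lambda>p. indicator (strip T) p * D p) = 0"
  proof (rule integral_directional_derivative_eq_0[where R=R, OF Fm _ _ _ Dm])
    show "\<bar>F p\<bar> \<le> C" for p using C by (auto simp: F_def indicator_def)
    show "F p = 0" if "norm p > R" for p using R[of p] that by (auto simp: F_def indicator_def)
    show "\<bar>F (p + h *\<^sub>R (axis k 1, 0)) - F p\<bar> \<le> M * \<bar>h\<bar>" for p h
      using lipF[of "fst p + h *\<^sub>R axis k 1" "snd p" "fst p"] by (cases p) simp
    have "AE p in lborel. p \<in> strip T \<longrightarrow> ((\<lambda>h. f (fst p + h *\<^sub>R axis k 1, snd p)) has_real_derivative D p) (at 0)"
      using der by (simp add: AE_\<mu>_iff)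
    thus "AE p in lborel. ((\<lambda>h. F (p + h *\<^sub>R (axis k 1, 0))) has_real_derivative indicator (strip T) p * D p) (at 0)"
    proof eventually_elim
      case (elim p)
      obtain x t where p: "p = (x, t)" by (cases p)
      have ev_near: "\<forall>\<^sub>F h in nhds 0. norm (x + h *\<^sub>R axis k (1::real)) < 4" if "norm x < 4"
      proof -
        have "((\<lambda>h. norm (x + h *\<^sub>R axis k (1::real))) \<longlongrightarrow> norm (x + 0 *\<^sub>R axis k (1::real))) (nhds 0)"
          by (intro tendsto_intros filterlim_ident)
        thus ?thesis using that by (intro order_tendstoD(2)) auto
      qed
      have ev_far: "\<forall>\<^sub>F h in nhds 0. norm (x + h *\<^sub>R axis k (1::real)) > r" if "norm x > r"
      proof -
        have "((\<lambda>h. norm (x + h *\<^sub>R axis k (1::real))) \<longlongrightarrow> norm (x + 0 *\<^sub>R axis k (1::real))) (nhds 0)"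
          by (intro tendsto_intros filterlim_ident)
        thus ?thesis using that by (intro order_tendstoD(1)) auto
      qed
      consider "t \<notin> {0..T}" | "t \<in> {0..T}" "norm x < 4" | "t \<in> {0..T}" "norm x \<ge> 4" by linarith
      thus ?case
      proof cases
        case 1
        hence "p \<notin> strip T" "F (p + h *\<^sub>R (axis k 1, 0)) = 0" for h
          by (auto simp: F_def p strip_def)
        thus ?thesis by simp
      next
        case 2
        hence D: "((\<lambda>h. f (x + h *\<^sub>R axis k 1, t)) has_real_derivative D p) (at 0)"
          using elim by (simp add: p strip_def)
        have "\<forall>\<^sub>F h in nhds 0. F (p + h *\<^sub>R (axis k 1, 0)) = f (x + h *\<^sub>R axis k 1, t)"
          using ev_near[OF 2(2)] by eventually_elim (use 2 in \<open>simp add: F_def p strip_def\<close>)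
        from DERIV_cong_ev[OF refl this refl, THEN iffD2, OF D] show ?thesis
          using 2 by (simp add: p strip_def)
      next
        case 3
        have ev: "\<forall>\<^sub>F h in nhds 0. f (x + h *\<^sub>R axis k 1, t) = 0"
          using ev_far[OF order_less_le_trans[OF r 3(2)]] by eventually_elim (use z[OF 3(1)] in simp)
        have "\<forall>\<^sub>F h in nhds 0. F (p + h *\<^sub>R (axis k 1, 0)) = 0"
          using ev by eventually_elim (simp add: F_def p)
        from DERIV_cong_ev[OF refl this refl, THEN iffD2, of 0]
        have F0: "((\<lambda>h. F (p + h *\<^sub>R (axis k 1, 0))) has_real_derivative 0) (at 0)" by simp
        have "indicator (strip T) p * D p = 0"
        proof (cases "p \<in> strip T")
          case True
          hence "((\<lambda>h. f (x + h *\<^sub>R axis k 1, t)) has_real_derivative D p) (at 0)" using elim by (simp add: p)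
          moreover have "((\<lambda>h. f (x + h *\<^sub>R axis k 1, t)) has_real_derivative 0) (at 0)"
            using DERIV_cong_ev[OF refl ev refl, THEN iffD2, of 0] by simp
          ultimately show ?thesis by (simp add: DERIV_unique)
        qed simp
        thus ?thesis using F0 by (simp only:)
      qed
    qed
  qed
  thus ?thesis by (simp add: integral_\<mu>_eq)
qed

lemma integral_divergence_eq_0:
  fixes \<Psi> :: "(real^'n) \<times> real \<Rightarrow> real^'n"
  assumes f: "xlip T \<Psi>" and r: "r < 4"
    and z: "\<And>x t. t \<in> {0..T} \<Longrightarrow> norm x \<ge> r \<Longrightarrow> \<Psi> (x, t) = 0"
    and D: "\<And>k. tame T (D k)"
    and der: "AE p in \<mu> T. \<forall>k. ((\<lambda>h. \<Psi> (fst p + h *\<^sub>R axis k 1, snd p)) has_vector_derivative D k p) (at 0)"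
  shows "integral\<^sup>L (\<mu> T) (\<lambda>p. \<Sum>k\<in>UNIV. D k p $ k) = 0"
proof -
  have "integral\<^sup>L (\<mu> T) (\<lambda>p. \<Sum>k\<in>UNIV. D k p $ k) = (\<Sum>k\<in>UNIV. integral\<^sup>L (\<mu> T) (\<lambda>p. D k p $ k))"
    by (intro Bochner_Integration.integral_sum tame_integrable tame_vec_nth D)
  also have "\<dots> = 0"
  proof (intro sum.neutral ballI)
    fix k
    show "integral\<^sup>L (\<mu> T) (\<lambda>p. D k p $ k) = 0"
    proof (rule integral_x_derivative_eq_0[OF xlip_vec_nth[OF f] r _ tame_vec_nth[OF D]])
      show "\<Psi> (x, t) $ k = 0" if "t \<in> {0..T}" "r \<le> norm x" for x t using z[OF that] by simp
      show "AE p in \<mu> T. ((\<lambda>h. \<Psi> (fst p + h *\<^sub>R axis k 1, snd p) $ k) has_real_derivative D k p $ k) (at 0)"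
        using der
      proof eventually_elim
        case (elim p)
        hence "((\<lambda>h. \<Psi> (fst p + h *\<^sub>R axis k 1, snd p)) has_vector_derivative D k p) (at 0)" by blast
        from bounded_linear.has_vector_derivative[OF bounded_linear_vec_nth[of k] this]
        show ?case by (simp add: has_real_derivative_iff_has_vector_derivative)
      qed
    qed
  qed
  finally show ?thesis .
qed

text \<open>Fubini and the fundamental theorem of calculus on each vertical segment.\<close>

lemma integral_t_derivative:
  fixes \<Phi> :: "(real^'n) \<times> real \<Rightarrow> real"
  assumes T: "T \<ge> 0" and c: "continuous_on (strip T) \<Phi>'"
    and der: "\<And>x t. (x, t) \<in> strip T \<Longrightarrow> ((\<lambda>s. \<Phi> (x, s)) has_real_derivative \<Phi>' (x, t)) (at t within {0..T})"
    and z: "\<And>x. \<Phi> (x, T) = 0"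
  shows "integral\<^sup>L (\<mu> T) \<Phi>' = - (\<integral>x. indicator (cball 0 4) x * \<Phi> (x, 0) \<partial>lborel)"
proof -
  have tm: "tame T \<Phi>'" by (rule tame_continuous[OF c])
  have i: "integrable (lborel \<Otimes>\<^sub>M lborel) (\<lambda>p. indicator (strip T) p * \<Phi>' p)"
    using tame_integrable[OF tm] by (simp add: \<mu>_def integrable_restrict_space lborel_prod)
  have "integral\<^sup>L (\<mu> T) \<Phi>' = (\<integral>x. (\<integral>t. indicator (strip T) (x, t) * \<Phi>' (x, t) \<partial>lborel) \<partial>lborel)"
    using lborel_pair.integral_fst'[OF i] by (simp add: integral_\<mu>_eq lborel_prod)
  also have "\<dots> = (\<integral>x. - (indicator (cball 0 4) x * \<Phi> (x, 0)) \<partial>lborel)"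
  proof (intro Bochner_Integration.integral_cong refl)
    fix x :: "real^'n"
    show "(\<integral>t. indicator (strip T) (x, t) * \<Phi>' (x, t) \<partial>lborel) = - (indicator (cball 0 4) x * \<Phi> (x, 0))"
    proof (cases "x \<in> cball 0 4")
      case True
      have "(\<integral>t. indicator {0..T} t *\<^sub>R \<Phi>' (x, t) \<partial>lborel) = \<Phi> (x, T) - \<Phi> (x, 0)"
      proof (rule integral_FTC_Icc[OF T])
        show "((\<lambda>s. \<Phi> (x, s)) has_vector_derivative \<Phi>' (x, t)) (at t within {0..T})" if "0 \<le> t" "t \<le> T" for t
          using der[of x t] that True by (simp add: strip_def has_real_derivative_iff_has_vector_derivative)
        show "continuous_on {0..T} (\<lambda>t. \<Phi>' (x, t))"
          using True by (intro continuous_on_compose2[OF c]) (auto intro!: continuous_intros simp: strip_def)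
      qed
      moreover have "indicator (strip T) (x, t) = (indicator {0..T} t :: real)" for t
        using True by (simp add: strip_def indicator_def)
      ultimately show ?thesis using True z by simp
    next
      case False
      thus ?thesis by (simp add: strip_def indicator_def)
    qed
  qed
  finally show ?thesis by simp
qed

text \<open>This is how a uniform bound for the weight on a part of the cylinder becomes a multiple of the supremum over \<open>t\<close>.\<close>

lemma integral_\<mu>_le_slices:
  fixes F g :: "(real^'n) \<times> real \<Rightarrow> real"
  assumes T: "T \<ge> 0" and F: "tame T F" and g: "continuous_on (strip T) g" "\<And>p. p \<in> strip T \<Longrightarrow> g p \<ge> 0"
    and le: "\<And>p. p \<in> strip T \<Longrightarrow> F p \<le> k * g p" and k: "k \<ge> 0"
    and m: "\<And>t. t \<in> {0..T} \<Longrightarrow> (\<integral>x. indicator (cball 0 4) x * g (x, t) \<partial>lborel) \<le> m"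
  shows "integral\<^sup>L (\<mu> T) F \<le> k * (T * m)"
proof -
  have tg: "tame T g" by (rule tame_continuous[OF g(1)])
  have i: "integrable (lborel \<Otimes>\<^sub>M lborel) (\<lambda>(x, t). indicator (strip T) (x, t) * g (x, t))"
    using tame_integrable[OF tg] by (simp add: \<mu>_def integrable_restrict_space lborel_prod case_prod_unfold)
  have "integral\<^sup>L (\<mu> T) F \<le> integral\<^sup>L (\<mu> T) (\<lambda>p. k * g p)"
    by (intro integral_mono tame_integrable F tame_mult tame_const tg) (use le in simp)
  also have "\<dots> = k * integral\<^sup>L (\<mu> T) g" by simp
  also have "integral\<^sup>L (\<mu> T) g = (\<integral>t. (\<integral>x. indicator (strip T) (x, t) * g (x, t) \<partial>lborel) \<partial>lborel)"
    using lborel_pair.integral_snd[OF i] by (simp add: integral_\<mu>_eq lborel_prod case_prod_unfold)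
  also have "\<dots> \<le> (\<integral>t. indicator {0..T} t * m \<partial>lborel)"
  proof (rule integral_mono)
    show "integrable lborel (\<lambda>t. \<integral>x. indicator (strip T) (x, t) * g (x, t) \<partial>lborel)"
      using lborel_pair.integrable_snd[OF i] by simp
    show "integrable lborel (\<lambda>t. indicator {0..T} t * m)" using T by simp
    show "(\<integral>x. indicator (strip T) (x, t) * g (x, t) \<partial>lborel) \<le> indicator {0..T} t * m" for t
    proof (cases "t \<in> {0..T}")
      case True
      hence "indicator (strip T) (x, t) = (indicator (cball 0 4) x :: real)" for x :: "real^'n"
        by (simp add: strip_def indicator_def)
      thus ?thesis using m[OF True] True by simp
    next
      case False
      hence "indicator (strip T) (x, t) = (0 :: real)" for x :: "real^'n"
        by (simp add: strip_def indicator_def)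
      thus ?thesis using False by simp
    qed
  qed
  also have "\<dots> = T * m" using T by simp
  finally show ?thesis using k by (simp add: mult_left_mono)
qed

text \<open>The completion of Lebesgue measure absorbs the null set on which \<open>div_x\<close> has an unspecified value.\<close>

lemma space_time_integral_eq_\<mu>:
  fixes f F :: "(real^'n) \<times> real \<Rightarrow> real"
  assumes F: "F \<in> borel_measurable (\<mu> T)"
    and eq: "AE p in \<mu> T. f p = F p"
    and z: "\<And>p. snd p \<ge> 0 \<Longrightarrow> p \<notin> strip T \<Longrightarrow> f p = 0"
  shows "space_time_integral f = integral\<^sup>L (\<mu> T) F"
proof -
  have Fm: "(\<lambda>p. indicator (strip T) p * F p) \<in> borel_measurable lborel"
    using F unfolding measurable_\<mu>_iff by simp
  have ae: "AE p in lborel. indicator (UNIV \<times> {0..}) p * f p = indicator (strip T) p * F p"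
  proof -
    have "AE p in lborel. p \<in> strip T \<longrightarrow> f p = F p"
      using eq by (simp add: AE_\<mu>_iff)
    thus ?thesis
    proof eventually_elim
      case (elim p)
      have "p \<in> UNIV \<times> {0..} \<longleftrightarrow> snd p \<ge> 0" by (cases p) auto
      moreover have "p \<in> strip T \<Longrightarrow> snd p \<ge> 0" by (cases p) (auto simp: strip_def)
      ultimately show ?case using elim z[of p] by (auto simp: indicator_def)
    qed
  qed
  have "space_time_integral f = integral\<^sup>L lebesgue (\<lambda>p. indicator (UNIV \<times> {0..}) p * f p)"
    by (simp add: space_time_integral_def set_lebesgue_integral_def)
  also have "\<dots> = integral\<^sup>L lebesgue (\<lambda>p. indicator (strip T) p * F p)"
  proof (rule integral_cong_AE)
    show m: "(\<lambda>p. indicator (strip T) p * F p) \<in> borel_measurable lebesgue"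
      using Fm by (rule measurable_completion)
    show "AE p in lebesgue. indicator (UNIV \<times> {0..}) p * f p = indicator (strip T) p * F p"
      using ae by (rule AE_completion)
    hence "AE p in lebesgue. indicator (strip T) p * F p = indicator (UNIV \<times> {0..}) p * f p"
      by eventually_elim simp
    thus "(\<lambda>p. indicator (UNIV \<times> {0..}) p * f p) \<in> borel_measurable lebesgue"
      by (rule borel_measurable_AE[OF m])
  qed
  also have "\<dots> = integral\<^sup>L (\<mu> T) F" by (subst integral_completion[OF Fm]) (simp add: integral_\<mu>_eq)
  finally show ?thesis .
qed

lemma integral_\<mu>_mono:
  assumes "tame T F" "tame T H" "\<And>p. p \<in> strip T \<Longrightarrow> F p \<le> H p"
  shows "integral\<^sup>L (\<mu> T) F \<le> integral\<^sup>L (\<mu> T) (H :: _ \<Rightarrow> real)"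
  by (intro integral_mono tame_integrable assms) (use assms in simp)

section \<open>The weight\<close>

lemma nondecreasing_of_derivative:
  fixes f :: "real \<Rightarrow> real"
  assumes "s \<le> t" and d: "\<And>x. x \<in> {s..t} \<Longrightarrow> (f has_real_derivative f' x) (at x within {s..t})"
    and nn: "\<And>x. x \<in> {s..t} \<Longrightarrow> f' x \<ge> 0"
  shows "f s \<le> f t"
proof (cases "s < t")
  case True
  have "\<exists>x\<in>{s<..<t}. f t - f s = f' x * (t - s)"
    by (rule mvt_simple[OF True]) (use d in \<open>auto simp: has_field_derivative_def\<close>)
  then obtain x where x: "x \<in> {s<..<t}" "f t - f s = f' x * (t - s)" by blast
  have "f' x * (t - s) \<ge> 0" using nn[of x] x(1) True by (intro mult_nonneg_nonneg) auto
  thus ?thesis using x(2) by simp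
qed (use assms(1) in simp)

lemma \<theta>_nonneg: "0 < s \<Longrightarrow> s \<le> 1 \<Longrightarrow> \<theta> s \<ge> 0"
  by (simp add: \<theta>_def)

text \<open>A power of the logarithm is dominated by a small power, so \<open>\<theta>(s)/s\<close> is integrable at \<open>0\<close>.\<close>

lemma \<theta>_le_root: assumes "0 < s" "s \<le> 1" shows "\<theta> s \<le> 15 * s powr (1/4)"
proof -
  have "ln (1 / s) \<le> 6 * s powr (-1/6)"
  proof -
    have "ln (s powr (-1/6)) \<le> s powr (-1/6) - 1" using assms by (intro ln_le_minus_one) simp
    moreover have "ln (s powr (-1/6)) = (-1/6) * ln s" using assms by (simp add: ln_powr)
    moreover have "ln (1 / s) = - ln s" using assms by (simp add: ln_div)
    ultimately show ?thesis by simp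
  qed
  hence "ln (1 / s) powr (3/2) \<le> (6 * s powr (-1/6)) powr (3/2)"
    using assms by (intro powr_mono2) auto
  also have "\<dots> = 6 powr (3/2) * s powr (-1/4)" using assms by (simp add: powr_mult powr_powr)
  also have "\<dots> \<le> 15 * s powr (-1/4)"
  proof (rule mult_right_mono)
    have "(6::real) powr (3/2) = 6 powr (1 + 1/2)" by simp
    also have "\<dots> = 6 * sqrt 6" by (subst powr_add) (simp add: powr_half_sqrt)
    also have "sqrt 6 \<le> (5/2 :: real)" by (rule real_le_lsqrt) (auto simp: power2_eq_square)
    finally show "(6::real) powr (3/2) \<le> 15" by simp
  qed simp
  finally have "\<theta> s \<le> sqrt s * (15 * s powr (-1/4))" unfolding \<theta>_def by (intro mult_left_mono) (use assms in auto)
  also have "\<dots> = 15 * (s powr (1/2) * s powr (-1/4))" using assms by (simp add: powr_half_sqrt)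
  also have "s powr (1/2) * s powr (-1/4) = s powr (1/4)" by (subst powr_add[symmetric]) simp
  finally show ?thesis .
qed

lemma \<theta>_le_15: assumes "0 < s" "s \<le> 1" shows "\<theta> s \<le> 15"
proof -
  have "s powr (1/4) \<le> 1 powr (1/4)" using assms by (intro powr_mono2) auto
  thus ?thesis using \<theta>_le_root[OF assms] by simp
qed

lemma ln_inverse_ge: assumes "0 < s" "s \<le> 3/4" shows "ln (1 / s) \<ge> (1/4::real)"
proof -
  have "s \<le> 1 - 1/4" using assms by simp
  hence "ln s \<le> s - 1" "s - 1 \<le> - 1/4" using assms ln_le_minus_one[of s] by auto
  thus ?thesis using assms by (simp add: ln_div)
qed

text \<open>On the range \<open>s \<le> 3/4\<close> the logarithm is bounded below, so the powers of \<open>s\<close> met in the error terms are dominated by \<open>\<theta>\<close>.\<close>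

lemma \<theta>_ge_log:
  assumes "0 < s" "s \<le> 3/4"
  shows "sqrt (s * ln (1 / s)) \<le> 4 * \<theta> s" "ln (1 / s) powr (3/2) = ln (1 / s) * sqrt (ln (1 / s))"
    "sqrt s \<le> 8 * \<theta> s" "s \<le> 8 * \<theta> s"
proof -
  define l where "l = ln (1 / s)"
  have l: "l \<ge> 1/4" unfolding l_def by (rule ln_inverse_ge[OF assms])
  have e: "l powr (3/2) = l * sqrt l"
  proof -
    have "l powr (3/2) = l powr (1 + 1/2)" by simp
    also have "\<dots> = l * sqrt l" using l by (subst powr_add) (simp add: powr_half_sqrt)
    finally show ?thesis .
  qed
  thus "ln (1 / s) powr (3/2) = ln (1 / s) * sqrt (ln (1 / s))" by (simp add: l_def)
  have th: "\<theta> s = l * (sqrt s * sqrt l)" using e by (simp add: \<theta>_def l_def)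
  have sl: "sqrt l \<ge> 1/2" by (rule real_le_rsqrt) (use l in \<open>simp add: power2_eq_square\<close>)
  have "sqrt s * sqrt l \<le> 4 * l * (sqrt s * sqrt l)" using l assms by (intro mult_right_mono[of 1 "4 * l", simplified]) auto
  thus "sqrt (s * ln (1 / s)) \<le> 4 * \<theta> s" using th by (simp add: l_def real_sqrt_mult)
  moreover have "sqrt s \<le> 2 * (sqrt s * sqrt l)" using mult_left_mono[OF sl, of "sqrt s"] assms by simp
  ultimately show 8: "sqrt s \<le> 8 * \<theta> s" by (simp add: l_def real_sqrt_mult)
  have "s \<le> sqrt s" using assms by (intro real_le_rsqrt) (simp add: power2_eq_square mult_left_le)
  thus "s \<le> 8 * \<theta> s" using 8 by simp
qed

text \<open>With \<open>\<gamma> = \<sigma>/\<sigma>'\<close> the equation reads \<open>(log(\<gamma>/t))' = \<theta>(\<lambda>t)/t\<close>. The right-hand side is nonnegative and at most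
\<open>15 \<lambda>\<^sup>1\<^sup>/\<^sup>4 t\<^sup>-\<^sup>3\<^sup>/\<^sup>4\<close>, whose integral over the interval is \<open>60\<close>; together with the normalisation at \<open>0\<close> this
gives \<open>t \<le> \<gamma> \<le> e\<^sup>6\<^sup>0 t\<close>. Integrating \<open>\<sigma>'/\<sigma> = 1/\<gamma>\<close> in the same way compares \<open>\<sigma>\<close> with \<open>t\<close>.\<close>

lemma weight_facts:
  assumes lam: "lam > 0" and w: "is_weight lam \<sigma>"
  obtains \<gamma> where
    "\<And>t. t \<in> {0<..1/lam} \<Longrightarrow> \<sigma> t > 0"
    "\<And>t. t \<in> {0<..1/lam} \<Longrightarrow> t \<le> \<gamma> t \<and> \<gamma> t \<le> exp 60 * t"
    "\<And>t. t \<in> {0<..1/lam} \<Longrightarrow> \<sigma> t \<le> t \<and> t \<le> exp 240 * \<sigma> t"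
    "\<And>t. t \<in> {0<..1/lam} \<Longrightarrow> (\<sigma> has_real_derivative \<sigma> t / \<gamma> t) (at t within {0..1/lam})"
    "\<And>t. t \<in> {0<..1/lam} \<Longrightarrow> (\<gamma> has_real_derivative \<gamma> t * (1 + \<theta> (lam * t)) / t) (at t within {0..1/lam})"
proof -
  define b where "b = 1 / lam"
  have b: "b > 0" "\<And>t. t \<in> {0<..b} \<Longrightarrow> 0 < lam * t \<and> lam * t \<le> 1" using lam by (auto simp: b_def field_simps)
  obtain \<sigma>' where d: "\<And>t. t \<in> {0..b} \<Longrightarrow> (\<sigma> has_real_derivative \<sigma>' t) (at t within {0..b})"
    and s0: "\<sigma> 0 = 0" "\<sigma>' 0 = 1"
    and pos: "\<And>t. t \<in> {0<..b} \<Longrightarrow> \<sigma> t / (t * \<sigma>' t) > 0"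
    and eq: "\<And>t. t \<in> {0<..b} \<Longrightarrow> ((\<lambda>s. ln (\<sigma> s / (s * \<sigma>' s))) has_real_derivative \<theta> (lam * t) / t) (at t within {0..b})"
    using w unfolding is_weight_def b_def[symmetric] by blast
  have lim0: "((\<lambda>t. \<sigma> t / t) \<longlongrightarrow> 1) (at_right 0)"
  proof -
    have "((\<lambda>t. (\<sigma> t - \<sigma> 0) / (t - 0)) \<longlongrightarrow> 1) (at 0 within {0..b})"
      using d[of 0] s0 b by (simp add: has_field_derivative_iff)
    thus ?thesis using s0 b(1) by (simp add: at_within_Icc_at_right)
  qed
  have cont: "continuous_on {0..b} \<sigma>" using d by (rule DERIV_continuous_on)
  have ne: "\<sigma> t \<noteq> 0" "\<sigma>' t \<noteq> 0" if "t \<in> {0<..b}" for t using pos[OF that] by (auto simp: zero_less_divide_iff)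
  have \<sigma>_pos: "\<sigma> t > 0" if t: "t \<in> {0<..b}" for t
  proof (rule ccontr)
    assume "\<not> \<sigma> t > 0"
    hence neg: "\<sigma> t < 0" using ne[OF t] by simp
    have "\<forall>\<^sub>F s in at_right 0. \<sigma> s / s > 0" using order_tendstoD(1)[OF lim0, of 0] by simp
    moreover have "\<forall>\<^sub>F s in at_right 0. s \<in> {0<..<t}" using t by (intro eventually_at_rightI[of 0 t]) auto
    ultimately have "\<forall>\<^sub>F s in at_right 0. \<sigma> s / s > 0 \<and> s \<in> {0<..<t}" by (rule eventually_conj)
    then obtain s where s: "\<sigma> s / s > 0" "s \<in> {0<..<t}" using eventually_happens[of _ "at_right (0::real)"] by auto
    hence "\<sigma> s > 0" by (auto simp: zero_less_divide_iff)
    then obtain z where "s \<le> z" "z \<le> t" "\<sigma> z = 0"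
      using IVT2'[of \<sigma> t 0 s] neg s t continuous_on_subset[OF cont, of "{s..t}"] by auto
    thus False using ne(1)[of z] s t by auto
  qed
  have \<sigma>'_pos: "\<sigma>' t > 0" if t: "t \<in> {0<..b}" for t
    using pos[OF t] \<sigma>_pos[OF t] t by (auto simp: zero_less_divide_iff zero_less_mult_iff)
  define \<Theta> where "\<Theta> t = ln (\<sigma> t / (t * \<sigma>' t))" for t
  define \<gamma> where "\<gamma> t = \<sigma> t / \<sigma>' t" for t
  have \<gamma>_eq: "\<gamma> t = t * exp (\<Theta> t)" if "t \<in> {0<..b}" for t
    using pos[OF that] that by (simp add: \<gamma>_def \<Theta>_def)
  define l where "l t = ln (\<sigma> t / t)" for t
  have l_der: "(l has_real_derivative (exp (- \<Theta> t) - 1) / t) (at t within {0..b})" if t: "t \<in> {0<..b}" for t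
  proof -
    have "(l has_real_derivative (\<sigma>' t * t - \<sigma> t) / (t * t) / (\<sigma> t / t)) (at t within {0..b})"
      unfolding l_def using d[of t] t \<sigma>_pos[OF t] by (auto intro!: derivative_eq_intros simp: field_simps)
    moreover have "exp (- \<Theta> t) = t * \<sigma>' t / \<sigma> t"
      using pos[OF t] by (simp add: \<Theta>_def exp_minus inverse_eq_divide)
    hence "(\<sigma>' t * t - \<sigma> t) / (t * t) / (\<sigma> t / t) = (exp (- \<Theta> t) - 1) / t"
      using t \<sigma>_pos[OF t] by (simp add: field_simps)
    ultimately show ?thesis by simp
  qed
  have l_lim: "(l \<longlongrightarrow> 0) (at_right 0)"
    unfolding l_def using tendsto_ln[OF lim0] by simp
  have \<Theta>_der: "(\<Theta> has_real_derivative \<theta> (lam * t) / t) (at t within {0..b})" if "t \<in> {0<..b}" for t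
    unfolding \<Theta>_def by (rule eq[OF that])
  have sub: "(f has_real_derivative y) (at x within {s..t})"
    if "(f has_real_derivative y) (at x within {0..b})" "0 < s" "t \<le> b" for f y x s t
    by (rule DERIV_subset[OF that(1)]) (use that in auto)
  have \<Theta>_mono: "\<Theta> s \<le> \<Theta> t" if "0 < s" "s \<le> t" "t \<le> b" for s t
  proof (rule nondecreasing_of_derivative[where f=\<Theta> and f'="\<lambda>x. \<theta> (lam * x) / x", OF that(2)])
    fix x assume x: "x \<in> {s..t}"
    hence xb: "x \<in> {0<..b}" using that by auto
    show "(\<Theta> has_real_derivative \<theta> (lam * x) / x) (at x within {s..t})"
      by (rule sub[OF \<Theta>_der[OF xb] that(1,3)])
    show "0 \<le> \<theta> (lam * x) / x" using \<theta>_nonneg b(2)[OF xb] xb by simp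
  qed
  have small: "\<exists>s\<in>{0<..<t}. \<bar>l s\<bar> < 1 \<and> ln s < m" if "t > 0" for t m
  proof -
    have "\<forall>\<^sub>F s in at_right 0. \<bar>l s\<bar> < 1" using l_lim tendstoD[OF l_lim, of 1] by (simp add: dist_real_def)
    moreover have "\<forall>\<^sub>F s in at_right 0. ln s < m" using ln_at_0 by (simp add: filterlim_at_bot_dense)
    moreover have "\<forall>\<^sub>F s in at_right 0. s \<in> {0<..<t}" using that by (intro eventually_at_rightI[of 0 t]) auto
    ultimately have "\<forall>\<^sub>F s in at_right 0. \<bar>l s\<bar> < 1 \<and> ln s < m \<and> s \<in> {0<..<t}" by (intro eventually_conj)
    then obtain s where "\<bar>l s\<bar> < 1 \<and> ln s < m \<and> s \<in> {0<..<t}" using eventually_happens[of _ "at_right (0::real)"] by auto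
    thus ?thesis by auto
  qed
  have \<Theta>_nonneg: "\<Theta> t \<ge> 0" if t: "t \<in> {0<..b}" for t
  proof (rule ccontr)
    assume "\<not> \<Theta> t \<ge> 0"
    define c where "c = - \<Theta> t"
    have c: "c > 0" using \<open>\<not> \<Theta> t \<ge> 0\<close> by (simp add: c_def)
    obtain s where s: "s \<in> {0<..<t}" "\<bar>l s\<bar> < 1" "ln s < ln t - (l t + 2) / c" using small[of t "ln t - (l t + 2) / c"] t by auto
    have "l s - c * ln s \<le> l t - c * ln t"
    proof (rule nondecreasing_of_derivative[where f="\<lambda>x. l x - c * ln x" and f'="\<lambda>x. (exp (- \<Theta> x) - 1) / x - c * (1 / x)"])
      fix x assume x: "x \<in> {s..t}"
      hence xb: "x \<in> {0<..b}" using s t by auto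
      have "(l has_real_derivative (exp (- \<Theta> x) - 1) / x) (at x within {s..t})"
        by (rule sub[OF l_der[OF xb]]) (use s t in auto)
      thus "((\<lambda>x. l x - c * ln x) has_real_derivative (exp (- \<Theta> x) - 1) / x - c * (1 / x)) (at x within {s..t})"
        using xb by (auto intro!: derivative_eq_intros simp: inverse_eq_divide)
      have "\<Theta> x \<le> - c" using \<Theta>_mono[of x t] x s t by (simp add: c_def)
      hence "exp (- \<Theta> x) - 1 \<ge> c" using exp_ge_add_one_self[of "- \<Theta> x"] by linarith
      hence "(exp (- \<Theta> x) - 1 - c) / x \<ge> 0" using xb by simp
      thus "0 \<le> (exp (- \<Theta> x) - 1) / x - c * (1 / x)" by (simp add: diff_divide_distrib)
    qed (use s in auto)
    moreover have "c * (ln t - (l t + 2) / c) = c * ln t - (l t + 2)" using c by (simp add: field_simps)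
    hence "c * ln s < c * ln t - (l t + 2)" using mult_strict_left_mono[OF s(3) c] by simp
    ultimately show False using s(2) by linarith
  qed
  define P where "P t = (lam * t) powr (1/4)" for t
  have P_der: "(P has_real_derivative P t / (4 * t)) (at t within {0..b})" if t: "t \<in> {0<..b}" for t
  proof -
    have "0 < lam * t" using b(2)[OF t] by simp
    hence "(P has_real_derivative (1/4) * (lam * t) powr (1/4 - 1) * lam) (at t within {0..b})"
      unfolding P_def by (auto intro!: derivative_eq_intros)
    moreover have "(lam * t) powr (1/4 - 1) = P t / (lam * t)"
      using b(2)[OF t] powr_diff[of "lam * t" "1/4" 1] by (simp add: P_def)
    ultimately show ?thesis using lam t by (simp add: field_simps)
  qed
  have P_bd: "0 \<le> P t" "P t \<le> 1" if t: "t \<in> {0<..b}" for t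
  proof -
    have "P t \<le> 1 powr (1/4)" unfolding P_def using b(2)[OF t] by (intro powr_mono2) auto
    thus "0 \<le> P t" "P t \<le> 1" by (auto simp: P_def)
  qed
  have \<Theta>_upper: "\<Theta> t \<le> 60 * P t" if t: "t \<in> {0<..b}" for t
  proof (rule ccontr)
    assume neg: "\<not> \<Theta> t \<le> 60 * P t"
    define c where "c = \<Theta> t - 60 * P t"
    have c: "c > 0" using neg by (simp add: c_def)
    define e where "e = 1 - exp (- c)"
    have e: "e > 0" using c by (simp add: e_def)
    obtain s where s: "s \<in> {0<..<t}" "\<bar>l s\<bar> < 1" "ln s < ln t - (2 - l t) / e" using small[of t "ln t - (2 - l t) / e"] t by auto
    have \<Theta>c: "\<Theta> x \<ge> c" if x: "x \<in> {s..t}" for x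
    proof -
      have "60 * P x - \<Theta> x \<le> 60 * P t - \<Theta> t"
      proof (rule nondecreasing_of_derivative[where f="\<lambda>x. 60 * P x - \<Theta> x" and f'="\<lambda>y. 60 * (P y / (4 * y)) - \<theta> (lam * y) / y"])
        fix y assume y: "y \<in> {x..t}"
        hence yb: "y \<in> {0<..b}" using x s t by auto
        show "((\<lambda>y. 60 * P y - \<Theta> y) has_real_derivative 60 * (P y / (4 * y)) - \<theta> (lam * y) / y) (at y within {x..t})"
          by (intro DERIV_diff DERIV_cmult sub[OF P_der[OF yb]] sub[OF \<Theta>_der[OF yb]]) (use x s t in auto)
        have "\<theta> (lam * y) \<le> 15 * P y" unfolding P_def using b(2)[OF yb] by (intro \<theta>_le_root) auto
        hence "(15 * P y - \<theta> (lam * y)) / y \<ge> 0" using yb by simp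
        thus "0 \<le> 60 * (P y / (4 * y)) - \<theta> (lam * y) / y" by (simp add: diff_divide_distrib)
      qed (use x in auto)
      moreover have "P x \<ge> 0" using P_bd[of x] x s t by auto
      ultimately show ?thesis by (simp add: c_def)
    qed
    have "- l s - e * ln s \<le> - l t - e * ln t"
    proof (rule nondecreasing_of_derivative[where f="\<lambda>x. - l x - e * ln x" and f'="\<lambda>x. - ((exp (- \<Theta> x) - 1) / x) - e * (1 / x)"])
      fix x assume x: "x \<in> {s..t}"
      hence xb: "x \<in> {0<..b}" using s t by auto
      have "(l has_real_derivative (exp (- \<Theta> x) - 1) / x) (at x within {s..t})"
        by (rule sub[OF l_der[OF xb]]) (use s t in auto)
      thus "((\<lambda>x. - l x - e * ln x) has_real_derivative - ((exp (- \<Theta> x) - 1) / x) - e * (1 / x)) (at x within {s..t})"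
        using xb by (auto intro!: derivative_eq_intros simp: inverse_eq_divide)
      have "exp (- \<Theta> x) \<le> exp (- c)" using \<Theta>c[OF x] by simp
      hence "(1 - exp (- \<Theta> x) - e) / x \<ge> 0" using xb by (simp add: e_def)
      thus "0 \<le> - ((exp (- \<Theta> x) - 1) / x) - e * (1 / x)" by (simp add: diff_divide_distrib)
    qed (use s in auto)
    moreover have "e * (ln t - (2 - l t) / e) = e * ln t - (2 - l t)" using e by (simp add: field_simps)
    hence "e * ln s < e * ln t - (2 - l t)" using mult_strict_left_mono[OF s(3) e] by simp
    ultimately show False using s(2) by linarith
  qed
  have l_upper: "l t \<le> 0" if t: "t \<in> {0<..b}" for t
  proof (rule tendsto_lowerbound[OF l_lim])
    have "\<forall>\<^sub>F s in at_right 0. s \<in> {0<..<t}" using t by (intro eventually_at_rightI[of 0 t]) auto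
    thus "\<forall>\<^sub>F s in at_right 0. l t \<le> l s"
    proof eventually_elim
      case (elim s)
      have "- l s \<le> - l t"
      proof (rule nondecreasing_of_derivative[where f="\<lambda>x. - l x" and f'="\<lambda>x. - ((exp (- \<Theta> x) - 1) / x)"])
        fix x assume x: "x \<in> {s..t}"
        hence xb: "x \<in> {0<..b}" using elim t by auto
        have "(l has_real_derivative (exp (- \<Theta> x) - 1) / x) (at x within {s..t})"
          by (rule sub[OF l_der[OF xb]]) (use elim t in auto)
        thus "((\<lambda>x. - l x) has_real_derivative - ((exp (- \<Theta> x) - 1) / x)) (at x within {s..t})"
          by (rule DERIV_minus)
        show "0 \<le> - ((exp (- \<Theta> x) - 1) / x)" using \<Theta>_nonneg[OF xb] xb by (simp add: divide_nonpos_pos)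
      qed (use elim in auto)
      thus ?case by simp
    qed
  qed simp
  have l_lower: "l t \<ge> - 240" if t: "t \<in> {0<..b}" for t
  proof -
    have "((\<lambda>s. l s + 240 * P s) \<longlongrightarrow> 0 + 240 * (lam * 0) powr (1/4)) (at_right 0)"
      unfolding P_def by (intro tendsto_add l_lim tendsto_mult tendsto_const tendsto_powr' tendsto_ident_at) (auto intro!: eventually_at_rightI[of 0 1] simp: lam less_imp_le)
    hence lim: "((\<lambda>s. l s + 240 * P s) \<longlongrightarrow> 0) (at_right 0)" by simp
    have "0 \<le> l t + 240 * P t"
    proof (rule tendsto_upperbound[OF lim])
      have "\<forall>\<^sub>F s in at_right 0. s \<in> {0<..<t}" using t by (intro eventually_at_rightI[of 0 t]) auto
      thus "\<forall>\<^sub>F s in at_right 0. l s + 240 * P s \<le> l t + 240 * P t"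
      proof eventually_elim
        case (elim s)
        show ?case
        proof (rule nondecreasing_of_derivative[where f="\<lambda>x. l x + 240 * P x" and f'="\<lambda>x. (exp (- \<Theta> x) - 1) / x + 240 * (P x / (4 * x))"])
          fix x assume x: "x \<in> {s..t}"
          hence xb: "x \<in> {0<..b}" using elim t by auto
          show "((\<lambda>x. l x + 240 * P x) has_real_derivative (exp (- \<Theta> x) - 1) / x + 240 * (P x / (4 * x))) (at x within {s..t})"
            by (intro DERIV_add DERIV_cmult sub[OF l_der[OF xb]] sub[OF P_der[OF xb]]) (use elim t in auto)
          have "exp (- \<Theta> x) - 1 + 60 * P x \<ge> 0"
            using \<Theta>_upper[OF xb] exp_ge_add_one_self[of "- \<Theta> x"] by linarith
          hence "(exp (- \<Theta> x) - 1 + 60 * P x) / x \<ge> 0" using xb by simp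
          thus "0 \<le> (exp (- \<Theta> x) - 1) / x + 240 * (P x / (4 * x))" by (simp add: add_divide_distrib)
        qed (use elim in auto)
      qed
    qed simp
    thus ?thesis using P_bd[OF t] by linarith
  qed
  show ?thesis
  proof (rule that[of \<gamma>], unfold b_def[symmetric])
    fix t assume t: "t \<in> {0<..b}"
    show "\<sigma> t > 0" by (rule \<sigma>_pos[OF t])
    show "t \<le> \<gamma> t \<and> \<gamma> t \<le> exp 60 * t"
    proof -
      have "1 \<le> exp (\<Theta> t)" "exp (\<Theta> t) \<le> exp 60"
        using \<Theta>_nonneg[OF t] \<Theta>_upper[OF t] P_bd[OF t] by auto
      thus ?thesis using t \<gamma>_eq[OF t] by (auto simp: mult.commute intro: mult_left_mono)
    qed
    show "\<sigma> t \<le> t \<and> t \<le> exp 240 * \<sigma> t"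
    proof -
      have e: "\<sigma> t = t * exp (l t)" using t \<sigma>_pos[OF t] by (simp add: l_def)
      have "exp (l t) \<le> 1" "exp (- 240) \<le> exp (l t)" using l_upper[OF t] l_lower[OF t] by auto
      moreover have "exp 240 * exp (l t) \<ge> 1"
        unfolding exp_add[symmetric] using l_lower[OF t] by simp
      ultimately show ?thesis unfolding e using t
        by (auto simp: mult_left_le mult.left_commute[of "exp 240" t])
    qed
    show "(\<sigma> has_real_derivative \<sigma> t / \<gamma> t) (at t within {0..b})"
      using d[of t] t \<sigma>_pos[OF t] \<sigma>'_pos[OF t] by (simp add: \<gamma>_def)
    show "(\<gamma> has_real_derivative \<gamma> t * (1 + \<theta> (lam * t)) / t) (at t within {0..b})"
    proof -
      have D: "((\<lambda>t. t * exp (\<Theta> t)) has_real_derivative 1 * exp (\<Theta> t) + exp (\<Theta> t) * (\<theta> (lam * t) / t) * t) (at t within {0..b})"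
        by (intro DERIV_mult DERIV_ident DERIV_chain2[OF DERIV_exp] \<Theta>_der t)
      have eqd: "1 * exp (\<Theta> t) + exp (\<Theta> t) * (\<theta> (lam * t) / t) * t = \<gamma> t * (1 + \<theta> (lam * t)) / t"
        using t by (simp add: \<gamma>_eq[OF t] field_simps)
      show ?thesis
      proof (rule has_field_derivative_transform_within[OF D[unfolded eqd], of t])
        show "x * exp (\<Theta> x) = \<gamma> x" if "x \<in> {0..b}" "dist x t < t" for x
          using \<gamma>_eq[of x] that t by (auto simp: dist_real_def)
      qed (use t in auto)
    qed
  qed
qed

section \<open>Derivatives along the coordinate directions of space\<close>

text \<open>A relational derivative in the direction of a coordinate of space. As a relation it composes by rules, and it can be
asserted almost everywhere without choosing a value where the derivative fails to exist.\<close>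

definition xd :: "'n \<Rightarrow> (real^'n) \<times> real \<Rightarrow> ((real^'n) \<times> real \<Rightarrow> 'b::real_normed_vector) \<Rightarrow> 'b \<Rightarrow> bool"
  where "xd k p f d \<longleftrightarrow> ((\<lambda>h. f (fst p + h *\<^sub>R axis k 1, snd p)) has_vector_derivative d) (at 0)"

lemma xd_const: "xd k p (\<lambda>q. c) 0" by (simp add: xd_def)

lemma xd_time: "xd k p (\<lambda>q. \<phi> (snd q)) 0" by (simp add: xd_def)

lemma xd_fst: "xd k p fst (axis k 1)"
  unfolding xd_def by (auto intro!: derivative_eq_intros)

lemma xd_add: "xd k p f d \<Longrightarrow> xd k p g e \<Longrightarrow> xd k p (\<lambda>q. f q + g q) (d + e)"
  unfolding xd_def by (rule has_vector_derivative_add)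

lemma xd_diff: "xd k p f d \<Longrightarrow> xd k p g e \<Longrightarrow> xd k p (\<lambda>q. f q - g q) (d - e)"
  unfolding xd_def by (rule has_vector_derivative_diff)

lemma xd_minus: "xd k p f d \<Longrightarrow> xd k p (\<lambda>q. - f q) (- d)"
  unfolding xd_def by (rule has_vector_derivative_minus)

lemma xd_bilinear:
  assumes "bounded_bilinear pr" "xd k p f d" "xd k p g e"
  shows "xd k p (\<lambda>q. pr (f q) (g q)) (pr (f p) e + pr d (g p))"
  using bounded_bilinear.has_vector_derivative[OF assms(1) assms(2)[unfolded xd_def] assms(3)[unfolded xd_def]]
  by (simp add: xd_def)

lemmas xd_mult = xd_bilinear[OF bounded_bilinear_mult]
  and xd_scaleR = xd_bilinear[OF bounded_bilinear_scaleR]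
  and xd_inner = xd_bilinear[OF bounded_bilinear_inner]
  and xd_mv = xd_bilinear[OF bounded_bilinear_matrix_vector_mult]

lemma xd_sum: "(\<And>i. i \<in> I \<Longrightarrow> xd k p (f i) (d i)) \<Longrightarrow> xd k p (\<lambda>q. \<Sum>i\<in>I. f i q) (\<Sum>i\<in>I. d i)"
  unfolding xd_def by (rule has_vector_derivative_sum)

lemma xd_cong: "xd k p f d \<Longrightarrow> d = e \<Longrightarrow> xd k p f e" by simp

lemma xd_smooth: "smooth f \<Longrightarrow> xd k p f (dd (axis k 1, 0) f p)"
  using smooth_line_derivative[of f p "(axis k 1, 0)" 0]
  by (cases p) (simp add: xd_def has_real_derivative_iff_has_vector_derivative)

lemma xd_vec:
  fixes f :: "(real^'n) \<times> real \<Rightarrow> 'm::finite \<Rightarrow> real"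
  assumes "\<And>i. xd k p (\<lambda>q. f q i) (d i)"
  shows "xd k p (\<lambda>q. \<chi> i. f q i) (\<chi> i. d i)"
proof -
  have eq: "(\<chi> i. g i) = (\<Sum>i\<in>UNIV. g i *\<^sub>R (axis i 1 :: real^'m))" for g
    by (simp add: vec_eq_iff axis_def if_distrib[where f="\<lambda>x. _ * x"] cong: if_cong)
  have "xd k p (\<lambda>q. \<Sum>i\<in>UNIV. f q i *\<^sub>R (axis i 1 :: real^'m)) (\<Sum>i\<in>UNIV. f p i *\<^sub>R 0 + d i *\<^sub>R (axis i 1 :: real^'m))"
    by (intro xd_sum xd_scaleR assms xd_const)
  thus ?thesis by (simp add: eq)
qed

lemma xd_compose:
  assumes "xd k p f d" "(\<phi> has_real_derivative c) (at (f p))"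
  shows "xd k p (\<lambda>q. \<phi> (f q :: real) :: real) (c * d)"
proof -
  have "((\<lambda>h. \<phi> (f (fst p + h *\<^sub>R axis k 1, snd p))) has_real_derivative c * d) (at 0)"
    by (rule DERIV_chain2) (use assms in \<open>simp_all add: xd_def has_real_derivative_iff_has_vector_derivative\<close>)
  thus ?thesis by (simp add: xd_def has_real_derivative_iff_has_vector_derivative)
qed

section \<open>Frozen coefficients and the conjugated operator\<close>

text \<open>The data after extension to all of space-time: \<open>A\<close> and the frozen potential \<open>V0\<close> are defined and Lipschitz everywhere, and
\<open>dA\<close>, \<open>dA0\<close>, \<open>dV\<close> are bounded representatives of their derivatives. The functions \<open>sg\<close> and \<open>gm\<close> are \<open>\<sigma>\<close>
and \<open>\<gamma>\<close> shifted by \<open>a\<close>; the bound \<open>3/4\<close> keeps \<open>\<lambda>\<tau>\<close> away from \<open>1\<close>, where \<open>\<theta>\<close> vanishes. The constant \<open>C\<close>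
dominates the dimension, the ellipticity and the Lipschitz constant, and \<open>vb\<close> all norms of the potential.\<close>

locale carleman_setting =
  fixes A :: "(real^'n) \<times> real \<Rightarrow> real^'n^'n" and V :: "(real^'n) \<times> real \<Rightarrow> real" and V0 :: "real^'n \<Rightarrow> real"
    and w :: "(real^'n) \<times> real \<Rightarrow> real" and C K vb r T a \<alpha> lam :: real and sg gm :: "real \<Rightarrow> real"
    and dA dA0 :: "'n \<Rightarrow> (real^'n) \<times> real \<Rightarrow> real^'n^'n" and dV :: "'n \<Rightarrow> (real^'n) \<times> real \<Rightarrow> real"
  assumes C: "C \<ge> 1" "real CARD('n) \<le> C" "K \<ge> 0" "K \<le> C"
    and A_sym: "\<And>p. transpose (A p) = A p"
    and A_ell: "\<And>p v. (norm v)\<^sup>2 \<le> C * (v \<bullet> (A p *v v))"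
    and A_bd: "\<And>p. norm (A p) \<le> C"
    and A_lip: "\<And>x t y s. norm (A (x, t) - A (y, s)) \<le> K * (norm (x - y) + sqrt \<bar>t - s\<bar>)"
    and A_0: "A (0, 0) = mat 1"
    and A_cont: "continuous_on UNIV A"
    and V_cont: "continuous_on (strip T) V" and V_bd: "\<And>p. p \<in> strip T \<Longrightarrow> \<bar>V p\<bar> \<le> vb"
    and V0_lip: "\<And>x y. \<bar>V0 x - V0 y\<bar> \<le> vb * norm (x - y)" and V0_bd: "\<And>x. \<bar>V0 x\<bar> \<le> vb"
    and V_V0: "\<And>x t. (x, t) \<in> strip T \<Longrightarrow> \<bar>V (x, t) - V0 x\<bar> \<le> vb * sqrt t"
    and vb: "0 \<le> vb" "vb \<le> \<alpha>\<^sup>2"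
    and dA: "\<And>k. tame T (dA k)" "\<And>k p. norm (dA k p) \<le> C"
      "AE p in \<mu> T. \<forall>k. xd k p A (dA k p)"
    and dA0: "\<And>k. tame T (dA0 k)" "\<And>k p. norm (dA0 k p) \<le> C"
      "AE p in \<mu> T. \<forall>k. xd k p (\<lambda>q. A (fst q, 0)) (dA0 k p)"
    and dV: "\<And>k. tame T (dV k)" "\<And>k p. \<bar>dV k p\<bar> \<le> vb"
      "AE p in \<mu> T. \<forall>k. xd k p (\<lambda>q. V0 (fst q)) (dV k p)"
    and w: "smooth w" and r: "0 < r" "r < 4" and w_supp: "\<And>x t. t \<ge> 0 \<Longrightarrow> norm x \<ge> r \<Longrightarrow> w (x, t) = 0"
    and w_T: "\<And>x. w (x, T) = 0"
    and pos: "0 < T" "0 < a" "1 \<le> \<alpha>" "1 \<le> lam" "\<alpha> \<le> lam" "lam * (T + a) \<le> 3/4"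
    and sg_pos: "\<And>t. t \<in> {0..T} \<Longrightarrow> sg t > 0"
    and gm: "\<And>t. t \<in> {0..T} \<Longrightarrow> t + a \<le> gm t \<and> gm t \<le> exp 60 * (t + a)"
    and sg: "\<And>t. t \<in> {0..T} \<Longrightarrow> sg t \<le> t + a \<and> t + a \<le> exp 240 * sg t"
    and sg_der: "\<And>t. t \<in> {0..T} \<Longrightarrow> (sg has_real_derivative sg t / gm t) (at t within {0..T})"
    and gm_der: "\<And>t. t \<in> {0..T} \<Longrightarrow> (gm has_real_derivative gm t * (1 + \<theta> (lam * (t + a))) / (t + a)) (at t within {0..T})"
begin

text \<open>Abbreviations: \<open>ta\<close>, \<open>th\<close>, \<open>it\<close>, \<open>ka\<close> stand for \<open>\<tau>\<close>, \<open>\<theta>(\<lambda>\<tau>)\<close>, \<open>1/\<tau>\<close>, \<open>\<alpha>/\<gamma>\<close>; \<open>gw\<close>, \<open>hw k\<close>, \<open>wt\<close> for \<open>\<nabla>w\<close>, \<open>\<partial>\<^sub>k\<nabla>w\<close>, \<open>\<partial>\<^sub>tw\<close>;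
\<open>F = A0 \<nabla>w\<close>, \<open>y = A0 x\<close>, and \<open>m\<close> is the divergence of \<open>F\<close>. The function \<open>b\<close> is half the difference between
\<open>|x|\<^sup>2/4\<tau>\<^sup>2\<close>, which comes from the Gaussian, and its analogue with \<open>A0\<close>, and \<open>U = V0 - b\<close>. By construction \<open>Bt + St\<close> is the frozen operator applied to \<open>w\<close>.\<close>

definition "ta t = t + a"
definition "th t = \<theta> (lam * ta t)"
definition "it t = inverse (ta t)"
definition "ka t = \<alpha> * inverse (gm t)"
definition "wgt t = sg t powr (- 2 * \<alpha>)"
definition "om t = gm t * wgt t"
definition Gp :: "(real^'n) \<times> real \<Rightarrow> real" where "Gp p = G (fst p) (ta (snd p))"
definition "gw p = (\<chi> i. dd (axis i 1, 0) w p)"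
definition "hw k p = (\<chi> i. dd (axis i 1, 0) (dd (axis k 1, 0) w) p)"
definition "wt = dd (0, 1) w"
definition "gwt p = (\<chi> i. dd (axis i 1, 0) wt p)"
definition "A0 p = A (fst p, 0)"
definition "F p = A0 p *v gw p"
definition "y p = A0 p *v fst p"
definition "q p = gw p \<bullet> F p"
definition "b p = (fst p \<bullet> fst p - fst p \<bullet> y p) * (it (snd p))\<^sup>2 / 8"
definition "U p = V0 (fst p) - b p"
definition "dF k p = A0 p *v hw k p + dA0 k p *v gw p"
definition "m p = (\<Sum>k\<in>UNIV. dF k p $ k)"
definition "dy k p = A0 p *v axis k 1 + dA0 k p *v fst p"
definition "dvy p = (\<Sum>k\<in>UNIV. dy k p $ k)"
definition "Sw p = m p - (F p \<bullet> fst p) * it (snd p) / 2"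
definition "Bt p = wt p + (F p \<bullet> fst p) * it (snd p) / 2 + (b p - ka (snd p)) * w p"
definition "St p = Sw p + (U p + ka (snd p)) * w p"

lemma ta_pos: "t \<ge> 0 \<Longrightarrow> ta t > 0" using pos by (simp add: ta_def)

lemma lam_ta: assumes "t \<in> {0..T}" shows "0 < lam * ta t" "lam * ta t \<le> 3/4" "ta t \<le> 3/4"
proof -
  show "0 < lam * ta t" using assms pos ta_pos[of t] by simp
  have "lam * ta t \<le> lam * (T + a)" using assms pos by (intro mult_left_mono) (auto simp: ta_def)
  thus 1: "lam * ta t \<le> 3/4" using pos(6) by linarith
  have "ta t \<le> lam * ta t" using pos ta_pos[of t] assms by simp
  thus "ta t \<le> 3/4" using 1 by simp
qed

lemma gm_pos: "t \<in> {0..T} \<Longrightarrow> gm t > 0" using gm[of t] ta_pos[of t] by (auto simp: ta_def)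

lemma it_pos: "t \<in> {0..T} \<Longrightarrow> it t > 0" using ta_pos[of t] by (simp add: it_def)
lemma ta_it: "t \<in> {0..T} \<Longrightarrow> ta t * it t = 1" using ta_pos[of t] by (simp add: it_def)
lemma gm_ka: "t \<in> {0..T} \<Longrightarrow> gm t * ka t = \<alpha>" using gm_pos[of t] by (simp add: ka_def)
lemma ka_pos: "t \<in> {0..T} \<Longrightarrow> ka t > 0" using gm_pos[of t] pos by (simp add: ka_def)
lemma ka_le: "t \<in> {0..T} \<Longrightarrow> ka t \<le> \<alpha> * it t"
  using gm[of t] ta_pos[of t] pos by (auto simp: ka_def it_def ta_def intro!: mult_left_mono le_imp_inverse_le)
lemma wgt_pos: "t \<in> {0..T} \<Longrightarrow> wgt t > 0" using sg_pos[of t] by (simp add: wgt_def)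
lemma om_pos: "t \<in> {0..T} \<Longrightarrow> om t > 0" using wgt_pos gm_pos by (simp add: om_def)
lemma th_bounds: assumes "t \<in> {0..T}" shows "0 \<le> th t" "th t \<le> 15" "ta t * lam \<le> 8 * th t"
  using lam_ta[OF assms] \<theta>_nonneg[of "lam * ta t"] \<theta>_le_15[of "lam * ta t"] \<theta>_ge_log(4)[of "lam * ta t"]
  by (auto simp: th_def mult.commute)
lemma Gp_pos: "Gp p \<ge> 0" by (simp add: Gp_def G_def)

lemma strip_T: "p \<in> strip T \<Longrightarrow> snd p \<in> {0..T}" "p \<in> strip T \<Longrightarrow> norm (fst p) \<le> 4"
  by (auto simp: strip_def)

subsection \<open>Continuity and time derivatives of the weights\<close>

lemma der_wgt: assumes "t \<in> {0..T}" shows "(wgt has_real_derivative - 2 * ka t * wgt t) (at t within {0..T})"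
proof -
  have "((\<lambda>t. sg t powr (- 2 * \<alpha>)) has_real_derivative (- 2 * \<alpha>) * sg t powr (- 2 * \<alpha> - 1) * (sg t / gm t)) (at t within {0..T})"
    by (rule DERIV_chain2[OF has_real_derivative_powr[OF sg_pos[OF assms]] sg_der[OF assms]])
  moreover have "sg t powr (- 2 * \<alpha> - 1) * sg t = wgt t"
    using sg_pos[OF assms] by (simp add: powr_diff wgt_def)
  hence "(- 2 * \<alpha>) * sg t powr (- 2 * \<alpha> - 1) * (sg t / gm t) = - 2 * ka t * wgt t"
    by (simp add: ka_def divide_inverse mult_ac)
  ultimately show ?thesis by (simp add: wgt_def[abs_def])
qed

lemma der_gm: "t \<in> {0..T} \<Longrightarrow> (gm has_real_derivative gm t * (1 + th t) * it t) (at t within {0..T})"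
  using gm_der[of t] by (simp add: th_def it_def ta_def divide_inverse)

lemma der_om: assumes "t \<in> {0..T}" shows "(om has_real_derivative om t * ((1 + th t) * it t - 2 * ka t)) (at t within {0..T})"
  unfolding om_def[abs_def] by (rule DERIV_cong[OF DERIV_mult[OF der_gm[OF assms] der_wgt[OF assms]]])
    (simp add: algebra_simps)

lemma der_it: assumes "t \<in> {0..T}" shows "(it has_real_derivative - (it t)\<^sup>2) (at t within {0..T})"
  unfolding it_def[abs_def] ta_def using assms pos
  by (auto intro!: derivative_eq_intros simp: power2_eq_square field_simps)

lemma der_ka: assumes "t \<in> {0..T}" shows "(ka has_real_derivative - ka t * (1 + th t) * it t) (at t within {0..T})"
  unfolding ka_def[abs_def]
  by (rule DERIV_cong[OF DERIV_cmult[OF DERIV_inverse'[OF der_gm[OF assms]]]])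
     (use gm_pos[OF assms] in \<open>auto simp: field_simps\<close>)

lemma cont_time: "continuous_on {0..T} wgt" "continuous_on {0..T} om" "continuous_on {0..T} it"
  "continuous_on {0..T} ka" "continuous_on {0..T} gm" "continuous_on {0..T} ta" "continuous_on {0..T} th"
proof -
  show "continuous_on {0..T} wgt" by (rule DERIV_continuous_on[OF der_wgt])
  show "continuous_on {0..T} om" by (rule DERIV_continuous_on[OF der_om])
  show "continuous_on {0..T} it" by (rule DERIV_continuous_on[OF der_it])
  show "continuous_on {0..T} ka" by (rule DERIV_continuous_on[OF der_ka])
  show "continuous_on {0..T} gm" by (rule DERIV_continuous_on[OF der_gm])
  show ta: "continuous_on {0..T} ta" unfolding ta_def by (intro continuous_intros)
  have l: "lam * ta x > 0" "ln (1 / (lam * ta x)) > 0" if "x \<in> {0..T}" for x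
    using lam_ta[OF that] ln_inverse_ge[of "lam * ta x"] by auto
  show "continuous_on {0..T} th"
    unfolding th_def \<theta>_def by (intro continuous_intros ta) (use l in \<open>force+\<close>)
qed

lemmas xlip_t = cont_time[THEN xlip_time]

subsection \<open>Regularity of the data\<close>

lemma xlip_w: "xlip T w" by (rule xlip_smooth[OF w])
lemma xlip_wt: "xlip T wt" unfolding wt_def by (rule xlip_smooth[OF smooth_dd[OF w]])
lemma xlip_gw: "xlip T gw" unfolding gw_def[abs_def] by (intro xlip_vec xlip_smooth smooth_dd w)
lemma xlip_gwt: "xlip T gwt" unfolding gwt_def[abs_def] wt_def by (intro xlip_vec xlip_smooth smooth_dd w)
lemma xlip_hw: "xlip T (hw k)" unfolding hw_def[abs_def] by (intro xlip_vec xlip_smooth smooth_dd w)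

lemma xlip_A: "xlip T A"
  unfolding xlip_def using A_cont A_lip by (auto intro: continuous_on_subset intro!: exI[of _ K])
    (metis abs_zero add.right_neutral cancel_comm_monoid_add_class.diff_cancel real_sqrt_zero)

lemma xlip_A0: "xlip T A0"
proof -
  have "norm (A (x, 0) - A (x', 0)) \<le> K * norm (x - x')" for x x' using A_lip[of x 0 x' 0] by simp
  moreover have "continuous_on (strip T) (\<lambda>p. A (fst p, 0))"
    by (intro continuous_on_compose2[OF A_cont]) (auto intro!: continuous_intros)
  ultimately show ?thesis unfolding xlip_def A0_def[abs_def] by auto
qed

lemma xlip_V0: "xlip T (\<lambda>p. V0 (fst p))"
proof -
  have "continuous_on UNIV V0"
  proof (rule lipschitz_on_continuous_on)
    show "vb-lipschitz_on UNIV V0" using V0_lip vb by (intro lipschitz_onI) (auto simp: dist_norm)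
  qed
  hence "continuous_on (strip T) (\<lambda>p. V0 (fst p))"
    by (rule continuous_on_compose2) (auto intro!: continuous_intros)
  thus ?thesis unfolding xlip_def using V0_lip by auto
qed

lemma xlip_F: "xlip T F" unfolding F_def[abs_def] by (intro xlip_mv xlip_A0 xlip_gw)
lemma xlip_y: "xlip T y" unfolding y_def[abs_def] by (intro xlip_mv xlip_A0 xlip_fst)
lemma xlip_q: "xlip T q" unfolding q_def[abs_def] by (intro xlip_inner xlip_gw xlip_F)

lemma xlip_b: "xlip T b"
proof -
  have "xlip T (\<lambda>p. (fst p \<bullet> fst p - fst p \<bullet> y p) * (it (snd p))\<^sup>2 * (1/8))"
    by (intro xlip_mult xlip_diff xlip_inner xlip_fst xlip_y xlip_power xlip_t xlip_const)
  thus ?thesis by (simp add: b_def[abs_def])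
qed

lemma xlip_U: "xlip T U" unfolding U_def[abs_def] by (intro xlip_diff xlip_V0 xlip_b)

lemma gauss_exponent: "- (norm x)\<^sup>2 / (4 * ta t) = (x \<bullet> x) * (- it t / 4)" for x :: "real^'n"
proof -
  have "(norm x)\<^sup>2 = x \<bullet> x" by (rule power2_norm_eq_inner)
  moreover have "- u / (4 * s) = u * (- inverse s / 4)" for u s :: real
    by (cases "s = 0") (simp_all add: field_simps)
  ultimately show ?thesis unfolding it_def by (simp only:)
qed

lemma Gp_eq:
  assumes "p \<in> strip T"
  shows "Gp p = it (snd p) powr (real CARD('n) / 2) * exp (- (fst p \<bullet> fst p) * it (snd p) / 4)"
proof -
  have "ta (snd p) powr (- real CARD('n) / 2) = ta (snd p) powr (- (real CARD('n) / 2))" by simp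
  also have "\<dots> = inverse (ta (snd p) powr (real CARD('n) / 2))" by (rule powr_minus)
  also have "\<dots> = it (snd p) powr (real CARD('n) / 2)"
    using ta_pos[of "snd p"] strip_T(1)[OF assms] by (simp add: it_def inverse_powr)
  finally show ?thesis unfolding Gp_def G_def gauss_exponent by (simp only:) simp
qed

lemma xlip_cong: "xlip T f \<Longrightarrow> (\<And>p. p \<in> strip T \<Longrightarrow> g p = f p) \<Longrightarrow> xlip T g"
  unfolding xlip_def by (auto cong: continuous_on_cong)

lemma xlip_Gp: "xlip T Gp"
proof -
  have "continuous_on {0..T} (\<lambda>t. it t powr (real CARD('n) / 2))"
    by (intro continuous_intros cont_time) (use it_pos in force)
  hence 1: "xlip T (\<lambda>p :: (real^'n) \<times> real. it (snd p) powr (real CARD('n) / 2))" by (rule xlip_time)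
  have "xlip T (\<lambda>p :: (real^'n) \<times> real. exp (- (fst p \<bullet> fst p) * it (snd p) * (1/4)))"
    by (intro xlip_exp xlip_mult xlip_minus xlip_inner xlip_fst xlip_t xlip_const)
  hence "xlip T (\<lambda>p :: (real^'n) \<times> real. it (snd p) powr (real CARD('n) / 2) * exp (- (fst p \<bullet> fst p) * it (snd p) / 4))"
    using xlip_mult[OF 1] by simp
  thus ?thesis by (rule xlip_cong) (rule Gp_eq)
qed

lemma xlip_Bt: "xlip T Bt"
proof -
  have "xlip T (\<lambda>p. wt p + (F p \<bullet> fst p) * it (snd p) * (1/2) + (b p - ka (snd p)) * w p)"
    by (intro xlip_add xlip_mult xlip_diff xlip_inner xlip_wt xlip_F xlip_fst xlip_b xlip_w xlip_t xlip_const)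
  thus ?thesis by (simp add: Bt_def[abs_def])
qed

lemmas xlip_all = xlip_t xlip_w xlip_wt xlip_gw xlip_gwt xlip_hw xlip_A xlip_A0 xlip_V0 xlip_F xlip_y xlip_q xlip_b
  xlip_U xlip_Gp xlip_Bt xlip_fst xlip_const
lemmas xlip_ops = xlip_add xlip_diff xlip_minus xlip_mult xlip_scaleR xlip_inner xlip_mv xlip_power xlip_vec_nth
lemmas tame_ops = tame_add tame_diff tame_minus tame_mult tame_scaleR tame_inner tame_mv tame_power tame_vec_nth
  tame_abs tame_norm tame_sum

lemma tame_V: "tame T V" by (rule tame_continuous[OF V_cont])
lemma tame_dF: "tame T (dF k)"
  unfolding dF_def[abs_def] by (intro tame_ops dA0 xlip_all[THEN xlip_tame])
lemma tame_dy: "tame T (dy k)"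
  unfolding dy_def[abs_def] by (intro tame_ops dA0 xlip_all[THEN xlip_tame])
lemma tame_m: "tame T m" unfolding m_def[abs_def] by (intro tame_ops tame_dF)
lemma tame_dvy: "tame T dvy" unfolding dvy_def[abs_def] by (intro tame_ops tame_dy)
lemma tame_Sw: "tame T Sw"
proof -
  have "tame T (\<lambda>p. m p - (F p \<bullet> fst p) * it (snd p) * (1/2))"
    by (intro tame_diff tame_mult tame_inner tame_m xlip_all[THEN xlip_tame])
  thus ?thesis by (simp add: Sw_def[abs_def])
qed
lemma tame_St: "tame T St"
  unfolding St_def[abs_def] by (intro tame_add tame_mult tame_Sw xlip_all[THEN xlip_tame])

lemmas tame_all = xlip_all[THEN xlip_tame] tame_V tame_dF tame_dy tame_m tame_dvy tame_Sw tame_St dA(1) dA0(1) dV(1)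

subsection \<open>Vanishing near the lateral boundary and at the final time\<close>

text \<open>Derivatives of \<open>w\<close> vanish for \<open>|x| > r\<close> only; a slightly larger radius gives a closed condition.\<close>

definition "r' = (r + 4) / 2"
lemma r': "r' < 4" "r < r'" using r by (auto simp: r'_def)

lemma dd_zero:
  fixes f :: "(real^'n) \<times> real \<Rightarrow> real"
  assumes "smooth f" "\<And>x t. t \<ge> 0 \<Longrightarrow> norm x \<ge> s \<Longrightarrow> f (x, t) = 0" "t \<ge> 0" "norm x > s"
  shows "dd (axis i 1, 0) f (x, t) = 0"
proof (rule dd_eq_0_one_sided[OF assms(1)])
  fix h :: real assume h: "h \<in> {0..<norm x - s}"
  have "norm (x + h *\<^sub>R axis i 1) \<ge> s" using h norm_diff_ineq[of x "h *\<^sub>R axis i 1"] by simp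
  thus "f ((x, t) + h *\<^sub>R (axis i 1, 0)) = 0" using assms(2,3) by simp
qed (use assms in auto)

lemma gw_zero: "t \<ge> 0 \<Longrightarrow> norm x \<ge> r' \<Longrightarrow> gw (x, t) = 0"
proof -
  assume a: "t \<ge> 0" "norm x \<ge> r'"
  have "dd (axis i 1, 0) w (x, t) = 0" for i
    by (rule dd_zero[OF w w_supp]) (use a r' in auto)
  thus ?thesis by (simp add: gw_def vec_eq_iff)
qed

lemma w_zero: "t \<ge> 0 \<Longrightarrow> norm x \<ge> r' \<Longrightarrow> w (x, t) = 0"
  using w_supp[of t x] r' by simp

lemma F_zero: "t \<ge> 0 \<Longrightarrow> norm x \<ge> r' \<Longrightarrow> F (x, t) = 0"
  by (simp add: F_def gw_zero)

lemma gw_T: "gw (x, T) = 0"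
proof -
  have "dd (axis i 1, 0) w (x, T) = 0" for i
    by (rule dd_eq_0_one_sided[OF w, of 1]) (use w_T in auto)
  thus ?thesis by (simp add: gw_def vec_eq_iff)
qed

lemma divergence_integral:
  fixes \<Psi> :: "(real^'n) \<times> real \<Rightarrow> real^'n"
  assumes "xlip T \<Psi>" "\<And>x t. t \<in> {0..T} \<Longrightarrow> norm x \<ge> r' \<Longrightarrow> \<Psi> (x, t) = 0" "\<And>k. tame T (D k)"
    "AE p in \<mu> T. \<forall>k. xd k p \<Psi> (D k p)"
  shows "integral\<^sup>L (\<mu> T) (\<lambda>p. \<Sum>k\<in>UNIV. D k p $ k) = 0"
  using integral_divergence_eq_0[OF assms(1) r'(1) assms(2,3)] assms(4) by (simp add: xd_def)

subsection \<open>Spatial derivatives\<close>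

lemma xd_w: "xd k p w (gw p $ k)" using xd_smooth[OF w] by (simp add: gw_def)
lemma xd_wt: "xd k p wt (gwt p $ k)" using xd_smooth[OF smooth_dd[OF w]] by (simp add: gwt_def wt_def)

lemma xd_gw: "xd k p gw (hw k p)"
proof -
  have "xd k p gw (\<chi> i. dd (axis k 1, 0) (dd (axis i 1, 0) w) p)"
    unfolding gw_def[abs_def] by (intro xd_vec xd_smooth smooth_dd w)
  thus ?thesis unfolding hw_def by (subst dd_commute[OF w])
qed

lemma hw_sym: "hw k p $ i = hw i p $ k"
  unfolding hw_def using dd_commute[OF w, of "(axis i 1, 0)" "(axis k 1, 0)"] by simp

lemma xd_Gp: assumes "p \<in> strip T" shows "xd k p Gp (- (fst p $ k) * it (snd p) / 2 * Gp p)"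
proof -
  define g where "g q = ta (snd q) powr (- real CARD('n) / 2) * exp ((fst q \<bullet> fst q) * (- it (snd q) / 4))" for q :: "(real^'n) \<times> real"
  have eq: "Gp = g"
    by (rule ext) (simp only: Gp_def g_def G_def gauss_exponent)
  have 1: "xd k p (\<lambda>q. fst q \<bullet> fst q) (2 * fst p $ k)"
    by (rule xd_cong[OF xd_inner[OF xd_fst xd_fst]]) (simp add: inner_axis inner_axis')
  have 2: "xd k p (\<lambda>q. (fst q \<bullet> fst q) * (- it (snd q) / 4)) ((fst p \<bullet> fst p) * 0 + (2 * fst p $ k) * (- it (snd p) / 4))"
    by (rule xd_mult[OF 1 xd_time])
  have 3: "xd k p (\<lambda>q. exp ((fst q \<bullet> fst q) * (- it (snd q) / 4)))
     (exp ((fst p \<bullet> fst p) * (- it (snd p) / 4)) * ((fst p \<bullet> fst p) * 0 + (2 * fst p $ k) * (- it (snd p) / 4)))"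
    by (rule xd_compose[OF 2 DERIV_exp])
  have "xd k p g (ta (snd p) powr (- real CARD('n) / 2) * (exp ((fst p \<bullet> fst p) * (- it (snd p) / 4)) * ((fst p \<bullet> fst p) * 0 + (2 * fst p $ k) * (- it (snd p) / 4)))
     + 0 * exp ((fst p \<bullet> fst p) * (- it (snd p) / 4)))"
    unfolding g_def by (rule xd_mult[OF xd_time 3])
  thus ?thesis unfolding eq by (rule xd_cong) (simp add: g_def)
qed

text \<open>The points at which all the Lipschitz data are differentiable in \<open>x\<close>; the pointwise calculus takes place there.\<close>

definition "reg p \<longleftrightarrow> p \<in> strip T \<and> (\<forall>k. xd k p A (dA k p) \<and> xd k p A0 (dA0 k p) \<and> xd k p (\<lambda>q. V0 (fst q)) (dV k p))"

lemma AE_reg: "AE p in \<mu> T. reg p"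
proof -
  have "AE p in \<mu> T. p \<in> strip T" using AE_space[of "\<mu> T"] by simp
  with dA(3) dA0(3) dV(3) show ?thesis
    by eventually_elim (simp add: reg_def A0_def[abs_def])
qed

lemma xd_F: "reg p \<Longrightarrow> xd k p F (dF k p)"
  unfolding F_def[abs_def] dF_def by (rule xd_mv[OF _ xd_gw]) (simp add: reg_def)

lemma xd_y: "reg p \<Longrightarrow> xd k p y (dy k p)"
  unfolding y_def[abs_def] dy_def by (rule xd_mv[OF _ xd_fst]) (simp add: reg_def)

definition "dq k p = gw p \<bullet> dF k p + hw k p \<bullet> F p"
definition "db k p = (2 * fst p $ k - (fst p \<bullet> dy k p + y p $ k)) * (it (snd p))\<^sup>2 / 8"
definition "dB k p = gwt p $ k + (F p \<bullet> axis k 1 + dF k p \<bullet> fst p) * it (snd p) / 2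
  + ((b p - ka (snd p)) * gw p $ k + db k p * w p)"

lemma xd_q: "reg p \<Longrightarrow> xd k p q (dq k p)"
  unfolding q_def[abs_def] dq_def by (rule xd_inner[OF xd_gw xd_F])

lemma xd_b: assumes "reg p" shows "xd k p b (db k p)"
proof -
  have "xd k p (\<lambda>q. (fst q \<bullet> fst q - fst q \<bullet> y q) * ((it (snd q))\<^sup>2 / 8))
    ((fst p \<bullet> fst p - fst p \<bullet> y p) * 0 + ((fst p \<bullet> axis k 1 + axis k 1 \<bullet> fst p) - (fst p \<bullet> dy k p + axis k 1 \<bullet> y p)) * ((it (snd p))\<^sup>2 / 8))"
    by (rule xd_mult[OF xd_diff[OF xd_inner[OF xd_fst xd_fst] xd_inner[OF xd_fst xd_y[OF assms]]] xd_time[of k p "\<lambda>t. (it t)\<^sup>2 / 8"]])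
  thus ?thesis by (simp add: b_def[abs_def] db_def inner_axis inner_axis')
qed

lemma xd_U: "reg p \<Longrightarrow> xd k p U (dV k p - db k p)"
  unfolding U_def[abs_def] by (rule xd_diff[OF _ xd_b]) (simp_all add: reg_def)

lemma xd_Bt: assumes "reg p" shows "xd k p Bt (dB k p)"
proof -
  have "xd k p (\<lambda>p. wt p + (F p \<bullet> fst p) * (it (snd p) / 2) + (b p - ka (snd p)) * w p)
     (gwt p $ k + ((F p \<bullet> fst p) * 0 + (F p \<bullet> axis k 1 + dF k p \<bullet> fst p) * (it (snd p) / 2)) + ((b p - ka (snd p)) * gw p $ k + (db k p - 0) * w p))"
    by (rule xd_add[OF xd_add[OF xd_wt xd_mult[OF xd_inner[OF xd_F[OF assms] xd_fst] xd_time[of k p "\<lambda>t. it t / 2"]]]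
        xd_mult[OF xd_diff[OF xd_b[OF assms] xd_time] xd_w]])
  thus ?thesis by (simp add: Bt_def[abs_def] dB_def)
qed

end

section \<open>The commutator identity\<close>

text \<open>The commutator identity after all derivatives have been computed, as a polynomial identity in independent scalars: \<open>H1\<close> is
the term with second derivatives, which cancels by symmetry of \<open>A0\<close> and of the Hessian.\<close>

lemma commutator_algebra:
  fixes om G wt Fx it xx xy ka w m U th n q FF e1 e2 H1 bF yV yb gF dvy b :: real
  assumes b: "b = (xx - xy) * it^2 / 8"
  shows "2 * om * G * (wt + Fx * it / 2 + (b - ka) * w) * (m - Fx * it / 2 + (U + ka) * w) =
    (2 * om * G * (wt + Fx * it / 2 + (b - ka) * w) * m
      + 2 * om * G * (- Fx * it / 2 * (wt + Fx * it / 2 + (b - ka) * w) + gF + (FF + e1 + H1) * it / 2 + (b - ka) * q + w * bF)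
      + om * it / 2 * G * (- q + (U + ka) * w^2) * dvy
      + om * it / 2 * G * (- xy * it / 2 * (- q + (U + ka) * w^2) - (e2 + 2 * H1) + w^2 * (yV - yb) + (U + ka) * 2 * w * Fx))
    + (om * ((1 + th) * it - 2 * ka) * G * (- q + (U + ka) * w^2)
      + om * (G * (- n * it / 2 + xx * it^2 / 4)) * (- q + (U + ka) * w^2)
      + om * G * (- 2 * gF + (2 * b * it - ka * (1 + th) * it) * w^2 + (U + ka) * 2 * w * wt))
    + om * G * (th * it * q - (1 + th) * it * U * w^2
      + ((dvy - n) * it / 2 * q + (q - FF) * it - e1 * it + e2 * it / 2 - 2 * w * bF
        - w^2 * (U + ka) * ((dvy - n) * it / 2) - w^2 * (2 * b * it + (yV - yb) * it / 2)))"
proof -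
  \<comment> \<open>With \<open>it = 4 k\<close> every coefficient becomes an integer.\<close>
  define k where "k = it / 4"
  have it: "it = 4 * k" by (simp add: k_def)
  have 1: "4 * k / 2 = 2 * k" "- Fx * (4 * k) / 2 = - Fx * (2 * k)" "Fx * (4 * k) / 2 = Fx * (2 * k)"
    "om * (4 * k) / 2 = om * (2 * k)" "- xy * (4 * k) / 2 = - xy * (2 * k)" "- n * (4 * k) / 2 = - n * (2 * k)"
    "xx * (4 * k)\<^sup>2 / 4 = xx * (4 * k\<^sup>2)" "e2 * (4 * k) / 2 = e2 * (2 * k)" "(dvy - n) * (4 * k) / 2 = (dvy - n) * (2 * k)"
    "(yV - yb) * (4 * k) / 2 = (yV - yb) * (2 * k)" "(FF + e1 + H1) * (4 * k) / 2 = (FF + e1 + H1) * (2 * k)"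
    "(xx - xy) * (4 * k)\<^sup>2 / 8 = (xx - xy) * (2 * k\<^sup>2)"
    by (simp_all add: power2_eq_square)
  show ?thesis unfolding b it 1 by algebra
qed

lemma sym_inner: "transpose M = M \<Longrightarrow> (M *v u) \<bullet> v = u \<bullet> (M *v v)" for M :: "real^'n^'n"
  by (metis dot_lmul_matrix vector_transpose_matrix)

lemma norm_mv_le: "norm (M *v v) \<le> norm M * norm v" for M :: "real^'n^'m"
proof -
  have "norm (M *v v) \<le> L2_set (\<lambda>i. norm (M $ i) * norm v) UNIV"
    unfolding norm_vec_def[of "M *v v"]
    by (rule L2_set_mono) (auto simp: matrix_vector_mul_component intro: Cauchy_Schwarz_ineq2)
  also have "\<dots> = norm M * norm v" by (simp add: L2_set_left_distrib norm_vec_def[of M])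
  finally show ?thesis .
qed

lemma abs_inner_mono: "norm u \<le> a \<Longrightarrow> norm v \<le> b \<Longrightarrow> \<bar>u \<bullet> v\<bar> \<le> a * b"
  by (meson Cauchy_Schwarz_ineq2 mult_mono norm_ge_zero order_trans)

lemma inner_vec_sum: "u \<bullet> v = (\<Sum>k\<in>UNIV. u $ k * v $ k)" for u v :: "real^'n"
  by (simp add: inner_vec_def)

context carleman_setting
begin

text \<open>The vector field \<open>\<Psi>\<close> and the function \<open>\<Phi>\<close> carry the total derivatives, \<open>R\<close> the remainder. In \<open>R\<close>, \<open>e1\<close> and \<open>e2\<close> come
from differentiating \<open>A0\<close>; the terms with \<open>dvy - n\<close> and \<open>q - |F|\<^sup>2\<close> vanish when \<open>A0\<close> is the identity.\<close>

definition "xx p = fst p \<bullet> fst p"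
definition "Fx p = F p \<bullet> fst p"
definition "H1 p = (\<Sum>k\<in>UNIV. y p $ k * (F p \<bullet> hw k p))"
definition "e1 p = (\<Sum>k\<in>UNIV. F p $ k * ((dA0 k p *v gw p) \<bullet> fst p))"
definition "e2 p = (\<Sum>k\<in>UNIV. y p $ k * (gw p \<bullet> (dA0 k p *v gw p)))"
definition "bF p = (\<Sum>k\<in>UNIV. F p $ k * db k p)"
definition "yV p = (\<Sum>k\<in>UNIV. y p $ k * dV k p)"
definition "yb p = (\<Sum>k\<in>UNIV. y p $ k * db k p)"
definition "Nn p = - q p + (U p + ka (snd p)) * (w p)\<^sup>2"
definition "dNn k p = - dq k p + ((dV k p - db k p) * (w p)\<^sup>2 + (U p + ka (snd p)) * (2 * w p * gw p $ k))"
definition "c1 p = 2 * om (snd p) * Gp p * Bt p"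
definition "c2 p = om (snd p) * it (snd p) / 2 * Gp p * Nn p"
definition "\<Psi> p = c1 p *\<^sub>R F p + c2 p *\<^sub>R y p"
definition "dG k p = - (fst p $ k) * it (snd p) / 2 * Gp p"
definition "dc1 k p = 2 * om (snd p) * (dG k p * Bt p + Gp p * dB k p)"
definition "dc2 k p = om (snd p) * it (snd p) / 2 * (dG k p * Nn p + Gp p * dNn k p)"
definition "d\<Psi> k p = c1 p *\<^sub>R dF k p + dc1 k p *\<^sub>R F p + (c2 p *\<^sub>R dy k p + dc2 k p *\<^sub>R y p)"
definition "\<Phi> p = om (snd p) * Gp p * Nn p"
definition "Gt p = Gp p * (- real CARD('n) * it (snd p) / 2 + xx p * (it (snd p))\<^sup>2 / 4)"
definition "\<Phi>' p = om (snd p) * ((1 + th (snd p)) * it (snd p) - 2 * ka (snd p)) * Gp p * Nn p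
      + om (snd p) * Gt p * Nn p
      + om (snd p) * Gp p * (- 2 * (F p \<bullet> gwt p) + (2 * b p * it (snd p) - ka (snd p) * (1 + th (snd p)) * it (snd p)) * (w p)\<^sup>2
         + (U p + ka (snd p)) * 2 * w p * wt p)"
definition "R p = (dvy p - real CARD('n)) * it (snd p) / 2 * q p + (q p - F p \<bullet> F p) * it (snd p) - e1 p * it (snd p)
   + e2 p * it (snd p) / 2 - 2 * w p * bF p
        - (w p)\<^sup>2 * (U p + ka (snd p)) * ((dvy p - real CARD('n)) * it (snd p) / 2)
        - (w p)\<^sup>2 * (2 * b p * it (snd p) + (yV p - yb p) * it (snd p) / 2)"

lemma A0_inner: "(A0 p *v u) \<bullet> v = u \<bullet> (A0 p *v v)"
  unfolding A0_def by (rule sym_inner[OF A_sym])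

lemma gw_y: "gw p \<bullet> y p = Fx p" by (simp add: y_def Fx_def F_def A0_inner)

lemma H1_alt: "(\<Sum>k\<in>UNIV. F p $ k * ((A0 p *v hw k p) \<bullet> fst p)) = H1 p"
proof -
  have "(\<Sum>k\<in>UNIV. F p $ k * ((A0 p *v hw k p) \<bullet> fst p)) = (\<Sum>k\<in>UNIV. \<Sum>i\<in>UNIV. F p $ k * (hw k p $ i * y p $ i))"
    by (simp add: A0_inner y_def[symmetric] inner_vec_sum[of "hw _ p"] sum_distrib_left)
  also have "\<dots> = (\<Sum>i\<in>UNIV. \<Sum>k\<in>UNIV. F p $ k * (hw k p $ i * y p $ i))" by (rule sum.swap)
  also have "\<dots> = (\<Sum>i\<in>UNIV. \<Sum>k\<in>UNIV. y p $ i * (F p $ k * hw i p $ k))"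
    by (intro sum.cong refl) (subst hw_sym, simp)
  also have "\<dots> = H1 p" by (simp add: H1_def inner_vec_sum[of "F p"] sum_distrib_left)
  finally show ?thesis .
qed

lemma sum_d\<Psi>:
  "(\<Sum>k\<in>UNIV. d\<Psi> k p $ k) = 2 * om (snd p) * Gp p * Bt p * m p
     + 2 * om (snd p) * Gp p * (- Fx p * it (snd p) / 2 * Bt p + F p \<bullet> gwt p + (F p \<bullet> F p + e1 p + H1 p) * it (snd p) / 2
        + (b p - ka (snd p)) * q p + w p * bF p)
      + om (snd p) * it (snd p) / 2 * Gp p * Nn p * dvy p
      + om (snd p) * it (snd p) / 2 * Gp p * (- (fst p \<bullet> y p) * it (snd p) / 2 * Nn p - (e2 p + 2 * H1 p) + (w p)\<^sup>2 * (yV p - yb p)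
         + (U p + ka (snd p)) * 2 * w p * Fx p)"
proof -
  have s1: "(\<Sum>k\<in>UNIV. dc1 k p * F p $ k) = 2 * om (snd p) * Gp p * (- Fx p * it (snd p) / 2 * Bt p + F p \<bullet> gwt p + (F p \<bullet> F p + e1 p + H1 p) * it (snd p) / 2
        + (b p - ka (snd p)) * q p + w p * bF p)"
  proof -
    have dec: "dc1 k p * F p $ k = 2 * om (snd p) * Gp p * (- it (snd p) / 2 * Bt p * (F p $ k * fst p $ k) + F p $ k * gwt p $ k
       + it (snd p) / 2 * (F p $ k * F p $ k) + it (snd p) / 2 * (F p $ k * ((dA0 k p *v gw p) \<bullet> fst p))
       + it (snd p) / 2 * (F p $ k * ((A0 p *v hw k p) \<bullet> fst p)) + (b p - ka (snd p)) * (gw p $ k * F p $ k) + w p * (F p $ k * db k p))" for k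
      by (simp add: dc1_def dG_def dB_def dF_def inner_add_left inner_axis algebra_simps)
    have sums: "(\<Sum>k\<in>UNIV. F p $ k * fst p $ k) = Fx p" "(\<Sum>k\<in>UNIV. F p $ k * gwt p $ k) = F p \<bullet> gwt p"
      "(\<Sum>k\<in>UNIV. F p $ k * F p $ k) = F p \<bullet> F p" "(\<Sum>k\<in>UNIV. gw p $ k * F p $ k) = q p"
      by (simp_all add: Fx_def q_def inner_vec_sum)
    show ?thesis unfolding dec sum_distrib_left[symmetric] sum.distrib sums H1_alt e1_def[symmetric] bF_def[symmetric]
      by (simp add: field_simps)
  qed
  have s2: "(\<Sum>k\<in>UNIV. dc2 k p * y p $ k) = om (snd p) * it (snd p) / 2 * Gp p * (- (fst p \<bullet> y p) * it (snd p) / 2 * Nn p - (e2 p + 2 * H1 p) + (w p)\<^sup>2 * (yV p - yb p)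
         + (U p + ka (snd p)) * 2 * w p * Fx p)"
  proof -
    have dq: "dq k p = gw p \<bullet> (dA0 k p *v gw p) + 2 * (F p \<bullet> hw k p)" for k
      by (simp add: dq_def dF_def inner_add_right F_def A0_inner inner_commute[of "hw k p"])
    have dec: "dc2 k p * y p $ k = om (snd p) * it (snd p) / 2 * Gp p * (- it (snd p) / 2 * Nn p * (fst p $ k * y p $ k)
       - y p $ k * (gw p \<bullet> (dA0 k p *v gw p)) - 2 * (y p $ k * (F p \<bullet> hw k p)) + (w p)\<^sup>2 * (y p $ k * dV k p) - (w p)\<^sup>2 * (y p $ k * db k p)
       + (U p + ka (snd p)) * 2 * w p * (gw p $ k * y p $ k))" for k
      by (simp add: dc2_def dG_def dNn_def dq algebra_simps)
    have sums: "(\<Sum>k\<in>UNIV. fst p $ k * y p $ k) = fst p \<bullet> y p" "(\<Sum>k\<in>UNIV. gw p $ k * y p $ k) = Fx p"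
      unfolding gw_y[symmetric] by (simp_all add: inner_vec_sum)
    show ?thesis unfolding dec sum_distrib_left[symmetric] sum.distrib sum_subtractf sums
        H1_def[symmetric] e2_def[symmetric] yV_def[symmetric] yb_def[symmetric]
      by (simp add: field_simps)
  qed
  have "(\<Sum>k\<in>UNIV. d\<Psi> k p $ k) = c1 p * m p + (\<Sum>k\<in>UNIV. dc1 k p * F p $ k) + (c2 p * dvy p + (\<Sum>k\<in>UNIV. dc2 k p * y p $ k))"
    by (simp add: d\<Psi>_def sum.distrib m_def dvy_def sum_distrib_left)
  thus ?thesis unfolding s1 s2 by (simp add: c1_def c2_def)
qed

text \<open>The time derivative of \<open>\<omega>\<close> contributes \<open>(1 + \<theta>)/\<tau> - 2 \<kappa>\<close>. All of it except \<open>\<theta>/\<tau>\<close> is compensated by the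
divergence of \<open>\<Psi>\<close>, up to terms that vanish when \<open>A0\<close> is the identity.\<close>

lemma commutator_identity:
  "2 * om (snd p) * Gp p * Bt p * St p = (\<Sum>k\<in>UNIV. d\<Psi> k p $ k) + \<Phi>' p
    + om (snd p) * Gp p * (th (snd p) * it (snd p) * q p - (1 + th (snd p)) * it (snd p) * U p * (w p)\<^sup>2 + R p)"
proof -
  have b: "b p = (xx p - fst p \<bullet> y p) * (it (snd p))\<^sup>2 / 8" by (simp add: b_def xx_def)
  show ?thesis
    unfolding sum_d\<Psi> \<Phi>'_def R_def St_def Sw_def Gt_def Fx_def[symmetric] Nn_def Bt_def
    using commutator_algebra[OF b] by (simp only: mult.assoc)
qed

lemma xd_\<Psi>: assumes "reg p" shows "xd k p \<Psi> (d\<Psi> k p)"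
proof -
  have s: "p \<in> strip T" using assms by (simp add: reg_def)
  have G: "xd k p Gp (dG k p)" using xd_Gp[OF s] by (simp add: dG_def)
  have N: "xd k p Nn (dNn k p)"
  proof -
    have w2: "xd k p (\<lambda>p. (w p)\<^sup>2) (2 * w p * gw p $ k)"
      unfolding power2_eq_square by (rule xd_cong[OF xd_mult[OF xd_w xd_w]]) simp
    show ?thesis unfolding Nn_def[abs_def] dNn_def
      by (rule xd_cong[OF xd_add[OF xd_minus[OF xd_q[OF assms]] xd_mult[OF xd_add[OF xd_U[OF assms] xd_time] w2]]]) simp
  qed
  have c1: "xd k p c1 (dc1 k p)" unfolding c1_def[abs_def] dc1_def
    by (rule xd_cong[OF xd_mult[OF xd_mult[OF xd_time[of k p "\<lambda>t. 2 * om t"] G] xd_Bt[OF assms]]]) (simp add: algebra_simps)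
  have c2: "xd k p c2 (dc2 k p)" unfolding c2_def[abs_def] dc2_def
    by (rule xd_cong[OF xd_mult[OF xd_mult[OF xd_time[of k p "\<lambda>t. om t * it t / 2"] G] N]]) (simp add: algebra_simps)
  show ?thesis unfolding \<Psi>_def[abs_def] d\<Psi>_def
    by (rule xd_add[OF xd_scaleR[OF c1 xd_F[OF assms]] xd_scaleR[OF c2 xd_y[OF assms]]])
qed

lemma xlip_Nn: "xlip T Nn"
  unfolding Nn_def[abs_def] by (intro xlip_ops xlip_all)

lemma xlip_\<Psi>: "xlip T \<Psi>"
proof -
  have "xlip T (\<lambda>p. (2 * om (snd p) * Gp p * Bt p) *\<^sub>R F p + (om (snd p) * it (snd p) * (1/2) * Gp p * Nn p) *\<^sub>R y p)"
    by (intro xlip_ops xlip_all xlip_Nn)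
  thus ?thesis by (simp add: \<Psi>_def[abs_def] c1_def c2_def)
qed

lemma tame_dq: "tame T (dq k)" unfolding dq_def[abs_def] by (intro tame_ops tame_all)

lemma tame_db: "tame T (db k)"
proof -
  have "tame T (\<lambda>p. (2 * fst p $ k - (fst p \<bullet> dy k p + y p $ k)) * (it (snd p))\<^sup>2 * (1/8))"
    by (intro tame_ops tame_all)
  thus ?thesis by (simp add: db_def[abs_def])
qed

lemma tame_d\<Psi>: "tame T (d\<Psi> k)"
proof -
  have dG: "tame T (dG k)"
  proof -
    have "tame T (\<lambda>p. - (fst p $ k) * it (snd p) * (1/2) * Gp p)" by (intro tame_ops tame_all)
    thus ?thesis by (simp add: dG_def[abs_def])
  qed
  have dB: "tame T (dB k)"
  proof -
    have "tame T (\<lambda>p. gwt p $ k + (F p \<bullet> axis k 1 + dF k p \<bullet> fst p) * it (snd p) * (1/2)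
       + ((b p - ka (snd p)) * gw p $ k + db k p * w p))" by (intro tame_ops tame_all tame_db)
    thus ?thesis by (simp add: dB_def[abs_def])
  qed
  have dN: "tame T (dNn k)" unfolding dNn_def[abs_def] by (intro tame_ops tame_all tame_db tame_dq)
  have "tame T (\<lambda>p. (2 * om (snd p) * Gp p * Bt p) *\<^sub>R dF k p + (2 * om (snd p) * (dG k p * Bt p + Gp p * dB k p)) *\<^sub>R F p
     + ((om (snd p) * it (snd p) * (1/2) * Gp p * Nn p) *\<^sub>R dy k p + (om (snd p) * it (snd p) * (1/2) * (dG k p * Nn p + Gp p * dNn k p)) *\<^sub>R y p))"
    by (intro tame_ops tame_all dG dB dN xlip_tame[OF xlip_Nn])
  thus ?thesis by (simp add: d\<Psi>_def[abs_def] c1_def c2_def dc1_def dc2_def)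
qed

lemma integral_d\<Psi>: "integral\<^sup>L (\<mu> T) (\<lambda>p. \<Sum>k\<in>UNIV. d\<Psi> k p $ k) = 0"
proof (rule divergence_integral[OF xlip_\<Psi> _ tame_d\<Psi>])
  show "\<Psi> (x, t) = 0" if "t \<in> {0..T}" "norm x \<ge> r'" for x t
    using that w_zero[of t x] gw_zero[of t x] F_zero[of t x]
    by (simp add: \<Psi>_def c2_def Nn_def q_def)
  show "AE p in \<mu> T. \<forall>k. xd k p \<Psi> (d\<Psi> k p)" using AE_reg by eventually_elim (simp add: xd_\<Psi>)
qed

lemma der_Gp: assumes "t \<in> {0..T}"
  shows "((\<lambda>s. Gp (x, s)) has_real_derivative Gt (x, t)) (at t within {0..T})"
proof -
  define g where "g s = ta s powr (- real CARD('n) / 2) * exp ((x \<bullet> x) * (- it s / 4))" for s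
  have eq: "(\<lambda>s. Gp (x, s)) = g"
    by (rule ext) (simp only: Gp_def g_def G_def gauss_exponent fst_conv snd_conv)
  have tp: "ta t > 0" using ta_pos assms by simp
  have dta: "(ta has_real_derivative 1) (at t within {0..T})"
    unfolding ta_def[abs_def] by (auto intro!: derivative_eq_intros)
  have 1: "((\<lambda>s. ta s powr (- real CARD('n) / 2)) has_real_derivative (- real CARD('n) / 2) * ta t powr (- real CARD('n) / 2 - 1) * 1) (at t within {0..T})"
    by (rule DERIV_chain2[OF has_real_derivative_powr[OF tp] dta])
  have 2: "((\<lambda>s. exp ((x \<bullet> x) * (- it s / 4))) has_real_derivative exp ((x \<bullet> x) * (- it t / 4)) * ((x \<bullet> x) * (- (- (it t)\<^sup>2) / 4))) (at t within {0..T})"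
    by (rule DERIV_chain2[OF DERIV_exp]) (intro DERIV_cmult DERIV_cdivide DERIV_minus der_it assms)
  have "ta t powr (- real CARD('n) / 2 - 1) = ta t powr (- real CARD('n) / 2) * it t"
  proof -
    have "ta t powr (- real CARD('n) / 2 - 1) = ta t powr (- real CARD('n) / 2) / ta t powr 1" by (rule powr_diff)
    moreover have "ta t powr 1 = ta t" using tp by simp
    ultimately show ?thesis by (simp only: it_def divide_inverse)
  qed
  moreover have "(- N / 2) * (P * i) * 1 * e + e * (X * (- (- i\<^sup>2) / 4)) * P = P * e * (- N * i / 2 + X * i\<^sup>2 / 4)" for N P i e X :: real
    by (simp add: field_simps)
  ultimately have "(- real CARD('n) / 2) * ta t powr (- real CARD('n) / 2 - 1) * 1 * exp ((x \<bullet> x) * (- it t / 4)) + exp ((x \<bullet> x) * (- it t / 4)) * ((x \<bullet> x) * (- (- (it t)\<^sup>2) / 4)) * ta t powr (- real CARD('n) / 2) = g t * (- real CARD('n) * it t / 2 + (x \<bullet> x) * (it t)\<^sup>2 / 4)"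
    by (simp only: g_def)
  hence "(g has_real_derivative g t * (- real CARD('n) * it t / 2 + (x \<bullet> x) * (it t)\<^sup>2 / 4)) (at t within {0..T})"
    using DERIV_mult[OF 1 2] by (simp add: g_def[abs_def])
  thus ?thesis using fun_cong[OF eq, of t] by (simp add: eq Gt_def xx_def)
qed

lemma der_w: "((\<lambda>s. w (x, s)) has_real_derivative wt (x, t)) (at t within {0..T})"
  using smooth_line_derivative[OF w, of "(x, 0)" "(0, 1)" t]
  by (auto simp: wt_def intro: has_field_derivative_at_within)

lemma der_gw: "((\<lambda>s. gw (x, s)) has_vector_derivative gwt (x, t)) (at t within {0..T})"
proof -
  have "((\<lambda>s. gw (x, s) $ i) has_real_derivative gwt (x, t) $ i) (at t)" for i
    using smooth_line_derivative[OF smooth_dd[OF w], of "(axis i 1, 0)" "(x, 0)" "(0, 1)" t]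
    by (simp add: gw_def gwt_def wt_def dd_commute[OF w, of "(0, 1)"])
  hence gi: "((\<lambda>s. gw (x, s) $ i) has_vector_derivative gwt (x, t) $ i) (at t within {0..T})" for i
    unfolding has_real_derivative_iff_has_vector_derivative by (rule has_vector_derivative_at_within)
  have "((\<lambda>s. \<Sum>i\<in>UNIV. gw (x, s) $ i *\<^sub>R (axis i 1 :: real^'n)) has_vector_derivative (\<Sum>i\<in>UNIV. gwt (x, t) $ i *\<^sub>R (axis i 1 :: real^'n))) (at t within {0..T})"
    by (intro has_vector_derivative_sum bounded_linear.has_vector_derivative[OF bounded_linear_scaleR_left gi])
  moreover have "(\<Sum>i\<in>UNIV. v $ i *\<^sub>R (axis i 1 :: real^'n)) = v" for v
    by (simp add: vec_eq_iff axis_def if_distrib[where f="\<lambda>x. _ * x"] cong: if_cong)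
  ultimately show ?thesis by simp
qed

lemma der_\<Phi>: assumes t: "t \<in> {0..T}"
  shows "((\<lambda>s. \<Phi> (x, s)) has_real_derivative \<Phi>' (x, t)) (at t within {0..T})"
proof -
  have dF: "((\<lambda>s. F (x, s)) has_vector_derivative A (x, 0) *v gwt (x, t)) (at t within {0..T})"
    unfolding F_def A0_def fst_conv
    using bounded_linear.has_vector_derivative[OF matrix_vector_mul_bounded_linear[of "A (x, 0)"] der_gw] .
  have dq: "((\<lambda>s. q (x, s)) has_real_derivative 2 * (F (x, t) \<bullet> gwt (x, t))) (at t within {0..T})"
  proof -
    have "((\<lambda>s. q (x, s)) has_vector_derivative gw (x, t) \<bullet> (A (x, 0) *v gwt (x, t)) + gwt (x, t) \<bullet> F (x, t)) (at t within {0..T})"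
      unfolding q_def by (rule bounded_bilinear.has_vector_derivative[OF bounded_bilinear_inner der_gw dF])
    moreover have "gw (x, t) \<bullet> (A (x, 0) *v gwt (x, t)) = F (x, t) \<bullet> gwt (x, t)"
      using A0_inner[of "(x, t)" "gw (x, t)" "gwt (x, t)"] by (simp add: F_def A0_def)
    ultimately show ?thesis by (simp add: has_real_derivative_iff_has_vector_derivative inner_commute)
  qed
  have y: "y (x, s) = A (x, 0) *v x" for s by (simp add: y_def A0_def)
  have db: "((\<lambda>s. b (x, s)) has_real_derivative - 2 * b (x, t) * it t) (at t within {0..T})"
    unfolding b_def fst_conv snd_conv y
    by (rule DERIV_cong[OF DERIV_cdivide[OF DERIV_cmult[OF DERIV_power[OF der_it[OF t]]]]])
       (simp add: power2_eq_square field_simps)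
  have dU: "((\<lambda>s. U (x, s)) has_real_derivative 2 * b (x, t) * it t) (at t within {0..T})"
    unfolding U_def fst_conv by (rule DERIV_cong[OF DERIV_diff[OF DERIV_const db]]) simp
  have dw2: "((\<lambda>s. (w (x, s))\<^sup>2) has_real_derivative 2 * w (x, t) * wt (x, t)) (at t within {0..T})"
    by (rule DERIV_cong[OF DERIV_power[OF der_w]]) simp
  have dN: "((\<lambda>s. Nn (x, s)) has_real_derivative - 2 * (F (x, t) \<bullet> gwt (x, t)) + (2 * b (x, t) * it t - ka t * (1 + th t) * it t) * (w (x, t))\<^sup>2
         + (U (x, t) + ka t) * 2 * w (x, t) * wt (x, t)) (at t within {0..T})"
    unfolding Nn_def snd_conv
    by (rule DERIV_cong[OF DERIV_add[OF DERIV_minus[OF dq] DERIV_mult[OF DERIV_add[OF dU der_ka[OF t]] dw2]]])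
       (simp add: algebra_simps)
  show ?thesis unfolding \<Phi>_def \<Phi>'_def snd_conv
    by (rule DERIV_cong[OF DERIV_mult[OF DERIV_mult[OF der_om[OF t] der_Gp[OF t]] dN]]) (simp add: algebra_simps)
qed

lemma cont_\<Phi>': "continuous_on (strip T) \<Phi>'"
proof -
  have Gt: "xlip T Gt"
  proof -
    have "xlip T (\<lambda>p. Gp p * (- real CARD('n) * it (snd p) * (1/2) + (fst p \<bullet> fst p) * (it (snd p))\<^sup>2 * (1/4)))"
      by (intro xlip_ops xlip_all)
    thus ?thesis by (simp add: Gt_def[abs_def] xx_def)
  qed
  show ?thesis unfolding \<Phi>'_def[abs_def] by (intro xlip_continuous xlip_ops xlip_all xlip_Nn Gt)
qed

lemma integral_\<Phi>': "integral\<^sup>L (\<mu> T) \<Phi>' = - (\<integral>x. indicator (cball 0 4) x * \<Phi> (x, 0) \<partial>lborel)"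
proof (rule integral_t_derivative[OF _ cont_\<Phi>'])
  show "((\<lambda>s. \<Phi> (x, s)) has_real_derivative \<Phi>' (x, t)) (at t within {0..T})" if "(x, t) \<in> strip T" for x t
    using that by (intro der_\<Phi>) (simp add: strip_def)
  show "\<Phi> (x, T) = 0" for x by (simp add: \<Phi>_def Nn_def q_def F_def gw_T w_T)
qed (use pos in simp)

end

section \<open>Pointwise bounds\<close>

lemma R_algebra:
  fixes x i P W q FF e1 e2 bF yV yb U k d al vb c w b :: real
  assumes c: "c \<ge> 1" and nn: "0 \<le> x" "x \<le> 4" "0 < i" "0 \<le> P" "0 \<le> vb" "0 \<le> al" "0 \<le> k" "k \<le> al * i"
    and d: "\<bar>d\<bar> \<le> 2 * c\<^sup>2 * x" and q: "0 \<le> q" "q \<le> c * P\<^sup>2" and FF: "\<bar>q - FF\<bar> \<le> c\<^sup>2 * x * P\<^sup>2"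
    and e: "\<bar>e1\<bar> \<le> c^3 * x * P\<^sup>2" "\<bar>e2\<bar> \<le> c^3 * x * P\<^sup>2" and bF: "\<bar>bF\<bar> \<le> c^3 * P * (x\<^sup>2 * i\<^sup>2)"
    and U: "\<bar>U\<bar> \<le> vb + c * (x^3 * i\<^sup>2)" and b: "\<bar>b\<bar> \<le> c * (x^3 * i\<^sup>2) / 8"
    and yV: "\<bar>yV\<bar> \<le> c\<^sup>2 * x * vb" and yb: "\<bar>yb\<bar> \<le> c^3 * (x^3 * i\<^sup>2)"
  shows "\<bar>d * i / 2 * q + (q - FF) * i - e1 * i + e2 * i / 2 - 2 * w * bF - w\<^sup>2 * (U + k) * (d * i / 2) - w\<^sup>2 * (2 * b * i + (yV - yb) * i / 2)\<bar>
     \<le> 10 * c^3 * i * (x * P\<^sup>2 + (x^3 * i\<^sup>2 + al * x * i + vb) * w\<^sup>2)"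
proof -
  define B where "B = x^3 * i\<^sup>2"
  have B: "B \<ge> 0" using nn by (simp add: B_def)
  have cc: "c \<le> c^3" "c\<^sup>2 \<le> c^3" "1 \<le> c^3"
    using c power_increasing[of 1 3 c] power_increasing[of 2 3 c] power_increasing[of 0 3 c] by auto
  have c2: "c\<^sup>2 \<ge> 0" by simp
  have xP: "x * P\<^sup>2 \<ge> 0" using nn by simp
  have t1: "\<bar>d * i / 2 * q\<bar> \<le> c^3 * i * (x * P\<^sup>2)"
  proof -
    have "\<bar>d\<bar> * q \<le> (2 * c\<^sup>2 * x) * (c * P\<^sup>2)" using d q nn by (intro mult_mono) auto
    hence "(i / 2) * (\<bar>d\<bar> * q) \<le> (i / 2) * ((2 * c\<^sup>2 * x) * (c * P\<^sup>2))" using nn by (intro mult_left_mono) auto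
    thus ?thesis using q nn by (simp add: abs_mult power3_eq_cube power2_eq_square mult_ac)
  qed
  have t2: "\<bar>(q - FF) * i\<bar> \<le> c^3 * i * (x * P\<^sup>2)"
  proof -
    have "\<bar>q - FF\<bar> \<le> c^3 * (x * P\<^sup>2)" using FF mult_right_mono[OF cc(2) xP] by (simp add: mult_ac)
    hence "\<bar>q - FF\<bar> * i \<le> c^3 * (x * P\<^sup>2) * i" using nn by (intro mult_right_mono) auto
    thus ?thesis using nn by (simp add: abs_mult mult_ac)
  qed
  have t3: "\<bar>e1 * i\<bar> \<le> c^3 * i * (x * P\<^sup>2)" "\<bar>e2 * i / 2\<bar> \<le> c^3 * i * (x * P\<^sup>2)"
  proof -
    have "\<bar>e1\<bar> * i \<le> c^3 * x * P\<^sup>2 * i" "\<bar>e2\<bar> * i \<le> c^3 * x * P\<^sup>2 * i" using e nn by (intro mult_right_mono; simp)+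
    moreover have "c^3 * x * P\<^sup>2 * i \<ge> 0" using c nn by simp
    ultimately show "\<bar>e1 * i\<bar> \<le> c^3 * i * (x * P\<^sup>2)" "\<bar>e2 * i / 2\<bar> \<le> c^3 * i * (x * P\<^sup>2)"
      using nn by (simp_all add: abs_mult mult_ac)
  qed
  have t4: "\<bar>2 * w * bF\<bar> \<le> c^3 * i * (x * P\<^sup>2) + c^3 * i * (B * w\<^sup>2)"
  proof -
    have "\<bar>2 * w * bF\<bar> \<le> 2 * \<bar>w\<bar> * (c^3 * P * (x\<^sup>2 * i\<^sup>2))" unfolding abs_mult using bF by (simp add: mult_left_mono)
    also have "\<dots> = c^3 * i * x * (2 * P * (x * i * \<bar>w\<bar>))" by (simp add: power2_eq_square mult_ac)
    also have "\<dots> \<le> c^3 * i * x * (P\<^sup>2 + (x * i * \<bar>w\<bar>)\<^sup>2)"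
      using sum_squares_bound[of P "x * i * \<bar>w\<bar>"] c nn by (intro mult_left_mono) (auto simp: mult_ac)
    also have "\<dots> = c^3 * i * (x * P\<^sup>2) + c^3 * i * (B * w\<^sup>2)"
      by (simp add: B_def power2_eq_square power3_eq_cube algebra_simps)
    finally show ?thesis .
  qed
  have t5: "\<bar>w\<^sup>2 * (U + k) * (d * i / 2)\<bar> \<le> c^3 * i * ((4 * vb + 4 * B + al * x * i) * w\<^sup>2)"
  proof -
    have Uk: "\<bar>U + k\<bar> \<le> vb + c * B + al * i" using U nn by (simp add: B_def)
    have "\<bar>d\<bar> * \<bar>U + k\<bar> \<le> (2 * c\<^sup>2 * x) * (vb + c * B + al * i)"
      using d Uk nn by (intro mult_mono) auto
    also have "\<dots> = 2 * (c\<^sup>2 * (vb * x) + c^3 * (B * x) + c\<^sup>2 * (al * x * i))" by (simp add: power2_eq_square power3_eq_cube algebra_simps)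
    also have "\<dots> \<le> 2 * (c^3 * (vb * 4) + c^3 * (B * 4) + c^3 * (al * x * i))"
      using nn B cc c by (intro mult_left_mono[of _ _ 2] add_mono mult_mono) auto
    finally have "\<bar>d\<bar> * \<bar>U + k\<bar> \<le> 2 * c^3 * (4 * vb + 4 * B + al * x * i)" by (simp add: algebra_simps)
    hence "(w\<^sup>2 * i / 2) * (\<bar>d\<bar> * \<bar>U + k\<bar>) \<le> (w\<^sup>2 * i / 2) * (2 * c^3 * (4 * vb + 4 * B + al * x * i))"
      using nn by (intro mult_left_mono) auto
    thus ?thesis using nn by (simp add: abs_mult mult_ac)
  qed
  have t6: "\<bar>w\<^sup>2 * (2 * b * i + (yV - yb) * i / 2)\<bar> \<le> c^3 * i * ((2 * B + 2 * vb) * w\<^sup>2)"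
  proof -
    have "\<bar>b\<bar> \<le> c^3 * B / 8" using b mult_right_mono[OF cc(1) B] by (simp add: B_def)
    moreover have "\<bar>yV\<bar> \<le> 4 * (c^3 * vb)"
    proof -
      have "c\<^sup>2 * x * vb \<le> c^3 * 4 * vb" using cc nn c by (intro mult_mono) auto
      thus ?thesis using yV by simp
    qed
    moreover have "\<bar>yb\<bar> \<le> c^3 * B" using yb by (simp add: B_def)
    moreover have "\<bar>2 * s + (u - v) / 2\<bar> \<le> 2 * mm + 2 * n" if "\<bar>s\<bar> \<le> mm / 8" "\<bar>u\<bar> \<le> 4 * n" "\<bar>v\<bar> \<le> mm" for s u v mm n :: real
    proof -
      have "s \<le> mm / 8" "- s \<le> mm / 8" "u \<le> 4 * n" "- u \<le> 4 * n" "v \<le> mm" "- v \<le> mm"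
        using that by (simp_all add: abs_le_iff)
      thus ?thesis unfolding abs_le_iff diff_divide_distrib by (intro conjI) linarith+
    qed
    ultimately have "\<bar>2 * b + (yV - yb) / 2\<bar> \<le> 2 * (c^3 * B) + 2 * (c^3 * vb)" by blast
    also have "\<dots> = c^3 * (2 * B + 2 * vb)" by (simp add: algebra_simps)
    finally have "\<bar>2 * b + (yV - yb) / 2\<bar> \<le> c^3 * (2 * B + 2 * vb)" .
    hence "(w\<^sup>2 * i) * \<bar>2 * b + (yV - yb) / 2\<bar> \<le> (w\<^sup>2 * i) * (c^3 * (2 * B + 2 * vb))"
      using nn by (intro mult_left_mono) auto
    moreover have "\<bar>w\<^sup>2 * (2 * b * i + (yV - yb) * i / 2)\<bar> = (w\<^sup>2 * i) * \<bar>2 * b + (yV - yb) / 2\<bar>"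
    proof -
      have "w\<^sup>2 * (2 * b * i + (yV - yb) * i / 2) = (w\<^sup>2 * i) * (2 * b + (yV - yb) / 2)" by (simp add: algebra_simps)
      thus ?thesis using nn by (simp only: abs_mult) simp
    qed
    ultimately show ?thesis by (simp add: mult_ac)
  qed
  have tri: "\<bar>a1 + a2 - a3 + a4 - a5 - a6 - a7\<bar> \<le> \<bar>a1\<bar> + \<bar>a2\<bar> + \<bar>a3\<bar> + \<bar>a4\<bar> + \<bar>a5\<bar> + \<bar>a6\<bar> + \<bar>a7\<bar>" for a1 a2 a3 a4 a5 a6 a7 :: real
    by linarith
  define ci where "ci = c^3 * i"
  have ci: "ci \<ge> 0" using c nn by (simp add: ci_def)
  have "\<bar>d * i / 2 * q + (q - FF) * i - e1 * i + e2 * i / 2 - 2 * w * bF - w\<^sup>2 * (U + k) * (d * i / 2) - w\<^sup>2 * (2 * b * i + (yV - yb) * i / 2)\<bar>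
     \<le> ci * (5 * (x * P\<^sup>2) + (7 * B + 6 * vb + al * x * i) * w\<^sup>2)"
    using tri[of "d * i / 2 * q" "(q - FF) * i" "e1 * i" "e2 * i / 2" "2 * w * bF" "w\<^sup>2 * (U + k) * (d * i / 2)" "w\<^sup>2 * (2 * b * i + (yV - yb) * i / 2)"]
      t1 t2 t3 t4 t5 t6 unfolding ci_def[symmetric] by (simp add: algebra_simps)
  also have "\<dots> \<le> ci * (10 * (x * P\<^sup>2) + (10 * B + 10 * vb + 10 * (al * x * i)) * w\<^sup>2)"
    using ci xP B nn by (intro mult_left_mono add_mono mult_right_mono) auto
  also have "\<dots> = 10 * c^3 * i * (x * P\<^sup>2 + (x^3 * i\<^sup>2 + al * x * i + vb) * w\<^sup>2)"
    by (simp add: ci_def B_def algebra_simps)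
  finally show ?thesis .
qed

context carleman_setting
begin

definition nx :: "(real^'n) \<times> real \<Rightarrow> real" where "nx p = norm (fst p)"
definition "P p = norm (gw p)"

lemma nx_nonneg [simp]: "nx p \<ge> 0" and P_nonneg [simp]: "P p \<ge> 0" by (simp_all add: nx_def P_def)

lemma nx_le: "p \<in> strip T \<Longrightarrow> nx p \<le> 4" using strip_T(2) by (simp add: nx_def)

lemma C_le_power: "k \<le> l \<Longrightarrow> C ^ k \<le> C ^ l" by (rule power_increasing[OF _ C(1)])

lemma A0_mat1: "norm (A0 p - mat 1) \<le> C * nx p"
proof -
  have "norm (A0 p - mat 1) \<le> K * nx p" using A_lip[of "fst p" 0 0 0] A_0 by (simp add: A0_def nx_def)
  also have "\<dots> \<le> C * nx p" using C by (intro mult_right_mono) auto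
  finally show ?thesis .
qed

lemma A_mat1: "p \<in> strip T \<Longrightarrow> norm (A p - mat 1) \<le> C * (nx p + sqrt (ta (snd p)))"
proof -
  assume p: "p \<in> strip T"
  have "norm (A p - mat 1) \<le> K * (nx p + sqrt \<bar>snd p\<bar>)" using A_lip[of "fst p" "snd p" 0 0] A_0 by (simp add: nx_def)
  also have "\<dots> \<le> C * (nx p + sqrt (ta (snd p)))"
    using C strip_T(1)[OF p] pos by (intro mult_mono add_mono real_sqrt_le_mono) (auto simp: ta_def)
  finally show ?thesis .
qed

lemma A_A0: "p \<in> strip T \<Longrightarrow> norm (A0 p - A p) \<le> C * sqrt (snd p)"
proof -
  assume p: "p \<in> strip T"
  have "norm (A0 p - A p) \<le> K * sqrt (snd p)"
    using A_lip[of "fst p" 0 "fst p" "snd p"] strip_T(1)[OF p] by (simp add: A0_def)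
  also have "\<dots> \<le> C * sqrt (snd p)" using C strip_T(1)[OF p] by (intro mult_right_mono) auto
  finally show ?thesis .
qed

lemma mv_le: "norm M \<le> a' \<Longrightarrow> norm v \<le> b' \<Longrightarrow> norm (M *v v) \<le> a' * b'" for M :: "real^'n^'n"
  using norm_mv_le[of M v] mult_mono[of "norm M" a' "norm v" b'] norm_ge_zero[of M] norm_ge_zero[of v]
  by linarith

lemma F_le: "norm (F p) \<le> C * P p" unfolding F_def A0_def P_def by (rule mv_le[OF A_bd order_refl])
lemma y_le: "norm (y p) \<le> C * nx p" unfolding y_def A0_def nx_def by (rule mv_le[OF A_bd order_refl])

lemma sum_abs_le:
  assumes "\<And>k. \<bar>f k\<bar> \<le> B" shows "\<bar>\<Sum>k\<in>(UNIV::'n set). f k\<bar> \<le> C * B"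
proof -
  have "\<bar>\<Sum>k\<in>(UNIV::'n set). f k\<bar> \<le> (\<Sum>k\<in>(UNIV::'n set). B)" by (rule order_trans[OF sum_abs sum_mono]) (rule assms)
  also have "\<dots> = real CARD('n) * B" by simp
  also have "\<dots> \<le> C * B" using C assms[of undefined] by (intro mult_right_mono) (auto intro: order_trans[OF abs_ge_zero])
  finally show ?thesis .
qed

lemma trace_mat1: "(\<Sum>k\<in>UNIV. ((M - mat 1) *v axis k 1) $ k) = (\<Sum>k\<in>UNIV. (M *v axis k 1) $ k) - real CARD('n)" for M :: "real^'n^'n"
  by (simp add: matrix_vector_mult_diff_rdistrib sum_subtractf axis_def)

lemma div_y_general:
  fixes M :: "real^'n^'n" and D :: "'n \<Rightarrow> real^'n^'n"
  assumes M: "norm (M - mat 1) \<le> C * e" and D: "\<And>k. norm (D k) \<le> C" and e: "e \<ge> 0"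
  shows "\<bar>(\<Sum>k\<in>UNIV. (M *v axis k 1 + D k *v x) $ k) - real CARD('n)\<bar> \<le> C\<^sup>2 * (e + norm x)"
proof -
  have eq: "(\<Sum>k\<in>UNIV. (M *v axis k 1 + D k *v x) $ k) - real CARD('n) = (\<Sum>k\<in>UNIV. ((M - mat 1) *v axis k 1 + D k *v x) $ k)"
    using trace_mat1[of M] by (simp add: sum.distrib)
  have "\<bar>\<Sum>k\<in>(UNIV::'n set). ((M - mat 1) *v axis k 1 + D k *v x) $ k\<bar> \<le> C * (C * e + C * norm x)"
  proof (rule sum_abs_le)
    fix k
    have "\<bar>((M - mat 1) *v axis k 1 + D k *v x) $ k\<bar> \<le> norm ((M - mat 1) *v axis k 1 + D k *v x)" by (rule component_le_norm_cart)
    also have "\<dots> \<le> norm ((M - mat 1) *v axis k 1) + norm (D k *v x)" by (rule norm_triangle_ineq)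
    also have "\<dots> \<le> (C * e) * 1 + C * norm x" by (intro add_mono mv_le M D) simp_all
    finally show "\<bar>((M - mat 1) *v axis k 1 + D k *v x) $ k\<bar> \<le> C * e + C * norm x" by simp
  qed
  thus ?thesis unfolding eq by (simp add: power2_eq_square algebra_simps)
qed

lemma dvy_le: "\<bar>dvy p - real CARD('n)\<bar> \<le> 2 * C\<^sup>2 * nx p"
  using div_y_general[of "A0 p" "nx p" "\<lambda>k. dA0 k p" "fst p", OF A0_mat1 dA0(2) nx_nonneg] by (simp add: dvy_def dy_def nx_def)

lemma q_ge: "(P p)\<^sup>2 \<le> C * q p" unfolding P_def q_def F_def A0_def by (rule A_ell)
lemma q_le: "q p \<le> C * (P p)\<^sup>2"
proof -
  have "\<bar>q p\<bar> \<le> P p * (C * P p)" unfolding q_def by (rule abs_inner_mono[OF _ F_le]) (simp add: P_def)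
  hence "q p \<le> P p * (C * P p)" by linarith
  thus ?thesis by (simp add: power2_eq_square mult_ac)
qed
lemma q_nonneg: "q p \<ge> 0"
proof -
  have "0 \<le> C * q p" using q_ge[of p] zero_le_power2[of "P p"] by linarith
  thus ?thesis using C(1) by (simp add: zero_le_mult_iff)
qed

lemma x_y_le: "norm (fst p - y p) \<le> C * nx p * nx p"
proof -
  have "fst p - y p = - ((A0 p - mat 1) *v fst p)" by (simp add: y_def matrix_vector_mult_diff_rdistrib)
  thus ?thesis using mv_le[OF A0_mat1, of "fst p" "nx p" p] by (simp add: nx_def)
qed

lemma b_le: assumes "p \<in> strip T" shows "\<bar>b p\<bar> \<le> C * (nx p ^ 3 * (it (snd p))\<^sup>2) / 8"
proof -
  have "\<bar>fst p \<bullet> fst p - fst p \<bullet> y p\<bar> \<le> nx p * (C * nx p * nx p)"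
    unfolding inner_diff_right[symmetric] by (rule abs_inner_mono) (simp_all add: nx_def x_y_le[unfolded nx_def])
  hence "\<bar>fst p \<bullet> fst p - fst p \<bullet> y p\<bar> * (it (snd p))\<^sup>2 / 8 \<le> nx p * (C * nx p * nx p) * (it (snd p))\<^sup>2 / 8"
    by (intro divide_right_mono mult_right_mono) auto
  thus ?thesis by (simp add: b_def abs_mult power3_eq_cube mult_ac)
qed

lemma U_le: assumes "p \<in> strip T" shows "\<bar>U p\<bar> \<le> vb + C * (nx p ^ 3 * (it (snd p))\<^sup>2)"
proof -
  have "\<bar>b p\<bar> \<le> C * (nx p ^ 3 * (it (snd p))\<^sup>2)" using b_le[OF assms] C(1) by simp
  thus ?thesis using V0_bd[of "fst p"] by (simp add: U_def)
qed

lemma e1_le: "\<bar>e1 p\<bar> \<le> C^3 * nx p * (P p)\<^sup>2"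
proof -
  have "\<bar>e1 p\<bar> \<le> C * ((C * P p) * (C * P p * nx p))" unfolding e1_def
  proof (rule sum_abs_le)
    fix k
    have "\<bar>F p $ k\<bar> \<le> C * P p" using component_le_norm_cart[of "F p" k] F_le[of p] by linarith
    moreover have "\<bar>(dA0 k p *v gw p) \<bullet> fst p\<bar> \<le> C * P p * nx p"
      by (intro abs_inner_mono mv_le dA0(2)) (simp_all add: P_def nx_def)
    ultimately show "\<bar>F p $ k * ((dA0 k p *v gw p) \<bullet> fst p)\<bar> \<le> (C * P p) * (C * P p * nx p)"
      unfolding abs_mult by (intro mult_mono) auto
  qed
  thus ?thesis by (simp add: power2_eq_square power3_eq_cube mult_ac)
qed

lemma e2_le: "\<bar>e2 p\<bar> \<le> C^3 * nx p * (P p)\<^sup>2"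
proof -
  have "\<bar>e2 p\<bar> \<le> C * ((C * nx p) * (P p * (C * P p)))" unfolding e2_def
  proof (rule sum_abs_le)
    fix k
    have "\<bar>y p $ k\<bar> \<le> C * nx p" using component_le_norm_cart[of "y p" k] y_le[of p] by linarith
    moreover have "\<bar>gw p \<bullet> (dA0 k p *v gw p)\<bar> \<le> P p * (C * P p)"
      by (intro abs_inner_mono mv_le dA0(2)) (simp_all add: P_def)
    ultimately show "\<bar>y p $ k * (gw p \<bullet> (dA0 k p *v gw p))\<bar> \<le> (C * nx p) * (P p * (C * P p))"
      unfolding abs_mult using C(1) by (intro mult_mono) auto
  qed
  thus ?thesis by (simp add: power2_eq_square power3_eq_cube mult_ac)
qed

lemma db_le: assumes "p \<in> strip T" shows "\<bar>db k p\<bar> \<le> C * ((nx p)\<^sup>2 * (it (snd p))\<^sup>2)"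
proof -
  have "fst p \<bullet> dy k p = y p $ k + fst p \<bullet> (dA0 k p *v fst p)"
    by (simp add: dy_def inner_add_right A0_inner[symmetric] y_def[symmetric] inner_axis)
  hence "2 * fst p $ k - (fst p \<bullet> dy k p + y p $ k) = 2 * (fst p - y p) $ k - fst p \<bullet> (dA0 k p *v fst p)" by simp
  moreover have "\<bar>(fst p - y p) $ k\<bar> \<le> C * nx p * nx p"
    using component_le_norm_cart[of "fst p - y p" k] x_y_le[of p] by linarith
  moreover have "\<bar>fst p \<bullet> (dA0 k p *v fst p)\<bar> \<le> nx p * (C * nx p)"
    by (intro abs_inner_mono mv_le dA0(2)) (simp_all add: nx_def)
  ultimately have "\<bar>2 * fst p $ k - (fst p \<bullet> dy k p + y p $ k)\<bar> \<le> 3 * (C * nx p * nx p)" by (simp add: mult_ac)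
  also have "\<dots> \<le> 8 * (C * nx p * nx p)" using C(1) by simp
  finally have "\<bar>2 * fst p $ k - (fst p \<bullet> dy k p + y p $ k)\<bar> * (it (snd p))\<^sup>2 / 8 \<le> 8 * (C * nx p * nx p) * (it (snd p))\<^sup>2 / 8"
    by (intro divide_right_mono mult_right_mono) auto
  thus ?thesis by (simp add: db_def abs_mult power2_eq_square mult_ac)
qed

lemma bF_le: assumes "p \<in> strip T" shows "\<bar>bF p\<bar> \<le> C^3 * P p * ((nx p)\<^sup>2 * (it (snd p))\<^sup>2)"
proof -
  have "\<bar>bF p\<bar> \<le> C * ((C * P p) * (C * ((nx p)\<^sup>2 * (it (snd p))\<^sup>2)))" unfolding bF_def
  proof (rule sum_abs_le)
    fix k
    have "\<bar>F p $ k\<bar> \<le> C * P p" using component_le_norm_cart[of "F p" k] F_le[of p] by linarith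
    thus "\<bar>F p $ k * db k p\<bar> \<le> (C * P p) * (C * ((nx p)\<^sup>2 * (it (snd p))\<^sup>2))"
      unfolding abs_mult using C(1) by (intro mult_mono db_le assms) auto
  qed
  thus ?thesis by (simp add: power3_eq_cube mult_ac)
qed

lemma yb_le: assumes "p \<in> strip T" shows "\<bar>yb p\<bar> \<le> C^3 * (nx p ^ 3 * (it (snd p))\<^sup>2)"
proof -
  have "\<bar>yb p\<bar> \<le> C * ((C * nx p) * (C * ((nx p)\<^sup>2 * (it (snd p))\<^sup>2)))" unfolding yb_def
  proof (rule sum_abs_le)
    fix k
    have "\<bar>y p $ k\<bar> \<le> C * nx p" using component_le_norm_cart[of "y p" k] y_le[of p] by linarith
    thus "\<bar>y p $ k * db k p\<bar> \<le> (C * nx p) * (C * ((nx p)\<^sup>2 * (it (snd p))\<^sup>2))"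
      unfolding abs_mult using C(1) by (intro mult_mono db_le assms) auto
  qed
  thus ?thesis by (simp add: power3_eq_cube power2_eq_square mult_ac)
qed

lemma yV_le: "\<bar>yV p\<bar> \<le> C\<^sup>2 * nx p * vb"
proof -
  have "\<bar>yV p\<bar> \<le> C * ((C * nx p) * vb)" unfolding yV_def
  proof (rule sum_abs_le)
    fix k
    have "\<bar>y p $ k\<bar> \<le> C * nx p" using component_le_norm_cart[of "y p" k] y_le[of p] by linarith
    thus "\<bar>y p $ k * dV k p\<bar> \<le> (C * nx p) * vb"
      unfolding abs_mult using C(1) dV(2) by (intro mult_mono) auto
  qed
  thus ?thesis by (simp add: power2_eq_square mult_ac)
qed

text \<open>The weight of all zero-order errors.\<close>

definition "Kx p = nx p ^ 3 * (it (snd p))\<^sup>2 + \<alpha> * nx p * it (snd p)"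

text \<open>Since \<open>A(0,0) = 1\<close>, each of \<open>A0 - 1\<close>, \<open>div y - n\<close> and \<open>b\<close> gains a factor \<open>|x|\<close>, so the remainder is bounded by the
gradient with weight \<open>|x|/\<tau>\<close> and by \<open>w\<^sup>2\<close> with weight \<open>Kx/\<tau>\<close> up to the norm of the potential.\<close>

lemma R_le: assumes p: "p \<in> strip T"
  shows "\<bar>R p\<bar> \<le> 10 * C^3 * it (snd p) * (nx p * (P p)\<^sup>2 + (Kx p + vb) * (w p)\<^sup>2)"
proof -
  note t = strip_T(1)[OF p]
  have FF: "\<bar>q p - F p \<bullet> F p\<bar> \<le> C\<^sup>2 * nx p * (P p)\<^sup>2"
  proof -
    have "gw p - F p = - ((A0 p - mat 1) *v gw p)" by (simp add: F_def matrix_vector_mult_diff_rdistrib)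
    hence "norm (gw p - F p) \<le> (C * nx p) * P p" using mv_le[OF A0_mat1, of "gw p" "P p" p] by (simp add: P_def)
    from abs_inner_mono[OF this F_le[of p]] show ?thesis
      by (simp add: q_def inner_diff_left power2_eq_square mult_ac)
  qed
  show ?thesis unfolding R_def Kx_def
    using R_algebra[OF C(1) nx_nonneg nx_le[OF p] it_pos[OF t] P_nonneg vb(1) _ less_imp_le[OF ka_pos[OF t]] ka_le[OF t]
      dvy_le[of p] q_nonneg[of p] q_le[of p] FF e1_le e2_le bF_le[OF p] U_le[OF p] b_le[OF p] yV_le yb_le[OF p], where w="w p"] pos(3)
    by simp
qed

end

section \<open>The basic inequality\<close>

context carleman_setting
begin

abbreviation II :: "((real^'n) \<times> real \<Rightarrow> real) \<Rightarrow> real" where "II f1 \<equiv> integral\<^sup>L (\<mu> T) f1"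

lemma II_add: "tame T f1 \<Longrightarrow> tame T H \<Longrightarrow> II (\<lambda>p. f1 p + H p) = II f1 + II H"
  by (intro Bochner_Integration.integral_add tame_integrable)
lemma II_cmult: "II (\<lambda>p. c * f1 p) = c * II f1" by simp
lemma tame_cmult: "tame T f1 \<Longrightarrow> tame T (\<lambda>p. c * f1 p :: real)" by (rule tame_mult[OF tame_const])

definition "E p = wgt (snd p) * Gp p"
definition "dFA k p = A p *v hw k p + dA k p *v gw p"
definition "mA p = (\<Sum>k\<in>UNIV. dFA k p $ k)"
definition "f p = mA p + wt p + V p * w p"
definition "ft p = m p + wt p + V0 (fst p) * w p"

text \<open>The densities of the closing argument. The good terms are \<open>X1d\<close>, \<open>X0d\<close> and \<open>Zd\<close>; \<open>Y1d\<close>, \<open>Y0d\<close>, \<open>S0d\<close>, \<open>X2d\<close> and \<open>Wd\<close> are errors;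
\<open>Fd\<close> and \<open>Ftd\<close> contain the true and the frozen operator.\<close>

definition "X1d p = E p * (th (snd p) * (P p)\<^sup>2)"
definition "X0d p = E p * (th (snd p) * \<alpha> * it (snd p) * (w p)\<^sup>2)"
definition "Y1d p = E p * (nx p * (P p)\<^sup>2)"
definition "Y0d p = E p * (Kx p * (w p)\<^sup>2)"
definition "Wd p = E p * (w p)\<^sup>2"
definition "S0d p = E p * (\<alpha> * it (snd p) * sqrt (ta (snd p)) * (w p)\<^sup>2)"
definition "X2d p = E p * (ta (snd p) * (P p)\<^sup>2)"
definition "Zd p = om (snd p) * Gp p * (St p)\<^sup>2"
definition "Fd p = om (snd p) * Gp p * (f p)\<^sup>2"
definition "Ftd p = om (snd p) * Gp p * (ft p)\<^sup>2"

lemma tame_nx: "tame T nx" unfolding nx_def[abs_def] by (intro tame_ops tame_all)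
lemma tame_P: "tame T P" unfolding P_def[abs_def] by (intro tame_ops tame_all)
lemma tame_E: "tame T E" unfolding E_def[abs_def] by (intro tame_ops tame_all)
lemma tame_Kx: "tame T Kx" unfolding Kx_def[abs_def] by (intro tame_ops tame_all tame_nx)
lemma tame_dFA: "tame T (dFA k)" unfolding dFA_def[abs_def] by (intro tame_ops tame_all)
lemma tame_mA: "tame T mA" unfolding mA_def[abs_def] by (intro tame_ops tame_dFA)
lemma tame_f: "tame T f" unfolding f_def[abs_def] by (intro tame_ops tame_all tame_mA)
lemma tame_ft: "tame T ft" unfolding ft_def[abs_def] by (intro tame_ops tame_all)
lemma tame_sqrt_ta: "tame T (\<lambda>p. sqrt (ta (snd p)))"
  by (intro xlip_tame xlip_time[of T "\<lambda>t. sqrt (ta t)"] continuous_intros cont_time)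

lemma tame_dens: "tame T X1d" "tame T X0d" "tame T Y1d" "tame T Y0d" "tame T Wd" "tame T S0d" "tame T X2d" "tame T Zd" "tame T Fd" "tame T Ftd"
  unfolding X1d_def[abs_def] X0d_def[abs_def] Y1d_def[abs_def] Y0d_def[abs_def] Wd_def[abs_def] S0d_def[abs_def]
    X2d_def[abs_def] Zd_def[abs_def] Fd_def[abs_def] Ftd_def[abs_def]
  by (intro tame_ops tame_all tame_nx tame_P tame_E tame_Kx tame_f tame_ft tame_sqrt_ta)+

lemma E_nonneg: "p \<in> strip T \<Longrightarrow> E p \<ge> 0"
  using wgt_pos[OF strip_T(1), of p] Gp_pos[of p] by (simp add: E_def)

lemma Kx_nonneg: "p \<in> strip T \<Longrightarrow> Kx p \<ge> 0"
  using it_pos[OF strip_T(1), of p] pos by (simp add: Kx_def)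

lemma dens_nonneg: assumes p: "p \<in> strip T"
  shows "X1d p \<ge> 0" "X0d p \<ge> 0" "Y1d p \<ge> 0" "Y0d p \<ge> 0" "Wd p \<ge> 0" "S0d p \<ge> 0" "X2d p \<ge> 0" "Zd p \<ge> 0" "Fd p \<ge> 0" "Ftd p \<ge> 0"
proof -
  note t = strip_T(1)[OF p]
  have tt: "snd p \<ge> 0" using t by simp
  have "0 \<le> th (snd p)" "0 \<le> it (snd p)" "0 \<le> ta (snd p)" "0 \<le> om (snd p)" "0 \<le> \<alpha>"
    using th_bounds(1)[OF t] it_pos[OF t] ta_pos[OF tt] om_pos[OF t] pos by auto
  thus "X1d p \<ge> 0" "X0d p \<ge> 0" "Y1d p \<ge> 0" "Y0d p \<ge> 0" "Wd p \<ge> 0" "S0d p \<ge> 0" "X2d p \<ge> 0" "Zd p \<ge> 0" "Fd p \<ge> 0" "Ftd p \<ge> 0"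
    using E_nonneg[OF p] Kx_nonneg[OF p] Gp_pos[of p]
    by (simp_all add: X1d_def X0d_def Y1d_def Y0d_def Wd_def S0d_def X2d_def Zd_def Fd_def Ftd_def)
qed

lemma II_nonneg: assumes "\<And>p. p \<in> strip T \<Longrightarrow> H p \<ge> 0" shows "II H \<ge> 0"
  by (rule integral_nonneg_AE) (use AE_space[of "\<mu> T"] assms in \<open>auto elim!: eventually_mono\<close>)

lemma om_it: assumes "t \<in> {0..T}" shows "wgt t \<le> om t * it t" "om t * it t \<le> exp 60 * wgt t"
proof -
  have w0: "wgt t \<ge> 0" using wgt_pos[OF assms] by simp
  have i: "it t \<ge> 0" using it_pos[OF assms] by simp
  have "ta t * it t \<le> gm t * it t" "gm t * it t \<le> exp 60 * ta t * it t"
    using gm[OF assms] i by (auto simp: ta_def intro!: mult_right_mono)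
  hence "1 \<le> gm t * it t" "gm t * it t \<le> exp 60" using ta_it[OF assms] by (simp_all add: mult.assoc)
  hence "1 * wgt t \<le> gm t * it t * wgt t" "gm t * it t * wgt t \<le> exp 60 * wgt t"
    using w0 by (intro mult_right_mono; simp)+
  thus "wgt t \<le> om t * it t" "om t * it t \<le> exp 60 * wgt t" by (simp_all add: om_def mult_ac)
qed

lemma om_le: assumes "t \<in> {0..T}" shows "om t \<le> exp 60 * (ta t * wgt t)" "ta t * wgt t \<le> om t"
  using gm[OF assms] wgt_pos[OF assms] by (auto simp: om_def ta_def mult.assoc[symmetric] intro!: mult_right_mono)

lemma Bt_St: "Bt p + St p = ft p"
  by (simp add: Bt_def St_def Sw_def ft_def U_def algebra_simps)

definition "cc1 = 26 * C^3 * exp 60"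

lemma cc1_ge: "cc1 \<ge> 1" "C^3 \<ge> 1" "C^3 \<ge> C"
proof -
  show 1: "C^3 \<ge> 1" using C(1) by simp
  show "C^3 \<ge> C" using C_le_power[of 1 3] by simp
  have "1 * 1 \<le> C^3 * exp 60" using 1 C(1) by (intro mult_mono) auto
  thus "cc1 \<ge> 1" by (simp add: cc1_def)
qed

text \<open>Uses \<open>2 B S = 2 (ft - S) S \<le> ft\<^sup>2 - S\<^sup>2\<close> in the commutator identity.\<close>

lemma basic_pointwise: assumes p: "p \<in> strip T"
  shows "(\<Sum>k\<in>UNIV. d\<Psi> k p $ k) + \<Phi>' p + Zd p + (1 / C) * X1d p \<le> Ftd p + cc1 * (Y1d p + Y0d p + vb * Wd p)"
proof -
  note t = strip_T(1)[OF p]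
  define o1 where "o1 = om (snd p) * it (snd p)"
  have o1: "wgt (snd p) \<le> o1" "o1 \<le> exp 60 * wgt (snd p)" using om_it[OF t] by (simp_all add: o1_def)
  have G: "Gp p \<ge> 0" by (rule Gp_pos)
  have o0: "o1 \<ge> 0" "wgt (snd p) \<ge> 0" using o1 wgt_pos[OF t] by auto
  have oE: "o1 * Gp p \<le> exp 60 * E p" using mult_right_mono[OF o1(2) G] by (simp add: E_def mult_ac)
  have q: "om (snd p) * Gp p * (th (snd p) * it (snd p) * q p) \<ge> (1 / C) * X1d p"
  proof -
    have "(P p)\<^sup>2 / C \<le> q p" using q_ge[of p] C(1) by (simp add: field_simps)
    hence "(wgt (snd p) * Gp p * th (snd p)) * ((P p)\<^sup>2 / C) \<le> (o1 * Gp p * th (snd p)) * q p"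
      using o1 o0 G th_bounds(1)[OF t] C(1) by (intro mult_mono mult_nonneg_nonneg) auto
    thus ?thesis by (simp add: X1d_def E_def o1_def mult_ac)
  qed
  have u: "om (snd p) * Gp p * ((1 + th (snd p)) * it (snd p) * U p * (w p)\<^sup>2) \<le> 16 * C^3 * exp 60 * (Y0d p + vb * Wd p)"
  proof -
    have "U p \<le> \<bar>U p\<bar>" by simp
    also have "\<dots> \<le> vb + C * (nx p ^ 3 * (it (snd p))\<^sup>2)" by (rule U_le[OF p])
    also have "\<dots> \<le> vb + C * Kx p"
      using C(1) pos it_pos[OF t] by (intro add_left_mono mult_left_mono) (auto simp: Kx_def)
    also have "\<dots> \<le> C^3 * vb + C^3 * Kx p"
      using vb(1) cc1_ge Kx_nonneg[OF p] mult_right_mono[OF cc1_ge(2) vb(1)] by (intro add_mono mult_right_mono) auto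
    finally have UK: "U p \<le> C^3 * (Kx p + vb)" by (simp add: algebra_simps)
    have "(1 + th (snd p)) * U p \<le> 16 * (C^3 * (Kx p + vb))"
    proof (cases "U p \<ge> 0")
      case True
      thus ?thesis using UK th_bounds[OF t] by (intro mult_mono) auto
    next
      case False
      hence "(1 + th (snd p)) * U p \<le> 0" using th_bounds(1)[OF t] by (intro mult_nonneg_nonpos) auto
      also have "0 \<le> 16 * (C^3 * (Kx p + vb))" using C Kx_nonneg[OF p] vb by simp
      finally show ?thesis .
    qed
    hence "(o1 * Gp p * (w p)\<^sup>2) * ((1 + th (snd p)) * U p) \<le> (o1 * Gp p * (w p)\<^sup>2) * (16 * (C^3 * (Kx p + vb)))"
      using o0 G by (intro mult_left_mono) auto
    also have "\<dots> \<le> (exp 60 * E p * (w p)\<^sup>2) * (16 * (C^3 * (Kx p + vb)))"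
      using oE C Kx_nonneg[OF p] vb by (intro mult_right_mono) auto
    finally show ?thesis by (simp add: o1_def Y0d_def Wd_def algebra_simps)
  qed
  have R: "om (snd p) * Gp p * R p \<ge> - (10 * C^3 * exp 60 * (Y1d p + Y0d p + vb * Wd p))"
  proof -
    define M where "M = nx p * (P p)\<^sup>2 + (Kx p + vb) * (w p)\<^sup>2"
    have M: "M \<ge> 0" using Kx_nonneg[OF p] vb by (simp add: M_def)
    have "- R p \<le> 10 * C^3 * it (snd p) * M" using R_le[OF p] by (simp add: M_def)
    hence "(om (snd p) * Gp p) * (- R p) \<le> (om (snd p) * Gp p) * (10 * C^3 * it (snd p) * M)"
      using om_pos[OF t] G by (intro mult_left_mono) auto
    also have "\<dots> = (o1 * Gp p) * (10 * C^3 * M)" by (simp add: o1_def mult_ac)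
    also have "\<dots> \<le> (exp 60 * E p) * (10 * C^3 * M)" using oE M C by (intro mult_right_mono) auto
    also have "\<dots> = 10 * C^3 * exp 60 * (Y1d p + Y0d p + vb * Wd p)"
      by (simp add: M_def Y1d_def Y0d_def Wd_def algebra_simps)
    finally show ?thesis by simp
  qed
  have sq: "Ftd p \<ge> Zd p + 2 * om (snd p) * Gp p * Bt p * St p"
  proof -
    have "(ft p)\<^sup>2 = (Bt p)\<^sup>2 + 2 * Bt p * St p + (St p)\<^sup>2" unfolding Bt_St[symmetric] by (simp add: power2_eq_square algebra_simps)
    hence "2 * Bt p * St p + (St p)\<^sup>2 \<le> (ft p)\<^sup>2" by simp
    hence "(om (snd p) * Gp p) * (2 * Bt p * St p + (St p)\<^sup>2) \<le> (om (snd p) * Gp p) * (ft p)\<^sup>2"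
      using om_pos[OF t] G by (intro mult_left_mono) auto
    thus ?thesis by (simp add: Zd_def Ftd_def algebra_simps)
  qed
  have "16 * C^3 * exp 60 * (Y0d p + vb * Wd p) \<le> 16 * C^3 * exp 60 * (Y1d p + Y0d p + vb * Wd p)"
    using C(1) dens_nonneg[OF p] by (intro mult_left_mono) auto
  moreover have "cc1 * (Y1d p + Y0d p + vb * Wd p) = 16 * C^3 * exp 60 * (Y1d p + Y0d p + vb * Wd p) + 10 * C^3 * exp 60 * (Y1d p + Y0d p + vb * Wd p)"
    by (simp add: cc1_def algebra_simps)
  moreover have "om (snd p) * Gp p * (th (snd p) * it (snd p) * q p - (1 + th (snd p)) * it (snd p) * U p * (w p)\<^sup>2 + R p)
    = om (snd p) * Gp p * (th (snd p) * it (snd p) * q p) - om (snd p) * Gp p * ((1 + th (snd p)) * it (snd p) * U p * (w p)\<^sup>2) + om (snd p) * Gp p * R p"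
    by (simp add: algebra_simps)
  ultimately show ?thesis using q u R sq commutator_identity[of p] by linarith
qed

definition J :: "((real^'n) \<Rightarrow> real) \<Rightarrow> real" where "J g = (\<integral>x. indicator (cball 0 4) x * g x \<partial>lborel)"
definition "B1 = J (\<lambda>x. Gp (x, 0) * (P (x, 0))\<^sup>2)"
definition "B0 = J (\<lambda>x. Gp (x, 0) * (w (x, 0))\<^sup>2)"
definition "B3 = J (\<lambda>x. Gp (x, 0) * (norm x ^ 3 * it 0) * (w (x, 0))\<^sup>2)"

lemma slice_0: "xlip T H \<Longrightarrow> continuous_on (cball 0 4) (\<lambda>x. H (x, 0))"
  using pos by (intro continuous_on_compose2[OF xlip_continuous[of T H]]) (auto intro!: continuous_intros simp: strip_def)

lemma J_integrable: "continuous_on (cball 0 4) g \<Longrightarrow> integrable lborel (\<lambda>x. indicator (cball 0 4) x * g x)"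
  for g :: "real^'n \<Rightarrow> real"
  using borel_integrable_compact[of "cball 0 4" g] by (simp add: indicator_scaleR_eq_if)

lemma J_mono: "continuous_on (cball 0 4) g \<Longrightarrow> continuous_on (cball 0 4) h \<Longrightarrow> (\<And>x. norm x \<le> 4 \<Longrightarrow> g x \<le> h x) \<Longrightarrow> J g \<le> J h"
  unfolding J_def by (intro integral_mono J_integrable) (auto simp: indicator_def)

lemma J_add: "continuous_on (cball 0 4) g \<Longrightarrow> continuous_on (cball 0 4) h \<Longrightarrow> J (\<lambda>x. g x + h x) = J g + J h"
  unfolding J_def distrib_left by (intro Bochner_Integration.integral_add J_integrable)

lemma J_cmult: "J (\<lambda>x. c * g x) = c * J g"
  unfolding J_def by (simp add: mult.left_commute[of _ c])

lemma J_nonneg: "(\<And>x. norm x \<le> 4 \<Longrightarrow> g x \<ge> 0) \<Longrightarrow> J g \<ge> 0"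
  unfolding J_def by (intro integral_nonneg_AE) (auto simp: indicator_def)

lemma cont_slices: "continuous_on (cball 0 4) (\<lambda>x. Gp (x, 0) * (P (x, 0))\<^sup>2)" "continuous_on (cball 0 4) (\<lambda>x. Gp (x, 0) * (w (x, 0))\<^sup>2)"
  "continuous_on (cball 0 4) (\<lambda>x. Gp (x, 0) * (norm x ^ 3 * it 0) * (w (x, 0))\<^sup>2)" "continuous_on (cball 0 4) (\<lambda>x. \<Phi> (x, 0))"
proof -
  show "continuous_on (cball 0 4) (\<lambda>x. Gp (x, 0) * (P (x, 0))\<^sup>2)"
    unfolding P_def by (intro continuous_intros slice_0 xlip_all)
  show "continuous_on (cball 0 4) (\<lambda>x. Gp (x, 0) * (w (x, 0))\<^sup>2)" by (intro continuous_intros slice_0 xlip_all)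
  show "continuous_on (cball 0 4) (\<lambda>x. Gp (x, 0) * (norm x ^ 3 * it 0) * (w (x, 0))\<^sup>2)" by (intro continuous_intros slice_0 xlip_all)
  have "xlip T \<Phi>" unfolding \<Phi>_def[abs_def] by (intro xlip_ops xlip_all xlip_Nn)
  thus "continuous_on (cball 0 4) (\<lambda>x. \<Phi> (x, 0))" by (rule slice_0)
qed

lemma t0: "0 \<in> {0..T}" using pos by simp
lemma ta_0: "ta 0 = a" by (simp add: ta_def)

text \<open>As \<open>a \<le> 1/\<lambda> \<le> 1/\<alpha>\<close> and \<open>vb \<le> \<alpha>\<^sup>2\<close>, the potential at the initial time is dominated by \<open>\<alpha>/a\<close>.\<close>

lemma a_vb: "a * vb \<le> \<alpha>" "a * lam \<le> 1" "a \<le> 1"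
proof -
  show al: "a * lam \<le> 1" using lam_ta(2)[OF t0] by (simp add: ta_0 mult.commute)
  show "a \<le> 1" using lam_ta(3)[OF t0] by (simp add: ta_0)
  have "a * vb \<le> a * \<alpha>\<^sup>2" using vb pos by (intro mult_left_mono) auto
  also have "\<dots> = (a * \<alpha>) * \<alpha>" by (simp add: power2_eq_square)
  also have "\<dots> \<le> (a * lam) * \<alpha>" using pos by (intro mult_right_mono mult_left_mono) auto
  also have "\<dots> \<le> 1 * \<alpha>" using al pos by (intro mult_right_mono) auto
  finally show "a * vb \<le> \<alpha>" by simp
qed

text \<open>The value of \<open>-\<Phi>\<close> at \<open>t = 0\<close>: ellipticity gives the gradient term its sign, and \<open>\<kappa> \<gamma> = \<alpha>\<close> bounds the zero-order term.\<close>

lemma boundary_le: "J (\<lambda>x. \<Phi> (x, 0)) \<le> wgt 0 * (- (a / C) * B1 + 2 * exp 60 * \<alpha> * B0 + exp 60 * C * B3)"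
proof -
  have "J (\<lambda>x. \<Phi> (x, 0)) \<le> J (\<lambda>x. wgt 0 * (- (a / C) * (Gp (x, 0) * (P (x, 0))\<^sup>2) + 2 * exp 60 * \<alpha> * (Gp (x, 0) * (w (x, 0))\<^sup>2)
     + exp 60 * C * (Gp (x, 0) * (norm x ^ 3 * it 0) * (w (x, 0))\<^sup>2)))"
  proof (rule J_mono[OF cont_slices(4)])
    show "continuous_on (cball 0 4) (\<lambda>x. wgt 0 * (- (a / C) * (Gp (x, 0) * (P (x, 0))\<^sup>2) + 2 * exp 60 * \<alpha> * (Gp (x, 0) * (w (x, 0))\<^sup>2)
     + exp 60 * C * (Gp (x, 0) * (norm x ^ 3 * it 0) * (w (x, 0))\<^sup>2)))"
      by (intro continuous_on_mult continuous_on_add continuous_on_const cont_slices)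
    fix x :: "real^'n" assume "norm x \<le> 4"
    hence p: "(x, 0) \<in> strip T" using pos by (simp add: strip_def)
    define g where "g = wgt 0 * Gp (x, 0)"
    have g: "g \<ge> 0" using wgt_pos[OF t0] Gp_pos by (simp add: g_def)
    have gm0: "a \<le> gm 0" "gm 0 \<le> exp 60 * a" using gm[OF t0] by auto
    have 1: "gm 0 * q (x, 0) \<ge> (a / C) * (P (x, 0))\<^sup>2"
    proof -
      have "(P (x, 0))\<^sup>2 / C \<le> q (x, 0)" using q_ge[of "(x, 0)"] C(1) by (simp add: field_simps)
      hence "a * ((P (x, 0))\<^sup>2 / C) \<le> gm 0 * q (x, 0)" using gm0 pos C(1) by (intro mult_mono) auto
      thus ?thesis by simp
    qed
    have 2: "gm 0 * (U (x, 0) + ka 0) \<le> 2 * exp 60 * \<alpha> + exp 60 * C * (norm x ^ 3 * it 0)"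
    proof -
      have "U (x, 0) \<le> vb + C * (norm x ^ 3 * (it 0)\<^sup>2)" using U_le[OF p] by (simp add: nx_def)
      hence "gm 0 * U (x, 0) \<le> gm 0 * (vb + C * (norm x ^ 3 * (it 0)\<^sup>2))" using gm0 pos by (intro mult_left_mono) auto
      also have "\<dots> \<le> (exp 60 * a) * (vb + C * (norm x ^ 3 * (it 0)\<^sup>2))" using gm0 vb C by (intro mult_right_mono) auto
      also have "\<dots> = exp 60 * (a * vb) + exp 60 * C * (norm x ^ 3 * (it 0 * (a * it 0)))" by (simp add: algebra_simps power2_eq_square)
      also have "a * it 0 = 1" using ta_it[OF t0] by (simp add: ta_0)
      also have "exp 60 * (a * vb) \<le> exp 60 * \<alpha>" using a_vb by simp
      finally have "gm 0 * U (x, 0) \<le> exp 60 * \<alpha> + exp 60 * C * (norm x ^ 3 * it 0)" by simp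
      moreover have "gm 0 * ka 0 \<le> exp 60 * \<alpha>" using gm_ka[OF t0] pos mult_right_mono[of 1 "exp 60" \<alpha>] by simp
      ultimately show ?thesis by (simp add: distrib_left)
    qed
    have "\<Phi> (x, 0) = g * (- (gm 0 * q (x, 0)) + gm 0 * (U (x, 0) + ka 0) * (w (x, 0))\<^sup>2)"
      by (simp add: \<Phi>_def Nn_def om_def g_def algebra_simps)
    also have "\<dots> \<le> g * (- ((a / C) * (P (x, 0))\<^sup>2) + (2 * exp 60 * \<alpha> + exp 60 * C * (norm x ^ 3 * it 0)) * (w (x, 0))\<^sup>2)"
      using 1 2 g by (intro mult_left_mono add_mono mult_right_mono) auto
    also have "\<dots> = wgt 0 * (- (a / C) * (Gp (x, 0) * (P (x, 0))\<^sup>2) + 2 * exp 60 * \<alpha> * (Gp (x, 0) * (w (x, 0))\<^sup>2)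
     + exp 60 * C * (Gp (x, 0) * (norm x ^ 3 * it 0) * (w (x, 0))\<^sup>2))" by (simp add: g_def algebra_simps)
    finally show "\<Phi> (x, 0) \<le> \<dots>" .
  qed
  also have "\<dots> = wgt 0 * (- (a / C) * B1 + 2 * exp 60 * \<alpha> * B0 + exp 60 * C * B3)"
    unfolding J_cmult B1_def B0_def B3_def
    by (subst J_add, intro continuous_on_mult continuous_on_add continuous_on_const cont_slices, intro continuous_on_mult continuous_on_const cont_slices,
        subst J_add, (intro continuous_on_mult continuous_on_const cont_slices)+) (simp only: J_cmult)
  finally show ?thesis .
qed

text \<open>Integrating the pointwise inequality removes the divergence; the time derivative leaves only the value at \<open>t = 0\<close>, since
\<open>w\<close> vanishes at \<open>t = T\<close>.\<close>

theorem basic_inequality: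
  "II Zd + (1 / C) * II X1d + wgt 0 * (a / C) * B1
    \<le> II Ftd + cc1 * (II Y1d + II Y0d + vb * II Wd) + wgt 0 * (2 * exp 60 * \<alpha> * B0 + exp 60 * C * B3)"
proof -
  have t\<Psi>: "tame T (\<lambda>p. \<Sum>k\<in>UNIV. d\<Psi> k p $ k)" by (intro tame_ops tame_d\<Psi>)
  have t\<Phi>: "tame T \<Phi>'" by (rule tame_continuous[OF cont_\<Phi>'])
  have "II (\<lambda>p. (\<Sum>k\<in>UNIV. d\<Psi> k p $ k) + \<Phi>' p + Zd p + (1 / C) * X1d p)
     \<le> II (\<lambda>p. Ftd p + cc1 * (Y1d p + Y0d p + vb * Wd p))"
    by (rule integral_\<mu>_mono[OF _ _ basic_pointwise]) (intro tame_add tame_cmult tame_dens t\<Psi> t\<Phi>)+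
  also have "\<dots> = II Ftd + cc1 * (II Y1d + II Y0d + vb * II Wd)"
    by (simp add: II_add tame_add tame_cmult tame_dens)
  also have "II (\<lambda>p. (\<Sum>k\<in>UNIV. d\<Psi> k p $ k) + \<Phi>' p + Zd p + (1 / C) * X1d p)
     = II (\<lambda>p. \<Sum>k\<in>UNIV. d\<Psi> k p $ k) + II \<Phi>' + II Zd + (1 / C) * II X1d"
    by (simp only: II_add[OF tame_add[OF tame_add[OF t\<Psi> t\<Phi>] tame_dens(8)] tame_cmult[OF tame_dens(1)]]
       II_add[OF tame_add[OF t\<Psi> t\<Phi>] tame_dens(8)] II_add[OF t\<Psi> t\<Phi>] II_cmult)
  also have "II \<Phi>' = - J (\<lambda>x. \<Phi> (x, 0))" using integral_\<Phi>' by (simp add: J_def)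
  finally have "- J (\<lambda>x. \<Phi> (x, 0)) + II Zd + (1 / C) * II X1d \<le> II Ftd + cc1 * (II Y1d + II Y0d + vb * II Wd)"
    by (simp add: integral_d\<Psi>)
  thus ?thesis using boundary_le by (simp add: algebra_simps)
qed

text \<open>The divergence of \<open>\<theta> \<sigma>\<^sup>-\<^sup>2\<^sup>\<alpha> G w A0 \<nabla>w\<close> integrates to zero, and it equals \<open>\<theta> E (w S + q - (U + \<kappa>) w\<^sup>2)\<close>. As
\<open>\<kappa>\<close> is comparable to \<open>\<alpha>/\<tau>\<close>, this bounds \<open>X0d\<close> by \<open>X1d\<close> and \<open>Zd\<close>, the product \<open>w S\<close> being split by
Cauchy and Schwarz.\<close>

theorem zero_order_inequality:
  "II X0d \<le> exp 60 * (II Zd + (8 / \<alpha>) * II X0d + C * II X1d + 15 * C * (II Y0d + vb * II Wd))"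
proof -
  define \<eta> where "\<eta> t = wgt t * th t" for t
  have \<eta>: "continuous_on {0..T} \<eta>" unfolding \<eta>_def by (intro continuous_intros cont_time)
  define \<Psi>4 where "\<Psi>4 p = (\<eta> (snd p) * Gp p * w p) *\<^sub>R F p" for p
  define D4 where "D4 k p = (\<eta> (snd p) * Gp p * w p) *\<^sub>R dF k p + (\<eta> (snd p) * (dG k p * w p + Gp p * gw p $ k)) *\<^sub>R F p" for k p
  have tdG: "tame T (dG k)" for k
  proof -
    have "tame T (\<lambda>p. - (fst p $ k) * it (snd p) * (1/2) * Gp p)" by (intro tame_ops tame_all)
    thus ?thesis by (simp add: dG_def[abs_def])
  qed
  have "II (\<lambda>p. \<Sum>k\<in>UNIV. D4 k p $ k) = 0"
  proof (rule divergence_integral)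
    show "xlip T \<Psi>4" unfolding \<Psi>4_def[abs_def] by (intro xlip_ops xlip_all xlip_time[OF \<eta>])
    show "\<Psi>4 (x, t) = 0" if "t \<in> {0..T}" "norm x \<ge> r'" for x t using F_zero[of t x] that by (simp add: \<Psi>4_def)
    show "tame T (D4 k)" for k unfolding D4_def[abs_def] by (intro tame_ops tame_all tdG xlip_tame[OF xlip_time[OF \<eta>]])
    show "AE p in \<mu> T. \<forall>k. xd k p \<Psi>4 (D4 k p)"
      using AE_reg
    proof eventually_elim
      case (elim p)
      hence s: "p \<in> strip T" by (simp add: reg_def)
      have G: "xd k p Gp (dG k p)" for k using xd_Gp[OF s] by (simp add: dG_def)
      show ?case unfolding \<Psi>4_def[abs_def] D4_def
        by (intro allI) (rule xd_cong[OF xd_scaleR[OF xd_mult[OF xd_mult[OF xd_time[where \<phi>=\<eta>] G] xd_w] xd_F[OF elim]]], simp add: algebra_simps)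
    qed
  qed
  moreover have "(\<Sum>k\<in>UNIV. D4 k p $ k) = \<eta> (snd p) * Gp p * (w p * Sw p + q p)" for p
  proof -
    have dec: "D4 k p $ k = \<eta> (snd p) * Gp p * (w p * dF k p $ k - it (snd p) / 2 * w p * (F p $ k * fst p $ k) + gw p $ k * F p $ k)" for k
      by (simp add: D4_def dG_def algebra_simps)
    have sums: "(\<Sum>k\<in>UNIV. F p $ k * fst p $ k) = F p \<bullet> fst p" "(\<Sum>k\<in>UNIV. gw p $ k * F p $ k) = q p"
      by (simp_all add: q_def inner_vec_sum)
    show ?thesis unfolding dec sum_distrib_left[symmetric] sum.distrib sum_subtractf sums m_def[symmetric]
      by (simp add: Sw_def field_simps)
  qed
  ultimately have zero: "II (\<lambda>p. \<eta> (snd p) * Gp p * (w p * Sw p + q p)) = 0" by simp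
  have t0: "tame T (\<lambda>p. \<eta> (snd p) * Gp p * (w p * Sw p + q p))"
    by (intro tame_ops tame_all xlip_tame[OF xlip_time[OF \<eta>]])
  have "II (\<lambda>p. X0d p + exp 60 * (\<eta> (snd p) * Gp p * (w p * Sw p + q p)))
     \<le> II (\<lambda>p. exp 60 * (Zd p + ((8 / \<alpha>) * X0d p + (C * X1d p + 15 * C * (Y0d p + vb * Wd p)))))"
  proof (rule integral_\<mu>_mono)
    show "tame T (\<lambda>p. X0d p + exp 60 * (\<eta> (snd p) * Gp p * (w p * Sw p + q p)))"
      by (intro tame_add tame_cmult tame_dens t0)
    show "tame T (\<lambda>p. exp 60 * (Zd p + ((8 / \<alpha>) * X0d p + (C * X1d p + 15 * C * (Y0d p + vb * Wd p)))))"
      by (intro tame_add tame_cmult tame_dens)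
    fix p :: "(real^'n) \<times> real" assume p: "p \<in> strip T"
    note t = strip_T(1)[OF p]
    have thb: "0 \<le> th (snd p)" "th (snd p) \<le> 15" using th_bounds[OF t] by auto
    have E: "E p \<ge> 0" by (rule E_nonneg[OF p])
    have ip: "it (snd p) > 0" by (rule it_pos[OF t])
    have gp: "gm (snd p) > 0" by (rule gm_pos[OF t])
    have kk: "\<alpha> * it (snd p) \<le> exp 60 * ka (snd p)"
    proof -
      have "gm (snd p) \<le> exp 60 * ta (snd p)" using gm[OF t] by (simp add: ta_def)
      hence "inverse (ta (snd p)) \<le> exp 60 * inverse (gm (snd p))"
        using gp ta_pos[of "snd p"] t by (simp add: field_simps)
      hence "\<alpha> * inverse (ta (snd p)) \<le> \<alpha> * (exp 60 * inverse (gm (snd p)))"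
        using pos by (intro mult_left_mono) auto
      thus ?thesis by (simp add: ka_def it_def mult_ac)
    qed
    define e where "e = E p * th (snd p)"
    have e: "e \<ge> 0" using E thb by (simp add: e_def)
    have x0: "X0d p \<le> exp 60 * (e * (ka (snd p) * (w p)\<^sup>2))"
    proof -
      have "(e * (w p)\<^sup>2) * (\<alpha> * it (snd p)) \<le> (e * (w p)\<^sup>2) * (exp 60 * ka (snd p))"
        by (rule mult_left_mono[OF kk]) (use e in simp)
      thus ?thesis by (simp add: X0d_def e_def mult_ac)
    qed
    have eta: "\<eta> (snd p) * Gp p = e" by (simp add: \<eta>_def e_def E_def mult_ac)
      have 1: "e * (w p * St p) \<le> Zd p + (8 / \<alpha>) * X0d p"
      proof -
        have "th (snd p) * (w p * St p) \<le> gm (snd p) * (St p)\<^sup>2 + (th (snd p))\<^sup>2 * inverse (gm (snd p)) / 4 * (w p)\<^sup>2"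
        proof -
          have "0 \<le> (gm (snd p) * St p - th (snd p) * w p / 2)\<^sup>2 * inverse (gm (snd p))" using gp by simp
          also have "\<dots> = gm (snd p) * (St p)\<^sup>2 - th (snd p) * (w p * St p) + (th (snd p))\<^sup>2 * inverse (gm (snd p)) / 4 * (w p)\<^sup>2"
            using gp by (simp add: power2_eq_square field_simps)
          finally show ?thesis by simp
        qed
        also have "(th (snd p))\<^sup>2 * inverse (gm (snd p)) / 4 * (w p)\<^sup>2 \<le> 8 * th (snd p) * it (snd p) * (w p)\<^sup>2"
        proof (rule mult_right_mono)
          have "inverse (gm (snd p)) \<le> it (snd p)" using gm[OF t] ta_pos[of "snd p"] t by (auto simp: it_def ta_def intro!: le_imp_inverse_le)
          hence "(th (snd p) * th (snd p)) * inverse (gm (snd p)) \<le> (15 * th (snd p)) * it (snd p)"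
            using thb gp by (intro mult_mono mult_right_mono) auto
          moreover have "0 \<le> th (snd p) * it (snd p)" using thb ip by simp
          ultimately show "(th (snd p))\<^sup>2 * inverse (gm (snd p)) / 4 \<le> 8 * th (snd p) * it (snd p)" by (simp add: power2_eq_square)
        qed simp
        finally have "E p * (th (snd p) * (w p * St p)) \<le> E p * (gm (snd p) * (St p)\<^sup>2 + 8 * th (snd p) * it (snd p) * (w p)\<^sup>2)"
          using E by (intro mult_left_mono) auto
        moreover have "E p * (gm (snd p) * (St p)\<^sup>2) = Zd p" by (simp add: E_def Zd_def om_def mult_ac)
        moreover have "(8 / \<alpha>) * X0d p = E p * (8 * th (snd p) * it (snd p) * (w p)\<^sup>2)" using pos by (simp add: X0d_def)
        ultimately show ?thesis by (simp add: e_def distrib_left mult.assoc)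
      qed
      have 2: "e * (- U p * (w p)\<^sup>2) \<le> 15 * C * (Y0d p + vb * Wd p)"
      proof -
        have "- U p \<le> \<bar>U p\<bar>" by simp
        also have "\<dots> \<le> vb + C * (nx p ^ 3 * (it (snd p))\<^sup>2)" by (rule U_le[OF p])
        also have "\<dots> \<le> C * vb + C * Kx p"
          using C(1) pos ip vb mult_right_mono[OF C(1) vb(1)] by (intro add_mono mult_left_mono) (auto simp: Kx_def)
        finally have "th (snd p) * (- U p * (w p)\<^sup>2) \<le> th (snd p) * ((C * vb + C * Kx p) * (w p)\<^sup>2)"
          using thb by (intro mult_left_mono mult_right_mono) auto
        also have "\<dots> \<le> 15 * ((C * vb + C * Kx p) * (w p)\<^sup>2)"
          using thb C(1) vb Kx_nonneg[OF p] by (intro mult_right_mono) auto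
        finally have "E p * (th (snd p) * (- U p * (w p)\<^sup>2)) \<le> E p * (15 * ((C * vb + C * Kx p) * (w p)\<^sup>2))"
          using E by (intro mult_left_mono) auto
        thus ?thesis by (simp add: e_def Y0d_def Wd_def algebra_simps)
      qed
      have 3: "C * X1d p \<ge> e * q p"
      proof -
        have "e * q p \<le> e * (C * (P p)\<^sup>2)" by (rule mult_left_mono[OF q_le e])
        thus ?thesis by (simp add: X1d_def e_def mult_ac)
      qed
    have eq: "e * (ka (snd p) * (w p)\<^sup>2) + e * (w p * Sw p + q p) = e * (w p * St p) + e * (- U p * (w p)\<^sup>2) + e * q p"
      by (simp add: St_def power2_eq_square algebra_simps)
    have "X0d p + exp 60 * (\<eta> (snd p) * Gp p * (w p * Sw p + q p)) \<le> exp 60 * (e * (ka (snd p) * (w p)\<^sup>2) + e * (w p * Sw p + q p))"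
      unfolding eta distrib_left[of "exp 60"] using x0 by simp
    also have "\<dots> \<le> exp 60 * (Zd p + ((8 / \<alpha>) * X0d p + (C * X1d p + 15 * C * (Y0d p + vb * Wd p))))"
      unfolding eq using 1 2 3 by (intro mult_left_mono) auto
    finally show "X0d p + exp 60 * (\<eta> (snd p) * Gp p * (w p * Sw p + q p))
       \<le> exp 60 * (Zd p + ((8 / \<alpha>) * X0d p + (C * X1d p + 15 * C * (Y0d p + vb * Wd p))))" .
  qed
  also have "\<dots> = exp 60 * (II Zd + (8 / \<alpha>) * II X0d + C * II X1d + 15 * C * (II Y0d + vb * II Wd))"
    by (simp only: II_add tame_add tame_cmult tame_dens II_cmult add.assoc distrib_left mult.assoc)
  also have "II (\<lambda>p. X0d p + exp 60 * (\<eta> (snd p) * Gp p * (w p * Sw p + q p))) = II X0d"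
    by (simp only: II_add[OF tame_dens(2) tame_cmult[OF t0]] II_cmult zero)
  finally show ?thesis .
qed

end

section \<open>The weighted gradient\<close>

lemma gradient_algebra:
  fixes h i e Gx rh w mA wt qA Fx dv xy ka n xx V f :: real
  assumes rh: "rh = e * h * Gx" and f: "f = mA + wt + V * w" and h: "h > 0"
    and z: "z = e * Gx * (inverse h - h * i / 2)"
  shows "(2 * rh * w * mA + (2 * (z * w * Fx) + 2 * (rh * qA)) - w\<^sup>2 * z * dv
       - (2 * w * z * Fx + w\<^sup>2 * (e * Gx * (h * i\<^sup>2 / 4 - i * inverse h - inverse h ^ 3)) * xy))
     + (e * Gx * (- 2 * ka * h + h * (- n * i / 2 + xx * i\<^sup>2 / 4) + inverse h / 2) * w\<^sup>2 + 2 * rh * w * wt)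
    = 2 * rh * qA + 2 * rh * w * (f - V * w)
      - e * Gx * w\<^sup>2 * (2 * ka * h + h * i * (n - dv) / 2 + inverse h * dv - inverse h / 2
          - xy * (i * inverse h + inverse h ^ 3) + h * i\<^sup>2 * (xy - xx) / 4)"
  unfolding rh f z by (simp add: field_simps power2_eq_square)

text \<open>Bounds the zero-order coefficient \<open>er3\<close>. With \<open>h = (|x|\<^sup>2 + \<tau>)\<^sup>1\<^sup>/\<^sup>2 \<le> |x| + \<tau>\<^sup>1\<^sup>/\<^sup>2\<close>
the term \<open>2 \<kappa> h\<close> produces \<open>\<alpha> |x|/\<tau>\<close> and \<open>\<alpha> \<tau>\<^sup>-\<^sup>1\<^sup>/\<^sup>2\<close>, the terms of size \<open>1/h\<close> are at most \<open>\<tau>\<^sup>-\<^sup>1\<^sup>/\<^sup>2\<close>,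
and the others contain a difference that vanishes for \<open>A = 1\<close>.\<close>

lemma gradient_error_bound:
  fixes h i s x c al ka n dv xy xx :: real
  assumes c: "c \<ge> 1" and i: "i > 0" and s: "s > 0" "s * s * i = 1" "s \<le> 1" and x: "0 \<le> x" "x \<le> 4"
    and h: "h > 0" "h\<^sup>2 = x\<^sup>2 + s\<^sup>2" and al: "al \<ge> 1" and ka: "0 \<le> ka" "ka \<le> al * i"
    and n: "0 \<le> n" "n \<le> c" and dv: "\<bar>dv - n\<bar> \<le> c\<^sup>2 * (2 * x + s)" and xy: "xy \<ge> 0" "\<bar>xy - xx\<bar> \<le> c * (x + s) * x\<^sup>2"
  shows "2 * ka * h + h * i * (n - dv) / 2 + inverse h * dv - inverse h / 2
          - xy * (i * inverse h + inverse h ^ 3) + h * i\<^sup>2 * (xy - xx) / 4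
     \<le> 30 * c\<^sup>2 * (x^3 * i\<^sup>2 + al * x * i + al * i * s)" (is "_ \<le> 30 * c\<^sup>2 * ?B")
proof -
  have hs: "s \<le> h" "x \<le> h" "h \<le> x + s"
  proof -
    show "s \<le> h" by (rule power2_le_imp_le) (use h in auto)
    show "x \<le> h" by (rule power2_le_imp_le) (use h in auto)
    show "h \<le> x + s" by (rule power2_le_imp_le) (use h x s in \<open>auto simp: power2_sum\<close>)
  qed
  have c2: "1 \<le> c\<^sup>2" "c \<le> c\<^sup>2" using c power_increasing[of 1 2 c] power_increasing[of 0 2 c] by auto
  have ss: "s\<^sup>2 * i = 1" using s(2) by (simp add: power2_eq_square)
  have one: "1 \<le> al * i * s"
  proof -
    have "1 \<le> i * s" using s i mult_left_mono[of s 1 "s * i"] by (simp add: mult_ac)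
    thus ?thesis using al i s mult_mono[of 1 al 1 "i * s"] by (simp add: mult.assoc)
  qed
  have xi: "x\<^sup>2 * i \<le> 4 * (al * x * i)"
  proof -
    have "x * x * i \<le> 4 * x * i" using x i by (intro mult_right_mono) auto
    also have "\<dots> \<le> 4 * (al * x * i)" using al x i mult_right_mono[of 1 al "x * i"] by (simp add: mult_ac)
    finally show ?thesis by (simp add: power2_eq_square)
  qed
  have B: "x^3 * i\<^sup>2 \<ge> 0" "al * x * i \<ge> 0" using x i al by auto
  have t1: "2 * ka * h \<le> 2 * c\<^sup>2 * ?B"
  proof -
    have "ka * h \<le> (al * i) * (x + s)" using ka hs h al i by (intro mult_mono) auto
    hence "ka * h \<le> ?B" using B by (simp add: algebra_simps)
    also have "\<dots> \<le> c\<^sup>2 * ?B" using c2 B one by (intro mult_right_mono[of 1 "c\<^sup>2", simplified]) auto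
    finally show ?thesis by simp
  qed
  have hx: "h * (2 * x + s) * i \<le> 16 * ?B"
  proof -
    have "h * (2 * x + s) \<le> (x + s) * (2 * x + s)" using hs x s by (intro mult_right_mono) auto
    also have "\<dots> = 2 * x\<^sup>2 + s\<^sup>2 + 3 * (x * s)" by (simp add: power2_eq_square algebra_simps)
    also have "\<dots> \<le> 4 * x\<^sup>2 + 4 * s\<^sup>2" using sum_squares_bound[of x s] zero_le_power2[of x] zero_le_power2[of s] by linarith
    finally have "h * (2 * x + s) * i \<le> (4 * x\<^sup>2 + 4 * s\<^sup>2) * i" using i by (intro mult_right_mono) auto
    also have "\<dots> = 4 * (x\<^sup>2 * i) + 4" using ss by (simp add: algebra_simps)
    also have "\<dots> \<le> 16 * (al * x * i) + 4 * (al * i * s)" using xi one by simp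
    also have "\<dots> \<le> 16 * ?B" using B one by (simp add: algebra_simps)
    finally show ?thesis .
  qed
  have t2: "h * i * (n - dv) / 2 \<le> 8 * c\<^sup>2 * ?B"
  proof -
    have "n - dv \<le> c\<^sup>2 * (2 * x + s)" using dv by linarith
    hence "(h * i) * (n - dv) \<le> (h * i) * (c\<^sup>2 * (2 * x + s))" using h i by (intro mult_left_mono) auto
    also have "\<dots> = c\<^sup>2 * (h * (2 * x + s) * i)" by (simp add: mult_ac)
    also have "\<dots> \<le> c\<^sup>2 * (16 * ?B)" by (rule mult_left_mono[OF hx]) simp
    also have "\<dots> = 16 * (c\<^sup>2 * ?B)" by (rule mult.left_commute)
    finally show ?thesis by simp
  qed
  have hi: "inverse h \<le> i * s"
  proof -
    have "inverse h \<le> inverse s" using hs s by (intro le_imp_inverse_le) auto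
    also have "inverse s = i * s" using s by (simp add: field_simps)
    finally show ?thesis .
  qed
  have his: "i * s \<le> al * i * s" using al i s mult_right_mono[of 1 al "i * s"] by (simp add: mult_ac)
  have t3: "inverse h * dv \<le> 10 * c\<^sup>2 * ?B"
  proof -
    have "dv \<le> n + c\<^sup>2 * (2 * x + s)" using dv by linarith
    also have "\<dots> \<le> c\<^sup>2 + c\<^sup>2 * 9" using n c2 x s by (intro add_mono mult_left_mono) auto
    finally have "inverse h * dv \<le> inverse h * (10 * c\<^sup>2)" using h by (intro mult_left_mono) auto
    also have "\<dots> \<le> (i * s) * (10 * c\<^sup>2)" using hi by (intro mult_right_mono) auto
    also have "\<dots> \<le> ?B * (10 * c\<^sup>2)" using his B by (intro mult_right_mono) auto
    finally show ?thesis by (simp add: mult_ac)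
  qed
  have t4: "- inverse h / 2 \<le> 0" "- xy * (i * inverse h + inverse h ^ 3) \<le> 0"
    using h xy i by (auto simp: mult_nonneg_nonneg)
  have t5: "h * i\<^sup>2 * (xy - xx) / 4 \<le> 10 * c\<^sup>2 * ?B"
  proof -
    have "xy - xx \<le> c * (x + s) * x\<^sup>2" using xy by linarith
    hence "(h * i\<^sup>2) * (xy - xx) \<le> (h * i\<^sup>2) * (c * (x + s) * x\<^sup>2)" using h by (intro mult_left_mono) auto
    also have "\<dots> = (c * x\<^sup>2 * i\<^sup>2) * (h * (x + s))" by (simp add: mult_ac)
    also have "\<dots> \<le> (c * x\<^sup>2 * i\<^sup>2) * (2 * x\<^sup>2 + 2 * s\<^sup>2)"
    proof (rule mult_left_mono)
      have "h * (x + s) \<le> (x + s) * (x + s)" using hs x s by (intro mult_right_mono) auto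
      also have "\<dots> \<le> 2 * x\<^sup>2 + 2 * s\<^sup>2" using sum_squares_bound[of x s] by (simp add: power2_eq_square algebra_simps)
      finally show "h * (x + s) \<le> 2 * x\<^sup>2 + 2 * s\<^sup>2" .
    qed (use c in simp)
    also have "\<dots> = c * (2 * (x * (x^3 * i\<^sup>2)) + 2 * (x\<^sup>2 * i) * (s\<^sup>2 * i))" by (simp add: power2_eq_square power3_eq_cube algebra_simps)
    also have "\<dots> = c * (2 * (x * (x^3 * i\<^sup>2)) + 2 * (x\<^sup>2 * i))" unfolding ss by simp
    also have "\<dots> \<le> c * (2 * (4 * (x^3 * i\<^sup>2)) + 2 * (4 * (al * x * i)))"
      using c x B xi by (intro mult_left_mono add_mono mult_right_mono) auto
    also have "\<dots> \<le> c * (8 * ?B)" using c one by (intro mult_left_mono) (auto simp: algebra_simps)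
    also have "\<dots> \<le> c\<^sup>2 * (8 * ?B)" using c2 B one by (intro mult_right_mono) auto
    also have "\<dots> \<le> c\<^sup>2 * (40 * ?B)" using B one by (intro mult_left_mono mult_right_mono) auto
    also have "\<dots> = 40 * (c\<^sup>2 * ?B)" by (rule mult.left_commute)
    finally show ?thesis by simp
  qed
  have "- xy * (i * inverse h + inverse h ^ 3) = - (xy * (i * inverse h + inverse h ^ 3))" by simp
  hence "2 * ka * h + h * i * (n - dv) / 2 + inverse h * dv - inverse h / 2
          - xy * (i * inverse h + inverse h ^ 3) + h * i\<^sup>2 * (xy - xx) / 4
     \<le> 2 * c\<^sup>2 * ?B + 8 * c\<^sup>2 * ?B + 10 * c\<^sup>2 * ?B + 10 * c\<^sup>2 * ?B"
    using t1 t2 t3 t4 t5 by linarith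
  also have "\<dots> = 30 * c\<^sup>2 * ?B" by (simp add: algebra_simps)
  finally show ?thesis .
qed

context carleman_setting
begin

text \<open>The smooth substitute \<open>hh\<close> for \<open>|x|\<close>. The field \<open>\<Psi>3\<close> and the function \<open>\<Phi>3\<close> come from testing the true equation with
\<open>rh w\<close>: all derivatives of \<open>w\<close> that are not in \<open>q\<close> or in the equation are moved onto the weight, and \<open>ze x\<close> is
the gradient of \<open>rh\<close>.\<close>

definition "hh p = sqrt (fst p \<bullet> fst p + ta (snd p))"
definition "rh p = wgt (snd p) * hh p * Gp p"
definition "ze p = wgt (snd p) * Gp p * (inverse (hh p) - hh p * it (snd p) / 2)"
definition "FA p = A p *v gw p"
definition "yA p = A p *v fst p"
definition "qA p = gw p \<bullet> FA p"
definition "dyA k p = A p *v axis k 1 + dA k p *v fst p"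
definition "dvA p = (\<Sum>k\<in>UNIV. dyA k p $ k)"
definition "\<Psi>3 p = (2 * rh p * w p) *\<^sub>R FA p - ((w p)\<^sup>2 * ze p) *\<^sub>R yA p"
definition "drh k p = ze p * fst p $ k"
definition "dze k p = wgt (snd p) * Gp p * (hh p * (it (snd p))\<^sup>2 / 4 - it (snd p) * inverse (hh p) - inverse (hh p) ^ 3) * fst p $ k"
definition "D3 k p = (2 * rh p * w p) *\<^sub>R dFA k p + (2 * (drh k p * w p + rh p * gw p $ k)) *\<^sub>R FA p
   - (((w p)\<^sup>2 * ze p) *\<^sub>R dyA k p + (2 * w p * gw p $ k * ze p + (w p)\<^sup>2 * dze k p) *\<^sub>R yA p)"
definition "\<Phi>3 p = rh p * (w p)\<^sup>2"
definition "\<Phi>3' p = wgt (snd p) * Gp p * (- 2 * ka (snd p) * hh p + hh p * (- real CARD('n) * it (snd p) / 2 + xx p * (it (snd p))\<^sup>2 / 4) + inverse (hh p) / 2) * (w p)\<^sup>2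
   + 2 * rh p * w p * wt p"
definition "er3 p = 2 * ka (snd p) * hh p + hh p * it (snd p) * (real CARD('n) - dvA p) / 2 + inverse (hh p) * dvA p - inverse (hh p) / 2
          - (fst p \<bullet> yA p) * (it (snd p) * inverse (hh p) + inverse (hh p) ^ 3) + hh p * (it (snd p))\<^sup>2 * (fst p \<bullet> yA p - xx p) / 4"

lemma hh_arg: "p \<in> strip T \<Longrightarrow> fst p \<bullet> fst p + ta (snd p) > 0"
  using ta_pos[of "snd p"] strip_T(1)[of p] by (simp add: add_nonneg_pos)

lemma hh_pos: "p \<in> strip T \<Longrightarrow> hh p > 0" using hh_arg by (simp add: hh_def)

lemma xlip_hh: "xlip T hh" unfolding hh_def[abs_def]
  by (rule xlip_sqrt) (intro xlip_ops xlip_all, rule hh_arg)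

lemma xlip_ihh: "xlip T (\<lambda>p. inverse (hh p))" by (rule xlip_inverse[OF xlip_hh hh_pos])

lemma xlip_FA: "xlip T FA" unfolding FA_def[abs_def] by (intro xlip_mv xlip_all)
lemma xlip_yA: "xlip T yA" unfolding yA_def[abs_def] by (intro xlip_mv xlip_all)
lemma xlip_rh: "xlip T rh" unfolding rh_def[abs_def] by (intro xlip_ops xlip_all xlip_hh)
lemma xlip_ze: "xlip T ze"
proof -
  have "xlip T (\<lambda>p. wgt (snd p) * Gp p * (inverse (hh p) - hh p * it (snd p) * (1/2)))"
    by (intro xlip_ops xlip_all xlip_hh xlip_ihh)
  thus ?thesis by (simp add: ze_def[abs_def])
qed

lemma xd_hh: assumes "p \<in> strip T" shows "xd k p hh (inverse (hh p) * fst p $ k)"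
proof -
  have 1: "xd k p (\<lambda>q. fst q \<bullet> fst q + ta (snd q)) (2 * fst p $ k)"
    by (rule xd_cong[OF xd_add[OF xd_inner[OF xd_fst xd_fst] xd_time]]) (simp add: inner_axis inner_axis')
  have "xd k p (\<lambda>q. sqrt (fst q \<bullet> fst q + ta (snd q))) (inverse (hh p) / 2 * (2 * fst p $ k))"
    by (rule xd_compose[OF 1]) (use hh_arg[OF assms] in \<open>auto simp: hh_def intro!: DERIV_real_sqrt\<close>)
  thus ?thesis by (simp add: hh_def[abs_def])
qed

lemma xd_ihh: assumes "p \<in> strip T" shows "xd k p (\<lambda>q. inverse (hh q)) (- (inverse (hh p) ^ 3) * fst p $ k)"
proof -
  have "xd k p (\<lambda>q. inverse (hh q)) (- (inverse (hh p) * inverse (hh p)) * (inverse (hh p) * fst p $ k))"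
    by (rule xd_compose[OF xd_hh[OF assms]]) (use hh_pos[OF assms] in \<open>auto intro!: derivative_eq_intros\<close>)
  thus ?thesis by (simp add: power3_eq_cube mult_ac)
qed

lemma xd_rh: assumes "p \<in> strip T" shows "xd k p rh (drh k p)"
  unfolding rh_def[abs_def]
  by (rule xd_cong[OF xd_mult[OF xd_mult[OF xd_time[where \<phi>=wgt] xd_hh[OF assms]] xd_Gp[OF assms]]])
     (simp add: drh_def ze_def field_simps)

lemma xd_ze: assumes "p \<in> strip T" shows "xd k p ze (dze k p)"
proof -
  have g: "xd k p (\<lambda>q. inverse (hh q) - hh q * (it (snd q) / 2)) (- (inverse (hh p) ^ 3) * fst p $ k - (hh p * 0 + (inverse (hh p) * fst p $ k) * (it (snd p) / 2)))"
    by (rule xd_diff[OF xd_ihh[OF assms] xd_mult[OF xd_hh[OF assms] xd_time[where \<phi>="\<lambda>t. it t / 2"]]])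
  have "xd k p (\<lambda>q. wgt (snd q) * Gp q * (inverse (hh q) - hh q * (it (snd q) / 2))) (dze k p)"
    by (rule xd_cong[OF xd_mult[OF xd_mult[OF xd_time[where \<phi>=wgt] xd_Gp[OF assms]] g]])
       (simp add: dze_def power2_eq_square field_simps)
  thus ?thesis by (simp add: ze_def[abs_def])
qed

lemma tame_dyA: "tame T (dyA k)" unfolding dyA_def[abs_def] by (intro tame_ops tame_all)
lemma tame_dze: "tame T (dze k)"
proof -
  have "tame T (\<lambda>p. wgt (snd p) * Gp p * (hh p * (it (snd p))\<^sup>2 * (1/4) - it (snd p) * inverse (hh p) - inverse (hh p) ^ 3) * fst p $ k)"
    by (intro tame_ops tame_all xlip_tame[OF xlip_hh] xlip_tame[OF xlip_ihh])
  thus ?thesis by (simp add: dze_def[abs_def])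
qed

lemma A_inner: "(A p *v u) \<bullet> v = u \<bullet> (A p *v v)" by (rule sym_inner[OF A_sym])

lemma integral_D3: "II (\<lambda>p. \<Sum>k\<in>UNIV. D3 k p $ k) = 0"
proof (rule divergence_integral)
  show "xlip T \<Psi>3" unfolding \<Psi>3_def[abs_def] by (intro xlip_ops xlip_all xlip_rh xlip_ze xlip_FA xlip_yA)
  show "\<Psi>3 (x, t) = 0" if "t \<in> {0..T}" "norm x \<ge> r'" for x t using w_zero[of t x] that by (simp add: \<Psi>3_def)
  show "tame T (D3 k)" for k unfolding D3_def[abs_def] drh_def
    by (intro tame_ops tame_all tame_dFA tame_dyA tame_dze xlip_tame[OF xlip_rh] xlip_tame[OF xlip_ze] xlip_tame[OF xlip_FA] xlip_tame[OF xlip_yA])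
  show "AE p in \<mu> T. \<forall>k. xd k p \<Psi>3 (D3 k p)"
    using AE_reg
  proof eventually_elim
    case (elim p)
    hence s: "p \<in> strip T" and a: "\<And>k. xd k p A (dA k p)" by (auto simp: reg_def)
    have FA: "xd k p FA (dFA k p)" for k unfolding FA_def[abs_def] dFA_def by (rule xd_mv[OF a xd_gw])
    have yA: "xd k p yA (dyA k p)" for k unfolding yA_def[abs_def] dyA_def by (rule xd_mv[OF a xd_fst])
    have w2: "xd k p (\<lambda>p. (w p)\<^sup>2) (2 * w p * gw p $ k)" for k
      unfolding power2_eq_square by (rule xd_cong[OF xd_mult[OF xd_w xd_w]]) simp
    show ?case unfolding \<Psi>3_def[abs_def] D3_def
      by (intro allI) (rule xd_cong[OF xd_diff[OF xd_scaleR[OF xd_mult[OF xd_mult[OF xd_const xd_rh[OF s]] xd_w] FA]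
          xd_scaleR[OF xd_mult[OF w2 xd_ze[OF s]] yA]]], simp add: algebra_simps)
  qed
qed

lemma sum_D3: "(\<Sum>k\<in>UNIV. D3 k p $ k) = 2 * rh p * w p * mA p + (2 * (ze p * w p * (FA p \<bullet> fst p)) + 2 * (rh p * qA p)) - (w p)\<^sup>2 * ze p * dvA p
       - (2 * w p * ze p * (FA p \<bullet> fst p) + (w p)\<^sup>2 * (wgt (snd p) * Gp p * (hh p * (it (snd p))\<^sup>2 / 4 - it (snd p) * inverse (hh p) - inverse (hh p) ^ 3)) * (fst p \<bullet> yA p))"
proof -
  have gy: "gw p \<bullet> yA p = FA p \<bullet> fst p" by (simp add: yA_def FA_def A_inner)
  define dz where "dz = wgt (snd p) * Gp p * (hh p * (it (snd p))\<^sup>2 / 4 - it (snd p) * inverse (hh p) - inverse (hh p) ^ 3)"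
  have dzk: "dze k p = dz * fst p $ k" for k by (simp add: dze_def dz_def)
  have dec: "D3 k p $ k = 2 * rh p * w p * dFA k p $ k + 2 * ze p * w p * (FA p $ k * fst p $ k) + 2 * rh p * (gw p $ k * FA p $ k)
     - (w p)\<^sup>2 * ze p * dyA k p $ k - 2 * w p * ze p * (gw p $ k * yA p $ k) - (w p)\<^sup>2 * dz * (fst p $ k * yA p $ k)" for k
    by (simp add: D3_def drh_def dzk algebra_simps)
  have sums: "(\<Sum>k\<in>UNIV. FA p $ k * fst p $ k) = FA p \<bullet> fst p" "(\<Sum>k\<in>UNIV. gw p $ k * FA p $ k) = qA p"
    "(\<Sum>k\<in>UNIV. gw p $ k * yA p $ k) = gw p \<bullet> yA p" "(\<Sum>k\<in>UNIV. fst p $ k * yA p $ k) = fst p \<bullet> yA p"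
    by (simp_all add: inner_vec_sum[of "FA p"] qA_def inner_vec_sum[of "gw p"] inner_vec_sum[of "fst p"])
  show ?thesis unfolding dec sum.distrib sum_subtractf sum_distrib_left[symmetric] sums gy mA_def[symmetric] dvA_def[symmetric] dz_def[symmetric]
    by (simp add: algebra_simps)
qed

lemma gradient_identity: assumes "p \<in> strip T"
  shows "(\<Sum>k\<in>UNIV. D3 k p $ k) + \<Phi>3' p = 2 * rh p * qA p + 2 * rh p * w p * (f p - V p * w p) - E p * (w p)\<^sup>2 * er3 p"
  unfolding sum_D3 \<Phi>3'_def er3_def E_def
  by (rule gradient_algebra) (use hh_pos[OF assms] in \<open>auto simp: rh_def f_def ze_def\<close>)

lemma integral_\<Phi>3': "II \<Phi>3' \<le> 0"
proof -
  have "II \<Phi>3' = - (\<integral>x. indicator (cball 0 4) x * \<Phi>3 (x, 0) \<partial>lborel)"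
  proof (rule integral_t_derivative)
    have "continuous_on (strip T) (\<lambda>p. wgt (snd p) * Gp p * (- 2 * ka (snd p) * hh p + hh p * (- real CARD('n) * it (snd p) * (1/2) + (fst p \<bullet> fst p) * (it (snd p))\<^sup>2 * (1/4)) + inverse (hh p) * (1/2)) * (w p)\<^sup>2
         + 2 * rh p * w p * wt p)"
      by (intro xlip_continuous xlip_ops xlip_all xlip_hh xlip_ihh xlip_rh)
    thus "continuous_on (strip T) \<Phi>3'" by (simp add: \<Phi>3'_def[abs_def] xx_def)
    show "\<Phi>3 (x, T) = 0" for x by (simp add: \<Phi>3_def w_T)
    fix x t assume p: "(x, t) \<in> (strip T :: ((real^'n) \<times> real) set)"
    hence t: "t \<in> {0..T}" by (simp add: strip_def)
    have dta: "((\<lambda>s. x \<bullet> x + ta s) has_real_derivative 1) (at t within {0..T})"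
      unfolding ta_def[abs_def] by (auto intro!: derivative_eq_intros)
    have dhh: "((\<lambda>s. hh (x, s)) has_real_derivative inverse (hh (x, t)) / 2) (at t within {0..T})"
      unfolding hh_def fst_conv snd_conv
      by (rule DERIV_cong[OF DERIV_chain2[OF DERIV_real_sqrt dta]]) (use hh_arg[OF p] in auto)
    have dw2: "((\<lambda>s. (w (x, s))\<^sup>2) has_real_derivative 2 * w (x, t) * wt (x, t)) (at t within {0..T})"
      by (rule DERIV_cong[OF DERIV_power[OF der_w]]) simp
    show "((\<lambda>s. \<Phi>3 (x, s)) has_real_derivative \<Phi>3' (x, t)) (at t within {0..T})"
      unfolding \<Phi>3_def \<Phi>3'_def rh_def snd_conv
      by (rule DERIV_cong[OF DERIV_mult[OF DERIV_mult[OF DERIV_mult[OF der_wgt[OF t] dhh] der_Gp[OF t]] dw2]])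
         (simp add: Gt_def algebra_simps)
  qed (use pos in simp)
  moreover have "J (\<lambda>x. \<Phi>3 (x, 0)) \<ge> 0"
  proof (rule J_nonneg)
    fix x :: "real^'n" assume "norm x \<le> 4"
    hence "(x, 0) \<in> strip T" using pos by (simp add: strip_def)
    thus "0 \<le> \<Phi>3 (x, 0)" using hh_pos[of "(x, 0)"] wgt_pos[OF t0] Gp_pos[of "(x, 0)"] by (simp add: \<Phi>3_def rh_def)
  qed
  ultimately show ?thesis by (simp add: J_def)
qed

definition "cc3 = 50 * C^3"

text \<open>Here the coefficients are not frozen: \<open>A\<close> is differentiated in \<open>x\<close> only, while the time derivative
falls on the weight and on \<open>w\<^sup>2\<close>.\<close>

theorem gradient_inequality: "II Y1d \<le> cc3 * (II Fd + II Y0d + II S0d + vb * II Wd)"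
proof -
  have tD: "tame T (\<lambda>p. \<Sum>k\<in>UNIV. D3 k p $ k)"
    unfolding D3_def drh_def
    by (intro tame_ops tame_all tame_dFA tame_dyA tame_dze xlip_tame[OF xlip_rh] xlip_tame[OF xlip_ze] xlip_tame[OF xlip_FA] xlip_tame[OF xlip_yA])
  have t\<Phi>: "tame T \<Phi>3'"
  proof -
    have "tame T (\<lambda>p. wgt (snd p) * Gp p * (- 2 * ka (snd p) * hh p + hh p * (- real CARD('n) * it (snd p) * (1/2) + (fst p \<bullet> fst p) * (it (snd p))\<^sup>2 * (1/4)) + inverse (hh p) * (1/2)) * (w p)\<^sup>2
         + 2 * rh p * w p * wt p)"
      by (intro xlip_tame xlip_ops xlip_all xlip_hh xlip_ihh xlip_rh)
    thus ?thesis by (simp add: \<Phi>3'_def[abs_def] xx_def)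
  qed
  have "II (\<lambda>p. Y1d p) \<le> II (\<lambda>p. C * ((\<Sum>k\<in>UNIV. D3 k p $ k) + \<Phi>3' p) + cc3 * (Fd p + (Y0d p + (S0d p + vb * Wd p))))"
  proof (rule integral_\<mu>_mono)
    show "tame T (\<lambda>p. Y1d p)" by (rule tame_dens)
    show "tame T (\<lambda>p. C * ((\<Sum>k\<in>UNIV. D3 k p $ k) + \<Phi>3' p) + cc3 * (Fd p + (Y0d p + (S0d p + vb * Wd p))))"
      by (intro tame_add tame_cmult tame_dens tD t\<Phi>)
    fix p :: "(real^'n) \<times> real" assume p: "p \<in> strip T"
    note t = strip_T(1)[OF p]
    define s where "s = sqrt (ta (snd p))"
    have ta: "ta (snd p) > 0" using ta_pos t by simp
    have s: "s > 0" "s\<^sup>2 = ta (snd p)" "s \<le> 1" using ta lam_ta(3)[OF t] by (auto simp: s_def)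
    have si: "s * s * it (snd p) = 1" using s(2) ta_it[OF t] by (simp add: power2_eq_square)
    have hp: "hh p > 0" by (rule hh_pos[OF p])
    have h2: "(hh p)\<^sup>2 = (nx p)\<^sup>2 + s\<^sup>2" using hh_arg[OF p] s(2) by (simp add: hh_def nx_def power2_norm_eq_inner)
    have nh: "nx p \<le> hh p" "hh p \<le> nx p + s"
    proof -
      show "nx p \<le> hh p" by (rule power2_le_imp_le) (use h2 hp in auto)
      show "hh p \<le> nx p + s" by (rule power2_le_imp_le) (use h2 s nx_nonneg in \<open>auto simp: power2_sum\<close>)
    qed
    have E: "E p \<ge> 0" by (rule E_nonneg[OF p])
    have ip: "it (snd p) > 0" by (rule it_pos[OF t])
    have n: "0 \<le> real CARD('n)" "real CARD('n) \<le> C" using C by auto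
    define Bq where "Bq = nx p ^ 3 * (it (snd p))\<^sup>2 + \<alpha> * nx p * it (snd p) + \<alpha> * it (snd p) * s"
    have er: "er3 p \<le> 30 * C\<^sup>2 * Bq"
      unfolding er3_def Bq_def
    proof (rule gradient_error_bound)
      show "\<bar>dvA p - real CARD('n)\<bar> \<le> C\<^sup>2 * (2 * nx p + s)"
        using div_y_general[of "A p" "nx p + s" "\<lambda>k. dA k p" "fst p", OF A_mat1[OF p, folded s_def] dA(2)] s nx_nonneg[of p]
        by (simp add: dvA_def dyA_def nx_def add_ac)
      have "(norm (fst p))\<^sup>2 \<le> C * (fst p \<bullet> yA p)" unfolding yA_def by (rule A_ell)
      hence "0 \<le> C * (fst p \<bullet> yA p)" using zero_le_power2[of "norm (fst p)"] by linarith
      thus "0 \<le> fst p \<bullet> yA p" using C(1) by (simp add: zero_le_mult_iff)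
      have "fst p \<bullet> yA p - xx p = fst p \<bullet> ((A p - mat 1) *v fst p)"
        by (simp add: yA_def xx_def matrix_vector_mult_diff_rdistrib inner_diff_right)
      also have "\<bar>\<dots>\<bar> \<le> nx p * ((C * (nx p + s)) * nx p)"
        by (intro abs_inner_mono mv_le A_mat1[OF p, folded s_def]) (simp_all add: nx_def)
      finally show "\<bar>fst p \<bullet> yA p - xx p\<bar> \<le> C * (nx p + s) * (nx p)\<^sup>2" by (simp add: power2_eq_square mult_ac)
    qed (use C pos ip s si hp h2 nx_nonneg nx_le[OF p] ka_pos[OF t] ka_le[OF t] n in auto)
    have qge: "(P p)\<^sup>2 \<le> C * qA p" unfolding P_def qA_def FA_def by (rule A_ell)
    have c3: "C\<^sup>2 * C = C^3" "1 \<le> C\<^sup>2" "C \<le> C^3" "1 \<le> C^3"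
      using cc1_ge C(1) by (auto simp: power2_eq_square power3_eq_cube)
    have i1: "Y1d p \<le> C * (rh p * qA p)"
    proof -
      have "nx p * (P p)\<^sup>2 \<le> hh p * (C * qA p)" using nh qge hp by (intro mult_mono) auto
      hence "E p * (nx p * (P p)\<^sup>2) \<le> E p * (hh p * (C * qA p))" using E by (intro mult_left_mono) auto
      thus ?thesis by (simp add: Y1d_def rh_def E_def mult_ac)
    qed
    have q0: "0 \<le> rh p * qA p"
    proof -
      have "0 \<le> C * qA p" using qge zero_le_power2[of "P p"] by linarith
      hence "0 \<le> qA p" using C(1) by (simp add: zero_le_mult_iff)
      thus ?thesis using hp wgt_pos[OF t] Gp_pos[of p] by (simp add: rh_def)
    qed
    have w2: "0 \<le> (w p)\<^sup>2" by simp
    have BqY: "E p * (w p)\<^sup>2 * Bq = Y0d p + S0d p"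
      by (simp add: Y0d_def S0d_def Kx_def Bq_def s_def algebra_simps)
    have i2: "E p * (w p)\<^sup>2 * er3 p \<le> 30 * C\<^sup>2 * (Y0d p + S0d p)"
    proof -
      have "E p * (w p)\<^sup>2 * er3 p \<le> E p * (w p)\<^sup>2 * (30 * C\<^sup>2 * Bq)" by (rule mult_left_mono[OF er]) (use E in simp)
      also have "\<dots> = 30 * C\<^sup>2 * (E p * (w p)\<^sup>2 * Bq)" by (simp add: mult_ac)
      finally show ?thesis unfolding BqY .
    qed
    have i3: "- (2 * rh p * w p * f p) \<le> Fd p + 5 * (Y0d p + S0d p)"
    proof -
      have "- (2 * hh p * w p * f p) \<le> gm (snd p) * (f p)\<^sup>2 + (hh p)\<^sup>2 * inverse (gm (snd p)) * (w p)\<^sup>2"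
      proof -
        have "0 \<le> (gm (snd p) * f p + hh p * w p)\<^sup>2 * inverse (gm (snd p))" using gm_pos[OF t] by simp
        also have "\<dots> = gm (snd p) * (f p)\<^sup>2 + 2 * hh p * w p * f p + (hh p)\<^sup>2 * inverse (gm (snd p)) * (w p)\<^sup>2"
          using gm_pos[OF t] by (simp add: power2_eq_square field_simps)
        finally show ?thesis by simp
      qed
      also have "(hh p)\<^sup>2 * inverse (gm (snd p)) * (w p)\<^sup>2 \<le> 5 * Bq * (w p)\<^sup>2"
      proof (rule mult_right_mono[OF _ w2])
        have "inverse (gm (snd p)) \<le> it (snd p)" using gm[OF t] ta by (auto simp: it_def ta_def intro!: le_imp_inverse_le)
        hence "(hh p)\<^sup>2 * inverse (gm (snd p)) \<le> (hh p)\<^sup>2 * it (snd p)" by (intro mult_left_mono) auto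
        also have "\<dots> = nx p * nx p * it (snd p) + 1" unfolding h2 using si by (simp add: power2_eq_square algebra_simps)
        also have "\<dots> \<le> 4 * nx p * it (snd p) + \<alpha> * it (snd p) * s"
        proof (rule add_mono)
          show "nx p * nx p * it (snd p) \<le> 4 * nx p * it (snd p)" using nx_le[OF p] ip by (intro mult_right_mono) auto
          have "1 \<le> it (snd p) * s" using s si ip mult_left_mono[of s 1 "s * it (snd p)"] by (simp add: mult_ac)
          thus "1 \<le> \<alpha> * it (snd p) * s" using pos mult_mono[of 1 \<alpha> 1 "it (snd p) * s"] by (simp add: mult.assoc)
        qed
        also have "\<dots> \<le> 4 * (\<alpha> * nx p * it (snd p)) + 1 * (\<alpha> * it (snd p) * s)"
          using pos ip mult_right_mono[of 1 \<alpha> "nx p * it (snd p)"] by (simp add: mult_ac)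
        also have "\<dots> \<le> 5 * Bq" using ip pos s by (simp add: Bq_def)
        finally show "(hh p)\<^sup>2 * inverse (gm (snd p)) \<le> 5 * Bq" .
      qed
      finally have "E p * (- (2 * hh p * w p * f p)) \<le> E p * (gm (snd p) * (f p)\<^sup>2 + 5 * Bq * (w p)\<^sup>2)"
        using E by (intro mult_left_mono) auto
      moreover have "E p * (5 * Bq * (w p)\<^sup>2) = 5 * (Y0d p + S0d p)" unfolding BqY[symmetric] by (simp add: mult_ac)
      moreover have "E p * (gm (snd p) * (f p)\<^sup>2) = Fd p" by (simp add: E_def Fd_def om_def mult_ac)
      ultimately show ?thesis by (simp add: E_def rh_def algebra_simps)
    qed
    have i4: "2 * rh p * w p * (V p * w p) \<le> 10 * (vb * Wd p)"
    proof -
      have "hh p * V p \<le> 5 * vb"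
      proof -
        have "hh p * V p \<le> hh p * vb" using hp V_bd[OF p] by (intro mult_left_mono) auto
        also have "\<dots> \<le> 5 * vb" using nh nx_le[OF p] s vb by (intro mult_right_mono) auto
        finally show ?thesis .
      qed
      hence "(2 * E p * (w p)\<^sup>2) * (hh p * V p) \<le> (2 * E p * (w p)\<^sup>2) * (5 * vb)" using E by (intro mult_left_mono) auto
      thus ?thesis by (simp add: rh_def E_def Wd_def power2_eq_square mult_ac)
    qed
    have id: "2 * (rh p * qA p) = (\<Sum>k\<in>UNIV. D3 k p $ k) + \<Phi>3' p - 2 * rh p * w p * f p + 2 * rh p * w p * (V p * w p) + E p * (w p)\<^sup>2 * er3 p"
      using gradient_identity[OF p] by (simp add: right_diff_distrib)
    have "rh p * qA p \<le> (\<Sum>k\<in>UNIV. D3 k p $ k) + \<Phi>3' p + (Fd p + 5 * (Y0d p + S0d p) + 10 * (vb * Wd p) + 30 * C\<^sup>2 * (Y0d p + S0d p))"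
      using id i2 i3 i4 q0 by linarith
    also have "\<dots> \<le> (\<Sum>k\<in>UNIV. D3 k p $ k) + \<Phi>3' p + 50 * C\<^sup>2 * (Fd p + (Y0d p + (S0d p + vb * Wd p)))"
    proof -
      have "1 * Fd p \<le> C\<^sup>2 * Fd p" "1 * (Y0d p + S0d p) \<le> C\<^sup>2 * (Y0d p + S0d p)" "1 * (vb * Wd p) \<le> C\<^sup>2 * (vb * Wd p)"
        using c3 dens_nonneg[OF p] vb by (intro mult_right_mono; simp)+
      moreover have "C\<^sup>2 * Fd p \<ge> 0" "C\<^sup>2 * (Y0d p + S0d p) \<ge> 0" "C\<^sup>2 * (vb * Wd p) \<ge> 0" using dens_nonneg[OF p] vb by auto
      moreover have "50 * C\<^sup>2 * (Fd p + (Y0d p + (S0d p + vb * Wd p))) = 50 * (C\<^sup>2 * Fd p) + 50 * (C\<^sup>2 * (Y0d p + S0d p)) + 50 * (C\<^sup>2 * (vb * Wd p))"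
        by (simp add: algebra_simps)
      moreover have "30 * C\<^sup>2 * (Y0d p + S0d p) = 30 * (C\<^sup>2 * (Y0d p + S0d p))" by simp
      ultimately show ?thesis by linarith
    qed
    finally have "C * (rh p * qA p) \<le> C * ((\<Sum>k\<in>UNIV. D3 k p $ k) + \<Phi>3' p + 50 * C\<^sup>2 * (Fd p + (Y0d p + (S0d p + vb * Wd p))))"
      using C(1) by (intro mult_left_mono) auto
    also have "\<dots> = C * ((\<Sum>k\<in>UNIV. D3 k p $ k) + \<Phi>3' p) + cc3 * (Fd p + (Y0d p + (S0d p + vb * Wd p)))"
      by (simp add: cc3_def c3(1)[symmetric] algebra_simps)
    finally show "Y1d p \<le> C * ((\<Sum>k\<in>UNIV. D3 k p $ k) + \<Phi>3' p) + cc3 * (Fd p + (Y0d p + (S0d p + vb * Wd p)))"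
      using i1 by linarith
  qed
  also have "\<dots> = C * (0 + II \<Phi>3') + cc3 * (II Fd + (II Y0d + (II S0d + vb * II Wd)))"
    by (simp only: II_add[OF tame_cmult[OF tame_add[OF tD t\<Phi>]] tame_cmult[OF tame_add[OF tame_dens(9) tame_add[OF tame_dens(4) tame_add[OF tame_dens(6) tame_cmult[OF tame_dens(5)]]]]]]
       II_add[OF tD t\<Phi>] II_cmult integral_D3 II_add[OF tame_dens(9) tame_add[OF tame_dens(4) tame_add[OF tame_dens(6) tame_cmult[OF tame_dens(5)]]]]
       II_add[OF tame_dens(4) tame_add[OF tame_dens(6) tame_cmult[OF tame_dens(5)]]] II_add[OF tame_dens(6) tame_cmult[OF tame_dens(5)]])
  also have "\<dots> \<le> cc3 * (II Fd + (II Y0d + (II S0d + vb * II Wd)))"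
    using integral_\<Phi>3' C(1) by (simp add: mult_nonneg_nonpos)
  finally show ?thesis by (simp add: add.assoc)
qed

end

section \<open>Second derivatives and the frozen coefficients\<close>

lemma sum_sq_le:
  fixes a :: "'m::finite \<Rightarrow> real"
  shows "(\<Sum>k\<in>UNIV. a k)\<^sup>2 \<le> real CARD('m) * (\<Sum>k\<in>UNIV. (a k)\<^sup>2)"
  using Cauchy_Schwarz_ineq_sum[of "\<lambda>_. 1" a "UNIV :: 'm set"] by simp

lemma sq_add_le: "(u + v + z)\<^sup>2 \<le> 3 * (u\<^sup>2 + v\<^sup>2 + z\<^sup>2)" for u v z :: real
proof -
  have "0 \<le> (u - v)\<^sup>2 + (v - z)\<^sup>2 + (u - z)\<^sup>2" by simp
  thus ?thesis by (simp add: power2_eq_square algebra_simps)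
qed

context carleman_setting
begin

text \<open>The field \<open>\<Psi>5 = rho (L F - D\<^sup>2w F)\<close>, with \<open>L\<close> the Laplacian, is the classical one of the \<open>H\<^sup>2\<close> estimate: third derivatives cancel
in its divergence, which leaves \<open>L div F\<close> minus a quadratic form in the Hessian.\<close>

definition "h3 k i p = (\<chi> j. dd (axis k 1, 0) (dd (axis j 1, 0) (dd (axis i 1, 0) w)) p)"
definition "L p = (\<Sum>i\<in>UNIV. hw i p $ i)"
definition "dL k p = (\<Sum>i\<in>UNIV. h3 k i p $ i)"
definition "h2 p = (\<Sum>k\<in>UNIV. (norm (hw k p))\<^sup>2)"
definition "hs p = (\<Sum>k\<in>UNIV. norm (hw k p))"
definition "vv p = (\<chi> j. F p \<bullet> hw j p)"
definition "dvv k p = (\<chi> j. F p \<bullet> h3 k j p + dF k p \<bullet> hw j p)"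
definition "rho p = om (snd p) * snd p * Gp p"
definition "drho k p = - (fst p $ k) * it (snd p) / 2 * rho p"
definition "\<Psi>5 p = (rho p * L p) *\<^sub>R F p - rho p *\<^sub>R vv p"
definition "D5 k p = (rho p * L p) *\<^sub>R dF k p + (rho p * dL k p + drho k p * L p) *\<^sub>R F p - (rho p *\<^sub>R dvv k p + drho k p *\<^sub>R vv p)"
definition "H2d p = rho p * h2 p"

lemma xd_hw: "xd k p (hw i) (h3 k i p)"
  unfolding hw_def[abs_def] h3_def by (intro xd_vec xd_smooth smooth_dd w)

lemma xlip_h3: "xlip T (h3 k i)" unfolding h3_def[abs_def] by (intro xlip_vec xlip_smooth smooth_dd w)
lemma xlip_L: "xlip T L" unfolding L_def[abs_def] by (intro xlip_sum xlip_vec_nth xlip_hw)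
lemma xlip_vv: "xlip T vv" unfolding vv_def[abs_def] by (intro xlip_vec xlip_inner xlip_F xlip_hw)
lemma xlip_omt: "xlip T (\<lambda>p :: (real^'n) \<times> real. om (snd p) * snd p)"
  by (rule xlip_time[of T "\<lambda>t. om t * t"]) (intro continuous_intros cont_time)
lemma xlip_rho: "xlip T rho" unfolding rho_def[abs_def] by (intro xlip_mult xlip_omt xlip_Gp)

lemma xd_rho: assumes "p \<in> strip T" shows "xd k p rho (drho k p)"
  unfolding rho_def[abs_def]
  by (rule xd_cong[OF xd_mult[OF xd_time[where \<phi>="\<lambda>t. om t * t"] xd_Gp[OF assms]]]) (simp add: drho_def rho_def)

lemma third_sym: "h3 k i p $ i = h3 i i p $ k"
  unfolding h3_def using dd_commute[OF smooth_dd[OF w], of "(axis k 1, 0)" "(axis i 1, 0)"] by simp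

lemma tame_D5: "tame T (D5 k)"
proof -
  have dvv: "tame T (dvv k)"
  proof -
    have eq: "dvv k p = (\<Sum>j\<in>UNIV. (F p \<bullet> h3 k j p + dF k p \<bullet> hw j p) *\<^sub>R axis j 1)" for p
      by (simp add: dvv_def vec_eq_iff axis_def if_distrib[where f="\<lambda>x. _ * x"] cong: if_cong)
    show ?thesis unfolding eq[abs_def] by (intro tame_ops tame_all xlip_tame[OF xlip_h3])
  qed
  have dL: "tame T (dL k)" unfolding dL_def[abs_def] by (intro tame_ops xlip_tame[OF xlip_h3])
  have drho: "tame T (drho k)"
  proof -
    have "tame T (\<lambda>p. - (fst p $ k) * it (snd p) * (1/2) * rho p)" by (intro tame_ops tame_all xlip_tame[OF xlip_rho])
    thus ?thesis by (simp add: drho_def[abs_def])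
  qed
  show ?thesis unfolding D5_def[abs_def]
    by (intro tame_ops tame_all dvv dL drho xlip_tame[OF xlip_rho] xlip_tame[OF xlip_L] xlip_tame[OF xlip_vv])
qed

lemma integral_D5: "II (\<lambda>p. \<Sum>k\<in>UNIV. D5 k p $ k) = 0"
proof (rule divergence_integral[OF _ _ tame_D5])
  show "xlip T \<Psi>5" unfolding \<Psi>5_def[abs_def] by (intro xlip_ops xlip_all xlip_rho xlip_L xlip_vv)
  show "\<Psi>5 (x, t) = 0" if "t \<in> {0..T}" "norm x \<ge> r'" for x t
    using F_zero[of t x] that by (simp add: \<Psi>5_def vv_def zero_vec_def[symmetric])
  show "AE p in \<mu> T. \<forall>k. xd k p \<Psi>5 (D5 k p)"
    using AE_reg
  proof eventually_elim
    case (elim p)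
    hence s: "p \<in> strip T" by (simp add: reg_def)
    have L: "xd k p L (dL k p)" for k unfolding L_def[abs_def] dL_def
    proof (rule xd_sum)
      fix i
      have "xd k p (\<lambda>q. hw i q \<bullet> axis i 1) (hw i p \<bullet> 0 + h3 k i p \<bullet> axis i 1)" by (rule xd_inner[OF xd_hw xd_const])
      thus "xd k p (\<lambda>q. hw i q $ i) (h3 k i p $ i)" by (simp add: inner_axis)
    qed
    have v: "xd k p vv (dvv k p)" for k unfolding vv_def[abs_def] dvv_def
      by (intro xd_vec xd_inner xd_F elim xd_hw)
    show ?case unfolding \<Psi>5_def[abs_def] D5_def
      by (intro allI xd_diff[OF xd_scaleR[OF xd_mult[OF xd_rho[OF s] L] xd_F[OF elim]] xd_scaleR[OF xd_rho[OF s] v]])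
  qed
qed

lemma sum_D5: "(\<Sum>k\<in>UNIV. D5 k p $ k) = rho p * (L p * Sw p + it (snd p) / 2 * (\<Sum>k\<in>UNIV. fst p $ k * (F p \<bullet> hw k p))
    - (\<Sum>k\<in>UNIV. (A0 p *v hw k p) \<bullet> hw k p) - (\<Sum>k\<in>UNIV. (dA0 k p *v gw p) \<bullet> hw k p))"
proof -
  have s3: "(\<Sum>k\<in>UNIV. dL k p * F p $ k) = (\<Sum>k\<in>UNIV. F p \<bullet> h3 k k p)"
  proof -
    have "(\<Sum>k\<in>UNIV. dL k p * F p $ k) = (\<Sum>k\<in>UNIV. \<Sum>i\<in>UNIV. F p $ k * h3 i i p $ k)"
      unfolding dL_def sum_distrib_right
    proof (intro sum.cong refl)
      fix k i show "h3 k i p $ i * F p $ k = F p $ k * h3 i i p $ k"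
        using third_sym[of k i p] by simp
    qed
    also have "\<dots> = (\<Sum>i\<in>UNIV. \<Sum>k\<in>UNIV. F p $ k * h3 i i p $ k)" by (rule sum.swap)
    also have "\<dots> = (\<Sum>i\<in>UNIV. F p \<bullet> h3 i i p)" by (simp add: inner_vec_sum[of "F p"])
    finally show ?thesis .
  qed
  have dec: "D5 k p $ k = rho p * (L p * dF k p $ k + dL k p * F p $ k - it (snd p) / 2 * L p * (F p $ k * fst p $ k)
     - F p \<bullet> h3 k k p - (A0 p *v hw k p) \<bullet> hw k p - (dA0 k p *v gw p) \<bullet> hw k p + it (snd p) / 2 * (fst p $ k * (F p \<bullet> hw k p)))" for k
    by (simp add: D5_def dvv_def vv_def drho_def dF_def inner_add_left algebra_simps)
  have sm: "(\<Sum>k\<in>UNIV. F p $ k * fst p $ k) = F p \<bullet> fst p" by (simp add: inner_vec_sum)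
  show ?thesis unfolding dec sum_distrib_left[symmetric] sum.distrib sum_subtractf s3 sm m_def[symmetric]
    by (simp add: Sw_def algebra_simps)
qed

lemma hs_sq: "(hs p)\<^sup>2 \<le> C * h2 p"
proof -
  have "(hs p)\<^sup>2 \<le> real CARD('n) * h2 p" unfolding hs_def h2_def by (rule sum_sq_le)
  also have "\<dots> \<le> C * h2 p" using C by (intro mult_right_mono) (auto simp: h2_def sum_nonneg)
  finally show ?thesis .
qed

lemma hs_nonneg: "hs p \<ge> 0" by (simp add: hs_def sum_nonneg)
lemma h2_nonneg: "h2 p \<ge> 0" by (simp add: h2_def sum_nonneg)

lemma sum_hs: assumes "\<And>k. \<bar>g k\<bar> \<le> B * norm (hw k p)" shows "\<bar>\<Sum>k\<in>UNIV. g k\<bar> \<le> B * hs p"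
  unfolding hs_def sum_distrib_left by (rule order_trans[OF sum_abs sum_mono]) (rule assms)

lemma rho_nonneg: "p \<in> strip T \<Longrightarrow> rho p \<ge> 0"
  using om_pos[OF strip_T(1), of p] strip_T(1)[of p] Gp_pos[of p] by (simp add: rho_def)

text \<open>Ellipticity bounds the quadratic form from below by \<open>|D\<^sup>2w|\<^sup>2/C\<close>; the other terms are at most \<open>|D\<^sup>2w|\<close> times \<open>|Sw|\<close> or
\<open>(1 + |x|/\<tau>) |\<nabla>w|\<close> and are absorbed.\<close>

lemma second_derivative_pointwise: assumes p: "p \<in> strip T"
  shows "H2d p \<le> - (2 * C) * (\<Sum>k\<in>UNIV. D5 k p $ k) + 3 * C^3 * (rho p * (Sw p)\<^sup>2 + C\<^sup>2 * (rho p * (((it (snd p))\<^sup>2 * (nx p)\<^sup>2 + 1) * (P p)\<^sup>2)))"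
proof -
  note t = strip_T(1)[OF p]
  have ip: "it (snd p) > 0" by (rule it_pos[OF t])
  define S1 where "S1 = (\<Sum>k\<in>UNIV. fst p $ k * (F p \<bullet> hw k p))"
  define S2 where "S2 = (\<Sum>k\<in>UNIV. (A0 p *v hw k p) \<bullet> hw k p)"
  define S3 where "S3 = (\<Sum>k\<in>UNIV. (dA0 k p *v gw p) \<bullet> hw k p)"
  have S1: "\<bar>S1\<bar> \<le> (nx p * (C * P p)) * hs p" unfolding S1_def
  proof (rule sum_hs)
    fix k
    have "\<bar>fst p $ k\<bar> \<le> nx p" unfolding nx_def by (rule component_le_norm_cart)
    moreover have "\<bar>F p \<bullet> hw k p\<bar> \<le> (C * P p) * norm (hw k p)" by (rule abs_inner_mono[OF F_le order_refl])
    ultimately have "\<bar>fst p $ k\<bar> * \<bar>F p \<bullet> hw k p\<bar> \<le> nx p * ((C * P p) * norm (hw k p))" by (intro mult_mono) auto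
    thus "\<bar>fst p $ k * (F p \<bullet> hw k p)\<bar> \<le> nx p * (C * P p) * norm (hw k p)" by (simp add: abs_mult mult.assoc)
  qed
  have S3: "\<bar>S3\<bar> \<le> (C * P p) * hs p" unfolding S3_def
    by (rule sum_hs, rule abs_inner_mono, rule mv_le) (simp_all add: dA0(2) P_def)
  have L: "\<bar>L p\<bar> \<le> 1 * hs p" unfolding L_def by (rule sum_hs) (simp add: component_le_norm_cart)
  have S2: "h2 p \<le> C * S2"
    unfolding h2_def S2_def sum_distrib_left
  proof (rule sum_mono)
    fix k show "(norm (hw k p))\<^sup>2 \<le> C * ((A0 p *v hw k p) \<bullet> hw k p)"
      using A_ell[of "hw k p" "(fst p, 0)"] by (simp add: A0_def inner_commute)
  qed
  define Bb where "Bb = \<bar>Sw p\<bar> + C * (it (snd p) * nx p) * P p + C * P p"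
  have Bb0: "Bb \<ge> 0" using C(1) ip by (simp add: Bb_def)
  have up: "L p * Sw p + it (snd p) / 2 * S1 - S3 \<le> hs p * Bb"
  proof -
    have "L p * Sw p \<le> \<bar>L p\<bar> * \<bar>Sw p\<bar>" unfolding abs_mult[symmetric] by simp
    also have "\<dots> \<le> hs p * \<bar>Sw p\<bar>" using L by (intro mult_right_mono) auto
    finally have 1: "L p * Sw p \<le> hs p * \<bar>Sw p\<bar>" .
    have "it (snd p) / 2 * S1 \<le> it (snd p) / 2 * ((nx p * (C * P p)) * hs p)" using S1 ip by (intro mult_left_mono) auto
    also have "\<dots> \<le> it (snd p) * ((nx p * (C * P p)) * hs p)"
      using ip C(1) hs_nonneg[of p] by (intro mult_right_mono) auto
    finally have 2: "it (snd p) / 2 * S1 \<le> hs p * (C * (it (snd p) * nx p) * P p)" by (simp add: mult_ac)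
    have 3: "- S3 \<le> hs p * (C * P p)" using S3 by (simp add: mult_ac)
    show ?thesis using 1 2 3 unfolding Bb_def distrib_left by linarith
  qed
  have young: "hs p * Bb \<le> h2 p / (2 * C) + C\<^sup>2 * Bb\<^sup>2 / 2"
  proof -
    have "0 \<le> (hs p - C\<^sup>2 * Bb)\<^sup>2" by simp
    hence "2 * C\<^sup>2 * (hs p * Bb) \<le> (hs p)\<^sup>2 + (C\<^sup>2 * Bb)\<^sup>2" by (simp add: power2_diff mult_ac)
    also have "\<dots> \<le> C * h2 p + (C\<^sup>2 * Bb)\<^sup>2" using hs_sq by simp
    finally have "2 * C\<^sup>2 * (hs p * Bb) / (2 * C\<^sup>2) \<le> (C * h2 p + (C\<^sup>2 * Bb)\<^sup>2) / (2 * C\<^sup>2)" using C(1) by (intro divide_right_mono) auto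
    thus ?thesis using C(1) by (simp add: add_divide_distrib power2_eq_square mult_ac)
  qed
  have Bsq: "Bb\<^sup>2 \<le> 3 * ((Sw p)\<^sup>2 + C\<^sup>2 * (((it (snd p))\<^sup>2 * (nx p)\<^sup>2 + 1) * (P p)\<^sup>2))"
    using sq_add_le[of "\<bar>Sw p\<bar>" "C * (it (snd p) * nx p) * P p" "C * P p"]
    by (simp add: Bb_def power_mult_distrib algebra_simps)
  have "h2 p / C \<le> S2" using S2 C(1) by (simp add: field_simps)
  moreover have "h2 p / C = 2 * (h2 p / (2 * C))" by simp
  ultimately have "h2 p / (2 * C) \<le> S2 - (L p * Sw p + it (snd p) / 2 * S1 - S3) + C\<^sup>2 * Bb\<^sup>2 / 2"
    using up young by linarith
  hence "2 * C * (h2 p / (2 * C)) \<le> 2 * C * (S2 - (L p * Sw p + it (snd p) / 2 * S1 - S3) + C\<^sup>2 * Bb\<^sup>2 / 2)"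
    using C(1) by (intro mult_left_mono) auto
  hence "h2 p \<le> - (2 * C) * (L p * Sw p + it (snd p) / 2 * S1 - S2 - S3) + C^3 * Bb\<^sup>2"
    using C(1) by (simp add: power2_eq_square power3_eq_cube algebra_simps)
  also have "\<dots> \<le> - (2 * C) * (L p * Sw p + it (snd p) / 2 * S1 - S2 - S3) + C^3 * (3 * ((Sw p)\<^sup>2 + C\<^sup>2 * (((it (snd p))\<^sup>2 * (nx p)\<^sup>2 + 1) * (P p)\<^sup>2)))"
    using Bsq C(1) by (intro add_left_mono mult_left_mono) auto
  finally have "rho p * h2 p \<le> rho p * (- (2 * C) * (L p * Sw p + it (snd p) / 2 * S1 - S2 - S3) + C^3 * (3 * ((Sw p)\<^sup>2 + C\<^sup>2 * (((it (snd p))\<^sup>2 * (nx p)\<^sup>2 + 1) * (P p)\<^sup>2))))"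
    using rho_nonneg[OF p] by (rule mult_left_mono)
  also have "\<dots> = - (2 * C) * (rho p * (L p * Sw p + it (snd p) / 2 * S1 - S2 - S3)) + 3 * C^3 * (rho p * (Sw p)\<^sup>2 + C\<^sup>2 * (rho p * (((it (snd p))\<^sup>2 * (nx p)\<^sup>2 + 1) * (P p)\<^sup>2)))"
    by (simp add: algebra_simps)
  finally show ?thesis unfolding sum_D5 H2d_def S1_def S2_def S3_def .
qed

lemma omt_le: assumes "t \<in> {0..T}" shows "om t * t \<le> exp 60 * (ta t)\<^sup>2 * wgt t" "om t * t \<le> exp 60 * ta t * wgt t" "lam * t \<le> 1" "t * ka t \<le> \<alpha>"
  "vb * (ta t)\<^sup>2 \<le> 1"
proof -
  have tt: "0 \<le> t" "t \<le> ta t" "ta t > 0" "ta t \<le> 1" using assms pos ta_pos[of t] lam_ta(3)[OF assms] by (auto simp: ta_def)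
  have "om t * t \<le> (exp 60 * (ta t * wgt t)) * ta t"
    using om_le[OF assms] tt wgt_pos[OF assms] by (intro mult_mono) auto
  thus 1: "om t * t \<le> exp 60 * (ta t)\<^sup>2 * wgt t" by (simp add: power2_eq_square mult_ac)
  have "(ta t)\<^sup>2 \<le> ta t" using tt by (simp add: power2_eq_square mult_left_le)
  hence "exp 60 * (ta t)\<^sup>2 * wgt t \<le> exp 60 * ta t * wgt t" using wgt_pos[OF assms] by (intro mult_right_mono mult_left_mono) auto
  thus "om t * t \<le> exp 60 * ta t * wgt t" using 1 by linarith
  have "lam * t \<le> lam * ta t" using tt pos by (intro mult_left_mono) auto
  thus "lam * t \<le> 1" using lam_ta(2)[OF assms] by simp
  have "t * ka t \<le> ta t * (\<alpha> * it t)" using tt ka_le[OF assms] ka_pos[OF assms] by (intro mult_mono) auto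
  also have "\<dots> = \<alpha>" using ta_it[OF assms] by (simp add: mult_ac)
  finally show "t * ka t \<le> \<alpha>" .
  have "\<alpha> * ta t \<le> lam * ta t" using pos tt by (intro mult_right_mono) auto
  hence a1: "\<alpha> * ta t \<le> 1" using lam_ta(2)[OF assms] by simp
  have "vb * (ta t)\<^sup>2 \<le> \<alpha>\<^sup>2 * (ta t)\<^sup>2" using vb by (intro mult_right_mono) auto
  also have "\<dots> = (\<alpha> * ta t)\<^sup>2" by (simp add: power_mult_distrib)
  also have "\<dots> \<le> 1" using a1 pos tt by (intro power_le_one) auto
  finally show "vb * (ta t)\<^sup>2 \<le> 1" .
qed

definition "cc5 = 1200 * C^5 * exp 60"

text \<open>As \<open>rho\<close> is at most a multiple of \<open>\<tau>\<^sup>2 E\<close>, the weight \<open>|x|\<^sup>2/\<tau>\<^sup>2\<close> of the gradient becomes \<open>|x|\<^sup>2 \<le> 4 |x|\<close>, which is how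
\<open>Y1d\<close> enters. The factor \<open>t\<close> in \<open>rho\<close> also makes the coefficient of \<open>Zd\<close> as small as \<open>1/\<lambda>\<close>.\<close>

theorem second_derivative_inequality:
  "II H2d \<le> cc5 * ((1 / lam) * II Zd + \<alpha>\<^sup>2 * II Wd + II Y0d + II Y1d + II X2d)"
proof -
  have tD: "tame T (\<lambda>p. \<Sum>k\<in>UNIV. D5 k p $ k)" by (intro tame_ops tame_D5)
  have tH: "tame T H2d" unfolding H2d_def[abs_def] h2_def[abs_def] by (intro tame_ops tame_all xlip_tame[OF xlip_rho])
  have "II H2d \<le> II (\<lambda>p. - (2 * C) * (\<Sum>k\<in>UNIV. D5 k p $ k) + cc5 * ((1 / lam) * Zd p + (\<alpha>\<^sup>2 * Wd p + (Y0d p + (Y1d p + X2d p)))))"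
  proof (rule integral_\<mu>_mono[OF tH])
    show "tame T (\<lambda>p. - (2 * C) * (\<Sum>k\<in>UNIV. D5 k p $ k) + cc5 * ((1 / lam) * Zd p + (\<alpha>\<^sup>2 * Wd p + (Y0d p + (Y1d p + X2d p)))))"
      by (intro tame_add tame_cmult tame_dens tD)
    fix p :: "(real^'n) \<times> real" assume p: "p \<in> strip T"
    note t = strip_T(1)[OF p]
    have G: "Gp p \<ge> 0" by (rule Gp_pos)
    have E: "E p \<ge> 0" by (rule E_nonneg[OF p])
    have ip: "it (snd p) > 0" by (rule it_pos[OF t])
    have r1: "rho p \<le> exp 60 * (ta (snd p))\<^sup>2 * E p" "rho p \<le> exp 60 * ta (snd p) * E p"
      using mult_right_mono[OF omt_le(1)[OF t] G] mult_right_mono[OF omt_le(2)[OF t] G] by (simp_all add: rho_def E_def mult_ac)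
    have e60: "(1::real) \<le> exp 60" by simp
    have C2: "1 \<le> C\<^sup>2" using C_le_power[of 0 2] by simp
    have a: "rho p * (P p)\<^sup>2 \<le> exp 60 * X2d p"
      using mult_right_mono[OF r1(2), of "(P p)\<^sup>2"] by (simp add: X2d_def mult_ac)
    have b: "rho p * ((it (snd p))\<^sup>2 * (nx p)\<^sup>2 * (P p)\<^sup>2) \<le> 4 * exp 60 * Y1d p"
    proof -
      have "rho p * ((it (snd p))\<^sup>2 * (nx p)\<^sup>2 * (P p)\<^sup>2) \<le> (exp 60 * (ta (snd p))\<^sup>2 * E p) * ((it (snd p))\<^sup>2 * (nx p)\<^sup>2 * (P p)\<^sup>2)"
        by (rule mult_right_mono[OF r1(1)]) simp
      also have "\<dots> = (ta (snd p) * it (snd p))\<^sup>2 * (exp 60 * E p * (P p)\<^sup>2) * (nx p * nx p)" by (simp add: power2_eq_square mult_ac)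
      also have "\<dots> = exp 60 * E p * (P p)\<^sup>2 * (nx p * nx p)" using ta_it[OF t] by simp
      also have "\<dots> \<le> exp 60 * E p * (P p)\<^sup>2 * (4 * nx p)" using nx_le[OF p] E by (intro mult_left_mono mult_right_mono) auto
      finally show ?thesis by (simp add: Y1d_def mult_ac)
    qed
    have c: "rho p * (St p)\<^sup>2 \<le> (1 / lam) * Zd p"
    proof -
      have "lam * (rho p * (St p)\<^sup>2) = (lam * snd p) * Zd p" by (simp add: rho_def Zd_def mult_ac)
      also have "\<dots> \<le> 1 * Zd p" using omt_le(3)[OF t] dens_nonneg[OF p] by (intro mult_right_mono) auto
      finally show ?thesis using pos by (simp add: field_simps)
    qed
    have d: "rho p * ((ka (snd p))\<^sup>2 * (w p)\<^sup>2) \<le> \<alpha>\<^sup>2 * Wd p"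
    proof -
      have "om (snd p) * ka (snd p) = \<alpha> * wgt (snd p)" using gm_ka[OF t] by (simp add: om_def mult_ac)
      hence "rho p * ((ka (snd p))\<^sup>2 * (w p)\<^sup>2) = (\<alpha> * wgt (snd p)) * (snd p * ka (snd p)) * Gp p * (w p)\<^sup>2"
        by (simp add: rho_def power2_eq_square mult_ac)
      also have "\<dots> \<le> (\<alpha> * wgt (snd p)) * \<alpha> * Gp p * (w p)\<^sup>2"
        using omt_le(4)[OF t] pos wgt_pos[OF t] G by (intro mult_right_mono mult_left_mono) auto
      finally show ?thesis by (simp add: Wd_def E_def power2_eq_square mult_ac)
    qed
    have e: "rho p * ((U p)\<^sup>2 * (w p)\<^sup>2) \<le> 2 * exp 60 * (\<alpha>\<^sup>2 * Wd p) + 128 * C\<^sup>2 * exp 60 * Y0d p"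
    proof -
      define k where "k = nx p ^ 3 * (it (snd p))\<^sup>2"
      have k0: "k \<ge> 0" by (simp add: k_def)
      have "(U p)\<^sup>2 \<le> (vb + C * k)\<^sup>2" using U_le[OF p] by (intro abs_le_square_iff[THEN iffD1]) (use vb C k0 in \<open>simp add: k_def\<close>)
      also have "\<dots> \<le> 2 * vb\<^sup>2 + 2 * (C * k)\<^sup>2" using sum_squares_bound[of vb "C * k"] by (simp add: power2_sum)
      finally have "(ta (snd p))\<^sup>2 * (U p)\<^sup>2 \<le> (ta (snd p))\<^sup>2 * (2 * vb\<^sup>2 + 2 * (C * k)\<^sup>2)" by (intro mult_left_mono) auto
      also have "\<dots> = 2 * vb * (vb * (ta (snd p))\<^sup>2) + 2 * C\<^sup>2 * (k * ((ta (snd p))\<^sup>2 * k))" by (simp add: power2_eq_square algebra_simps)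
      also have "(ta (snd p))\<^sup>2 * k = (ta (snd p) * it (snd p))\<^sup>2 * nx p ^ 3" by (simp add: k_def power_mult_distrib mult_ac)
      also have "\<dots> = nx p ^ 3" using ta_it[OF t] by simp
      also have "2 * vb * (vb * (ta (snd p))\<^sup>2) + 2 * C\<^sup>2 * (k * nx p ^ 3) \<le> 2 * vb * 1 + 2 * C\<^sup>2 * (k * 64)"
      proof -
        have "nx p ^ 3 \<le> 4 ^ 3" using nx_le[OF p] by (intro power_mono) auto
        thus ?thesis using omt_le(5)[OF t] vb k0 by (intro add_mono mult_left_mono) auto
      qed
      also have "\<dots> \<le> 2 * \<alpha>\<^sup>2 + 128 * C\<^sup>2 * Kx p"
      proof -
        have "k \<le> Kx p" using pos ip by (simp add: Kx_def k_def)
        hence "C\<^sup>2 * k \<le> C\<^sup>2 * Kx p" by (rule mult_left_mono) simp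
        thus ?thesis using vb by simp
      qed
      finally have 1: "(ta (snd p))\<^sup>2 * (U p)\<^sup>2 \<le> 2 * \<alpha>\<^sup>2 + 128 * C\<^sup>2 * Kx p" .
      have "rho p * ((U p)\<^sup>2 * (w p)\<^sup>2) \<le> (exp 60 * (ta (snd p))\<^sup>2 * E p) * ((U p)\<^sup>2 * (w p)\<^sup>2)"
        by (rule mult_right_mono[OF r1(1)]) simp
      also have "\<dots> = (exp 60 * E p * (w p)\<^sup>2) * ((ta (snd p))\<^sup>2 * (U p)\<^sup>2)" by (simp add: mult_ac)
      also have "\<dots> \<le> (exp 60 * E p * (w p)\<^sup>2) * (2 * \<alpha>\<^sup>2 + 128 * C\<^sup>2 * Kx p)" by (rule mult_left_mono[OF 1]) (use E in simp)
      finally show ?thesis by (simp add: Wd_def Y0d_def algebra_simps)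
    qed
    have Sq: "rho p * (Sw p)\<^sup>2 \<le> 3 * ((1 / lam) * Zd p + (2 * exp 60 * (\<alpha>\<^sup>2 * Wd p) + 128 * C\<^sup>2 * exp 60 * Y0d p) + \<alpha>\<^sup>2 * Wd p)"
    proof -
      have "Sw p = St p + (- U p * w p) + (- ka (snd p) * w p)" by (simp add: St_def algebra_simps)
      hence "(Sw p)\<^sup>2 \<le> 3 * ((St p)\<^sup>2 + (U p)\<^sup>2 * (w p)\<^sup>2 + (ka (snd p))\<^sup>2 * (w p)\<^sup>2)"
        using sq_add_le[of "St p" "- U p * w p" "- ka (snd p) * w p"] by (simp add: power_mult_distrib)
      hence "rho p * (Sw p)\<^sup>2 \<le> rho p * (3 * ((St p)\<^sup>2 + (U p)\<^sup>2 * (w p)\<^sup>2 + (ka (snd p))\<^sup>2 * (w p)\<^sup>2))"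
        by (rule mult_left_mono[OF _ rho_nonneg[OF p]])
      also have "\<dots> = 3 * (rho p * (St p)\<^sup>2 + rho p * ((U p)\<^sup>2 * (w p)\<^sup>2) + rho p * ((ka (snd p))\<^sup>2 * (w p)\<^sup>2))" by (simp add: algebra_simps)
      also have "\<dots> \<le> 3 * ((1 / lam) * Zd p + (2 * exp 60 * (\<alpha>\<^sup>2 * Wd p) + 128 * C\<^sup>2 * exp 60 * Y0d p) + \<alpha>\<^sup>2 * Wd p)"
        by (intro mult_left_mono add_mono c d e) simp
      finally show ?thesis .
    qed
    have fin: "rho p * (Sw p)\<^sup>2 + C\<^sup>2 * (rho p * (((it (snd p))\<^sup>2 * (nx p)\<^sup>2 + 1) * (P p)\<^sup>2))
       \<le> 400 * (C\<^sup>2 * exp 60 * ((1 / lam) * Zd p + (\<alpha>\<^sup>2 * Wd p + (Y0d p + (Y1d p + X2d p)))))"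
    proof -
      define k where "k = C\<^sup>2 * exp 60"
      have k1: "exp 60 \<le> k" "1 \<le> k" "C\<^sup>2 \<le> k"
        using mult_right_mono[OF C2, of "exp 60"] mult_left_mono[OF e60, of "C\<^sup>2"] e60 C2 by (auto simp: k_def)
      have nn: "(1 / lam) * Zd p \<ge> 0" "\<alpha>\<^sup>2 * Wd p \<ge> 0" "Y0d p \<ge> 0" "Y1d p \<ge> 0" "X2d p \<ge> 0" using dens_nonneg[OF p] pos by auto
      have m: "1 * ((1 / lam) * Zd p) \<le> k * ((1 / lam) * Zd p)" "exp 60 * (\<alpha>\<^sup>2 * Wd p) \<le> k * (\<alpha>\<^sup>2 * Wd p)" "1 * (\<alpha>\<^sup>2 * Wd p) \<le> k * (\<alpha>\<^sup>2 * Wd p)"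
        using k1 nn by (intro mult_right_mono; simp)+
      have kn: "k * ((1 / lam) * Zd p) \<ge> 0" "k * (\<alpha>\<^sup>2 * Wd p) \<ge> 0" "k * Y0d p \<ge> 0" "k * Y1d p \<ge> 0" "k * X2d p \<ge> 0"
      proof -
        have k0: "0 \<le> k" using k1(2) by simp
        show "k * ((1 / lam) * Zd p) \<ge> 0" "k * (\<alpha>\<^sup>2 * Wd p) \<ge> 0" "k * Y0d p \<ge> 0" "k * Y1d p \<ge> 0" "k * X2d p \<ge> 0"
          by (rule mult_nonneg_nonneg[OF k0 nn(1)], rule mult_nonneg_nonneg[OF k0 nn(2)], rule mult_nonneg_nonneg[OF k0 nn(3)],
              rule mult_nonneg_nonneg[OF k0 nn(4)], rule mult_nonneg_nonneg[OF k0 nn(5)])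
      qed
      have "C\<^sup>2 * (rho p * (((it (snd p))\<^sup>2 * (nx p)\<^sup>2 + 1) * (P p)\<^sup>2)) = C\<^sup>2 * (rho p * ((it (snd p))\<^sup>2 * (nx p)\<^sup>2 * (P p)\<^sup>2)) + C\<^sup>2 * (rho p * (P p)\<^sup>2)"
        by (simp add: algebra_simps)
      also have "\<dots> \<le> C\<^sup>2 * (4 * exp 60 * Y1d p) + C\<^sup>2 * (exp 60 * X2d p)" by (intro add_mono mult_left_mono a b) auto
      also have "\<dots> = 4 * (k * Y1d p) + k * X2d p" by (simp add: k_def)
      finally have 2: "C\<^sup>2 * (rho p * (((it (snd p))\<^sup>2 * (nx p)\<^sup>2 + 1) * (P p)\<^sup>2)) \<le> 4 * (k * Y1d p) + k * X2d p" .
      have "rho p * (Sw p)\<^sup>2 \<le> 3 * (k * ((1 / lam) * Zd p) + (2 * (k * (\<alpha>\<^sup>2 * Wd p)) + 128 * (k * Y0d p)) + k * (\<alpha>\<^sup>2 * Wd p))"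
      proof -
        have e1: "2 * exp 60 * (\<alpha>\<^sup>2 * Wd p) = 2 * (exp 60 * (\<alpha>\<^sup>2 * Wd p))" by simp
        have e2: "128 * C\<^sup>2 * exp 60 * Y0d p = 128 * (k * Y0d p)" by (simp add: k_def)
        have gen: "s \<le> 3 * (z + (2 * ew + 128 * ky) + wv) \<Longrightarrow> z \<le> kz \<Longrightarrow> ew \<le> kw \<Longrightarrow> wv \<le> kw \<Longrightarrow> s \<le> 3 * (kz + (2 * kw + 128 * ky) + kw)"
          for s z ew wv kz kw ky :: real
        proof -
          assume h: "s \<le> 3 * (z + (2 * ew + 128 * ky) + wv)" "z \<le> kz" "ew \<le> kw" "wv \<le> kw"
          have "3 * (z + (2 * ew + 128 * ky) + wv) \<le> 3 * (kz + (2 * kw + 128 * ky) + kw)"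
            by (intro mult_left_mono add_mono h order_refl) auto
          with h(1) show "s \<le> 3 * (kz + (2 * kw + 128 * ky) + kw)" by (rule order_trans)
        qed
        show ?thesis by (rule gen[OF Sq[unfolded e1 e2] m(1)[unfolded mult_1] m(2) m(3)[unfolded mult_1]])
      qed
      moreover have "400 * (C\<^sup>2 * exp 60 * ((1 / lam) * Zd p + (\<alpha>\<^sup>2 * Wd p + (Y0d p + (Y1d p + X2d p)))))
        = 400 * (k * ((1 / lam) * Zd p)) + 400 * (k * (\<alpha>\<^sup>2 * Wd p)) + 400 * (k * Y0d p) + 400 * (k * Y1d p) + 400 * (k * X2d p)"
        unfolding k_def[symmetric] by (simp only: distrib_left add.assoc)
      moreover have fin2: "u1 \<le> 3 * (z + (2 * w0 + 128 * y0) + w0) \<Longrightarrow> u2 \<le> 4 * y1 + x2 \<Longrightarrow> 0 \<le> z \<Longrightarrow> 0 \<le> w0 \<Longrightarrow> 0 \<le> y0 \<Longrightarrow> 0 \<le> y1 \<Longrightarrow> 0 \<le> x2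
          \<Longrightarrow> u1 + u2 \<le> 400 * z + 400 * w0 + 400 * y0 + 400 * y1 + 400 * x2" for u1 u2 z w0 y0 y1 x2 :: real
        by (simp add: distrib_left)
      ultimately show ?thesis using fin2[OF _ 2 kn] by metis
    qed
    have "H2d p \<le> - (2 * C) * (\<Sum>k\<in>UNIV. D5 k p $ k) + 3 * C^3 * (400 * (C\<^sup>2 * exp 60 * ((1 / lam) * Zd p + (\<alpha>\<^sup>2 * Wd p + (Y0d p + (Y1d p + X2d p))))))"
      using second_derivative_pointwise[OF p] mult_left_mono[OF fin, of "3 * C^3"] C(1) by simp
    also have "3 * C^3 * (400 * (C\<^sup>2 * exp 60 * ((1 / lam) * Zd p + (\<alpha>\<^sup>2 * Wd p + (Y0d p + (Y1d p + X2d p)))))) = cc5 * ((1 / lam) * Zd p + (\<alpha>\<^sup>2 * Wd p + (Y0d p + (Y1d p + X2d p))))"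
      by (simp add: cc5_def power_add[of C 3 2, simplified] mult.assoc)
    finally show "H2d p \<le> - (2 * C) * (\<Sum>k\<in>UNIV. D5 k p $ k) + cc5 * ((1 / lam) * Zd p + (\<alpha>\<^sup>2 * Wd p + (Y0d p + (Y1d p + X2d p))))" .
  qed
  also have "\<dots> = - (2 * C) * 0 + cc5 * ((1 / lam) * II Zd + (\<alpha>\<^sup>2 * II Wd + (II Y0d + (II Y1d + II X2d))))"
    by (simp only: II_add tame_add tame_cmult tame_dens tD II_cmult integral_D5)
  finally show ?thesis by (simp add: add.assoc)
qed

text \<open>The difference of the two operators is at most \<open>t\<^sup>1\<^sup>/\<^sup>2 |D\<^sup>2w| + |\<nabla>w| + vb t\<^sup>1\<^sup>/\<^sup>2 |w|\<close> up to a constant.\<close>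

theorem frozen_coefficients_inequality:
  "II Ftd \<le> 4 * II Fd + 4 * C^3 * II H2d + 16 * C^4 * exp 60 * (II X2d + vb * II Wd)"
proof -
  have tH: "tame T H2d" unfolding H2d_def[abs_def] h2_def[abs_def] by (intro tame_ops tame_all xlip_tame[OF xlip_rho])
  have "II Ftd \<le> II (\<lambda>p. 4 * Fd p + (4 * C^3 * H2d p + 16 * C^4 * exp 60 * (X2d p + vb * Wd p)))"
  proof (rule integral_\<mu>_mono[OF tame_dens(10)])
    show "tame T (\<lambda>p. 4 * Fd p + (4 * C^3 * H2d p + 16 * C^4 * exp 60 * (X2d p + vb * Wd p)))"
      by (intro tame_add tame_cmult tame_dens tH)
    fix p :: "(real^'n) \<times> real" assume p: "p \<in> strip T"
    note t = strip_T(1)[OF p]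
    have tt: "snd p \<ge> 0" using t by simp
    have G: "Gp p \<ge> 0" by (rule Gp_pos)
    define s where "s = sqrt (snd p)"
    have s: "s \<ge> 0" "s\<^sup>2 = snd p" using tt by (auto simp: s_def)
    have dm: "\<bar>m p - mA p\<bar> \<le> C * s * hs p + 2 * C\<^sup>2 * P p"
    proof -
      have eq: "m p - mA p = (\<Sum>k\<in>UNIV. ((A0 p - A p) *v hw k p) $ k) + (\<Sum>k\<in>UNIV. ((dA0 k p - dA k p) *v gw p) $ k)"
        by (simp add: m_def mA_def dF_def dFA_def sum_subtractf[symmetric] sum.distrib[symmetric] matrix_vector_mult_diff_rdistrib)
           (simp add: algebra_simps)
      have 1: "\<bar>\<Sum>k\<in>UNIV. ((A0 p - A p) *v hw k p) $ k\<bar> \<le> (C * s) * hs p"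
      proof (rule sum_hs)
        fix k show "\<bar>((A0 p - A p) *v hw k p) $ k\<bar> \<le> C * s * norm (hw k p)"
          using component_le_norm_cart[of "(A0 p - A p) *v hw k p" k] mv_le[OF A_A0[OF p] order_refl, of "hw k p"] by (simp add: s_def)
      qed
      have 2: "\<bar>\<Sum>k\<in>UNIV. ((dA0 k p - dA k p) *v gw p) $ k\<bar> \<le> C * ((C + C) * P p)"
      proof (rule sum_abs_le)
        fix k
        have "norm (dA0 k p - dA k p) \<le> C + C" using dA0(2)[of k p] dA(2)[of k p] norm_triangle_ineq4[of "dA0 k p" "dA k p"] by linarith
        from mv_le[OF this, of "gw p" "P p"] show "\<bar>((dA0 k p - dA k p) *v gw p) $ k\<bar> \<le> (C + C) * P p"
          using component_le_norm_cart[of "(dA0 k p - dA k p) *v gw p" k] by (simp add: P_def)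
      qed
      show ?thesis unfolding eq using 1 2 abs_triangle_ineq[of "\<Sum>k\<in>UNIV. ((A0 p - A p) *v hw k p) $ k" "\<Sum>k\<in>UNIV. ((dA0 k p - dA k p) *v gw p) $ k"]
        by (simp add: power2_eq_square algebra_simps)
    qed
    have dV: "\<bar>(V0 (fst p) - V p) * w p\<bar> \<le> vb * s * \<bar>w p\<bar>"
      unfolding abs_mult using V_V0[of "fst p" "snd p"] p by (intro mult_right_mono) (auto simp: s_def abs_minus_commute)
    have "ft p = f p + (m p - mA p) + (V0 (fst p) - V p) * w p" by (simp add: ft_def f_def algebra_simps)
    hence "\<bar>ft p\<bar> \<le> \<bar>f p\<bar> + (C * s * hs p + 2 * C\<^sup>2 * P p) + vb * s * \<bar>w p\<bar>" using dm dV by linarith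
    hence "(ft p)\<^sup>2 \<le> (\<bar>f p\<bar> + (C * s * hs p + 2 * C\<^sup>2 * P p) + vb * s * \<bar>w p\<bar>)\<^sup>2"
      by (intro abs_le_square_iff[THEN iffD1]) auto
    also have "\<dots> \<le> 4 * (f p)\<^sup>2 + 4 * (C * s * hs p)\<^sup>2 + 4 * (2 * C\<^sup>2 * P p)\<^sup>2 + 4 * (vb * s * w p)\<^sup>2"
    proof -
      have "(u1 + (u2 + u3) + u4)\<^sup>2 \<le> 4 * u1\<^sup>2 + 4 * u2\<^sup>2 + 4 * u3\<^sup>2 + 4 * u4\<^sup>2" for u1 u2 u3 u4 :: real
      proof -
        have "0 \<le> (u1 - u2)\<^sup>2 + (u1 - u3)\<^sup>2 + (u1 - u4)\<^sup>2 + (u2 - u3)\<^sup>2 + (u2 - u4)\<^sup>2 + (u3 - u4)\<^sup>2" by simp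
        thus ?thesis by (simp add: power2_eq_square algebra_simps)
      qed
      from this[of "\<bar>f p\<bar>" "C * s * hs p" "2 * C\<^sup>2 * P p" "vb * s * \<bar>w p\<bar>"] show ?thesis by (simp add: power_mult_distrib)
    qed
    also have "\<dots> \<le> 4 * (f p)\<^sup>2 + 4 * C^3 * (snd p * h2 p) + 16 * C^4 * (P p)\<^sup>2 + 4 * vb\<^sup>2 * snd p * (w p)\<^sup>2"
    proof -
      have "(C * s * hs p)\<^sup>2 = C\<^sup>2 * snd p * (hs p)\<^sup>2" using s by (simp add: power_mult_distrib)
      also have "\<dots> \<le> C\<^sup>2 * snd p * (C * h2 p)" using hs_sq tt by (intro mult_left_mono) auto
      also have "\<dots> = C^3 * (snd p * h2 p)" by (simp add: power2_eq_square power3_eq_cube)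
      finally have 1: "(C * s * hs p)\<^sup>2 \<le> C^3 * (snd p * h2 p)" .
      have 2: "(2 * C\<^sup>2 * P p)\<^sup>2 = 4 * C^4 * (P p)\<^sup>2" by (simp add: power_mult_distrib)
      have 3: "(vb * s * w p)\<^sup>2 = vb\<^sup>2 * snd p * (w p)\<^sup>2" using s by (simp add: power_mult_distrib)
      show ?thesis using 1 unfolding 2 3 by simp
    qed
    finally have "(om (snd p) * Gp p) * (ft p)\<^sup>2 \<le> (om (snd p) * Gp p) * (4 * (f p)\<^sup>2 + 4 * C^3 * (snd p * h2 p) + 16 * C^4 * (P p)\<^sup>2 + 4 * vb\<^sup>2 * snd p * (w p)\<^sup>2)"
      using om_pos[OF t] G by (intro mult_left_mono) auto
    hence 1: "Ftd p \<le> 4 * Fd p + 4 * C^3 * H2d p + 16 * C^4 * (om (snd p) * Gp p * (P p)\<^sup>2) + 4 * vb * (vb * (rho p * (w p)\<^sup>2))"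
      by (simp add: Ftd_def Fd_def H2d_def rho_def power2_eq_square algebra_simps)
    have 2: "om (snd p) * Gp p * (P p)\<^sup>2 \<le> exp 60 * X2d p"
      using mult_right_mono[OF om_le(1)[OF t], of "Gp p * (P p)\<^sup>2"] G by (simp add: X2d_def E_def mult_ac)
    have 3: "vb * (rho p * (w p)\<^sup>2) \<le> exp 60 * Wd p"
    proof -
      have "vb * (om (snd p) * snd p) \<le> vb * (exp 60 * (ta (snd p))\<^sup>2 * wgt (snd p))" by (rule mult_left_mono[OF omt_le(1)[OF t] vb(1)])
      also have "\<dots> = (vb * (ta (snd p))\<^sup>2) * (exp 60 * wgt (snd p))" by (simp add: mult_ac)
      also have "\<dots> \<le> 1 * (exp 60 * wgt (snd p))" using omt_le(5)[OF t] wgt_pos[OF t] by (intro mult_right_mono) auto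
      finally have "vb * (om (snd p) * snd p) * (Gp p * (w p)\<^sup>2) \<le> 1 * (exp 60 * wgt (snd p)) * (Gp p * (w p)\<^sup>2)"
        using G by (intro mult_right_mono) auto
      thus ?thesis by (simp add: rho_def Wd_def E_def mult_ac)
    qed
    have "4 * vb * (vb * (rho p * (w p)\<^sup>2)) \<le> 4 * vb * (exp 60 * Wd p)" by (rule mult_left_mono[OF 3]) (use vb in simp)
    also have "\<dots> \<le> 16 * C^4 * (exp 60 * (vb * Wd p))"
    proof -
      have "1 \<le> C^4" using C_le_power[of 0 4] by simp
      hence "4 * (exp 60 * (vb * Wd p)) \<le> (16 * C^4) * (exp 60 * (vb * Wd p))"
        using vb dens_nonneg[OF p] by (intro mult_right_mono) auto
      thus ?thesis by (simp add: mult_ac)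
    qed
    finally have 4: "4 * vb * (vb * (rho p * (w p)\<^sup>2)) \<le> 16 * C^4 * (exp 60 * (vb * Wd p))" .
    have 5: "16 * C^4 * (om (snd p) * Gp p * (P p)\<^sup>2) \<le> 16 * C^4 * (exp 60 * X2d p)" using 2 C(1) by (intro mult_left_mono) auto
    show "Ftd p \<le> 4 * Fd p + (4 * C^3 * H2d p + 16 * C^4 * exp 60 * (X2d p + vb * Wd p))"
      using 1 4 5 by (simp add: algebra_simps)
  qed
  also have "\<dots> = 4 * II Fd + (4 * C^3 * II H2d + 16 * C^4 * exp 60 * (II X2d + vb * II Wd))"
    by (simp only: II_add tame_add tame_cmult tame_dens tH II_cmult)
  finally show ?thesis by (simp add: add.assoc)
qed

end

section \<open>Far from the origin the weight is bounded\<close>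

lemma powr_le_exp: "0 < x \<Longrightarrow> 0 \<le> k \<Longrightarrow> x powr k \<le> exp (k * x)" for x k :: real
proof -
  assume x: "0 < x" and k: "0 \<le> k"
  have "ln x \<le> x" using ln_le_minus_one[OF x] by simp
  hence "k * ln x \<le> k * x" using k by (rule mult_left_mono)
  thus ?thesis using x by (simp add: powr_def)
qed

text \<open>The constant in the far condition is chosen such that the Gaussian is at most \<open>(\<lambda>\<tau>)\<^sup>m\<close> with \<open>m = 2\<alpha> + n/2 + 2\<close>, the
exponent of \<open>1/\<tau>\<close> in the remaining factors; the powers of \<open>\<tau>\<close> then cancel and leave \<open>\<lambda>\<^sup>m\<close>.\<close>

lemma far_weight_bound:
  fixes al lam ta s nx n i :: real
  assumes al: "al \<ge> 1" and lam: "lam \<ge> 1" and ta: "ta > 0" "lam * ta \<le> 3/4" and s: "s > 0" "ta \<le> exp 240 * s"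
    and i: "i = inverse ta" and n: "n \<ge> 0" and nx: "0 \<le> nx" "nx \<le> 4"
    and far: "nx\<^sup>2 > (2 * n + 16) * al * ta * ln (1 / (lam * ta))"
  shows "s powr (- 2 * al) * (ta powr (- n / 2) * exp (- nx\<^sup>2 / (4 * ta))) * (nx^3 * i\<^sup>2 + al * nx * i + nx^3 * i)
     \<le> 132 * exp ((n + 484) * al) * lam powr (2 * al + n / 2 + 2)"
proof -
  define u where "u = lam * ta"
  have u: "0 < u" "u \<le> 3/4" using ta lam by (auto simp: u_def)
  define L where "L = ln (1 / u)"
  have L: "L \<ge> 0" using ln_inverse_ge[OF u] by (simp add: L_def)
  define m where "m = 2 * al + n / 2 + 2"
  have tale: "ta \<le> 1"
  proof -
    have "1 * ta \<le> lam * ta" using lam ta by (intro mult_right_mono) auto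
    thus ?thesis using ta by linarith
  qed
  have i1: "i \<ge> 1" using tale ta by (simp add: i one_le_inverse)
  have 1: "s powr (- 2 * al) \<le> exp (480 * al) * ta powr (- 2 * al)"
  proof -
    have e: "(exp 240 * s) powr (- 2 * al) = exp (- (480 * al)) * s powr (- 2 * al)"
      using s by (simp add: powr_mult powr_def[of "exp 240"])
    have "s powr (- 2 * al) = exp (480 * al) * (exp 240 * s) powr (- 2 * al)"
      unfolding e by (simp add: mult.assoc[symmetric] exp_add[symmetric])
    also have "\<dots> \<le> exp (480 * al) * ta powr (- 2 * al)"
      using s ta al by (intro mult_left_mono powr_mono2') auto
    finally show ?thesis .
  qed
  have 2: "exp (- nx\<^sup>2 / (4 * ta)) \<le> u powr m"
  proof -
    have "(2 * n + 16) * al * ta * L / (4 * ta) \<le> nx\<^sup>2 / (4 * ta)" using far ta by (intro divide_right_mono) (auto simp: L_def u_def)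
    moreover have "(2 * n + 16) * al * ta * L / (4 * ta) = (n / 2 + 4) * al * L" using ta by (simp add: field_simps)
    moreover have "m * L \<le> (n / 2 + 4) * al * L"
    proof (rule mult_right_mono[OF _ L])
      have "n / 2 * 1 \<le> n / 2 * al" using al n by (intro mult_left_mono) auto
      thus "m \<le> (n / 2 + 4) * al" using al by (simp add: m_def algebra_simps)
    qed
    ultimately have "- nx\<^sup>2 / (4 * ta) \<le> - (m * L)" by simp
    hence "exp (- nx\<^sup>2 / (4 * ta)) \<le> exp (- (m * L))" by simp
    also have "\<dots> = u powr m" using u by (simp add: powr_def L_def ln_div)
    finally show ?thesis .
  qed
  have 3: "nx^3 * i\<^sup>2 + al * nx * i + nx^3 * i \<le> 132 * al * ta powr (- 2)"
  proof -
    have n3: "nx^3 \<le> 4^3" using nx by (intro power_mono) auto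
    have ii: "i \<le> i\<^sup>2" using i1 by (simp add: power2_eq_square)
    have "nx^3 * i\<^sup>2 \<le> 64 * (al * i\<^sup>2)" using n3 al i1 mult_mono[of "nx^3" 64 "i\<^sup>2" "al * i\<^sup>2"] mult_right_mono[of 1 al "i\<^sup>2"] by simp
    moreover have "nx^3 * i \<le> 64 * (al * i\<^sup>2)"
    proof -
      have "nx^3 * i \<le> nx^3 * i\<^sup>2" using ii nx by (intro mult_left_mono) auto
      thus ?thesis using calculation by linarith
    qed
    moreover have "al * nx * i \<le> al * 4 * i\<^sup>2" using nx al ii i1 by (intro mult_mono) auto
    ultimately have "nx^3 * i\<^sup>2 + al * nx * i + nx^3 * i \<le> 132 * al * i\<^sup>2" by simp
    moreover have "i\<^sup>2 = ta powr (- 2)" using ta by (simp add: i powr_minus powr_numeral power_inverse)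
    ultimately show ?thesis by simp
  qed
  have nn: "0 \<le> nx^3 * i\<^sup>2 + al * nx * i + nx^3 * i" using nx al i1 by simp
  have "s powr (- 2 * al) * (ta powr (- n / 2) * exp (- nx\<^sup>2 / (4 * ta))) * (nx^3 * i\<^sup>2 + al * nx * i + nx^3 * i)
    \<le> (exp (480 * al) * ta powr (- 2 * al)) * (ta powr (- n / 2) * u powr m) * (132 * al * ta powr (- 2))"
    using 1 2 3 nn by (intro mult_mono) auto
  also have "\<dots> = 132 * al * exp (480 * al) * ((ta powr (- 2 * al) * ta powr (- n / 2) * ta powr (- 2)) * u powr m)" by (simp add: mult_ac)
  also have "ta powr (- 2 * al) * ta powr (- n / 2) * ta powr (- 2) = ta powr (- m)"
    by (simp add: powr_add[symmetric] m_def)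
  also have "u powr m = lam powr m * ta powr m" unfolding u_def using lam ta by (simp add: powr_mult)
  also have "ta powr (- m) * (lam powr m * ta powr m) = lam powr m"
    using ta by (simp add: powr_minus field_simps)
  also have "132 * al * exp (480 * al) * lam powr m \<le> 132 * exp ((n + 484) * al) * lam powr m"
  proof -
    have "al \<le> exp al" using exp_ge_add_one_self[of al] by linarith
    hence "al * exp (480 * al) \<le> exp al * exp (480 * al)" by (intro mult_right_mono) auto
    also have "\<dots> = exp (481 * al)" by (simp add: exp_add[symmetric])
    also have "\<dots> \<le> exp ((n + 484) * al)" using n al by (simp add: mult_right_mono)
    finally have "132 * (al * exp (480 * al)) * lam powr m \<le> 132 * exp ((n + 484) * al) * lam powr m"
      by (intro mult_right_mono mult_left_mono) auto
    thus ?thesis by (simp add: mult_ac)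
  qed
  finally show ?thesis by (simp add: m_def)
qed

context carleman_setting
begin

definition "Bad = 132 * exp ((real CARD('n) + 484) * \<alpha>) * lam powr (2 * \<alpha> + real CARD('n) / 2 + 2)"
definition "c0 = sqrt (2 * real CARD('n) + 16)"

lemma Bad_nonneg: "Bad \<ge> 0" by (simp add: Bad_def)
lemma c0: "c0\<^sup>2 = 2 * real CARD('n) + 16" "c0 > 0" by (simp_all add: c0_def add_nonneg_pos)

text \<open>This is \<open>\<delta>\<close>, since \<open>\<lambda> = \<alpha>/\<delta>\<^sup>2\<close>.\<close>

definition "dl = sqrt (\<alpha> / lam)"
lemma dl: "dl\<^sup>2 = \<alpha> / lam" "0 \<le> dl" "dl \<le> 1" using pos by (auto simp: dl_def)

lemma near_or_far: assumes p: "p \<in> strip T"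
  shows "(nx p)\<^sup>2 \<le> (2 * real CARD('n) + 16) * \<alpha> * ta (snd p) * ln (1 / (lam * ta (snd p))) \<or>
    E p * (Kx p + nx p ^ 3 * it (snd p)) \<le> Bad"
proof (cases "(nx p)\<^sup>2 \<le> (2 * real CARD('n) + 16) * \<alpha> * ta (snd p) * ln (1 / (lam * ta (snd p)))")
  case False
  note t = strip_T(1)[OF p]
  have "sg (snd p) powr (- 2 * \<alpha>) * (ta (snd p) powr (- real CARD('n) / 2) * exp (- (nx p)\<^sup>2 / (4 * ta (snd p)))) *
      (nx p ^ 3 * (it (snd p))\<^sup>2 + \<alpha> * nx p * it (snd p) + nx p ^ 3 * it (snd p)) \<le> Bad"
    unfolding Bad_def
    by (rule far_weight_bound) (use False pos t ta_pos[of "snd p"] lam_ta[OF t] sg_pos[OF t] sg[OF t] nx_le[OF p] in \<open>auto simp: it_def ta_def\<close>)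
  moreover have "E p = sg (snd p) powr (- 2 * \<alpha>) * (ta (snd p) powr (- real CARD('n) / 2) * exp (- (nx p)\<^sup>2 / (4 * ta (snd p))))"
    by (simp add: E_def wgt_def Gp_def G_def nx_def)
  ultimately have "E p * (Kx p + nx p ^ 3 * it (snd p)) \<le> Bad" by (simp only: Kx_def)
  thus ?thesis ..
qed simp

text \<open>In the near region \<open>|x| \<le> c0 \<delta> (\<lambda>\<tau> log(1/\<lambda>\<tau>))\<^sup>1\<^sup>/\<^sup>2\<close>. One more factor \<open>log\<close> turns the root into \<open>\<theta>\<close>: this is why
\<open>\<theta>\<close> contains the power \<open>3/2\<close>.\<close>

lemma near_bounds: assumes p: "p \<in> strip T"
    and near: "(nx p)\<^sup>2 \<le> (2 * real CARD('n) + 16) * \<alpha> * ta (snd p) * ln (1 / (lam * ta (snd p)))"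
  shows "nx p \<le> 4 * c0 * dl * th (snd p)" "nx p ^ 3 * (it (snd p))\<^sup>2 \<le> c0^3 * dl * (th (snd p) * \<alpha> * it (snd p))"
proof -
  note t = strip_T(1)[OF p]
  define u where "u = lam * ta (snd p)"
  have u: "0 < u" "u \<le> 3/4" using lam_ta[OF t] by (auto simp: u_def)
  define l where "l = ln (1 / u)"
  have l: "l \<ge> 1/4" unfolding l_def by (rule ln_inverse_ge[OF u])
  have tp: "ta (snd p) > 0" using ta_pos t by simp
  have ip: "it (snd p) > 0" by (rule it_pos[OF t])
  have eq: "(2 * real CARD('n) + 16) * \<alpha> * ta (snd p) * l = (c0 * dl * sqrt (u * l))\<^sup>2"
    using pos u l by (simp add: power_mult_distrib dl c0 u_def)
  have le: "nx p \<le> c0 * dl * sqrt (u * l)"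
    by (rule power2_le_imp_le) (use near c0 dl eq u l in \<open>auto simp: l_def u_def\<close>)
  also have "\<dots> \<le> c0 * dl * (4 * \<theta> u)"
    using \<theta>_ge_log(1)[OF u] c0 dl by (intro mult_left_mono) (auto simp: l_def)
  finally show "nx p \<le> 4 * c0 * dl * th (snd p)" by (simp add: th_def u_def mult_ac)
  have thu: "th (snd p) = sqrt (u * l) * l"
    using \<theta>_ge_log(2)[OF u] by (simp add: th_def \<theta>_def u_def[symmetric] l_def real_sqrt_mult mult_ac)
  have "nx p ^ 3 * (it (snd p))\<^sup>2 = nx p * (nx p)\<^sup>2 * (it (snd p))\<^sup>2" by (simp add: power2_eq_square power3_eq_cube)
  also have "\<dots> \<le> (c0 * dl * sqrt (u * l)) * ((2 * real CARD('n) + 16) * \<alpha> * ta (snd p) * l) * (it (snd p))\<^sup>2"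
    using le near c0(2) dl(2) u l by (intro mult_right_mono mult_mono) (auto simp: l_def u_def)
  also have "\<dots> = (c0 * dl * sqrt (u * l)) * (c0\<^sup>2 * \<alpha> * l) * (ta (snd p) * it (snd p)) * it (snd p)"
    unfolding c0(1) by (simp add: power2_eq_square mult_ac)
  also have "\<dots> = c0^3 * dl * (th (snd p) * \<alpha> * it (snd p))"
    unfolding ta_it[OF t] thu by (simp add: power2_eq_square power3_eq_cube mult_ac)
  finally show "nx p ^ 3 * (it (snd p))\<^sup>2 \<le> c0^3 * dl * (th (snd p) * \<alpha> * it (snd p))" .
qed

text \<open>Each of these errors is a good term times \<open>\<lambda>\<tau>/\<theta>\<close> or its square root, up to powers of \<open>\<delta>\<close>.\<close>

lemma small_terms:
  "II X2d \<le> (8 / lam) * II X1d" "\<alpha>\<^sup>2 * II Wd \<le> 8 * dl\<^sup>2 * II X0d" "II S0d \<le> 8 * dl * II X0d"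
proof -
  have "II X2d \<le> II (\<lambda>p. (8 / lam) * X1d p)"
  proof (rule integral_\<mu>_mono[OF tame_dens(7) tame_cmult[OF tame_dens(1)]])
    fix p :: "(real^'n) \<times> real" assume p: "p \<in> strip T"
    have "ta (snd p) \<le> (8 / lam) * th (snd p)" using th_bounds(3)[OF strip_T(1)[OF p]] pos by (simp add: field_simps)
    hence "(E p * (P p)\<^sup>2) * ta (snd p) \<le> (E p * (P p)\<^sup>2) * ((8 / lam) * th (snd p))" using E_nonneg[OF p] by (intro mult_left_mono) auto
    thus "X2d p \<le> (8 / lam) * X1d p" by (simp add: X2d_def X1d_def mult_ac)
  qed
  thus "II X2d \<le> (8 / lam) * II X1d" by (simp only: II_cmult)
  have "II (\<lambda>p. \<alpha>\<^sup>2 * Wd p) \<le> II (\<lambda>p. (8 * dl\<^sup>2) * X0d p)"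
  proof (rule integral_\<mu>_mono[OF tame_cmult[OF tame_dens(5)] tame_cmult[OF tame_dens(2)]])
    fix p :: "(real^'n) \<times> real" assume p: "p \<in> strip T"
    note t = strip_T(1)[OF p]
    have "ta (snd p) * it (snd p) * lam \<le> 8 * th (snd p) * it (snd p)"
      using mult_right_mono[OF th_bounds(3)[OF t], of "it (snd p)"] it_pos[OF t] by (simp add: mult_ac)
    hence "lam \<le> 8 * th (snd p) * it (snd p)" using ta_it[OF t] by simp
    hence "(\<alpha> * (\<alpha> / lam)) * lam \<le> (\<alpha> * (\<alpha> / lam)) * (8 * th (snd p) * it (snd p))" using pos by (intro mult_left_mono) auto
    hence "\<alpha>\<^sup>2 \<le> 8 * (\<alpha> / lam) * (th (snd p) * \<alpha> * it (snd p))" using pos by (simp add: power2_eq_square mult_ac)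
    hence "\<alpha>\<^sup>2 \<le> 8 * dl\<^sup>2 * (th (snd p) * \<alpha> * it (snd p))" by (simp only: dl)
    hence "(E p * (w p)\<^sup>2) * \<alpha>\<^sup>2 \<le> (E p * (w p)\<^sup>2) * (8 * dl\<^sup>2 * (th (snd p) * \<alpha> * it (snd p)))" using E_nonneg[OF p] by (intro mult_left_mono) auto
    thus "\<alpha>\<^sup>2 * Wd p \<le> (8 * dl\<^sup>2) * X0d p" by (simp add: Wd_def X0d_def mult_ac)
  qed
  thus "\<alpha>\<^sup>2 * II Wd \<le> 8 * dl\<^sup>2 * II X0d" by (simp only: II_cmult)
  have "II S0d \<le> II (\<lambda>p. (8 * dl) * X0d p)"
  proof (rule integral_\<mu>_mono[OF tame_dens(6) tame_cmult[OF tame_dens(2)]])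
    fix p :: "(real^'n) \<times> real" assume p: "p \<in> strip T"
    note t = strip_T(1)[OF p]
    have "sqrt (ta (snd p)) = sqrt (1 / lam) * sqrt (lam * ta (snd p))" using pos by (simp add: real_sqrt_mult[symmetric])
    also have "\<dots> \<le> dl * (8 * th (snd p))"
    proof (rule mult_mono)
      show "sqrt (1 / lam) \<le> dl" unfolding dl_def using pos by (intro real_sqrt_le_mono divide_right_mono) auto
      show "sqrt (lam * ta (snd p)) \<le> 8 * th (snd p)" unfolding th_def by (rule \<theta>_ge_log(3)) (use lam_ta[OF t] in auto)
    qed (use dl lam_ta[OF t] in auto)
    finally have "(E p * (\<alpha> * it (snd p)) * (w p)\<^sup>2) * sqrt (ta (snd p)) \<le> (E p * (\<alpha> * it (snd p)) * (w p)\<^sup>2) * (dl * (8 * th (snd p)))"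
      using E_nonneg[OF p] it_pos[OF t] pos by (intro mult_left_mono) auto
    thus "S0d p \<le> (8 * dl) * X0d p" by (simp add: S0d_def X0d_def mult_ac)
  qed
  thus "II S0d \<le> 8 * dl * II X0d" by (simp only: II_cmult)
qed

text \<open>Near the origin the weight is small against that of \<open>X0d\<close>; far from it the weight is bounded.\<close>

lemma Y0_le:
  assumes m: "\<And>t. t \<in> {0..T} \<Longrightarrow> J (\<lambda>x. (w (x, t))\<^sup>2) \<le> sp"
  shows "II Y0d \<le> (4 * c0 + c0^3) * dl * II X0d + Bad * sp"
proof -
  have sp: "sp \<ge> 0" using m[OF t0] J_nonneg[of "\<lambda>x. (w (x, 0))\<^sup>2"] by simp
  have "II (\<lambda>p. Y0d p + (- ((4 * c0 + c0^3) * dl)) * X0d p) \<le> Bad * (T * sp)"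
  proof (rule integral_\<mu>_le_slices)
    show "tame T (\<lambda>p. Y0d p + (- ((4 * c0 + c0^3) * dl)) * X0d p)" by (intro tame_add tame_cmult tame_dens)
    show "continuous_on (strip T) (\<lambda>p. (w p)\<^sup>2)" by (intro xlip_continuous xlip_power xlip_w)
    show "(\<integral>x. indicator (cball 0 4) x * (w (x, t))\<^sup>2 \<partial>lborel) \<le> sp" if "t \<in> {0..T}" for t using m[OF that] by (simp add: J_def)
    fix p :: "(real^'n) \<times> real" assume p: "p \<in> strip T"
    note t = strip_T(1)[OF p]
    have E: "E p \<ge> 0" by (rule E_nonneg[OF p])
    show "Y0d p + (- ((4 * c0 + c0^3) * dl)) * X0d p \<le> Bad * (w p)\<^sup>2"
      using near_or_far[OF p]
    proof
      assume "(nx p)\<^sup>2 \<le> (2 * real CARD('n) + 16) * \<alpha> * ta (snd p) * ln (1 / (lam * ta (snd p)))"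
      note nb = near_bounds[OF p this]
      have "Kx p \<le> c0^3 * dl * (th (snd p) * \<alpha> * it (snd p)) + \<alpha> * (4 * c0 * dl * th (snd p)) * it (snd p)"
        unfolding Kx_def using nb pos it_pos[OF t] by (intro add_mono mult_right_mono mult_left_mono) auto
      also have "\<dots> = (4 * c0 + c0^3) * dl * (th (snd p) * \<alpha> * it (snd p))" by (simp add: algebra_simps)
      finally have "(E p * (w p)\<^sup>2) * Kx p \<le> (E p * (w p)\<^sup>2) * ((4 * c0 + c0^3) * dl * (th (snd p) * \<alpha> * it (snd p)))"
        using E by (intro mult_left_mono) auto
      hence "Y0d p \<le> (4 * c0 + c0^3) * dl * X0d p" by (simp add: Y0d_def X0d_def mult_ac)
      moreover have "0 \<le> Bad * (w p)\<^sup>2" using Bad_nonneg by simp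
      ultimately show ?thesis by simp
    next
      assume far: "E p * (Kx p + nx p ^ 3 * it (snd p)) \<le> Bad"
      have "E p * Kx p \<le> E p * (Kx p + nx p ^ 3 * it (snd p))" using E it_pos[OF t] by (intro mult_left_mono) auto
      hence "(E p * Kx p) * (w p)\<^sup>2 \<le> Bad * (w p)\<^sup>2" using far by (intro mult_right_mono) auto
      moreover have "0 \<le> (4 * c0 + c0^3) * dl * X0d p" using c0 dl dens_nonneg[OF p] by simp
      ultimately show ?thesis by (simp add: Y0d_def mult_ac)
    qed
  qed (use pos Bad_nonneg in auto)
  also have "\<dots> \<le> Bad * (1 * sp)"
  proof -
    have "T \<le> 1" using lam_ta(3)[of T] pos by (simp add: ta_def)
    thus ?thesis using Bad_nonneg sp by (intro mult_left_mono mult_right_mono) auto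
  qed
  also have "II (\<lambda>p. Y0d p + (- ((4 * c0 + c0^3) * dl)) * X0d p) = II Y0d + (- ((4 * c0 + c0^3) * dl)) * II X0d"
    by (simp only: II_add tame_cmult tame_dens II_cmult)
  finally show ?thesis by simp
qed

lemma B3_le:
  assumes m: "J (\<lambda>x. (w (x, 0))\<^sup>2) \<le> sp"
  shows "wgt 0 * B3 \<le> 15 * c0^3 * wgt 0 * (\<alpha> * B0) + Bad * sp"
proof -
  have "J (\<lambda>x. wgt 0 * (Gp (x, 0) * (norm x ^ 3 * it 0) * (w (x, 0))\<^sup>2)) \<le> J (\<lambda>x. (15 * c0^3 * wgt 0 * \<alpha>) * (Gp (x, 0) * (w (x, 0))\<^sup>2) + Bad * (w (x, 0))\<^sup>2)"
  proof (rule J_mono)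
    show "continuous_on (cball 0 4) (\<lambda>x. wgt 0 * (Gp (x, 0) * (norm x ^ 3 * it 0) * (w (x, 0))\<^sup>2))"
      by (intro continuous_on_mult continuous_on_const cont_slices(3))
    show "continuous_on (cball 0 4) (\<lambda>x. (15 * c0^3 * wgt 0 * \<alpha>) * (Gp (x, 0) * (w (x, 0))\<^sup>2) + Bad * (w (x, 0))\<^sup>2)"
      by (intro continuous_intros slice_0 xlip_all)
    fix x :: "real^'n" assume "norm x \<le> 4"
    hence p: "(x, 0) \<in> strip T" using pos by (simp add: strip_def)
    have E: "E (x, 0) \<ge> 0" by (rule E_nonneg[OF p])
    have nxx: "nx (x, 0) = norm x" by (simp add: nx_def)
    show "wgt 0 * (Gp (x, 0) * (norm x ^ 3 * it 0) * (w (x, 0))\<^sup>2) \<le> (15 * c0^3 * wgt 0 * \<alpha>) * (Gp (x, 0) * (w (x, 0))\<^sup>2) + Bad * (w (x, 0))\<^sup>2"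
      using near_or_far[OF p]
    proof
      assume "(nx (x, 0))\<^sup>2 \<le> (2 * real CARD('n) + 16) * \<alpha> * ta (snd (x, 0)) * ln (1 / (lam * ta (snd (x, 0))))"
      from near_bounds(2)[OF p this] have "norm x ^ 3 * (it 0)\<^sup>2 \<le> c0^3 * dl * (th 0 * \<alpha> * it 0)" by (simp add: nxx)
      also have "\<dots> \<le> c0^3 * 1 * (15 * \<alpha> * it 0)"
        using c0 dl pos it_pos[OF t0] th_bounds[OF t0] by (intro mult_mono mult_right_mono) auto
      finally have "(norm x ^ 3 * it 0) * it 0 \<le> (15 * c0^3 * \<alpha>) * it 0" by (simp add: power2_eq_square mult_ac)
      hence "norm x ^ 3 * it 0 \<le> 15 * c0^3 * \<alpha>" using it_pos[OF t0] by simp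
      hence "(E (x, 0) * (w (x, 0))\<^sup>2) * (norm x ^ 3 * it 0) \<le> (E (x, 0) * (w (x, 0))\<^sup>2) * (15 * c0^3 * \<alpha>)" using E by (intro mult_left_mono) auto
      moreover have "0 \<le> Bad * (w (x, 0))\<^sup>2" using Bad_nonneg by simp
      ultimately show ?thesis by (simp add: E_def mult_ac)
    next
      assume far: "E (x, 0) * (Kx (x, 0) + nx (x, 0) ^ 3 * it (snd (x, 0))) \<le> Bad"
      have "E (x, 0) * (norm x ^ 3 * it 0) \<le> E (x, 0) * (Kx (x, 0) + nx (x, 0) ^ 3 * it (snd (x, 0)))"
        using E Kx_nonneg[OF p] by (intro mult_left_mono) (auto simp: nxx)
      hence "(E (x, 0) * (norm x ^ 3 * it 0)) * (w (x, 0))\<^sup>2 \<le> Bad * (w (x, 0))\<^sup>2" using far by (intro mult_right_mono) auto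
      moreover have "0 \<le> (15 * c0^3 * wgt 0 * \<alpha>) * (Gp (x, 0) * (w (x, 0))\<^sup>2)" using c0 pos wgt_pos[OF t0] Gp_pos[of "(x, 0)"] by simp
      ultimately show ?thesis by (simp add: E_def mult_ac)
    qed
  qed
  also have "\<dots> = (15 * c0^3 * wgt 0 * \<alpha>) * B0 + Bad * J (\<lambda>x. (w (x, 0))\<^sup>2)"
    unfolding B0_def by (subst J_add) (intro continuous_intros slice_0 xlip_all, intro continuous_intros slice_0 xlip_all, simp only: J_cmult)
  also have "\<dots> \<le> (15 * c0^3 * wgt 0 * \<alpha>) * B0 + Bad * sp" using m Bad_nonneg by (intro add_left_mono mult_left_mono)
  also have "J (\<lambda>x. wgt 0 * (Gp (x, 0) * (norm x ^ 3 * it 0) * (w (x, 0))\<^sup>2)) = wgt 0 * B3" by (simp only: J_cmult B3_def)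
  finally show ?thesis by (simp add: mult_ac)
qed

end

section \<open>Absorption\<close>

text \<open>Pure arithmetic: with \<open>Q = Z + X0 + X1\<close> every error is at most a power of \<open>M\<close> times \<open>D Q\<close> plus admissible terms, so
that for small \<open>D\<close> it is absorbed on the left. The exponent \<open>6\<close> counts the substitutions.\<close>

lemma absorption:
  fixes M D B Z X0 X1 Y0 Y1 S0 X2 W0 vW H F0 Ft b0 b1 b3 :: real
  assumes M: "M \<ge> 1" and D: "0 \<le> D" "62 * M^6 * D \<le> 1"
    and nn: "0 \<le> Z" "0 \<le> X0" "0 \<le> X1" "0 \<le> F0" "0 \<le> B" "0 \<le> b0" "0 \<le> b1"
    and i1: "Z + X1 + b1 \<le> M * (Ft + Y1 + Y0 + vW + b0 + b3)"
    and i2: "X0 \<le> M * (Z + X1 + Y0 + vW)"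
    and i3: "Y1 \<le> M * (F0 + Y0 + S0 + vW)"
    and i4: "H \<le> M * (D * Z + W0 + Y0 + Y1 + X2)"
    and i5: "Ft \<le> M * (F0 + H + X2 + vW)"
    and i6: "X2 \<le> M * (D * X1)" "W0 \<le> M * (D * X0)" "vW \<le> M * (D * X0)" "S0 \<le> M * (D * X0)"
    and i7: "Y0 \<le> M * (D * X0) + B"
    and i8: "b3 \<le> M * b0 + B"
  shows "Z + X0 + X1 + b1 \<le> 236 * M^6 * (F0 + B + b0)"
proof -
  define Q0 where "Q0 = D * (Z + X0 + X1)"
  have q: "0 \<le> Q0" "D * Z \<le> Q0" "D * X0 \<le> Q0" "D * X1 \<le> Q0" using D nn by (auto simp: Q0_def distrib_left)
  have M0: "0 \<le> M" using M by simp
  have up: "x \<le> M * y" if "x \<le> y" "0 \<le> y" for x y using that mult_right_mono[OF M, of y] by simp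
  define q0 where "q0 = M * Q0"
  have q0: "Q0 \<le> q0" "0 \<le> q0" using up[OF order_refl q(1)] q M0 by (auto simp: q0_def)
  have Mq: "M * (D * Z) \<le> q0" "M * (D * X0) \<le> q0" "M * (D * X1) \<le> q0" using q M0 by (auto simp: q0_def intro: mult_left_mono)
  have s: "X2 \<le> q0" "W0 \<le> q0" "vW \<le> q0" "S0 \<le> q0" "Y0 \<le> q0 + B" using i6 i7 Mq by linarith+
  define y where "y = F0 + 3 * q0 + B"
  have y0: "0 \<le> y" using nn q0 by (simp add: y_def)
  have "Y1 \<le> M * y" by (rule order_trans[OF i3 mult_left_mono[OF _ M0]]) (use s in \<open>simp add: y_def\<close>)
  note y1 = this
  have "H \<le> M * (Q0 + q0 + (q0 + B) + M * y + q0)"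
    by (rule order_trans[OF i4 mult_left_mono[OF _ M0]]) (use s q y1 in linarith)
  also have "\<dots> \<le> M * (4 * q0 + B + M * y)" using q0 M0 by (intro mult_left_mono) auto
  also have "\<dots> \<le> M * (3 * (M * y))"
  proof (rule mult_left_mono[OF _ M0])
    have "y \<le> M * y" by (rule up[OF order_refl y0])
    moreover have "4 * q0 + B \<le> 2 * y" using nn q0 by (simp add: y_def)
    ultimately show "4 * q0 + B + M * y \<le> 3 * (M * y)" by linarith
  qed
  finally have H: "H \<le> 3 * (M^2 * y)" by (simp add: power2_eq_square)
  have y2: "y \<le> M^2 * y" using mult_right_mono[OF one_le_power[OF M, of 2] y0] by simp
  have y3: "M^2 * y \<le> M^3 * y" "M * y \<le> M^3 * y" "y \<le> M^3 * y"
    using M y0 mult_right_mono[OF power_increasing[of 2 3 M] y0] mult_right_mono[OF power_increasing[of 1 3 M] y0] mult_right_mono[OF one_le_power[OF M, of 3] y0] by auto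
  have "Ft \<le> M * (F0 + 3 * (M^2 * y) + q0 + q0)"
    by (rule order_trans[OF i5 mult_left_mono[OF _ M0]]) (use s H in linarith)
  also have "\<dots> \<le> M * (4 * (M^2 * y))"
  proof (rule mult_left_mono[OF _ M0])
    have "F0 + q0 + q0 \<le> y" using nn q0 by (simp add: y_def)
    thus "F0 + 3 * (M^2 * y) + q0 + q0 \<le> 4 * (M^2 * y)" using y2 by linarith
  qed
  also have "\<dots> = 4 * (M^3 * y)" by (simp add: power2_eq_square power3_eq_cube)
  finally have Ft: "Ft \<le> 4 * (M^3 * y)" .
  define W where "W = y + b0"
  have W: "0 \<le> W" "y \<le> W" "b0 \<le> W" using y0 nn by (auto simp: W_def)
  have W3: "M^3 * y \<le> M^3 * W" "M * b0 \<le> M^3 * W" "b0 \<le> M^3 * W" "W \<le> M^3 * W"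
  proof -
    show "M^3 * y \<le> M^3 * W" using W M0 by (intro mult_left_mono) auto
    have "M * b0 \<le> M^3 * b0" using nn M mult_right_mono[OF power_increasing[of 1 3 M], of b0] by auto
    also have "\<dots> \<le> M^3 * W" using W M0 by (intro mult_left_mono) auto
    finally show "M * b0 \<le> M^3 * W" .
    show "W \<le> M^3 * W" using mult_right_mono[OF one_le_power[OF M, of 3] W(1)] by simp
    thus "b0 \<le> M^3 * W" using W by linarith
  qed
  have "Z + X1 + b1 \<le> M * (4 * (M^3 * y) + M * y + (q0 + B) + q0 + b0 + (M * b0 + B))"
    by (rule order_trans[OF i1 mult_left_mono[OF _ M0]]) (use s Ft y1 i8 in linarith)
  also have "\<dots> \<le> M * (9 * (M^3 * W))"
  proof (rule mult_left_mono[OF _ M0])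
    have "q0 + B + q0 + B \<le> 2 * y" using nn q0 by (simp add: y_def)
    thus "4 * (M^3 * y) + M * y + (q0 + B) + q0 + b0 + (M * b0 + B) \<le> 9 * (M^3 * W)" using y3 W3 by linarith
  qed
  also have "\<dots> = 9 * (M^4 * W)" by (simp add: power3_eq_cube power4_eq_xxxx)
  finally have a1: "Z + X1 + b1 \<le> 9 * (M^4 * W)" .
  have "X0 \<le> M * (9 * (M^4 * W) + (q0 + B) + q0)"
    by (rule order_trans[OF i2 mult_left_mono[OF _ M0]]) (use s a1 nn in linarith)
  also have "\<dots> \<le> M * (10 * (M^4 * W))"
  proof (rule mult_left_mono[OF _ M0])
    have "q0 + B + q0 \<le> W" using nn q0 by (simp add: y_def W_def)
    moreover have "W \<le> M^4 * W" using mult_right_mono[OF one_le_power[OF M, of 4] W(1)] by simp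
    ultimately show "9 * (M^4 * W) + (q0 + B) + q0 \<le> 10 * (M^4 * W)" by linarith
  qed
  also have "\<dots> = 10 * (M^5 * W)" by (simp add: numeral_eq_Suc)
  finally have a2: "X0 \<le> 10 * (M^5 * W)" .
  have M45: "M^4 * W \<le> M^5 * W" using M W by (intro mult_right_mono power_increasing) auto
  have a3: "Z + X0 + X1 + b1 \<le> 19 * (M^5 * W)" using a1 a2 M45 by linarith
  have "W \<le> M * (F0 + B + b0 + 3 * Q0)"
  proof -
    have "F0 + B + b0 \<le> M * (F0 + B + b0)" by (rule up[OF order_refl]) (use nn in simp)
    thus ?thesis by (simp add: W_def y_def q0_def distrib_left)
  qed
  hence "M^5 * W \<le> M^5 * (M * (F0 + B + b0 + 3 * Q0))" using M0 by (intro mult_left_mono) auto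
  also have "\<dots> = M^6 * (F0 + B + b0) + 3 * (M^6 * Q0)" by (simp add: numeral_eq_Suc algebra_simps)
  finally have a4: "Z + X0 + X1 + b1 \<le> 19 * (M^6 * (F0 + B + b0)) + 57 * (M^6 * Q0)" using a3 by linarith
  have "(62 * M^6 * D) * (Z + X0 + X1) \<le> 1 * (Z + X0 + X1)" using D nn by (intro mult_right_mono) auto
  hence "62 * (M^6 * Q0) \<le> Z + X0 + X1" by (simp add: Q0_def mult_ac)
  moreover have "62 * v \<le> s \<Longrightarrow> s + x \<le> 19 * g + 57 * v \<Longrightarrow> 0 \<le> x \<Longrightarrow> 0 \<le> g \<Longrightarrow> s + x \<le> 236 * g" for s x g v :: real
    by linarith
  moreover have "0 \<le> M^6 * (F0 + B + b0)" using nn M0 by simp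
  ultimately have "Z + X0 + X1 + b1 \<le> 236 * (M^6 * (F0 + B + b0))" using a4 nn(7) by blast
  thus ?thesis by simp
qed

text \<open>A common bound for all constants in the system of inequalities.\<close>

definition absorption_const :: "real \<Rightarrow> real \<Rightarrow> real" where
  "absorption_const c n = 1200 * c^5 * exp 60 + 15 * sqrt (2 * n + 16) ^ 3 + 4 * sqrt (2 * n + 16)"

context carleman_setting
begin

lemma tame_sg: "tame T (\<lambda>p. sg (snd p))"
  by (rule xlip_tame[OF xlip_time[OF DERIV_continuous_on[OF sg_der]]])

text \<open>After absorption the good terms are traded for those of the theorem: \<open>\<alpha>\<tau> \<le> 8 \<theta>\<close> and \<open>\<alpha>\<^sup>2 \<le> 8 \<theta> \<alpha>/\<tau>\<close>, while
\<open>\<sigma>\<close>, \<open>\<tau>\<close> and \<open>\<gamma>\<close> are comparable.\<close>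

theorem carleman_inequality_explicit:
  fixes sp :: real
  defines "M \<equiv> absorption_const C (real CARD('n))"
  assumes D: "62 * M^6 * dl \<le> 1" and al: "\<alpha> \<ge> 16 * exp 60"
    and sp: "\<And>t. t \<in> {0..T} \<Longrightarrow> J (\<lambda>x. (w (x, t))\<^sup>2) \<le> sp"
  shows "\<alpha>\<^sup>2 * II Wd + \<alpha> * II (\<lambda>p. E p * (sg (snd p) * (P p)\<^sup>2)) + wgt 0 * (a * B1)
    \<le> 1888 * M^6 * exp 300 * (II (\<lambda>p. E p * (sg (snd p) * (f p)\<^sup>2)) + Bad * sp + wgt 0 * (\<alpha> * B0))"
proof -
  have C1: "C \<ge> 1" by (rule C(1))
  have c0p: "0 \<le> c0" using c0 by simp
  have Mb: "1200 * C^5 * exp 60 \<le> M" "15 * c0^3 + 4 * c0 \<le> M"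
    using C1 c0p by (auto simp: M_def absorption_const_def c0_def)
  have e60: "(1::real) \<le> exp 60" by simp
  have Ck: "1 \<le> C^k" for k using C1 by (rule one_le_power)
  have b: "x * C^k * y \<le> M" if "0 \<le> x" "x \<le> 1200" "k \<le> 5" "0 \<le> y" "y \<le> exp 60" for x y :: real and k
  proof -
    have "x * C^k * y \<le> 1200 * C^5 * exp 60" using that C1 by (intro mult_mono power_increasing) auto
    thus ?thesis using Mb by linarith
  qed
  have M1: "1 \<le> M" using b[of 1 0 1] by simp
  have M0: "0 \<le> M" using M1 by simp
  have lam1: "1 / lam \<le> dl\<^sup>2" using pos by (simp add: dl divide_right_mono)
  have dl2: "dl\<^sup>2 \<le> dl" unfolding power2_eq_square using dl(2,3) by (rule mult_left_le[rotated])
  have lamd: "1 / lam \<le> dl" using lam1 dl2 by linarith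
  have n: "II X1d \<ge> 0" "II X0d \<ge> 0" "II Y1d \<ge> 0" "II Y0d \<ge> 0" "II Wd \<ge> 0" "II S0d \<ge> 0" "II X2d \<ge> 0" "II Zd \<ge> 0" "II Fd \<ge> 0" "II Ftd \<ge> 0"
    by (rule II_nonneg, erule dens_nonneg)+
  have nH: "II H2d \<ge> 0"
  proof (rule II_nonneg)
    fix p :: "(real^'n) \<times> real" assume p: "p \<in> strip T"
    show "0 \<le> H2d p" using rho_nonneg[OF p] h2_nonneg[of p] by (simp add: H2d_def)
  qed
  have nb: "0 \<le> B0" "0 \<le> B1" "0 \<le> B3"
    unfolding B0_def B1_def B3_def using Gp_pos it_pos[OF t0] by (auto intro!: J_nonneg mult_nonneg_nonneg)
  have w0: "wgt 0 \<ge> 0" using wgt_pos[OF t0] by simp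
  have spn: "sp \<ge> 0" using sp[OF t0] J_nonneg[of "\<lambda>x. (w (x, 0))\<^sup>2"] by simp
  have vW: "vb * II Wd \<le> 8 * dl * II X0d"
  proof -
    have "vb * II Wd \<le> \<alpha>\<^sup>2 * II Wd" using vb n by (intro mult_right_mono) auto
    also have "\<dots> \<le> 8 * dl\<^sup>2 * II X0d" by (rule small_terms)
    also have "\<dots> \<le> 8 * dl * II X0d" using dl2 n by (intro mult_right_mono mult_left_mono) auto
    finally show ?thesis .
  qed
  have W: "\<alpha>\<^sup>2 * II Wd \<le> 8 * dl * II X0d"
  proof -
    have "\<alpha>\<^sup>2 * II Wd \<le> 8 * dl\<^sup>2 * II X0d" by (rule small_terms)
    also have "\<dots> \<le> 8 * dl * II X0d" using dl2 n by (intro mult_right_mono mult_left_mono) auto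
    finally show ?thesis .
  qed
  have M8: "8 \<le> M" using b[of 8 0 1] by simp
  have d0: "0 \<le> dl * II X0d" "0 \<le> dl * II X1d" using dl n by auto
  have B0': "0 \<le> Bad * sp" using Bad_nonneg spn by simp
  have "II Zd + II X0d + II X1d + wgt 0 * (a * B1) \<le> 236 * M^6 * (II Fd + Bad * sp + wgt 0 * (\<alpha> * B0))"
  proof (rule absorption[OF M1 dl(2) D n(8) n(2) n(1) n(9) B0'])
    show "0 \<le> wgt 0 * (\<alpha> * B0)" "0 \<le> wgt 0 * (a * B1)" using w0 nb pos by auto
    show "II X2d \<le> M * (dl * II X1d)"
    proof -
      have "II X2d \<le> 8 * ((1 / lam) * II X1d)" using small_terms(1) by simp
      also have "\<dots> \<le> 8 * (dl * II X1d)" using lamd n by (intro mult_left_mono mult_right_mono) auto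
      also have "\<dots> \<le> M * (dl * II X1d)" using M8 d0 by (intro mult_right_mono) auto
      finally show ?thesis .
    qed
    have m: "8 * dl * II X0d \<le> M * (dl * II X0d)" using mult_right_mono[OF M8 d0(1)] by simp
    show "\<alpha>\<^sup>2 * II Wd \<le> M * (dl * II X0d)" "vb * II Wd \<le> M * (dl * II X0d)" "II S0d \<le> M * (dl * II X0d)"
      using W vW small_terms(3) m by linarith+
    show "II Y0d \<le> M * (dl * II X0d) + Bad * sp"
    proof -
      have "(4 * c0 + c0^3) \<le> M" using Mb(2) c0p by (smt (verit) zero_le_power)
      hence "(4 * c0 + c0^3) * (dl * II X0d) \<le> M * (dl * II X0d)" using d0 by (intro mult_right_mono) auto
      thus ?thesis using Y0_le[OF sp] by simp
    qed
    show "wgt 0 * B3 \<le> M * (wgt 0 * (\<alpha> * B0)) + Bad * sp"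
    proof -
      have "15 * c0^3 \<le> M" using Mb(2) c0p by simp
      hence "15 * c0^3 * (wgt 0 * (\<alpha> * B0)) \<le> M * (wgt 0 * (\<alpha> * B0))" using w0 nb pos by (intro mult_right_mono) auto
      thus ?thesis using B3_le[OF sp[OF t0]] by (simp add: mult_ac)
    qed
    show "II Ftd \<le> M * (II Fd + II H2d + II X2d + vb * II Wd)"
    proof -
      have "4 * II Fd \<le> M * II Fd" using b[of 4 0 1] n by (intro mult_right_mono) auto
      moreover have "4 * C^3 * II H2d \<le> M * II H2d" using b[of 4 3 1] nH by (intro mult_right_mono) auto
      moreover have "16 * C^4 * exp 60 * (II X2d + vb * II Wd) \<le> M * (II X2d + vb * II Wd)"
        using b[of 16 4 "exp 60"] n vb by (intro mult_right_mono) auto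
      ultimately show ?thesis using frozen_coefficients_inequality by (simp add: distrib_left)
    qed
    show "II H2d \<le> M * (dl * II Zd + \<alpha>\<^sup>2 * II Wd + II Y0d + II Y1d + II X2d)"
    proof -
      have "II H2d \<le> cc5 * ((1/lam) * II Zd + \<alpha>\<^sup>2 * II Wd + II Y0d + II Y1d + II X2d)" by (rule second_derivative_inequality)
      also have "\<dots> \<le> M * (dl * II Zd + \<alpha>\<^sup>2 * II Wd + II Y0d + II Y1d + II X2d)"
        using Mb(1) n lamd pos M0 by (intro mult_mono add_mono mult_right_mono order_refl add_nonneg_nonneg) (auto simp: cc5_def)
      finally show ?thesis .
    qed
    show "II Y1d \<le> M * (II Fd + II Y0d + II S0d + vb * II Wd)"
    proof -
      have "cc3 \<le> M" using b[of 50 3 1] by (simp add: cc3_def)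
      hence "cc3 * (II Fd + II Y0d + II S0d + vb * II Wd) \<le> M * (II Fd + II Y0d + II S0d + vb * II Wd)"
        using n vb by (intro mult_right_mono) auto
      thus ?thesis using gradient_inequality by linarith
    qed
    show "II X0d \<le> M * (II Zd + II X1d + II Y0d + vb * II Wd)"
    proof -
      have "8 / \<alpha> * exp 60 \<le> 1 / 2" using al pos(3) by (simp add: divide_le_eq)
      hence "(8 / \<alpha> * exp 60) * II X0d \<le> (1 / 2) * II X0d" using n by (intro mult_right_mono) auto
      hence "II X0d \<le> 2 * (exp 60 * (II Zd + C * II X1d + 15 * C * (II Y0d + vb * II Wd)))"
        using zero_order_inequality by (simp add: algebra_simps)
      also have "\<dots> = 2 * exp 60 * II Zd + 2 * C * exp 60 * II X1d + 30 * C * exp 60 * (II Y0d + vb * II Wd)" by (simp add: algebra_simps)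
      also have "\<dots> \<le> M * II Zd + M * II X1d + M * (II Y0d + vb * II Wd)"
        using b[of 2 0 "exp 60"] b[of 2 1 "exp 60"] b[of 30 1 "exp 60"] n vb by (intro add_mono mult_right_mono) auto
      finally show ?thesis by (simp add: distrib_left)
    qed
    show "II Zd + II X1d + wgt 0 * (a * B1) \<le> M * (II Ftd + II Y1d + II Y0d + vb * II Wd + wgt 0 * (\<alpha> * B0) + wgt 0 * B3)"
    proof -
      have "II Zd + II X1d + wgt 0 * (a * B1) \<le> C * II Zd + II X1d + wgt 0 * (a * B1)" using mult_right_mono[OF C1 n(8)] by simp
      also have "\<dots> = C * (II Zd + (1/C) * II X1d + wgt 0 * (a/C) * B1)" using C1 by (simp add: field_simps)
      also have "\<dots> \<le> C * (II Ftd + cc1 * (II Y1d + II Y0d + vb * II Wd) + wgt 0 * (2 * exp 60 * \<alpha> * B0 + exp 60 * C * B3))"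
        using basic_inequality C1 by (intro mult_left_mono) auto
      also have "\<dots> = 1 * C^1 * 1 * II Ftd + 26 * C^4 * exp 60 * (II Y1d + II Y0d + vb * II Wd) + 2 * C^1 * exp 60 * (wgt 0 * (\<alpha> * B0)) + 1 * C^2 * exp 60 * (wgt 0 * B3)"
        by (simp add: cc1_def power2_eq_square power3_eq_cube power4_eq_xxxx algebra_simps)
      also have "\<dots> \<le> M * II Ftd + M * (II Y1d + II Y0d + vb * II Wd) + M * (wgt 0 * (\<alpha> * B0)) + M * (wgt 0 * B3)"
        using n vb w0 nb pos by (intro add_mono mult_right_mono b) auto
      also have "\<dots> = M * (II Ftd + II Y1d + II Y0d + vb * II Wd + wgt 0 * (\<alpha> * B0) + wgt 0 * B3)" by (simp add: distrib_left)
      finally show ?thesis .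
    qed
  qed
  hence main: "8 * (II Zd + II X0d + II X1d + wgt 0 * (a * B1)) \<le> 1888 * M^6 * (II Fd + Bad * sp + wgt 0 * (\<alpha> * B0))" by simp
  have "\<alpha>\<^sup>2 * II Wd \<le> 8 * II X0d"
  proof -
    have "8 * dl * II X0d \<le> 8 * 1 * II X0d" using dl n by (intro mult_right_mono mult_left_mono) auto
    thus ?thesis using W by simp
  qed
  moreover have "\<alpha> * II (\<lambda>p. E p * (sg (snd p) * (P p)\<^sup>2)) \<le> 8 * II X1d"
  proof -
    have "II (\<lambda>p. \<alpha> * (E p * (sg (snd p) * (P p)\<^sup>2))) \<le> II (\<lambda>p. 8 * X1d p)"
    proof (rule integral_\<mu>_mono[OF _ tame_cmult[OF tame_dens(1)]])
      show "tame T (\<lambda>p. \<alpha> * (E p * (sg (snd p) * (P p)\<^sup>2)))" by (intro tame_cmult tame_mult tame_E tame_sg tame_power tame_P)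
      fix p :: "(real^'n) \<times> real" assume p: "p \<in> strip T"
      note t = strip_T(1)[OF p]
      have "\<alpha> * sg (snd p) \<le> lam * ta (snd p)" using sg[OF t] sg_pos[OF t] pos by (intro mult_mono) (auto simp: ta_def)
      also have "\<dots> \<le> 8 * th (snd p)" using th_bounds(3)[OF t] by (simp add: mult.commute)
      finally have "(E p * (P p)\<^sup>2) * (\<alpha> * sg (snd p)) \<le> (E p * (P p)\<^sup>2) * (8 * th (snd p))"
        using E_nonneg[OF p] by (intro mult_left_mono) auto
      thus "\<alpha> * (E p * (sg (snd p) * (P p)\<^sup>2)) \<le> 8 * X1d p" by (simp add: X1d_def mult_ac)
    qed
    thus ?thesis by (simp only: II_cmult)
  qed
  moreover have Fle: "II Fd \<le> exp 300 * II (\<lambda>p. E p * (sg (snd p) * (f p)\<^sup>2))"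
  proof -
    have "II Fd \<le> II (\<lambda>p. exp 300 * (E p * (sg (snd p) * (f p)\<^sup>2)))"
    proof (rule integral_\<mu>_mono[OF tame_dens(9)])
      show "tame T (\<lambda>p. exp 300 * (E p * (sg (snd p) * (f p)\<^sup>2)))" by (intro tame_cmult tame_mult tame_E tame_sg tame_power tame_f)
      fix p :: "(real^'n) \<times> real" assume p: "p \<in> strip T"
      note t = strip_T(1)[OF p]
      have "gm (snd p) \<le> exp 60 * (exp 240 * sg (snd p))"
        by (rule order_trans[OF conjunct2[OF gm[OF t]] mult_left_mono[OF conjunct2[OF sg[OF t]]]]) simp
      also have "\<dots> = exp 300 * sg (snd p)" by (simp add: mult.assoc[symmetric] exp_add[symmetric])
      finally have "(E p * (f p)\<^sup>2) * gm (snd p) \<le> (E p * (f p)\<^sup>2) * (exp 300 * sg (snd p))"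
        using E_nonneg[OF p] by (intro mult_left_mono) auto
      thus "Fd p \<le> exp 300 * (E p * (sg (snd p) * (f p)\<^sup>2))" by (simp add: Fd_def E_def om_def mult_ac)
    qed
    thus ?thesis by (simp only: II_cmult)
  qed
  moreover have "1888 * M^6 * (II Fd + Bad * sp + wgt 0 * (\<alpha> * B0))
     \<le> 1888 * M^6 * (exp 300 * (II (\<lambda>p. E p * (sg (snd p) * (f p)\<^sup>2)) + Bad * sp + wgt 0 * (\<alpha> * B0)))"
  proof (rule mult_left_mono)
    have "x \<le> exp 300 * x" if "0 \<le> x" for x :: real using mult_right_mono[of 1 "exp 300" x] that by simp
    moreover have "0 \<le> wgt 0 * (\<alpha> * B0)" using w0 nb pos by simp
    ultimately show "II Fd + Bad * sp + wgt 0 * (\<alpha> * B0) \<le> exp 300 * (II (\<lambda>p. E p * (sg (snd p) * (f p)\<^sup>2)) + Bad * sp + wgt 0 * (\<alpha> * B0))"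
      unfolding distrib_left using Fle B0' by (intro add_mono) auto
  qed (use M0 in simp)
  moreover have "0 \<le> II Zd" "0 \<le> wgt 0 * (a * B1)" using n w0 nb pos by auto
  moreover have "u \<le> 8 * x0 \<Longrightarrow> v \<le> 8 * x1 \<Longrightarrow> 0 \<le> z \<Longrightarrow> 0 \<le> b \<Longrightarrow> 8 * (z + x0 + x1 + b) \<le> s \<Longrightarrow> s \<le> t \<Longrightarrow> u + v + b \<le> t" for u v x0 x1 z b s t :: real
    unfolding distrib_left by linarith
  ultimately have "\<alpha>\<^sup>2 * II Wd + \<alpha> * II (\<lambda>p. E p * (sg (snd p) * (P p)\<^sup>2)) + wgt 0 * (a * B1)
    \<le> 1888 * M^6 * (exp 300 * (II (\<lambda>p. E p * (sg (snd p) * (f p)\<^sup>2)) + Bad * sp + wgt 0 * (\<alpha> * B0)))"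
    using main by blast
  thus ?thesis by (simp only: mult.assoc)
qed

end

section \<open>The potential\<close>

lemma AE_ex_in_open:
  fixes U :: "'a::euclidean_space set"
  assumes P: "AE x in lborel. P x" and U: "open U" "U \<noteq> {}"
  shows "\<exists>x\<in>U. P x"
proof (rule ccontr)
  assume n: "\<not> (\<exists>x\<in>U. P x)"
  from P obtain N where N: "{x \<in> space lborel. \<not> P x} \<subseteq> N" "N \<in> null_sets lborel" by (auto elim!: AE_E simp: null_setsI)
  have UN: "U \<subseteq> N" using N(1) n by auto
  have "U \<in> null_sets lborel" by (rule null_sets_subset[OF N(2) _ UN]) (use U(1) in simp)
  hence "negligible U" by (simp add: negligible_iff_null_sets null_sets_completionI)
  thus False using open_not_negligible[OF U] by simp
qed

lemma AE_bound_continuous: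
  fixes f :: "'a::euclidean_space \<Rightarrow> 'b::real_normed_vector"
  assumes "AE x in lborel. x \<in> U \<longrightarrow> norm (f x) \<le> M" "continuous_on U f" "open U" "x \<in> U"
  shows "norm (f x) \<le> M"
proof (rule ccontr)
  assume n: "\<not> norm (f x) \<le> M"
  have "open {x \<in> U. M < norm (f x)}"
  proof -
    obtain O' where "open O'" "O' \<inter> U = {x \<in> U. M < norm (f x)}"
      using open_Collect_less_Int[OF continuous_on_const[of U M] continuous_on_norm[OF assms(2)]] by blast
    thus ?thesis using assms(3) by (metis open_Int)
  qed
  moreover have "{x \<in> U. M < norm (f x)} \<noteq> {}" using n assms(4) not_le by blast
  ultimately obtain z where "z \<in> {x \<in> U. M < norm (f x)}" "z \<in> U \<longrightarrow> norm (f z) \<le> M"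
    using AE_ex_in_open[OF assms(1)] by blast
  thus False by auto
qed

text \<open>Fubini for null sets, in the order that puts time first.\<close>

lemma AE_swap_slices:
  fixes P :: "'a::euclidean_space \<times> real \<Rightarrow> bool"
  assumes "AE p in lborel. P p"
  shows "AE t in lborel. AE x in lborel. P (x, t)"
proof -
  from assms obtain N where N: "{p \<in> space lborel. \<not> P p} \<subseteq> N" "N \<in> null_sets (lborel :: ('a \<times> real) measure)"
    by (auto elim!: AE_E simp: null_setsI)
  have Ns: "N \<in> sets (lborel \<Otimes>\<^sub>M (lborel :: real measure))" using N(2) unfolding lborel_prod by (rule null_setsD2)
  have "AE p in lborel \<Otimes>\<^sub>M (lborel :: real measure). p \<notin> N" unfolding lborel_prod using N(2) by (rule AE_not_in)
  hence "AE x in lborel. AE t in lborel. (x, t) \<notin> N" by (rule lborel_pair.AE_pair)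
  hence "AE t in lborel. AE x in lborel. (x, t) \<notin> N"
  proof (subst (asm) lborel_pair.AE_commute)
    have eq: "{x \<in> space (lborel \<Otimes>\<^sub>M (lborel :: real measure)). (fst x, snd x) \<notin> N} = space (lborel \<Otimes>\<^sub>M (lborel :: real measure)) - N" by auto
    show "{x \<in> space (lborel \<Otimes>\<^sub>M (lborel :: real measure)). (fst x, snd x) \<notin> N} \<in> sets (lborel \<Otimes>\<^sub>M lborel)" unfolding eq by (rule sets.compl_sets[OF Ns])
  qed
  thus ?thesis
  proof eventually_elim
    case (elim t)
    thus ?case by eventually_elim (use N(1) in auto)
  qed
qed

text \<open>Nonnegativity needs that \<open>Q 4\<close> is not null. It makes both summands of \<open>norm1\<close> finite as soon as their sum is.\<close>

lemma Linf_norm_AE: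
  fixes f :: "(real^'n) \<times> real \<Rightarrow> 'b::real_normed_vector"
  shows "AE p in lborel. p \<in> Q 4 \<longrightarrow> ereal (norm (f p)) \<le> Linf_norm (Q 4) f" and "0 \<le> Linf_norm (Q 4) f"
proof -
  have Q: "(Q 4 :: ((real^'n) \<times> real) set) \<in> sets lebesgue"
    unfolding Q_def by (intro sets_completionI_sets) (simp add: borel_Times)
  have "AE p in lebesgue_on (Q 4). ereal (norm (f p)) \<le> Linf_norm (Q 4) f"
    unfolding Linf_norm_def by (rule esssup_AE)
  thus ae: "AE p in lborel. p \<in> Q 4 \<longrightarrow> ereal (norm (f p)) \<le> Linf_norm (Q 4) f"
    using Q by (simp add: AE_restrict_space_iff AE_completion_iff)
  have "open (ball 0 4 \<times> {0<..<16} :: ((real^'n) \<times> real) set)" by (intro open_Times) auto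
  moreover have "(0, 1) \<in> (ball 0 4 \<times> {0<..<16} :: ((real^'n) \<times> real) set)" by auto
  ultimately obtain p :: "(real^'n) \<times> real" where "p \<in> ball 0 4 \<times> {0<..<16}" "p \<in> Q 4 \<longrightarrow> ereal (norm (f p)) \<le> Linf_norm (Q 4) f"
    using AE_ex_in_open[OF ae] by blast
  hence "ereal (norm (f p)) \<le> Linf_norm (Q 4) f" by (auto simp: Q_def)
  moreover have "0 \<le> ereal (norm (f p))" by simp
  ultimately show "0 \<le> Linf_norm (Q 4) f" by (rule order_trans[rotated])
qed

lemma differentiable_partial_x:
  assumes "(\<lambda>x. V (x, t)) differentiable (at x)"
  shows "((\<lambda>x. V (x, t)) has_derivative (\<lambda>h. grad_x V (x, t) \<bullet> h)) (at (x :: real^'n))"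
proof -
  obtain f' where f': "((\<lambda>x. V (x, t)) has_derivative f') (at x)" using assms by (auto simp: differentiable_def)
  then interpret f': bounded_linear f' by (rule has_derivative_bounded_linear)
  have px: "partial_x i V (x, t) = f' (axis i 1)" for i
  proof -
    have d: "((\<lambda>h. x + h *\<^sub>R axis i 1) has_derivative (\<lambda>h. h *\<^sub>R axis i 1)) (at 0)"
      by (auto intro!: derivative_eq_intros)
    have "((\<lambda>h. V (x + h *\<^sub>R axis i 1, t)) has_derivative (\<lambda>h. f' (h *\<^sub>R axis i 1))) (at 0)"
      by (rule has_derivative_compose[OF d]) (use f' in simp)
    hence "((\<lambda>h. V (x + h *\<^sub>R axis i 1, t)) has_real_derivative f' (axis i 1)) (at 0)"
      by (simp add: has_field_derivative_def f'.scaleR mult.commute[of _ "f' (axis i 1)"])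
    thus ?thesis by (simp add: partial_x_def DERIV_imp_deriv)
  qed
  have "f' h = grad_x V (x, t) \<bullet> h" for h
  proof -
    have "h = (\<Sum>i\<in>UNIV. h $ i *\<^sub>R axis i 1)" by (simp add: vec_eq_iff axis_def if_distrib[where f="\<lambda>x. _ * x"] cong: if_cong)
    hence "f' h = (\<Sum>i\<in>UNIV. f' (h $ i *\<^sub>R axis i 1))" using f'.sum[of "\<lambda>i. h $ i *\<^sub>R axis i 1" UNIV] by simp
    also have "\<dots> = grad_x V (x, t) \<bullet> h" by (simp add: f'.scaleR inner_vec_def grad_x_def px mult.commute)
    finally show ?thesis .
  qed
  hence "f' = (\<lambda>h. grad_x V (x, t) \<bullet> h)" by (rule ext)
  thus ?thesis using f' by simp
qed

text \<open>The gradient is bounded only almost everywhere in space-time. By Fubini, for almost every \<open>t\<close> it is bounded for almost all \<open>x\<close>,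
hence for all \<open>x\<close> by continuity in \<open>x\<close>, and \<open>V\<close> is Lipschitz on that slice, the ball being convex. Hoelder continuity in \<open>t\<close>
carries the bound to the remaining slices, in particular to \<open>t = 0\<close>, where the coefficients are frozen.\<close>

lemma potential_bounds:
  fixes V :: "(real^'n) \<times> real \<Rightarrow> real"
  assumes C1: "C1_in_x V" and n1: "norm1 V < \<infinity>" and hh: "holder_half V < \<infinity>"
  defines "M \<equiv> real_of_ereal (norm1 V)" and "H \<equiv> real_of_ereal (holder_half V)"
  shows "0 \<le> M" "0 \<le> H"
    "\<And>x t. x \<in> ball 0 4 \<Longrightarrow> t \<in> {0..16} \<Longrightarrow> \<bar>V (x, t)\<bar> \<le> M"
    "\<And>x y t. x \<in> ball 0 4 \<Longrightarrow> y \<in> ball 0 4 \<Longrightarrow> t \<in> {0..16} \<Longrightarrow> \<bar>V (x, t) - V (y, t)\<bar> \<le> M * norm (x - y)"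
    "\<And>x t s. x \<in> ball 0 4 \<Longrightarrow> t \<in> {0..16} \<Longrightarrow> s \<in> {0..16} \<Longrightarrow> \<bar>V (x, t) - V (x, s)\<bar> \<le> H * sqrt \<bar>t - s\<bar>"
proof -
  have p: "0 \<le> Linf_norm (Q 4) V" "0 \<le> Linf_norm (Q 4) (grad_x V)" by (rule Linf_norm_AE)+
  have n: "0 \<le> norm1 V" unfolding norm1_def using p by simp
  have nM: "norm1 V = ereal M" using n n1 by (cases "norm1 V") (auto simp: M_def)
  thus M: "0 \<le> M" using n by simp
  have leM: "Linf_norm (Q 4) V \<le> ereal M" "Linf_norm (Q 4) (grad_x V) \<le> ereal M"
    unfolding nM[symmetric] norm1_def using p add_left_mono[OF p(2), of "Linf_norm (Q 4) V"] add_right_mono[OF p(1), of "Linf_norm (Q 4) (grad_x V)"] by auto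
  have hin: "ereal (\<bar>V (x, t) - V (x, s)\<bar> / sqrt \<bar>t - s\<bar>) \<le> holder_half V"
    if "x \<in> ball 0 4" "t \<in> {0..16}" "s \<in> {0..16}" "t \<noteq> s" for x t s
    unfolding holder_half_def using that by (intro Sup_upper) (auto simp: Q_def)
  have h0: "0 \<le> holder_half V" by (rule order_trans[OF _ hin[of 0 0 1]]) auto
  have nH: "holder_half V = ereal H" using h0 hh by (cases "holder_half V") (auto simp: H_def)
  thus H: "0 \<le> H" using h0 by simp
  show hold: "\<bar>V (x, t) - V (x, s)\<bar> \<le> H * sqrt \<bar>t - s\<bar>" if "x \<in> ball 0 4" "t \<in> {0..16}" "s \<in> {0..16}" for x t s
  proof (cases "t = s")
    case False
    thus ?thesis using hin[OF that False] by (simp add: nH divide_le_eq)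
  qed simp
  have ae: "AE t in lborel. (AE x in lborel. (x, t) \<in> Q 4 \<longrightarrow> \<bar>V (x, t)\<bar> \<le> M \<and> norm (grad_x V (x, t)) \<le> M)"
  proof (rule AE_swap_slices)
    show "AE p in lborel. p \<in> Q 4 \<longrightarrow> \<bar>V p\<bar> \<le> M \<and> norm (grad_x V p) \<le> M"
      using Linf_norm_AE(1)[of V] Linf_norm_AE(1)[of "grad_x V"]
    proof eventually_elim
      case (elim q)
      show ?case
      proof
        assume "q \<in> Q 4"
        hence "ereal (norm (V q)) \<le> ereal M" "ereal (norm (grad_x V q)) \<le> ereal M" using elim leM by (blast intro: order_trans)+
        thus "\<bar>V q\<bar> \<le> M \<and> norm (grad_x V q) \<le> M" by simp
      qed
    qed
  qed
  have good: "\<bar>V (x, t)\<bar> \<le> M \<and> \<bar>V (x, t) - V (y, t)\<bar> \<le> M * norm (x - y)"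
    if t: "t \<in> {0..16}" and a: "AE x in lborel. (x, t) \<in> Q 4 \<longrightarrow> \<bar>V (x, t)\<bar> \<le> M \<and> norm (grad_x V (x, t)) \<le> M"
      and xy: "x \<in> ball 0 4" "y \<in> ball 0 4" for t x y
  proof
    have df: "(\<lambda>x. V (x, t)) differentiable_on ball 0 4" and cg: "continuous_on (ball 0 4) (\<lambda>x. grad_x V (x, t))"
      using C1 t by (auto simp: C1_in_x_def)
    have aV: "AE x in lborel. x \<in> ball 0 4 \<longrightarrow> norm (V (x, t)) \<le> M"
      using a by eventually_elim (use t in \<open>auto simp: Q_def\<close>)
    show "\<bar>V (x, t)\<bar> \<le> M"
      using AE_bound_continuous[OF aV differentiable_imp_continuous_on[OF df] open_ball xy(1)] by simp
    have aG: "AE x in lborel. x \<in> ball 0 4 \<longrightarrow> norm (grad_x V (x, t)) \<le> M"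
      using a by eventually_elim (use t in \<open>auto simp: Q_def\<close>)
    have "norm (V (x, t) - V (y, t)) \<le> M * norm (x - y)"
    proof (rule differentiable_bound[where S = "ball 0 4" and f' = "\<lambda>z h. grad_x V (z, t) \<bullet> h"])
      fix z :: "real^'n" assume z: "z \<in> ball 0 4"
      have "(\<lambda>x. V (x, t)) differentiable (at z)"
        using df z unfolding differentiable_on_def by (metis at_within_open open_ball)
      from differentiable_partial_x[OF this]
      show "((\<lambda>x. V (x, t)) has_derivative (\<lambda>h. grad_x V (z, t) \<bullet> h)) (at z within ball 0 4)" by (rule has_derivative_at_withinI)
      have "norm (grad_x V (z, t)) \<le> M" by (rule AE_bound_continuous[OF aG cg open_ball z])
      thus "onorm (\<lambda>h. grad_x V (z, t) \<bullet> h) \<le> M"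
        by (intro onorm_le) (metis Cauchy_Schwarz_ineq2 mult_right_mono norm_ge_zero order_trans real_norm_def)
    qed (use xy in auto)
    thus "\<bar>V (x, t) - V (y, t)\<bar> \<le> M * norm (x - y)" by simp
  qed
  have near: "\<exists>s\<in>{0..16}. \<bar>t - s\<bar> < \<eta> \<and> (AE x in lborel. (x, s) \<in> Q 4 \<longrightarrow> \<bar>V (x, s)\<bar> \<le> M \<and> norm (grad_x V (x, s)) \<le> M)"
    if t: "t \<in> {0..16}" and e: "\<eta> > 0" for t \<eta> :: real
  proof -
    have "max 0 (t - \<eta>) < min 16 (t + \<eta>)" using t e by auto
    hence "{max 0 (t - \<eta>)<..<min 16 (t + \<eta>)} \<noteq> {}" by (simp only: greaterThanLessThan_empty_iff not_le not_False_eq_True)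
    from AE_ex_in_open[OF ae open_greaterThanLessThan this] obtain s where
      "s \<in> {max 0 (t - \<eta>)<..<min 16 (t + \<eta>)}" "AE x in lborel. (x, s) \<in> Q 4 \<longrightarrow> \<bar>V (x, s)\<bar> \<le> M \<and> norm (grad_x V (x, s)) \<le> M" by auto
    thus ?thesis by (intro bexI[of _ s]) auto
  qed
  have approx: "\<exists>s\<in>{0..16}. (\<forall>x\<in>ball 0 4. \<bar>V (x, t) - V (x, s)\<bar> \<le> e) \<and> (\<forall>x\<in>ball 0 4. \<forall>y\<in>ball 0 4. \<bar>V (x, s)\<bar> \<le> M \<and> \<bar>V (x, s) - V (y, s)\<bar> \<le> M * norm (x - y))"
    if t: "t \<in> {0..16}" and e: "e > 0" for t e :: real
  proof -
    obtain s where s: "s \<in> {0..16}" "\<bar>t - s\<bar> < (e / (H + 1))\<^sup>2" and g: "AE x in lborel. (x, s) \<in> Q 4 \<longrightarrow> \<bar>V (x, s)\<bar> \<le> M \<and> norm (grad_x V (x, s)) \<le> M"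
      using near[OF t, of "(e / (H + 1))\<^sup>2"] e H by auto
    have "sqrt \<bar>t - s\<bar> \<le> e / (H + 1)" by (rule real_le_lsqrt) (use s e H in auto)
    hence "H * sqrt \<bar>t - s\<bar> \<le> H * (e / (H + 1))" using H by (rule mult_left_mono)
    also have "\<dots> \<le> e" using H e by (simp add: field_simps)
    finally have "\<bar>V (x, t) - V (x, s)\<bar> \<le> e" if "x \<in> ball 0 4" for x using hold[OF that t s(1)] by linarith
    thus ?thesis using s(1) good[OF s(1) g] by blast
  qed
  show "\<bar>V (x, t)\<bar> \<le> M" if x: "x \<in> ball 0 4" and t: "t \<in> {0..16}" for x t
  proof (rule field_le_epsilon)
    fix e :: real assume "e > 0"
    from approx[OF t this] x show "\<bar>V (x, t)\<bar> \<le> M + e" by (smt (verit))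
  qed
  show "\<bar>V (x, t) - V (y, t)\<bar> \<le> M * norm (x - y)" if xy: "x \<in> ball 0 4" "y \<in> ball 0 4" and t: "t \<in> {0..16}" for x y t
  proof (rule field_le_epsilon)
    fix e :: real assume "e > 0"
    hence "e / 2 > 0" by simp
    from approx[OF t this] obtain s where s: "\<And>x. x \<in> ball 0 4 \<Longrightarrow> \<bar>V (x, t) - V (x, s)\<bar> \<le> e / 2" "\<bar>V (x, s) - V (y, s)\<bar> \<le> M * norm (x - y)"
      using xy by blast
    show "\<bar>V (x, t) - V (y, t)\<bar> \<le> M * norm (x - y) + e" using s(1)[OF xy(1)] s(1)[OF xy(2)] s(2) by linarith
  qed
qed

section \<open>Extension of the coefficients\<close>

text \<open>A nonexpansive retraction onto a cylinder inside \<open>Q 4\<close>. Composition with it extends the coefficients to all of space-time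
without changing their constants, and leaves them unchanged on the support of \<open>w\<close>.\<close>

definition cyl_retract :: "real \<Rightarrow> (real^'n) \<times> real \<Rightarrow> (real^'n) \<times> real"
  where "cyl_retract r p = (closest_point (cball 0 r) (fst p), max 0 (min 16 (snd p)))"

lemma cyl_retract_in: "0 < r \<Longrightarrow> r < 4 \<Longrightarrow> fst (cyl_retract r p) \<in> ball 0 4 \<and> snd (cyl_retract r p) \<in> {0..16}"
  using closest_point_in_set[of "cball 0 r" "fst p"] by (auto simp: cyl_retract_def)

lemma cyl_retract_id: "norm x \<le> r \<Longrightarrow> t \<in> {0..16} \<Longrightarrow> cyl_retract r (x, t) = (x, t)"
  by (simp add: cyl_retract_def closest_point_self)

lemma cyl_retract_lipschitz: assumes "0 < r"
  shows "norm (fst (cyl_retract r p) - fst (cyl_retract r q)) \<le> norm (fst p - fst q)" "\<bar>snd (cyl_retract r p) - snd (cyl_retract r q)\<bar> \<le> \<bar>snd p - snd q\<bar>"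
  using closest_point_lipschitz[of "cball 0 r" "fst p" "fst q"] assms by (auto simp: cyl_retract_def dist_norm)

lemma continuous_on_parabolic_lipschitz:
  fixes F :: "(real^'n) \<times> real \<Rightarrow> 'b::real_normed_vector"
  assumes "\<And>p q. norm (F p - F q) \<le> L * norm (fst p - fst q) + H * sqrt \<bar>snd p - snd q\<bar>"
  shows "continuous_on S F"
  unfolding continuous_on_def
proof
  fix p assume "p \<in> S"
  have "((\<lambda>q. L * norm (fst q - fst p) + H * sqrt \<bar>snd q - snd p\<bar>) \<longlongrightarrow> L * norm (fst p - fst p) + H * sqrt \<bar>snd p - snd p\<bar>) (at p within S)"
    by (intro tendsto_intros)
  hence 0: "((\<lambda>q. L * norm (fst q - fst p) + H * sqrt \<bar>snd q - snd p\<bar>) \<longlongrightarrow> 0) (at p within S)" by simp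
  have "((\<lambda>q. F q - F p) \<longlongrightarrow> 0) (at p within S)"
    by (rule Lim_null_comparison[OF _ 0]) (use assms in auto)
  thus "(F \<longlongrightarrow> F p) (at p within S)" by (rule LIM_zero_cancel)
qed

text \<open>The bound for \<open>A'\<close> comes from \<open>A(0,0) = 1\<close> and the Lipschitz condition, as \<open>|x| + t\<^sup>1\<^sup>/\<^sup>2 \<le> 8\<close> in \<open>Q 4\<close>.\<close>

lemma extended_coefficients:
  fixes A :: "(real^'n) \<times> real \<Rightarrow> real^'n^'n"
  assumes ell: "elliptic_on (Q 4) \<Lambda> A" and lip: "parabolic_lipschitz_on (Q 4) K A" and A0: "A (0, 0) = mat 1"
    and L: "\<Lambda> \<ge> 1" and r: "0 < r" "r < 4"
  defines "A' \<equiv> \<lambda>p. A (cyl_retract r p)"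
  shows "0 \<le> K" "transpose (A' p) = A' p" "(norm v)\<^sup>2 \<le> \<Lambda> * (v \<bullet> (A' p *v v))" "norm (A' p) \<le> norm (mat 1 :: real^'n^'n) + 8 * K"
    "norm (A' (x, t) - A' (y, s)) \<le> K * (norm (x - y) + sqrt \<bar>t - s\<bar>)" "A' (0, 0) = mat 1"
    "continuous_on UNIV A'"
proof -
  have cin: "cyl_retract r p \<in> Q 4" for p :: "(real^'n) \<times> real" using cyl_retract_in[OF r, of p] by (cases "cyl_retract r p") (auto simp: Q_def)
  have lipA: "norm (A p - A q) \<le> K * (norm (fst p - fst q) + sqrt \<bar>snd p - snd q\<bar>)" if "p \<in> Q 4" "q \<in> Q 4" for p q
    using lip that by (cases p; cases q) (auto simp: parabolic_lipschitz_on_def)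
  have "norm (A (0, 0) - A (0, 1)) \<le> K * (norm (0 - 0 :: real^'n) + sqrt \<bar>0 - 1\<bar>)" using lipA[of "(0, 0)" "(0, 1)"] by (simp add: Q_def)
  thus K: "0 \<le> K" by (simp add: order_trans[OF norm_ge_zero])
  have e: "loewner_le (inverse \<Lambda> *\<^sub>R mat 1) (A' p)" "loewner_le (A' p) (\<Lambda> *\<^sub>R mat 1)"
    using ell cin[of p] by (auto simp: elliptic_on_def A'_def)
  show "transpose (A' p) = A' p" using e by (simp add: loewner_le_def)
  have "v \<bullet> ((inverse \<Lambda> *\<^sub>R mat 1) *v v) \<le> v \<bullet> (A' p *v v)" using e by (simp add: loewner_le_def)
  hence "inverse \<Lambda> * (norm v)\<^sup>2 \<le> v \<bullet> (A' p *v v)"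
    by (simp add: scaleR_matrix_vector_assoc[symmetric] power2_norm_eq_inner)
  hence "\<Lambda> * (inverse \<Lambda> * (norm v)\<^sup>2) \<le> \<Lambda> * (v \<bullet> (A' p *v v))" using L by (intro mult_left_mono) auto
  moreover have "\<Lambda> * (inverse \<Lambda> * (norm v)\<^sup>2) = (norm v)\<^sup>2" using L by (simp add: mult.assoc[symmetric])
  ultimately show "(norm v)\<^sup>2 \<le> \<Lambda> * (v \<bullet> (A' p *v v))" by (simp only:)
  show l': "norm (A' (x, t) - A' (y, s)) \<le> K * (norm (x - y) + sqrt \<bar>t - s\<bar>)" for x y t s
  proof -
    have "norm (A' (x, t) - A' (y, s)) \<le> K * (norm (fst (cyl_retract r (x, t)) - fst (cyl_retract r (y, s))) + sqrt \<bar>snd (cyl_retract r (x, t)) - snd (cyl_retract r (y, s))\<bar>)"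
      unfolding A'_def by (rule lipA[OF cin cin])
    also have "\<dots> \<le> K * (norm (x - y) + sqrt \<bar>t - s\<bar>)"
      using cyl_retract_lipschitz[OF r(1), of "(x, t)" "(y, s)"] K by (intro mult_left_mono add_mono) auto
    finally show ?thesis .
  qed
  show A'0: "A' (0, 0) = mat 1" using r by (simp add: A'_def cyl_retract_id A0)
  show "norm (A' p) \<le> norm (mat 1 :: real^'n^'n) + 8 * K"
  proof -
    have c: "norm (fst (cyl_retract r p)) \<le> 4" "sqrt \<bar>snd (cyl_retract r p)\<bar> \<le> 4"
      using cyl_retract_in[OF r, of p] by (auto intro!: real_le_lsqrt)
    have "norm (A' p - mat 1) \<le> K * (norm (fst (cyl_retract r p) - 0) + sqrt \<bar>snd (cyl_retract r p) - 0\<bar>)"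
      unfolding A0[symmetric] A'_def using lipA[OF cin, of "(0, 0)" p] by (simp add: Q_def)
    also have "\<dots> \<le> K * (4 + 4)" using c K by (intro mult_left_mono add_mono) auto
    also have "\<dots> = 8 * K" by simp
    finally show ?thesis using norm_triangle_sub[of "A' p" "mat 1"] by linarith
  qed
  show "continuous_on UNIV A'"
  proof (rule continuous_on_parabolic_lipschitz[where L = K and H = K])
    show "norm (A' p - A' q) \<le> K * norm (fst p - fst q) + K * sqrt \<bar>snd p - snd q\<bar>" for p q
      using l'[of "fst p" "snd p" "fst q" "snd q"] by (simp add: distrib_left)
  qed
qed

section \<open>The constant in front of the supremum\<close>

text \<open>With \<open>\<lambda> = \<alpha>/\<delta>\<^sup>2\<close> the constant is \<open>\<alpha>\<^sup>2\<^sup>\<alpha>\<close> times factors that are at most exponential in \<open>\<alpha>\<close>, a fixed power of \<open>\<alpha>\<close> included;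
a large \<open>N\<close> beats them.\<close>

lemma bad_constant_absorbed:
  fixes al \<delta> n k N :: real
  assumes d: "0 < \<delta>" "\<delta> < 1" and al: "1 \<le> al" and k: "1 \<le> k" and n: "0 \<le> n"
    and N: "k * exp ((n + 484) + 16 + (n / 2 + 2) + (n + 8) * ln (1 / \<delta>)) \<le> N"
  shows "k * (132 * exp ((n + 484) * al) * (al / \<delta>\<^sup>2) powr (2 * al + n / 2 + 2)) \<le> N powr (2 * al) * al powr (2 * al)"
proof -
  define l where "l = ln (1 / \<delta>)"
  have l: "0 \<le> l" using d by (simp add: l_def)
  define tot where "tot = (n + 484) + 16 + (n / 2 + 2) + (n + 8) * l"
  have tot: "0 \<le> tot" using n l by (simp add: tot_def)
  have e132: "132 \<le> exp (16 * al)"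
  proof -
    have "(132::real) \<le> 1 + 16 + 16\<^sup>2 / 2" by simp
    also have "\<dots> \<le> exp 16" by (rule exp_lower_Taylor_quadratic) simp
    also have "\<dots> \<le> exp (16 * al)" using al by simp
    finally show ?thesis .
  qed
  define mm where "mm = 2 * al + n / 2 + 2"
  have "(al / \<delta>\<^sup>2) powr mm = al powr mm * exp (2 * mm * l)"
  proof -
    have "al / \<delta>\<^sup>2 = al * exp (2 * l)"
    proof -
      have "exp (2 * l) = (exp l)\<^sup>2" by (simp add: exp_double)
      also have "\<dots> = (1 / \<delta>)\<^sup>2" using d by (simp add: l_def)
      finally show ?thesis by (simp add: power_divide)
    qed
    thus ?thesis by (simp add: powr_mult exp_powr_real mult_ac)
  qed
  also have "\<dots> = al powr (2 * al) * (al powr (n / 2 + 2) * exp (2 * mm * l))" by (simp add: mm_def powr_add[symmetric] mult.assoc[symmetric] add.assoc)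
  also have "\<dots> \<le> al powr (2 * al) * (exp ((n / 2 + 2) * al) * exp ((n + 8) * l * al))"
  proof (intro mult_left_mono mult_mono)
    show "al powr (n / 2 + 2) \<le> exp ((n / 2 + 2) * al)" by (rule powr_le_exp) (use al n in auto)
    have "(n + 4) * 1 \<le> (n + 4) * al" using al n by (intro mult_left_mono) auto
    hence "2 * mm \<le> (n + 8) * al" by (simp add: mm_def algebra_simps)
    hence "2 * mm * l \<le> (n + 8) * al * l" using l by (rule mult_right_mono)
    thus "exp (2 * mm * l) \<le> exp ((n + 8) * l * al)" by (simp add: mult_ac)
  qed auto
  finally have pw: "(al / \<delta>\<^sup>2) powr mm \<le> al powr (2 * al) * (exp ((n / 2 + 2) * al) * exp ((n + 8) * l * al))" .
  have "132 * exp ((n + 484) * al) * (al / \<delta>\<^sup>2) powr mm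
     \<le> exp (16 * al) * exp ((n + 484) * al) * (al powr (2 * al) * (exp ((n / 2 + 2) * al) * exp ((n + 8) * l * al)))"
    using e132 pw by (intro mult_mono mult_right_mono) auto
  also have "\<dots> = al powr (2 * al) * ((exp (16 * al) * exp ((n + 484) * al)) * (exp ((n / 2 + 2) * al) * exp ((n + 8) * l * al)))"
    by (simp only: mult_ac)
  also have "(exp (16 * al) * exp ((n + 484) * al)) * (exp ((n / 2 + 2) * al) * exp ((n + 8) * l * al)) = exp (tot * al)"
    unfolding exp_add[symmetric] by (rule arg_cong[where f = exp]) (simp add: tot_def algebra_simps)
  finally have 1: "k * (132 * exp ((n + 484) * al) * (al / \<delta>\<^sup>2) powr mm) \<le> k * (al powr (2 * al) * exp (tot * al))"
    using k by (intro mult_left_mono) auto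
  have "k * exp (tot * al) \<le> k powr (2 * al) * exp tot powr (2 * al)"
  proof (rule mult_mono)
    have "k powr 1 \<le> k powr (2 * al)" using k al by (intro powr_mono) auto
    thus "k \<le> k powr (2 * al)" using k by simp
    have "tot * al \<le> tot * (2 * al)" using tot al by (intro mult_left_mono) auto
    thus "exp (tot * al) \<le> exp tot powr (2 * al)" by (simp add: powr_def mult_ac)
  qed auto
  also have "\<dots> = (k * exp tot) powr (2 * al)" by (simp add: powr_mult)
  also have "\<dots> \<le> N powr (2 * al)" using N k al by (intro powr_mono2) (auto simp: tot_def l_def)
  finally have "k * exp (tot * al) * al powr (2 * al) \<le> N powr (2 * al) * al powr (2 * al)" by (rule mult_right_mono) simp
  thus ?thesis using 1 by (simp add: mm_def mult_ac)
qed

section \<open>The estimate in terms of the original integrals\<close>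

lemma final_arithmetic:
  fixes W0 Gd wg a b1 k N Fi Bad sp NN al b0 :: real
  assumes i: "W0 + Gd + wg * (a * b1) \<le> k * (Fi + Bad * sp + wg * (al * b0))"
    and N: "1 \<le> N" "k \<le> N" and B: "k * Bad \<le> NN" and nn: "0 \<le> Fi" "0 \<le> sp" "0 \<le> wg" "0 \<le> b0" "0 \<le> b1" "0 \<le> al" "0 \<le> a"
  shows "W0 + Gd \<le> N * Fi + NN * sp + wg * (- (a / N) * b1 + N * al * b0)"
proof -
  have 1: "k * Fi \<le> N * Fi" by (rule mult_right_mono) (use N nn in auto)
  have 2: "(k * Bad) * sp \<le> NN * sp" by (rule mult_right_mono) (use B nn in auto)
  have 3: "k * (wg * (al * b0)) \<le> N * (wg * (al * b0))" by (rule mult_right_mono) (use N nn in auto)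
  have "a / N \<le> a / 1" by (rule divide_left_mono) (use N nn in auto)
  hence "a / N * b1 \<le> a * b1" using nn by (intro mult_right_mono) auto
  hence 4: "wg * (a / N * b1) \<le> wg * (a * b1)" using nn by (intro mult_left_mono) auto
  have "k * (Fi + Bad * sp + wg * (al * b0)) = k * Fi + (k * Bad) * sp + k * (wg * (al * b0))" by (simp add: distrib_left)
  hence "W0 + Gd \<le> N * Fi + NN * sp + N * (wg * (al * b0)) - wg * (a / N * b1)" using i 1 2 3 4 by linarith
  also have "\<dots> = N * Fi + NN * sp + wg * (- (a / N) * b1 + N * al * b0)" by (simp add: algebra_simps)
  finally show ?thesis .
qed

context carleman_setting
begin

lemma lebesgue_integral_J:
  assumes c: "continuous_on (cball 0 4) g" and z: "\<And>x. norm x > 4 \<Longrightarrow> g x = 0"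
  shows "(LINT x|lebesgue. g x) = J g"
proof -
  have "(LINT x|lebesgue. g x) = (LINT x|lebesgue. indicator (cball 0 4) x * g x)"
    by (rule Bochner_Integration.integral_cong) (use z in \<open>auto simp: indicator_def\<close>)
  also have "\<dots> = J g" unfolding J_def
    by (rule integral_completion) (rule borel_measurable_integrable[OF J_integrable[OF c]])
  finally show ?thesis .
qed

lemma slice: "t \<in> {0..T} \<Longrightarrow> xlip T H \<Longrightarrow> continuous_on (cball 0 4) (\<lambda>x. H (x, t))"
  by (rule continuous_on_compose2[OF xlip_continuous[of T H]]) (auto intro!: continuous_intros simp: strip_def)

lemma grad_x_eq: "grad_x w p = gw p"
  by (simp add: grad_x_def gw_def partial_x_smooth[OF w])

text \<open>\<open>As\<close> and \<open>Vs\<close> are the original coefficients: they have to agree with the extended ones only where \<open>\<nabla>w\<close> or \<open>w\<close> differs from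
zero. The supremum is over a bounded family, so each slice is below it.\<close>

theorem carleman_estimate:
  fixes \<sigma> :: "real \<Rightarrow> real" and As :: "(real^'n) \<times> real \<Rightarrow> real^'n^'n" and Vs :: "(real^'n) \<times> real \<Rightarrow> real" and N :: real
  defines "M \<equiv> absorption_const C (real CARD('n))"
  assumes w_late: "\<And>x t. t \<ge> T \<Longrightarrow> w (x, t) = 0"
    and sg_eq: "\<And>t. t \<in> {0..T} \<Longrightarrow> sg t = \<sigma> (t + a)"
    and As: "\<And>x t. t \<ge> 0 \<Longrightarrow> As (x, t) *v gw (x, t) = A (x, t) *v gw (x, t)"
    and Vs: "\<And>x t. t \<ge> 0 \<Longrightarrow> Vs (x, t) * w (x, t) = V (x, t) * w (x, t)"
    and D: "62 * M^6 * dl \<le> 1" and al: "\<alpha> \<ge> 16 * exp 60"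
    and N: "1 \<le> N" "1888 * M^6 * exp 300 \<le> N"
    and B: "(1888 * M^6 * exp 300) * Bad \<le> N powr (2 * \<alpha>) * \<alpha> powr (2 * \<alpha>)"
  shows "\<alpha>\<^sup>2 * space_time_integral
              (\<lambda>(x, t). \<sigma> (t + a) powr (- 2 * \<alpha>) * (w (x, t))\<^sup>2 * G x (t + a))
          + \<alpha> * space_time_integral
              (\<lambda>(x, t). \<sigma> (t + a) powr (1 - 2 * \<alpha>) * (norm (grad_x w (x, t)))\<^sup>2 * G x (t + a))
          \<le> N * space_time_integral
              (\<lambda>(x, t). \<sigma> (t + a) powr (1 - 2 * \<alpha>) *
                (div_x (\<lambda>q. As q *v grad_x w q) (x, t) + partial_t w (x, t) + Vs (x, t) * w (x, t))\<^sup>2 *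
                G x (t + a))
          + N powr (2 * \<alpha>) * \<alpha> powr (2 * \<alpha>) *
              (SUP t\<in>{0..}. LINT x|lebesgue. (w (x, t))\<^sup>2 + t * (norm (grad_x w (x, t)))\<^sup>2)
          + \<sigma> a powr (- 2 * \<alpha>) *
              (- (a / N) * (LINT x|lebesgue. (norm (grad_x w (x, 0)))\<^sup>2 * G x a)
               + N * \<alpha> * (LINT x|lebesgue. (w (x, 0))\<^sup>2 * G x a))"
proof -
  have gw_late: "gw (x, t) = 0" if "t \<ge> T" for x t
  proof -
    have "dd (axis i 1, 0) w (x, t) = 0" for i
      by (rule dd_eq_0_one_sided[OF w, of 1]) (use w_late that in auto)
    thus ?thesis by (simp add: gw_def vec_eq_iff)
  qed
  have gw_far: "gw (x, t) = 0" if "t \<ge> 0" "norm x > 4" for x t using gw_zero[of t x] r' that by simp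
  have w_far: "w (x, t) = 0" if "t \<ge> 0" "norm x > 4" for x t using w_zero[of t x] r' that by simp
  have w_out: "w (x, t) = 0" and gw_out: "gw (x, t) = 0" if "t \<ge> 0" "(x, t) \<notin> strip T" for x t
    using that w_far[of t x] gw_far[of t x] w_late[of t x] gw_late[of t x] by (auto simp: strip_def not_le)
  have wt_out: "wt (x, t) = 0" if "t \<ge> 0" "(x, t) \<notin> strip T" for x t
    unfolding wt_def
  proof (rule dd_eq_0_one_sided[OF w, of 1])
    fix h :: real assume "h \<in> {0..<1}"
    hence "t + h \<ge> 0" "(x, t + h) \<notin> strip T" using that by (auto simp: strip_def)
    thus "w ((x, t) + h *\<^sub>R (0, 1)) = 0" using w_out by simp
  qed simp
  have div_As: "div_x (\<lambda>q. As q *v grad_x w q) (x, t) = (\<Sum>i\<in>UNIV. deriv (\<lambda>h. (A (x + h *\<^sub>R axis i 1, t) *v gw (x + h *\<^sub>R axis i 1, t)) $ i) 0)"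
    if "t \<ge> 0" for x t
    using As[OF that] by (simp add: div_x_def partial_x_def grad_x_eq)
  have div_out: "div_x (\<lambda>q. As q *v grad_x w q) (x, t) = 0" if t: "t \<ge> 0" and o: "(x, t) \<notin> strip T" for x t
  proof -
    have "deriv (\<lambda>h. (A (x + h *\<^sub>R axis i 1, t) *v gw (x + h *\<^sub>R axis i 1, t)) $ i) 0 = 0" for i
    proof (cases "t \<ge> T")
      case True thus ?thesis by (simp add: gw_late)
    next
      case False
      hence x: "norm x > 4" using t o by (auto simp: strip_def)
      have "((\<lambda>h. (A (x + h *\<^sub>R axis i 1, t) *v gw (x + h *\<^sub>R axis i 1, t)) $ i) has_field_derivative 0) (at 0)"
      proof (rule has_field_derivative_transform_within_open[where f = "\<lambda>_. 0" and S = "ball 0 (norm x - 4)"])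
        fix h :: real assume "h \<in> ball 0 (norm x - 4)"
        hence "norm (x + h *\<^sub>R axis i 1) > 4" using norm_diff_ineq[of x "h *\<^sub>R axis i 1"] by simp
        thus "0 = (A (x + h *\<^sub>R axis i 1, t) *v gw (x + h *\<^sub>R axis i 1, t)) $ i" using gw_far[OF t] by simp
      qed (use x in auto)
      thus ?thesis by (rule DERIV_imp_deriv)
    qed
    thus ?thesis by (simp add: div_As[OF t])
  qed
  have div_AE: "AE p in \<mu> T. div_x (\<lambda>q. As q *v grad_x w q) p = mA p"
    using dA(3) AE_space
  proof eventually_elim
    case (elim p)
    obtain x t where p: "p = (x, t)" by (cases p)
    have t: "t \<ge> 0" using elim(2) p by (auto simp: strip_def)
    have "deriv (\<lambda>h. (A (x + h *\<^sub>R axis i 1, t) *v gw (x + h *\<^sub>R axis i 1, t)) $ i) 0 = dFA i p $ i" for i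
    proof -
      have "xd i p (\<lambda>q. A q *v gw q) (dFA i p)" unfolding dFA_def by (rule xd_mv) (use elim(1) xd_gw in auto)
      hence "((\<lambda>h. A (x + h *\<^sub>R axis i 1, t) *v gw (x + h *\<^sub>R axis i 1, t)) has_vector_derivative dFA i p) (at 0)"
        by (simp add: xd_def p)
      from bounded_linear.has_vector_derivative[OF bounded_linear_vec_nth this, of i]
      show ?thesis by (intro DERIV_imp_deriv) (simp add: has_real_derivative_iff_has_vector_derivative)
    qed
    thus ?case by (simp add: p div_As[OF t] mA_def)
  qed
  have in_strip: "wgt t = \<sigma> (t + a) powr (- 2 * \<alpha>)" "wgt t * sg t = \<sigma> (t + a) powr (1 - 2 * \<alpha>)" if "(x :: real^'n, t) \<in> strip T" for x t
  proof -
    have t: "t \<in> {0..T}" using that by (simp add: strip_def)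
    show "wgt t = \<sigma> (t + a) powr (- 2 * \<alpha>)" by (simp add: wgt_def sg_eq[OF t])
    have "sg t powr (- 2 * \<alpha> + 1) = sg t powr (- 2 * \<alpha>) * sg t powr 1" by (rule powr_add)
    hence "wgt t * sg t = sg t powr (- 2 * \<alpha> + 1)" using sg_pos[OF t] by (simp add: wgt_def)
    also have "\<dots> = sg t powr (1 - 2 * \<alpha>)" by (simp add: add.commute)
    finally show "wgt t * sg t = \<sigma> (t + a) powr (1 - 2 * \<alpha>)" by (simp only: sg_eq[OF t])
  qed
  have I1: "space_time_integral (\<lambda>(x, t). \<sigma> (t + a) powr (- 2 * \<alpha>) * (w (x, t))\<^sup>2 * G x (t + a)) = II Wd"
  proof (rule space_time_integral_eq_\<mu>, goal_cases)
    case 1 show ?case using tame_dens(5) by (simp add: tame_def)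
  next
    case 2 show ?case
    proof (rule AE_I2)
      fix p :: "(real^'n) \<times> real" assume "p \<in> space (\<mu> T)"
      then obtain x t where p: "p = (x, t)" "(x, t) \<in> strip T" by (cases p) auto
      show "(case p of (x, t) \<Rightarrow> \<sigma> (t + a) powr (- 2 * \<alpha>) * (w (x, t))\<^sup>2 * G x (t + a)) = Wd p"
        unfolding p(1) prod.case in_strip(1)[OF p(2), symmetric] by (simp add: Wd_def E_def Gp_def ta_def mult_ac)
    qed
  next
    case (3 p) thus ?case using w_out by (cases p) simp
  qed
  have I2: "space_time_integral (\<lambda>(x, t). \<sigma> (t + a) powr (1 - 2 * \<alpha>) * (norm (grad_x w (x, t)))\<^sup>2 * G x (t + a)) = II (\<lambda>p. E p * (sg (snd p) * (P p)\<^sup>2))"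
  proof (rule space_time_integral_eq_\<mu>, goal_cases)
    case 1
    have "tame T (\<lambda>p. E p * (sg (snd p) * (P p)\<^sup>2))" by (intro tame_mult tame_E tame_sg tame_power tame_P)
    thus ?case by (simp add: tame_def)
  next
    case 2 show ?case
    proof (rule AE_I2)
      fix p :: "(real^'n) \<times> real" assume "p \<in> space (\<mu> T)"
      then obtain x t where p: "p = (x, t)" "(x, t) \<in> strip T" by (cases p) auto
      show "(case p of (x, t) \<Rightarrow> \<sigma> (t + a) powr (1 - 2 * \<alpha>) * (norm (grad_x w (x, t)))\<^sup>2 * G x (t + a)) = E p * (sg (snd p) * (P p)\<^sup>2)"
        unfolding p(1) prod.case in_strip(2)[OF p(2), symmetric] by (simp add: E_def Gp_def ta_def P_def grad_x_eq mult_ac)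
    qed
  next
    case (3 p) thus ?case using gw_out by (cases p) (simp add: grad_x_eq)
  qed
  have I3: "space_time_integral (\<lambda>(x, t). \<sigma> (t + a) powr (1 - 2 * \<alpha>) *
        (div_x (\<lambda>q. As q *v grad_x w q) (x, t) + partial_t w (x, t) + Vs (x, t) * w (x, t))\<^sup>2 * G x (t + a))
     = II (\<lambda>p. E p * (sg (snd p) * (f p)\<^sup>2))"
  proof (rule space_time_integral_eq_\<mu>, goal_cases)
    case 1
    have "tame T (\<lambda>p. E p * (sg (snd p) * (f p)\<^sup>2))" by (intro tame_mult tame_E tame_sg tame_power tame_f)
    thus ?case by (simp add: tame_def)
  next
    case 2 show ?case using div_AE AE_space
    proof eventually_elim
      case (elim p)
      then obtain x t where p: "p = (x, t)" "(x, t) \<in> strip T" by (cases p) auto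
      have t: "t \<ge> 0" using p(2) by (simp add: strip_def)
      have "div_x (\<lambda>q. As q *v grad_x w q) (x, t) + partial_t w (x, t) + Vs (x, t) * w (x, t) = f p"
        using elim(1) Vs[OF t, of x] by (simp add: f_def p(1) partial_t_smooth[OF w] wt_def)
      thus ?case unfolding p(1) prod.case in_strip(2)[OF p(2), symmetric] by (simp add: E_def Gp_def ta_def mult_ac)
    qed
  next
    case (3 p) thus ?case using w_out wt_out div_out by (cases p) (simp add: partial_t_smooth[OF w] wt_def)
  qed
  have I4: "(LINT x|lebesgue. (norm (grad_x w (x, 0)))\<^sup>2 * G x a) = B1" "(LINT x|lebesgue. (w (x, 0))\<^sup>2 * G x a) = B0"
  proof -
    have "(LINT x|lebesgue. Gp (x, 0) * (P (x, 0))\<^sup>2) = B1" unfolding B1_def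
      by (rule lebesgue_integral_J[OF cont_slices(1)]) (simp add: P_def gw_far)
    moreover have "(LINT x|lebesgue. Gp (x, 0) * (w (x, 0))\<^sup>2) = B0" unfolding B0_def
      by (rule lebesgue_integral_J[OF cont_slices(2)]) (simp add: w_far)
    ultimately show "(LINT x|lebesgue. (norm (grad_x w (x, 0)))\<^sup>2 * G x a) = B1" "(LINT x|lebesgue. (w (x, 0))\<^sup>2 * G x a) = B0"
      by (simp_all add: P_def grad_x_eq Gp_def ta_def mult.commute)
  qed
  define en where "en t = (LINT x|lebesgue. (w (x, t))\<^sup>2 + t * (norm (grad_x w (x, t)))\<^sup>2)" for t
  have cs: "continuous_on (cball 0 4) (\<lambda>x. (w (x, t))\<^sup>2 + t * (norm (gw (x, t)))\<^sup>2)" if "t \<in> {0..T}" for t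
    by (intro continuous_intros slice[OF that] xlip_w xlip_gw)
  have enJ: "en t = J (\<lambda>x. (w (x, t))\<^sup>2 + t * (norm (gw (x, t)))\<^sup>2)" if "t \<in> {0..T}" for t
    unfolding en_def grad_x_eq by (rule lebesgue_integral_J[OF cs[OF that]]) (use that w_far gw_far in auto)
  have en_late: "en t = 0" if "t \<ge> T" for t using that w_late gw_late by (simp add: en_def grad_x_eq)
  obtain c1 where c1: "c1 \<ge> 0" "\<And>p. p \<in> strip T \<Longrightarrow> norm (w p) \<le> c1" using xlip_bound[OF xlip_w] by blast
  obtain c2 where c2: "c2 \<ge> 0" "\<And>p. p \<in> strip T \<Longrightarrow> norm (gw p) \<le> c2" using xlip_bound[OF xlip_gw] by blast
  have bdd: "bdd_above (en ` {0..})"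
  proof (rule bdd_aboveI2)
    fix t :: real assume "t \<in> {0..}"
    hence t0': "t \<ge> 0" by simp
    have cc: "0 \<le> J (\<lambda>x. c1\<^sup>2 + T * c2\<^sup>2)" using pos by (intro J_nonneg) auto
    show "en t \<le> J (\<lambda>x. c1\<^sup>2 + T * c2\<^sup>2)"
    proof (cases "t \<le> T")
      case True
      hence t: "t \<in> {0..T}" using t0' by simp
      show ?thesis unfolding enJ[OF t]
      proof (rule J_mono[OF cs[OF t] continuous_on_const])
        fix x :: "real^'n" assume "norm x \<le> 4"
        hence p: "(x, t) \<in> strip T" using t by (simp add: strip_def)
        have "\<bar>w (x, t)\<bar>\<^sup>2 \<le> c1\<^sup>2" "(norm (gw (x, t)))\<^sup>2 \<le> c2\<^sup>2" using c1(2)[OF p] c2(2)[OF p] by (intro power_mono; simp)+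
        thus "(w (x, t))\<^sup>2 + t * (norm (gw (x, t)))\<^sup>2 \<le> c1\<^sup>2 + T * c2\<^sup>2" using t unfolding power2_abs by (intro add_mono mult_mono) auto
      qed
    qed (use en_late[of t] cc in simp)
  qed
  define sp where "sp = (SUP t\<in>{0..}. en t)"
  have sp: "J (\<lambda>x. (w (x, t))\<^sup>2) \<le> sp" if t: "t \<in> {0..T}" for t
  proof -
    have "continuous_on (cball 0 4) (\<lambda>x. (w (x, t))\<^sup>2)" by (intro continuous_on_power slice[OF t] xlip_w)
    hence "J (\<lambda>x. (w (x, t))\<^sup>2) \<le> en t" unfolding enJ[OF t]
      by (rule J_mono[OF _ cs[OF t]]) (use t in simp)
    also have "\<dots> \<le> sp" unfolding sp_def by (rule cSUP_upper[OF _ bdd]) (use t in simp)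
    finally show ?thesis .
  qed
  have sp0: "0 \<le> sp" using sp[OF t0] J_nonneg[of "\<lambda>x. (w (x, 0))\<^sup>2"] by simp
  have nb: "0 \<le> B0" "0 \<le> B1"
    unfolding B0_def B1_def using Gp_pos by (auto intro!: J_nonneg mult_nonneg_nonneg)
  have Fi: "0 \<le> II (\<lambda>p. E p * (sg (snd p) * (f p)\<^sup>2))"
  proof (rule II_nonneg)
    fix p :: "(real^'n) \<times> real" assume p: "p \<in> strip T"
    have "0 \<le> sg (snd p)" using sg_pos[OF strip_T(1)[OF p]] by simp
    thus "0 \<le> E p * (sg (snd p) * (f p)\<^sup>2)" using E_nonneg[OF p] by simp
  qed
  have w00: "wgt 0 = \<sigma> a powr (- 2 * \<alpha>)" using sg_eq[OF t0] by (simp add: wgt_def)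
  show ?thesis unfolding I1 I2 I3 I4 en_def[symmetric] sp_def[symmetric] w00[symmetric]
    by (rule final_arithmetic[OF carleman_inequality_explicit[OF D[unfolded M_def] al sp, folded M_def] N B Fi sp0])
       (use wgt_pos[OF t0] nb pos in auto)
qed

end

section \<open>The Carleman inequality\<close>

text \<open>By compactness the support stays away from the lateral boundary.\<close>

lemma support_radius:
  fixes S :: "((real^'n) \<times> real) set"
  assumes "compact S" "S \<subseteq> ball 0 4 \<times> B"
  obtains r where "0 < r" "r < 4" "\<And>x t. (x, t) \<in> S \<Longrightarrow> norm x < r"
proof -
  have "compact (fst ` S)" by (intro compact_continuous_image assms continuous_intros)
  have "\<exists>s<4. \<forall>p\<in>S. norm (fst p) \<le> s"
  proof (cases "S = {}")
    case True thus ?thesis by (intro exI[of _ 0]) auto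
  next
    case False
    have "continuous_on S (\<lambda>p. norm (fst p))" by (intro continuous_intros)
    from continuous_attains_sup[OF assms(1) False this] obtain p where "p \<in> S" "\<forall>q\<in>S. norm (fst q) \<le> norm (fst p)" by blast
    thus ?thesis using assms(2) by (intro exI[of _ "norm (fst p)"]) auto
  qed
  then obtain s where s: "s < 4" "\<And>p. p \<in> S \<Longrightarrow> norm (fst p) \<le> s" by blast
  show ?thesis
  proof (rule that[of "(max 0 s + 4) / 2"])
    fix x t assume "(x, t) \<in> S"
    thus "norm x < (max 0 s + 4) / 2" using s(2)[of "(x, t)"] s(1) by (auto simp: max_def)
  qed (use s(1) in auto)
qed

theorem lemma3p1:
  fixes \<Lambda> K :: real
  assumes "\<Lambda> \<ge> 1"
  shows "\<exists>N \<delta>. N > 0 \<and> 0 < \<delta> \<and> \<delta> < 1 \<and>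
    (\<forall>(A :: (real^'n) \<times> real \<Rightarrow> real^'n^'n) (V :: (real^'n) \<times> real \<Rightarrow> real).
      elliptic_on (Q 4) \<Lambda> A \<longrightarrow> parabolic_lipschitz_on (Q 4) K A \<longrightarrow> A (0, 0) = mat 1 \<longrightarrow>
      C1_in_x V \<longrightarrow> norm1 V < \<infinity> \<longrightarrow> holder_half V < \<infinity> \<longrightarrow>
      (\<forall>\<alpha> \<ge> N * (1 + sqrt (real_of_ereal (norm1 V)) + sqrt (real_of_ereal (holder_half V))).
        let lam = \<alpha> / \<delta>\<^sup>2 in
        \<forall>\<sigma>. is_weight lam \<sigma> \<longrightarrow>
        (\<forall>a w. 0 < a \<longrightarrow> a \<le> 1 / (4 * lam) \<longrightarrow> w \<in> C0_infty (ball 0 4 \<times> {0..<1 / (2 * lam)}) \<longrightarrow>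
          \<alpha>\<^sup>2 * space_time_integral
              (\<lambda>(x, t). \<sigma> (t + a) powr (- 2 * \<alpha>) * (w (x, t))\<^sup>2 * G x (t + a))
          + \<alpha> * space_time_integral
              (\<lambda>(x, t). \<sigma> (t + a) powr (1 - 2 * \<alpha>) * (norm (grad_x w (x, t)))\<^sup>2 * G x (t + a))
          \<le> N * space_time_integral
              (\<lambda>(x, t). \<sigma> (t + a) powr (1 - 2 * \<alpha>) *
                (div_x (\<lambda>q. A q *v grad_x w q) (x, t) + partial_t w (x, t) + V (x, t) * w (x, t))\<^sup>2 *
                G x (t + a))
          + N powr (2 * \<alpha>) * \<alpha> powr (2 * \<alpha>) *
              (SUP t\<in>{0..}. LINT x|lebesgue. (w (x, t))\<^sup>2 + t * (norm (grad_x w (x, t)))\<^sup>2)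
          + \<sigma> a powr (- 2 * \<alpha>) *
              (- (a / N) * (LINT x|lebesgue. (norm (grad_x w (x, 0)))\<^sup>2 * G x a)
               + N * \<alpha> * (LINT x|lebesgue. (w (x, 0))\<^sup>2 * G x a)))))"
proof -
  define n where "n = real CARD('n)"
  define C where "C = \<Lambda> + n + norm (mat 1 :: real^'n^'n) + (8 + real DIM(real^'n^'n)) * \<bar>K\<bar>"
  define M where "M = absorption_const C n"
  define k where "k = 1888 * M^6 * exp 300"
  define \<delta> where "\<delta> = 1 / (62 * M^6 + 1)"
  define N where "N = (16 * exp 60 + k) * exp ((n + 484) + 16 + (n / 2 + 2) + (n + 8) * ln (1 / \<delta>))"
  have n0: "0 \<le> n" by (simp add: n_def)
  have K8: "0 \<le> (8 + real DIM(real^'n^'n)) * \<bar>K\<bar>" by (intro mult_nonneg_nonneg) auto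
  have CL: "\<Lambda> \<le> C" "n \<le> C" "1 \<le> C"
    using n0 K8 assms norm_ge_zero[of "mat 1 :: real^'n^'n"] unfolding C_def by linarith+
  have CK: "norm (mat 1 :: real^'n^'n) + 8 * \<bar>K\<bar> \<le> C" "real DIM(real^'n^'n) * \<bar>K\<bar> \<le> C" "\<bar>K\<bar> \<le> C"
  proof -
    have 1: "0 \<le> real DIM(real^'n^'n) * \<bar>K\<bar>" by simp
    have "C = \<Lambda> + n + norm (mat 1 :: real^'n^'n) + 8 * \<bar>K\<bar> + real DIM(real^'n^'n) * \<bar>K\<bar>" by (simp only: C_def distrib_right add.assoc)
    thus "norm (mat 1 :: real^'n^'n) + 8 * \<bar>K\<bar> \<le> C" "real DIM(real^'n^'n) * \<bar>K\<bar> \<le> C" "\<bar>K\<bar> \<le> C"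
      using 1 n0 assms norm_ge_zero[of "mat 1 :: real^'n^'n"] by linarith+
  qed
  have M1: "1 \<le> M"
  proof -
    have "1 * 1 \<le> C^5 * exp 60" using one_le_power[OF CL(3), of 5] CL(3) by (intro mult_mono) auto
    moreover have "0 \<le> sqrt (2 * n + 16)" using n0 by simp
    hence "0 \<le> 15 * sqrt (2 * n + 16) ^ 3 + 4 * sqrt (2 * n + 16)" by simp
    ultimately show ?thesis unfolding M_def absorption_const_def mult.assoc by linarith
  qed
  have M6: "1 \<le> M^6" using M1 by (rule one_le_power)
  have k1: "1 \<le> k"
  proof -
    have "1 * 1 \<le> (1888 * M^6) * exp (300::real)" using M6 by (intro mult_mono) auto
    thus ?thesis by (simp add: k_def)
  qed
  have d: "0 < \<delta>" "\<delta> < 1" using M6 by (auto simp: \<delta>_def divide_less_eq)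
  have Md: "62 * M^6 * \<delta> \<le> 1" using M6 by (simp add: \<delta>_def divide_le_eq)
  define tot where "tot = (n + 484) + 16 + (n / 2 + 2) + (n + 8) * ln (1 / \<delta>)"
  have tot: "0 \<le> tot" using n0 d by (simp add: tot_def)
  have e1: "1 \<le> exp tot" using tot by simp
  have Nt: "N = (16 * exp 60 + k) * exp tot" by (simp add: N_def tot_def)
  have Nk: "k * exp tot \<le> N" unfolding Nt by (rule mult_right_mono) auto
  have "(16 * exp 60 + k) * 1 \<le> N" unfolding Nt using e1 k1 by (intro mult_left_mono) (auto intro: add_nonneg_nonneg)
  hence Ne: "16 * exp 60 + k \<le> N" by simp
  have N16: "16 * exp 60 \<le> N" using Ne k1 by linarith
  have kN: "k \<le> N" using Ne exp_ge_zero[of "60::real"] by linarith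
  have N1: "1 \<le> N" using kN k1 by linarith
  show ?thesis
  proof (rule exI[of _ N], rule exI[of _ \<delta>], intro conjI allI impI)
    show "0 < N" using N1 by simp
    show "0 < \<delta>" by (rule d(1))
    show "\<delta> < 1" by (rule d(2))
    fix A :: "(real^'n) \<times> real \<Rightarrow> real^'n^'n" and V :: "(real^'n) \<times> real \<Rightarrow> real" and \<alpha> :: real
    assume ell: "elliptic_on (Q 4) \<Lambda> A" and lip: "parabolic_lipschitz_on (Q 4) K A" and A0: "A (0, 0) = mat 1"
      and V: "C1_in_x V" "norm1 V < \<infinity>" "holder_half V < \<infinity>"
      and al: "N * (1 + sqrt (real_of_ereal (norm1 V)) + sqrt (real_of_ereal (holder_half V))) \<le> \<alpha>"
    define m where "m = real_of_ereal (norm1 V)"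
    define h where "h = real_of_ereal (holder_half V)"
    note Vb = potential_bounds[OF V, folded m_def h_def]
    define lam where "lam = \<alpha> / \<delta>\<^sup>2"
    have sm: "0 \<le> sqrt m" "0 \<le> sqrt h" using Vb(1,2) by auto
    have aN: "N \<le> \<alpha>" "sqrt m + sqrt h \<le> \<alpha>"
    proof -
      have "N * 1 \<le> N * (1 + sqrt m + sqrt h)" using N1 sm by (intro mult_left_mono) auto
      thus "N \<le> \<alpha>" using al by (simp add: m_def h_def)
      have "1 * (sqrt m + sqrt h) \<le> N * (1 + sqrt m + sqrt h)" using N1 sm by (intro mult_mono) auto
      thus "sqrt m + sqrt h \<le> \<alpha>" using al by (simp add: m_def h_def)
    qed
    have al1: "1 \<le> \<alpha>" "16 * exp 60 \<le> \<alpha>" using aN N1 N16 by linarith+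
    have vb: "0 \<le> m + h" "m + h \<le> \<alpha>\<^sup>2"
    proof -
      show "0 \<le> m + h" using Vb(1,2) by simp
      have "m + h \<le> (sqrt m + sqrt h)\<^sup>2" using Vb(1,2) by (simp add: power2_sum)
      also have "\<dots> \<le> \<alpha>\<^sup>2" using aN(2) sm by (intro power_mono) auto
      finally show "m + h \<le> \<alpha>\<^sup>2" .
    qed
    have d2: "0 < \<delta>\<^sup>2" "\<delta>\<^sup>2 \<le> 1" using d by (auto simp: power_le_one)
    have alam: "\<alpha> \<le> lam" unfolding lam_def using d2 al1 by (simp add: le_divide_eq mult_left_le)
    have lam1: "1 \<le> lam" using alam al1 by linarith
    have "\<alpha>\<^sup>2 * space_time_integral
              (\<lambda>(x, t). \<sigma> (t + a) powr (- 2 * \<alpha>) * (w (x, t))\<^sup>2 * G x (t + a))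
          + \<alpha> * space_time_integral
              (\<lambda>(x, t). \<sigma> (t + a) powr (1 - 2 * \<alpha>) * (norm (grad_x w (x, t)))\<^sup>2 * G x (t + a))
          \<le> N * space_time_integral
              (\<lambda>(x, t). \<sigma> (t + a) powr (1 - 2 * \<alpha>) *
                (div_x (\<lambda>q. A q *v grad_x w q) (x, t) + partial_t w (x, t) + V (x, t) * w (x, t))\<^sup>2 *
                G x (t + a))
          + N powr (2 * \<alpha>) * \<alpha> powr (2 * \<alpha>) *
              (SUP t\<in>{0..}. LINT x|lebesgue. (w (x, t))\<^sup>2 + t * (norm (grad_x w (x, t)))\<^sup>2)
          + \<sigma> a powr (- 2 * \<alpha>) *
              (- (a / N) * (LINT x|lebesgue. (norm (grad_x w (x, 0)))\<^sup>2 * G x a)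
               + N * \<alpha> * (LINT x|lebesgue. (w (x, 0))\<^sup>2 * G x a))"
      if sig: "is_weight lam \<sigma>" and a: "0 < a" "a \<le> 1 / (4 * lam)" and w: "w \<in> C0_infty (ball 0 4 \<times> {0..<1 / (2 * lam)})" for \<sigma> a w
    proof -
      define T where "T = 1 / (2 * lam)"
      have T: "0 < T" "T \<le> 16" using lam1 by (auto simp: T_def divide_le_eq)
      obtain S where ws: "smooth w" and S: "compact S" "S \<subseteq> ball 0 4 \<times> {0..<T}"
        and wS: "\<And>x t. t \<ge> 0 \<Longrightarrow> (x, t) \<notin> S \<Longrightarrow> w (x, t) = 0"
        using w by (auto simp: C0_infty_def T_def)
      obtain r where r: "0 < r" "r < 4" and rS: "\<And>x t. (x, t) \<in> S \<Longrightarrow> norm x < r"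
        using support_radius[OF S] by blast
      have w_r: "w (x, t) = 0" if "t \<ge> 0" "norm x \<ge> r" for x t using wS[OF that(1)] rS[of x t] that(2) by fastforce
      have w_late: "w (x, t) = 0" if "t \<ge> T" for x t
      proof -
        have "(x, t) \<notin> S" using S(2) that by auto
        thus ?thesis using wS[of t x] that T by simp
      qed
      define A' where "A' p = A (cyl_retract r p)" for p
      define V' where "V' p = V (cyl_retract r p)" for p
      define V0 where "V0 x = V (cyl_retract r (x, 0))" for x
      note A' = extended_coefficients[OF ell lip A0 assms r, folded A'_def]
      have cin: "fst (cyl_retract r p) \<in> ball 0 4" "snd (cyl_retract r p) \<in> {0..16}" for p :: "(real^'n) \<times> real" using cyl_retract_in[OF r, of p] by auto
      have V'l: "\<bar>V' p - V' q\<bar> \<le> m * norm (fst p - fst q) + h * sqrt \<bar>snd p - snd q\<bar>" for p q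
      proof -
        have 1: "\<bar>V (fst (cyl_retract r p), snd (cyl_retract r p)) - V (fst (cyl_retract r q), snd (cyl_retract r p))\<bar> \<le> m * norm (fst (cyl_retract r p) - fst (cyl_retract r q))"
          by (rule Vb(4)[OF cin(1) cin(1) cin(2)])
        have 2: "\<bar>V (fst (cyl_retract r q), snd (cyl_retract r p)) - V (fst (cyl_retract r q), snd (cyl_retract r q))\<bar> \<le> h * sqrt \<bar>snd (cyl_retract r p) - snd (cyl_retract r q)\<bar>"
          by (rule Vb(5)[OF cin(1) cin(2) cin(2)])
        have 3: "m * norm (fst (cyl_retract r p) - fst (cyl_retract r q)) \<le> m * norm (fst p - fst q)"
          by (rule mult_left_mono[OF cyl_retract_lipschitz(1)[OF r(1)] Vb(1)])
        have 4: "h * sqrt \<bar>snd (cyl_retract r p) - snd (cyl_retract r q)\<bar> \<le> h * sqrt \<bar>snd p - snd q\<bar>"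
          by (rule mult_left_mono[OF real_sqrt_le_mono[OF cyl_retract_lipschitz(2)[OF r(1)]] Vb(2)])
        have "V' p = V (fst (cyl_retract r p), snd (cyl_retract r p))" "V' q = V (fst (cyl_retract r q), snd (cyl_retract r q))" by (simp_all add: V'_def)
        thus ?thesis using 1 2 3 4 by linarith
      qed
      have V'c: "continuous_on S' V'" for S'
        by (rule continuous_on_parabolic_lipschitz[where L = m and H = h]) (use V'l in simp)
      have V'b: "\<bar>V' p\<bar> \<le> m + h" for p
        using Vb(3)[OF cin(1) cin(2), of p p] Vb(2) by (simp add: V'_def)
      have V0': "V0 x = V' (x, 0)" for x by (simp add: V0_def V'_def)
      have V0l: "\<bar>V0 x - V0 y\<bar> \<le> (m + h) * norm (x - y)" for x y
      proof -
        have "0 \<le> h * norm (x - y)" using Vb(2) by simp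
        thus ?thesis using V'l[of "(x, 0)" "(y, 0)"] by (simp add: V0' distrib_right)
      qed
      have VV0: "\<bar>V' (x, t) - V0 x\<bar> \<le> (m + h) * sqrt t" if "t \<ge> 0" for x t
      proof -
        have "0 \<le> m * sqrt t" using Vb(1) that by simp
        thus ?thesis using V'l[of "(x, t)" "(x, 0)"] that by (simp add: V0' distrib_right)
      qed
      have Kp: "0 \<le> K" by (rule A'(1))
      obtain dA where dA: "\<And>k T. tame T (dA k)" "\<And>k p. norm (dA k p) \<le> real DIM(real^'n^'n) * K"
        "\<And>T. AE p in \<mu> T. \<forall>k. ((\<lambda>h. A' (fst p + h *\<^sub>R axis k 1, snd p)) has_vector_derivative dA k p) (at 0)"
        by (rule lipschitz_x_derivative[OF A'(7), of K]) (use A'(5)[of _ t _ t for t] in auto)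
      have cA0: "continuous_on UNIV (\<lambda>q :: (real^'n) \<times> real. A' (fst q, 0))"
        by (rule continuous_on_compose2[OF A'(7)]) (auto intro!: continuous_intros)
      obtain dA0 where dA0: "\<And>k T. tame T (dA0 k)" "\<And>k p. norm (dA0 k p) \<le> real DIM(real^'n^'n) * K"
        "\<And>T. AE p in \<mu> T. \<forall>k. ((\<lambda>h. A' (fst (fst p + h *\<^sub>R axis k 1, snd p), 0)) has_vector_derivative dA0 k p) (at 0)"
        by (rule lipschitz_x_derivative[OF cA0, of K]) (use A'(5)[of _ 0 _ 0] in auto)
      have cV0: "continuous_on UNIV (\<lambda>q :: (real^'n) \<times> real. V0 (fst q))"
        unfolding V0' by (rule continuous_on_compose2[OF V'c[of UNIV]]) (auto intro!: continuous_intros)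
      obtain dV where dV: "\<And>k T. tame T (dV k)" "\<And>k p. norm (dV k p) \<le> real DIM(real) * (m + h)"
        "\<And>T. AE p in \<mu> T. \<forall>k. ((\<lambda>h. V0 (fst (fst p + h *\<^sub>R axis k 1, snd p))) has_vector_derivative dV k p) (at 0)"
        by (rule lipschitz_x_derivative[OF cV0, of "m + h"]) (use V0l in auto)
      have DK: "real DIM(real^'n^'n) * K \<le> C" "norm (mat 1 :: real^'n^'n) + 8 * K \<le> C" "K \<le> C" using CK Kp by auto
      have lam0: "0 < lam" using lam1 by simp
      obtain \<gamma> where g: "\<And>t. t \<in> {0<..1/lam} \<Longrightarrow> \<sigma> t > 0"
        "\<And>t. t \<in> {0<..1/lam} \<Longrightarrow> t \<le> \<gamma> t \<and> \<gamma> t \<le> exp 60 * t"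
        "\<And>t. t \<in> {0<..1/lam} \<Longrightarrow> \<sigma> t \<le> t \<and> t \<le> exp 240 * \<sigma> t"
        "\<And>t. t \<in> {0<..1/lam} \<Longrightarrow> (\<sigma> has_real_derivative \<sigma> t / \<gamma> t) (at t within {0..1/lam})"
        "\<And>t. t \<in> {0<..1/lam} \<Longrightarrow> (\<gamma> has_real_derivative \<gamma> t * (1 + \<theta> (lam * t)) / t) (at t within {0..1/lam})"
        using weight_facts[OF lam0 sig] by blast
      have lT: "lam * (T + a) \<le> 3/4"
      proof -
        have "lam * (T + a) \<le> lam * (1 / (2 * lam) + 1 / (4 * lam))" unfolding T_def using a lam0 by (intro mult_left_mono add_left_mono) auto
        also have "\<dots> = 3 / 4" using lam0 by (simp add: field_simps)
        finally show ?thesis .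
      qed
      have Ta: "T + a \<le> 1 / lam" using lT lam0 by (simp add: field_simps)
      have ta: "t + a \<in> {0<..1/lam}" if "t \<in> {0..T}" for t using that a Ta by auto
      have shift: "((\<lambda>t. f (t + a)) has_real_derivative f') (at t within {0..T})"
        if "(f has_real_derivative f') (at (t + a) within {0..1/lam})" "t \<in> {0..T}" for f f' t
      proof -
        have "(f has_real_derivative f') (at (t + a) within (\<lambda>t. t + a) ` {0..T})"
          by (rule DERIV_subset[OF that(1)]) (use ta in force)
        moreover have "((\<lambda>t. t + a) has_real_derivative 1) (at t within {0..T})" by (auto intro!: derivative_eq_intros)
        ultimately have "(f \<circ> (\<lambda>t. t + a) has_real_derivative f' * 1) (at t within {0..T})" by (rule DERIV_image_chain)
        thus ?thesis by (simp add: o_def)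
      qed
      interpret carleman_setting A' V' V0 w C K "m + h" r T a \<alpha> lam "\<lambda>t. \<sigma> (t + a)" "\<lambda>t. \<gamma> (t + a)" dA dA0 dV
      proof
        show "1 \<le> C" "real CARD('n) \<le> C" "0 \<le> K" "K \<le> C" using CL Kp DK by (auto simp: n_def)
        show "transpose (A' p) = A' p" for p by (rule A'(2))
        show "(norm v)\<^sup>2 \<le> C * (v \<bullet> (A' p *v v))" for p v
        proof -
          have e: "(norm v)\<^sup>2 \<le> \<Lambda> * (v \<bullet> (A' p *v v))" by (rule A'(3))
          hence "0 \<le> \<Lambda> * (v \<bullet> (A' p *v v))" by (rule order_trans[OF zero_le_power2])
          hence "0 \<le> v \<bullet> (A' p *v v)" using assms by (simp add: zero_le_mult_iff)
          hence "\<Lambda> * (v \<bullet> (A' p *v v)) \<le> C * (v \<bullet> (A' p *v v))" using CL by (intro mult_right_mono)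
          thus ?thesis using e by linarith
        qed
        show "norm (A' p) \<le> C" for p using A'(4)[of p] DK(2) by linarith
        show "norm (A' (x, t) - A' (y, s)) \<le> K * (norm (x - y) + sqrt \<bar>t - s\<bar>)" for x t y s by (rule A'(5))
        show "A' (0, 0) = mat 1" by (rule A'(6))
        show "continuous_on UNIV A'" by (rule A'(7))
        show "continuous_on (strip T) V'" by (rule V'c)
        show "\<bar>V' p\<bar> \<le> m + h" for p by (rule V'b)
        show "\<bar>V0 x - V0 y\<bar> \<le> (m + h) * norm (x - y)" for x y by (rule V0l)
        show "\<bar>V0 x\<bar> \<le> m + h" for x unfolding V0' by (rule V'b)
        show "\<bar>V' (x, t) - V0 x\<bar> \<le> (m + h) * sqrt t" if "(x, t) \<in> strip T" for x t
          by (rule VV0) (use that in \<open>simp add: strip_def\<close>)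
        show "0 \<le> m + h" "m + h \<le> \<alpha>\<^sup>2" by (fact vb)+
        show "tame T (dA k)" "tame T (dA0 k)" "tame T (dV k)" for k by (rule dA dA0 dV)+
        show "norm (dA k p) \<le> C" "norm (dA0 k p) \<le> C" for k p using dA(2)[of k p] dA0(2)[of k p] DK(1) by linarith+
        show "\<bar>dV k p\<bar> \<le> m + h" for k p using dV(2)[of k p] by simp
        show "AE p in \<mu> T. \<forall>k. xd k p A' (dA k p)" using dA(3)[of T] by (simp add: xd_def)
        show "AE p in \<mu> T. \<forall>k. xd k p (\<lambda>q. A' (fst q, 0)) (dA0 k p)" using dA0(3)[of T] by (simp add: xd_def)
        show "AE p in \<mu> T. \<forall>k. xd k p (\<lambda>q. V0 (fst q)) (dV k p)" using dV(3)[of T] by (simp add: xd_def)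
        show "smooth w" "0 < r" "r < 4" by fact+
        show "w (x, t) = 0" if "0 \<le> t" "r \<le> norm x" for x t using w_r that by simp
        show "w (x, T) = 0" for x by (rule w_late) simp
        show "0 < T" "0 < a" "1 \<le> \<alpha>" "1 \<le> lam" "\<alpha> \<le> lam" "lam * (T + a) \<le> 3 / 4" using T a al1 lam1 alam lT by auto
        show "0 < \<sigma> (t + a)" if "t \<in> {0..T}" for t by (rule g(1)[OF ta[OF that]])
        show "t + a \<le> \<gamma> (t + a) \<and> \<gamma> (t + a) \<le> exp 60 * (t + a)" if "t \<in> {0..T}" for t by (rule g(2)[OF ta[OF that]])
        show "\<sigma> (t + a) \<le> t + a \<and> t + a \<le> exp 240 * \<sigma> (t + a)" if "t \<in> {0..T}" for t by (rule g(3)[OF ta[OF that]])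
        show "((\<lambda>t. \<sigma> (t + a)) has_real_derivative \<sigma> (t + a) / \<gamma> (t + a)) (at t within {0..T})" if "t \<in> {0..T}" for t
          by (rule shift[OF g(4)[OF ta[OF that]] that])
        show "((\<lambda>t. \<gamma> (t + a)) has_real_derivative \<gamma> (t + a) * (1 + \<theta> (lam * (t + a))) / (t + a)) (at t within {0..T})" if "t \<in> {0..T}" for t
          by (rule shift[OF g(5)[OF ta[OF that]] that])
      qed
      have "\<alpha> / lam = \<delta>\<^sup>2" using al1 d by (simp add: lam_def)
      hence dl_eq: "dl = \<delta>" using d unfolding dl_def by simp
      have far: "gw (x, t) = 0" if "t \<ge> 0" "r < norm x" for x t
      proof -
        have "dd (axis i 1, 0) w (x, t) = 0" for i by (rule dd_zero[OF ws w_r]) (use that in auto)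
        thus ?thesis by (simp add: gw_def vec_eq_iff)
      qed
      have late: "gw (x, t) = 0" if "t \<ge> T" for x t
      proof -
        have "dd (axis i 1, 0) w (x, t) = 0" for i
          by (rule dd_eq_0_one_sided[OF ws, of 1]) (use w_late that in auto)
        thus ?thesis by (simp add: gw_def vec_eq_iff)
      qed
      have cl: "cyl_retract r (x, t) = (x, t)" if "t \<ge> 0" "norm x \<le> r" "t \<le> T" for x :: "real^'n" and t
        using that T by (intro cyl_retract_id) auto
      show ?thesis
      proof (rule carleman_estimate)
        show "w (x, t) = 0" if "T \<le> t" for x t using w_late that .
        show "A (x, t) *v gw (x, t) = A' (x, t) *v gw (x, t)" if t: "0 \<le> t" for x t
        proof (cases "norm x \<le> r \<and> t \<le> T")
          case True thus ?thesis using cl[OF t] by (simp add: A'_def)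
        next
          case False thus ?thesis using far[OF t, of x] late[of t x] by auto
        qed
        show "V (x, t) * w (x, t) = V' (x, t) * w (x, t)" if t: "0 \<le> t" for x t
        proof (cases "norm x \<le> r \<and> t \<le> T")
          case True thus ?thesis using cl[OF t] by (simp add: V'_def)
        next
          case False thus ?thesis using w_r[OF t, of x] w_late[of t x] by auto
        qed
        show "62 * absorption_const C (real CARD('n)) ^ 6 * dl \<le> 1" using Md by (simp add: dl_eq M_def n_def)
        show "16 * exp 60 \<le> \<alpha>" "1 \<le> N" by (fact al1 N1)+
        show "1888 * absorption_const C (real CARD('n)) ^ 6 * exp 300 \<le> N" using kN by (simp add: k_def M_def n_def)
        show "1888 * absorption_const C (real CARD('n)) ^ 6 * exp 300 * Bad \<le> N powr (2 * \<alpha>) * \<alpha> powr (2 * \<alpha>)"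
          using bad_constant_absorbed[OF d al1(1) k1 n0 Nk[unfolded tot_def]] unfolding Bad_def by (simp add: k_def M_def n_def lam_def)
      qed simp
    qed
    thus "let lam = \<alpha> / \<delta>\<^sup>2 in
        \<forall>\<sigma>. is_weight lam \<sigma> \<longrightarrow>
        (\<forall>a w. 0 < a \<longrightarrow> a \<le> 1 / (4 * lam) \<longrightarrow> w \<in> C0_infty (ball 0 4 \<times> {0..<1 / (2 * lam)}) \<longrightarrow>
          \<alpha>\<^sup>2 * space_time_integral
              (\<lambda>(x, t). \<sigma> (t + a) powr (- 2 * \<alpha>) * (w (x, t))\<^sup>2 * G x (t + a))
          + \<alpha> * space_time_integral
              (\<lambda>(x, t). \<sigma> (t + a) powr (1 - 2 * \<alpha>) * (norm (grad_x w (x, t)))\<^sup>2 * G x (t + a))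
          \<le> N * space_time_integral
              (\<lambda>(x, t). \<sigma> (t + a) powr (1 - 2 * \<alpha>) *
                (div_x (\<lambda>q. A q *v grad_x w q) (x, t) + partial_t w (x, t) + V (x, t) * w (x, t))\<^sup>2 *
                G x (t + a))
          + N powr (2 * \<alpha>) * \<alpha> powr (2 * \<alpha>) *
              (SUP t\<in>{0..}. LINT x|lebesgue. (w (x, t))\<^sup>2 + t * (norm (grad_x w (x, t)))\<^sup>2)
          + \<sigma> a powr (- 2 * \<alpha>) *
              (- (a / N) * (LINT x|lebesgue. (norm (grad_x w (x, 0)))\<^sup>2 * G x a)
               + N * \<alpha> * (LINT x|lebesgue. (w (x, 0))\<^sup>2 * G x a)))"
      by (simp only: Let_def lam_def) blast
  qed
qed

end
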